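(* Let $F=(f_1,\ldots,f_k)$ be a system of nonconstant polynomials in $\mathbb C[x_1,\ldots,x_n]$. For $1\le i\le k$ let $F_i=(f_1,\ldots,f_i)$ and $\mathcal H_i=X(f_i)$. Assume that for every $i$, all irreducible components of $X(F_i)$ which contribute to irreducible components of $X(F)$ that are reduced with respect to $F$ are themselves reduced with respect to $F_i$. Then the $u$-regeneration algorithm (described in the context) applied to $F$ computes witness sets $W_1,\ldots,W_{\min(k,n)}$ whose witness points are precisely the witness points of the reduced equidimensional parts of $X(F)$. That is, for each $j=1,\ldots,\min(k,n)$, the witness point set of $W_j$ equals $\bigcup_Z (Z\cap L_j)$, where $Z$ runs over all irreducible components of $X(F)$ of codimension $j$ that are reduced with respect to $F$.
   Context: **Notation.** For a system $G$ of polynomials in $n$ variables, $X(G)\subset\mathbb C^n$ is its zero set and $JG(x)$ its Jacobian matrix at $x$. "Generic" means outside a certain proper algebraic subvariety of the parameter space. **Witness sets.** Let $X$ be an irreducible variety of codimension $j$ that is an irreducible component of $X(G)$. A witness set for $X$ is a triple $(G,L,P)$, where $L\subset\mathbb C^n$ is a generic affine linear subspace of dimension $j$ and $P=X\cap L$ (which consists of $\deg X$ points). For a union of irreducible components $X_1,\dots,X_\ell$ of $X(G)$, all of codimension $j$, a witness set is $(G,L,\bigcup_s (X_s\cap L))$. The points of $P$ are called witness points. A witness set $(G,L,P)$ in codimension $j$ is reduced if $\mathrm{rank}(JG(x))=j$ for all $x\in P$. An irreducible component of $X(G)$ is reduced with respect to $G$ if its witness set is reduced. **Contributes.** A component $Y$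 of $X(F_i)$ contributes to a component $Z$ of $X(F)$ if $Z$ is obtained from $Y$ by successively intersecting with the remaining hypersurfaces $\mathcal H_{i+1},\ldots,\mathcal H_k$. That is, there is a chain $Y=Y_i, Y_{i+1},\dots,Y_k=Z$ in which $Y_{s+1}$ is an irreducible component of $Y_s\cap\mathcal H_{s+1}$. **The $u$-regeneration algorithm.** All random choices are assumed generic and all computations (path tracking, membership tests, rank tests) exact. *Flag.* Choose random affine linear equations $\ell_1,\dots,\ell_{n-1}$ and set $L_j=\{\ell_1(x)=\cdots=\ell_{n-j}(x)=0\}$. This gives a flag $L_1\subset L_2\subset\cdots\subset L_n=\mathbb C^n$ with $\dim L_j=j$. *Start.* Solve $f_1=\ell_1=\cdots=\ell_{n-1}=0$. Set $W_1=(F_1,L_1,P_1)$, where $P_1$ is the set of regular solutions. *Step $i\to i+1$* (for $i=1,\dots,k-1$). Given $W_j=(F_i,L_j,P_j)$ for $j=1,\dots,\min(i,n)$, initialize $W_j'=(F_{i+1},L_j,\emptyset)$ for $j=1,\dots,\min(i+1,n)$. For each $j=1,\dots,\min(i,n)$ do the following. 1. Let $P_j'$ be the set of points of $P_j$ lying on $\mathcal H_{i+1}$. Add $P_j'$ to the point set of $W_j'$. 2. If $j<n$, let $Q_j=P_j\setminus P_j'$ and $d=\deg f_{i+1}$, introduce a new variable $u$, and choose a random $c\in\mathbb C$. Track the homotopy in the variables $(x,u)$ from the start system $$(f_1,\dots,f_i,\ u^d-1,\ \ell_1,\dots,\ell_{n-(j+1)},\ \ell_{n-j})$$ to the target system $$(f_1,\dots,f_i,\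 f_{i+1},\ \ell_1,\dots,\ell_{n-(j+1)},\ u-c),$$ using as start points $Q_j\times\{e^{2\pi\sqrt{-1}\,m/d}\mid m=0,\dots,d-1\}$. The endpoints lie on $(X(F_{i+1})\cap L_{j+1})\times\{u=c\}$; denote them $Q_j'\times\{c\}$. (Known property of this step, from earlier work of Duff, Leykin and Rodriguez: for an irreducible component $Y$ of $X(F_i)$ of codimension $j$, reduced with respect to $F_i$ and not contained in $\mathcal H_{i+1}$, the endpoints include the witness points of $Y\cap\mathcal H_{i+1}$ in codimension $j+1$, i.e. $Y\cap \mathcal H_{i+1}\cap L_{j+1}$.) 3. Add $Q_j'$ to the point set of $W_{j+1}'$, discarding all points $x$ that are not reduced, i.e. those with $\mathrm{rank}(JF_{i+1}(x))\ne j+1$. After the loop over $j$, replace $W_j$ by $W_j'$ for $j=1,\dots,\min(i+1,n)$. *Output.* After all $k$ polynomials have been processed, return $W_1,\dots,W_{\min(k,n)}$. *)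

theory Defs
  imports "HOL-Analysis.Analysis" "HOL-Library.Poly_Mapping"
begin

section \<open>Polynomials\<close>

text \<open>Polynomials over the complex numbers in variables indexed by \<open>'v\<close>: finitely supported
  maps from monomials (finitely supported exponent functions) to coefficients.\<close>

type_synonym 'v cpoly = "('v \<Rightarrow>\<^sub>0 nat) \<Rightarrow>\<^sub>0 complex"

definition peval :: "'v cpoly \<Rightarrow> ('v \<Rightarrow> complex) \<Rightarrow> complex" where
  "peval p a = (\<Sum>m\<in>Poly_Mapping.keys p.
     Poly_Mapping.lookup p m * (\<Prod>v\<in>Poly_Mapping.keys m. a v ^ Poly_Mapping.lookup m v))"

definition pvars :: "'v cpoly \<Rightarrow> 'v set" where
  "pvars p = (\<Union>m\<in>Poly_Mapping.keys p. Poly_Mapping.keys m)"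

definition nonconstant :: "'v cpoly \<Rightarrow> bool" where
  "nonconstant p \<longleftrightarrow> (\<forall>c. p \<noteq> Poly_Mapping.single 0 c)"

definition total_degree :: "'v cpoly \<Rightarrow> nat" where
  "total_degree p = Max (insert 0
     ((\<lambda>m. \<Sum>v\<in>Poly_Mapping.keys m. Poly_Mapping.lookup m v) ` Poly_Mapping.keys p))"

abbreviation val :: "'n cpoly \<Rightarrow> complex ^ 'n \<Rightarrow> complex" where
  "val p x \<equiv> peval p (\<lambda>v. x $ v)"

definition zeros :: "'n cpoly list \<Rightarrow> (complex ^ 'n) set" where
  "zeros G = {x. \<forall>g\<in>set G. val g x = 0}"

definition gradient :: "'n cpoly \<Rightarrow> complex ^ 'n \<Rightarrow> complex ^ 'n" where
  "gradient g x = (\<chi> v. deriv (\<lambda>z. peval g ((\<lambda>w. x $ w)(v := z))) (x $ v))"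

text \<open>The rank of the Jacobian matrix of the system \<open>G\<close> at \<open>x\<close>, whose rows are the gradients.
  As the number of rows is a number and not a type, the row rank is written out (cf. the
  library's \<open>rank\<close>, which is the dimension of the set of rows).\<close>

definition jac_rank :: "'n::finite cpoly list \<Rightarrow> complex ^ 'n \<Rightarrow> nat" where
  "jac_rank G x = vec.dim ((\<lambda>g. gradient g x) ` set G)"


section \<open>Algebraic sets, irreducible components, codimension\<close>

definition algebraic_set :: "(complex ^ 'n) set \<Rightarrow> bool" where
  "algebraic_set A \<longleftrightarrow> (\<exists>S :: 'n cpoly set. A = {x. \<forall>p\<in>S. val p x = 0})"

definition irreducible_variety :: "(complex ^ 'n) set \<Rightarrow> bool" where
  "irreducible_variety V \<longleftrightarrow> algebraic_set V \<and> V \<noteq> {} \<and>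
     (\<forall>A B. algebraic_set A \<and> algebraic_set B \<and> V = A \<union> B \<longrightarrow> V = A \<or> V = B)"

definition irreducible_component :: "(complex ^ 'n) set \<Rightarrow> (complex ^ 'n) set \<Rightarrow> bool" where
  "irreducible_component Z A \<longleftrightarrow> irreducible_variety Z \<and> Z \<subseteq> A \<and>
     (\<forall>V. irreducible_variety V \<and> Z \<subseteq> V \<and> V \<subseteq> A \<longrightarrow> V = Z)"

text \<open>Krull dimension. Chains in affine \<open>n\<close>-space have length at most \<open>n\<close>, so the greatest length
  exists and the subtraction in \<open>codim\<close> does not truncate.\<close>

definition alg_dim :: "(complex ^ 'n) set \<Rightarrow> nat" where
  "alg_dim V = (GREATEST l. \<exists>C :: nat \<Rightarrow> (complex ^ 'n) set.
     (\<forall>r\<le>l. irreducible_variety (C r) \<and> C r \<subseteq> V) \<and> (\<forall>r<l. C r \<subset> C (Suc r)))"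

definition codim :: "(complex ^ 'n) set \<Rightarrow> nat" where
  "codim V = CARD('n) - alg_dim V"


section \<open>Genericity and linear spaces\<close>

text \<open>A property holds generically on the parameter space of all assignments of complex numbers
  to the variables in \<open>V\<close> if it holds outside a proper algebraic subvariety. Values outside
  \<open>V\<close> do not matter, since the defining polynomials only involve variables in \<open>V\<close>.\<close>

definition generically :: "'v set \<Rightarrow> (('v \<Rightarrow> complex) \<Rightarrow> bool) \<Rightarrow> bool" where
  "generically V P \<longleftrightarrow> (\<exists>S. (\<forall>p\<in>S. pvars p \<subseteq> V) \<and> {a. \<forall>p\<in>S. peval p a = 0} \<noteq> UNIV \<and>
     (\<forall>a. a \<notin> {a. \<forall>p\<in>S. peval p a = 0} \<longrightarrow> P a))"

text \<open>The affine linear equation \<open>\<ell>\<^sub>m\<close>: \<open>a (m, Some v)\<close> is the coefficient of the variable \<open>v\<close> and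
  \<open>a (m, None)\<close> the constant term.\<close>

definition ell :: "(nat \<times> 'n::finite option \<Rightarrow> complex) \<Rightarrow> nat \<Rightarrow> 'n cpoly" where
  "ell a m = Poly_Mapping.single 0 (a (m, None)) +
     (\<Sum>v\<in>UNIV. Poly_Mapping.single (Poly_Mapping.single v 1) (a (m, Some v)))"

definition ells :: "(nat \<times> 'n::finite option \<Rightarrow> complex) \<Rightarrow> nat \<Rightarrow> 'n cpoly list" where
  "ells a r = map (ell a) [1..<r + 1]"

definition flag :: "(nat \<times> 'n::finite option \<Rightarrow> complex) \<Rightarrow> nat \<Rightarrow> (complex ^ 'n) set" where
  "flag a j = zeros (ells a (CARD('n) - j))"

definition affine_linear_space :: "nat \<Rightarrow> (complex ^ 'n::finite) set \<Rightarrow> bool" where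
  "affine_linear_space j L \<longleftrightarrow> (\<exists>p D. vec.subspace D \<and> vec.dim D = j \<and> L = (\<lambda>v. p + v) ` D)"


section \<open>Witness sets\<close>

type_synonym 'n witness = "'n cpoly list \<times> (complex ^ 'n) set \<times> (complex ^ 'n) set"

text \<open>\<open>W\<close> is a witness set in codimension \<open>j\<close> for the union of the family \<open>\<Z>\<close> of irreducible
  components of \<open>zeros G\<close>. That the linear space is generic is not a property of an individual
  linear space; it is expressed by \<open>generically\<close> wherever this predicate is used.\<close>

definition witness_set ::
  "'n::finite cpoly list \<Rightarrow> (complex ^ 'n) set set \<Rightarrow> nat \<Rightarrow> 'n witness \<Rightarrow> bool" where
  "witness_set G \<Z> j W \<longleftrightarrow>
     (\<forall>Z\<in>\<Z>. irreducible_component Z (zeros G) \<and> codim Z = j) \<and>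
     (\<exists>L. affine_linear_space j L \<and> W = (G, L, \<Union>Z\<in>\<Z>. Z \<inter> L))"

definition reduced_witness :: "nat \<Rightarrow> 'n::finite witness \<Rightarrow> bool" where
  "reduced_witness j W \<longleftrightarrow> (case W of (G, L, P) \<Rightarrow> \<forall>x\<in>P. jac_rank G x = j)"

text \<open>A generic linear space of dimension \<open>j\<close> is cut out by \<open>n - j\<close> generic affine linear
  equations.\<close>

definition reduced_component :: "'n::finite cpoly list \<Rightarrow> (complex ^ 'n) set \<Rightarrow> bool" where
  "reduced_component G Z \<longleftrightarrow>
     generically ({1..CARD('n) - codim Z} \<times> UNIV)
       (\<lambda>a. reduced_witness (codim Z) (G, flag a (codim Z), Z \<inter> flag a (codim Z)))"


section \<open>Contributing components\<close>

definition contributes ::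
  "'n cpoly list \<Rightarrow> nat \<Rightarrow> (complex ^ 'n) set \<Rightarrow> (complex ^ 'n) set \<Rightarrow> bool" where
  "contributes F i Y Z \<longleftrightarrow> (\<exists>C :: nat \<Rightarrow> (complex ^ 'n) set. C i = Y \<and> C (length F) = Z \<and>
     (\<forall>s\<in>{i..<length F}. irreducible_component (C (Suc s)) (C s \<inter> zeros [F ! s])))"


section \<open>The u-regeneration algorithm\<close>

text \<open>Lists are indexed from \<open>0\<close>: \<open>F ! i\<close> is \<open>f\<^sub>i\<^sub>+\<^sub>1\<close>, and \<open>take i F\<close> is \<open>F\<^sub>i\<close>.

  Systems in the variables \<open>(x,u)\<close> are lists of functions, and the homotopy between two such systems
  \<open>S\<close> and \<open>T\<close> is \<open>(1 - t) S + t T\<close>. The homotopy parameter \<open>t\<close> runs along a path \<open>\<tau>\<close> in the complex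
  plane from \<open>0\<close> to \<open>1\<close>; an endpoint is the end of a continuous solution path (solution paths that
  diverge for \<open>t \<rightarrow> 1\<close> have none).\<close>

definition track ::
  "('z::topological_space \<Rightarrow> complex) list \<Rightarrow> ('z \<Rightarrow> complex) list \<Rightarrow> (real \<Rightarrow> complex)
     \<Rightarrow> 'z set \<Rightarrow> 'z set" where
  "track S T \<tau> Q = {e. \<exists>z. path z \<and> pathstart z \<in> Q \<and> pathfinish z = e \<and>
     (\<forall>s\<in>{0..1}. \<forall>(g, h)\<in>set (zip S T). (1 - \<tau> s) * g (z s) + \<tau> s * h (z s) = 0)}"

definition start_system ::
  "'n::finite cpoly list \<Rightarrow> (nat \<times> 'n option \<Rightarrow> complex) \<Rightarrow> nat \<Rightarrow> nat
     \<Rightarrow> ((complex ^ 'n) \<times> complex \<Rightarrow> complex) list" where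
  "start_system F a i j =
     map (\<lambda>g (x, u). val g x) (take i F)
     @ [\<lambda>(x, u). u ^ total_degree (F ! i) - 1]
     @ map (\<lambda>g (x, u). val g x) (ells a (CARD('n) - (j + 1)))
     @ [\<lambda>(x, u). val (ell a (CARD('n) - j)) x]"

definition target_system ::
  "'n::finite cpoly list \<Rightarrow> (nat \<times> 'n option \<Rightarrow> complex) \<Rightarrow> complex \<Rightarrow> nat \<Rightarrow> nat
     \<Rightarrow> ((complex ^ 'n) \<times> complex \<Rightarrow> complex) list" where
  "target_system F a c i j =
     map (\<lambda>g (x, u). val g x) (take i F)
     @ [\<lambda>(x, u). val (F ! i) x]
     @ map (\<lambda>g (x, u). val g x) (ells a (CARD('n) - (j + 1)))
     @ [\<lambda>(x, u). u - c]"

definition roots_of_unity :: "nat \<Rightarrow> complex set" where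
  "roots_of_unity d = (\<lambda>m. exp (2 * of_real pi * \<i> * of_nat m / of_nat d)) ` {0..<d}"

definition start_points ::
  "'n::finite cpoly list \<Rightarrow> (nat \<times> 'n option \<Rightarrow> complex) \<Rightarrow> (complex ^ 'n) set" where
  "start_points F a = {x \<in> zeros (F ! 0 # ells a (CARD('n) - 1)).
     jac_rank (F ! 0 # ells a (CARD('n) - 1)) x = CARD('n)}"

text \<open>The set \<open>Q'\<^sub>j\<close> obtained from \<open>P\<^sub>j\<close> in step \<open>i \<rightarrow> i + 1\<close>.\<close>

definition regenerated ::
  "'n::finite cpoly list \<Rightarrow> (nat \<times> 'n option \<Rightarrow> complex) \<Rightarrow> complex \<Rightarrow> (real \<Rightarrow> complex)
     \<Rightarrow> nat \<Rightarrow> nat \<Rightarrow> (complex ^ 'n) set \<Rightarrow> (complex ^ 'n) set" where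
  "regenerated F a c \<tau> i j P = fst ` track (start_system F a i j) (target_system F a c i j) \<tau>
     ((P - zeros [F ! i]) \<times> roots_of_unity (total_degree (F ! i)))"

text \<open>\<open>ureg_points F a c \<tau> i j\<close> is the point set of \<open>W\<^sub>j\<close> after \<open>f\<^sub>1, \<dots>, f\<^sub>i\<close> have been processed. It
  collects the points added to \<open>W'\<^sub>j\<close> by the loop iteration for \<open>j\<close> and by that for \<open>j - 1\<close>.
  The constants and the tracking paths are chosen anew in each iteration \<open>(i,j)\<close>.\<close>

fun ureg_points ::
  "'n::finite cpoly list \<Rightarrow> (nat \<times> 'n option \<Rightarrow> complex) \<Rightarrow> (nat \<times> nat \<Rightarrow> complex)
     \<Rightarrow> (nat \<times> nat \<Rightarrow> real \<Rightarrow> complex) \<Rightarrow> nat \<Rightarrow> nat \<Rightarrow> (complex ^ 'n) set" where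
  "ureg_points F a c \<tau> 0 j = {}"
| "ureg_points F a c \<tau> (Suc 0) j = (if j = 1 then start_points F a else {})"
| "ureg_points F a c \<tau> (Suc (Suc r)) j = (let i = Suc r in
     (if j \<in> {1..min i CARD('n)} then ureg_points F a c \<tau> i j \<inter> zeros [F ! i] else {})
     \<union> (if j - 1 \<in> {1..min i CARD('n)} \<and> j - 1 < CARD('n)
        then {x \<in> regenerated F a (c (i, j - 1)) (\<tau> (i, j - 1)) i (j - 1)
                    (ureg_points F a c \<tau> i (j - 1)).
               jac_rank (take (Suc i) F) x = j}
        else {}))"

definition u_regeneration ::
  "'n::finite cpoly list \<Rightarrow> (nat \<times> 'n option \<Rightarrow> complex) \<Rightarrow> (nat \<times> nat \<Rightarrow> complex)
     \<Rightarrow> (nat \<times> nat \<Rightarrow> real \<Rightarrow> complex) \<Rightarrow> nat \<Rightarrow> 'n witness" where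
  "u_regeneration F a c \<tau> j = (F, flag a j, ureg_points F a c \<tau> (length F) j)"

text \<open>The random numbers of a run for \<open>k\<close> polynomials: the coefficients of
  \<open>\<ell>\<^sub>1, \<dots>, \<ell>\<^sub>n\<^sub>-\<^sub>1\<close> and the constants \<open>c\<close> of the iterations \<open>(i,j)\<close>.\<close>

definition random_params :: "nat \<Rightarrow> ((nat \<times> 'n::finite option) + (nat \<times> nat)) set" where
  "random_params k = Inl ` ({1..CARD('n) - 1} \<times> UNIV) \<union> Inr ` ({1..<k} \<times> {1..<CARD('n)})"

text \<open>The generic tracking path: \<open>t\<close> starts at \<open>0\<close>, ends at \<open>1\<close>, and avoids a finite set \<open>B\<close> of
  exceptional values on the way.\<close>

definition tracking_path :: "complex set \<Rightarrow> (real \<Rightarrow> complex) \<Rightarrow> bool" where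
  "tracking_path B \<tau> \<longleftrightarrow>
     path \<tau> \<and> pathstart \<tau> = 0 \<and> pathfinish \<tau> = 1 \<and> (\<forall>s\<in>{0..<1}. \<tau> s \<notin> B)"

end

theory Submission
  imports Defs "HOL-Complex_Analysis.Cauchy_Integral_Formula" "HOL-Computational_Algebra.Fundamental_Theorem_Algebra"
begin

text \<open>The codimension of an irreducible variety \<open>Y\<close> equals \<open>rk Y\<close>, the maximal rank of the gradients
  of the functions vanishing on \<open>Y\<close>, and \<open>Y\<close> meets exactly those generic linear sections that are cut
  out by at most \<open>n - rk Y\<close> equations. Hence a component \<open>Z\<close> of \<open>X(G)\<close> is reduced iff the Jacobian of
  \<open>G\<close> has rank \<open>rk Z\<close> somewhere on \<open>Z\<close>, and a point of a reduced component \<open>Y\<close> of \<open>X(F\<^sub>i)\<close> at which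
  \<open>f\<^sub>i\<^sub>+\<^sub>1\<close> vanishes and the rank rises by one lies on a reduced component of \<open>X(F\<^sub>i\<^sub>+\<^sub>1)\<close>; the rank test
  in the algorithm thus makes a dimension theorem for intersections superfluous.

  For the homotopy on a reduced component \<open>Y\<close>, generic sections of \<open>Y\<close> have a constant number of
  points, which bounds \<open>Y \<inter> L\<^sub>j\<^sub>+\<^sub>1\<close> linearly by the last equation. Therefore the fibres stay bounded
  near \<open>t = 0\<close>, and by quantifier elimination they are nondegenerate and of constant cardinality
  outside a finite set of values \<open>t\<close> that does not contain \<open>0\<close>. Solutions can then be continued
  along every path avoiding this set: backwards from a nondegenerate endpoint, and forwards without
  leaving \<open>Y\<close>. Soundness and completeness follow by induction on \<open>i\<close>.\<close>

section \<open>Polynomial functions\<close>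

text \<open>Dimension is defined through chains of varieties, while the algorithm only sees linear
  sections and ranks of Jacobians. The bridge is a zero-one law: a definable condition on the
  coefficients of the linear equations either holds generically or fails generically, so it is
  generic as soon as every nonempty set {f \<noteq> 0} contains one good parameter. Quantifier
  elimination is needed because the conditions quantify over the points of a variety. For a single
  parameter t the same law reads "finite or cofinite", which is how the exceptional values of a
  homotopy come out finite in number. Transversality can be proved by measure theory, since a null
  set of bad hyperplanes cannot cover a nonempty open set. The value t = 1 may itself be
  exceptional: the fibre there may contain degenerate points, and solutions may escape to infinity.
  Therefore endpoints are lifted backwards from t = 1, where only the one endpoint has to be
  nondegenerate. The tracked equations describe all of X(F_i) and not a single component, so
  soundness needs its own argument that a path starting on Y remains there.\<close>

inductive_set polyf :: "'v set \<Rightarrow> (('v \<Rightarrow> complex) \<Rightarrow> complex) set" for V where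
  const: "(\<lambda>a. c) \<in> polyf V"
| var: "v \<in> V \<Longrightarrow> (\<lambda>a. a v) \<in> polyf V"
| add: "f \<in> polyf V \<Longrightarrow> g \<in> polyf V \<Longrightarrow> (\<lambda>a. f a + g a) \<in> polyf V"
| mult: "f \<in> polyf V \<Longrightarrow> g \<in> polyf V \<Longrightarrow> (\<lambda>a. f a * g a) \<in> polyf V"

named_theorems polyf_intros
declare polyf.intros [polyf_intros]

lemma polyf_if:
  "(P \<Longrightarrow> f \<in> polyf V) \<Longrightarrow> (\<not> P \<Longrightarrow> g \<in> polyf V) \<Longrightarrow> (\<lambda>a. if P then f a else g a) \<in> polyf V"
  by (cases P) auto

lemma polyf_uminus [polyf_intros]: "f \<in> polyf V \<Longrightarrow> (\<lambda>a. - f a) \<in> polyf V"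
  using polyf.mult[OF polyf.const[of "-1"], of f V] by simp

lemma polyf_diff [polyf_intros]:
  "f \<in> polyf V \<Longrightarrow> g \<in> polyf V \<Longrightarrow> (\<lambda>a. f a - g a) \<in> polyf V"
  using polyf.add[OF _ polyf_uminus, of f V g] by simp

lemma polyf_power [polyf_intros]: "f \<in> polyf V \<Longrightarrow> (\<lambda>a. f a ^ n) \<in> polyf V"
  by (induction n) (auto intro: polyf_intros)

lemma polyf_sum [polyf_intros]:
  "(\<And>i. i \<in> I \<Longrightarrow> f i \<in> polyf V) \<Longrightarrow> (\<lambda>a. \<Sum>i\<in>I. f i a) \<in> polyf V"
  by (induction I rule: infinite_finite_induct) (auto intro: polyf_intros)

lemma polyf_prod [polyf_intros]:
  "(\<And>i. i \<in> I \<Longrightarrow> f i \<in> polyf V) \<Longrightarrow> (\<lambda>a. \<Prod>i\<in>I. f i a) \<in> polyf V"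
  by (induction I rule: infinite_finite_induct) (auto intro: polyf_intros)

lemma polyf_mono: "V \<subseteq> W \<Longrightarrow> f \<in> polyf V \<Longrightarrow> f \<in> polyf W"
  by (rotate_tac 1, induction rule: polyf.induct) (auto intro: polyf_intros)

lemma polyf_UNIV: "f \<in> polyf V \<Longrightarrow> f \<in> polyf UNIV"
  by (rule polyf_mono[OF subset_UNIV])

text \<open>This is the purpose of the index set \<open>V\<close>: it records the variables a
  function depends on. A condition on the first \<open>r\<close> linear equations must be
  insensitive to the coefficients of the later ones.\<close>

lemma polyf_cong:
  assumes "f \<in> polyf V" "\<And>v. v \<in> V \<Longrightarrow> a v = b v"
  shows "f a = f b"
  using assms by (induction rule: polyf.induct) auto

lemma polyf_subst:
  assumes "f \<in> polyf V" "\<And>v. v \<in> V \<Longrightarrow> (\<lambda>a. s a v) \<in> polyf W"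
  shows "(\<lambda>a. f (s a)) \<in> polyf W"
  using assms by (induction rule: polyf.induct) (auto intro: polyf_intros)

lemma polyf_det [polyf_intros]:
  assumes "\<And>i j. (\<lambda>a. A a $ i $ j) \<in> polyf V"
  shows "(\<lambda>a. det (A a :: complex^'n^'n)) \<in> polyf V"
  unfolding det_def using assms by (intro polyf_intros) auto

section \<open>Polynomial functions and formal polynomials\<close>

definition monom_val :: "('v \<Rightarrow>\<^sub>0 nat) \<Rightarrow> ('v \<Rightarrow> complex) \<Rightarrow> complex" where
  "monom_val m a = (\<Prod>v\<in>Poly_Mapping.keys m. a v ^ Poly_Mapping.lookup m v)"

lemma monom_val_superset:
  assumes "finite K" "Poly_Mapping.keys m \<subseteq> K"
  shows "monom_val m a = (\<Prod>v\<in>K. a v ^ Poly_Mapping.lookup m v)"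
  unfolding monom_val_def using assms
  by (intro prod.mono_neutral_left) (auto simp: in_keys_iff)

lemma monom_val_add: "monom_val (m + m') a = monom_val m a * monom_val m' a"
proof -
  let ?K = "Poly_Mapping.keys m \<union> Poly_Mapping.keys m'"
  have "Poly_Mapping.keys (m + m') \<subseteq> ?K" by (rule keys_add)
  then show ?thesis
    by (simp add: monom_val_superset[of ?K] lookup_add power_add prod.distrib)
qed

lemma peval_superset:
  assumes "finite K" "Poly_Mapping.keys p \<subseteq> K"
  shows "peval p a = (\<Sum>m\<in>K. Poly_Mapping.lookup p m * monom_val m a)"
  unfolding peval_def monom_val_def[symmetric] using assms
  by (intro sum.mono_neutral_left) (auto simp: in_keys_iff)

lemma peval_add [simp]: "peval (p + q) a = peval p a + peval q a"
proof -
  let ?K = "Poly_Mapping.keys p \<union> Poly_Mapping.keys q"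
  have "Poly_Mapping.keys (p + q) \<subseteq> ?K" by (rule keys_add)
  then show ?thesis
    by (simp add: peval_superset[of ?K] lookup_add distrib_right sum.distrib)
qed

lemma peval_zero [simp]: "peval 0 a = 0"
  by (simp add: peval_def)

lemma peval_sum: "peval (\<Sum>i\<in>I. p i) a = (\<Sum>i\<in>I. peval (p i) a)"
  by (induction I rule: infinite_finite_induct) auto

lemma peval_single: "peval (Poly_Mapping.single m c) a = c * monom_val m a"
  by (subst peval_superset[of "{m}"]) (auto simp: lookup_single)

lemma monom_val_zero [simp]: "monom_val 0 a = 1"
  by (simp add: monom_val_def)

lemma monom_val_single: "monom_val (Poly_Mapping.single v k) a = a v ^ k"
  by (subst monom_val_superset[of "{v}"]) (auto simp: lookup_single)

lemma pvars_add: "pvars (p + q) \<subseteq> pvars p \<union> pvars q"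
  unfolding pvars_def using keys_add[of p q] by blast

lemma pvars_zero [simp]: "pvars 0 = {}"
  by (simp add: pvars_def)

lemma pvars_sum:
  assumes "\<And>i. i \<in> I \<Longrightarrow> pvars (p i) \<subseteq> V" shows "pvars (\<Sum>i\<in>I. p i) \<subseteq> V"
  using assms
proof (induction I rule: infinite_finite_induct)
  case (insert x F)
  then show ?case using pvars_add[of "p x" "sum p F"] by auto
qed auto

lemma pvars_single: "pvars (Poly_Mapping.single m c) \<subseteq> Poly_Mapping.keys m"
  by (auto simp: pvars_def split: if_splits)

lemma peval_in_polyf: "pvars p \<subseteq> V \<Longrightarrow> peval p \<in> polyf V"
  unfolding peval_def[abs_def] pvars_def by (intro polyf_intros) auto

text \<open>The inductive set gives closure properties and inductions, whereas
  \<open>generically\<close> and \<open>algebraic_set\<close> speak of formal polynomials; this is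
  the passage between them. For products the double sum over pairs of monomials is written
  out.\<close>

lemma polyf_imp_peval: "f \<in> polyf V \<Longrightarrow> \<exists>p. pvars p \<subseteq> V \<and> f = peval p"
proof (induction rule: polyf.induct)
  case (const c)
  show ?case
    using pvars_single[of 0 c] by (intro exI[of _ "Poly_Mapping.single 0 c"]) (auto simp: peval_single)
next
  case (var v)
  show ?case
    using pvars_single[of "Poly_Mapping.single v 1" 1] var
    by (intro exI[of _ "Poly_Mapping.single (Poly_Mapping.single v 1) 1"])
      (auto simp: peval_single monom_val_single)
next
  case (add f g)
  then obtain p q where pq: "pvars p \<subseteq> V" "f = peval p" "pvars q \<subseteq> V" "g = peval q" by auto
  have "pvars (p + q) \<subseteq> V" by (rule order_trans[OF pvars_add]) (simp add: pq)
  moreover have "(\<lambda>a. f a + g a) = peval (p + q)" by (simp add: pq fun_eq_iff)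
  ultimately show ?case by blast
next
  case (mult f g)
  then obtain p q where pq: "pvars p \<subseteq> V" "f = peval p" "pvars q \<subseteq> V" "g = peval q" by auto
  let ?r = "\<Sum>m\<in>Poly_Mapping.keys p. \<Sum>m'\<in>Poly_Mapping.keys q.
    Poly_Mapping.single (m + m') (Poly_Mapping.lookup p m * Poly_Mapping.lookup q m')"
  have "pvars ?r \<subseteq> V"
  proof (intro pvars_sum)
    fix m m' assume m: "m \<in> Poly_Mapping.keys p" "m' \<in> Poly_Mapping.keys q"
    have "Poly_Mapping.keys (m + m') \<subseteq> V"
      using m pq(1,3) by (intro order_trans[OF keys_add] Un_least) (auto simp: pvars_def)
    then show "pvars (Poly_Mapping.single (m + m') (Poly_Mapping.lookup p m * Poly_Mapping.lookup q m')) \<subseteq> V"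
      by (rule order_trans[OF pvars_single])
  qed
  moreover have "(\<lambda>a. f a * g a) = peval ?r"
  proof
    fix a
    show "f a * g a = peval ?r a"
    unfolding pq peval_sum peval_single monom_val_add
    by (simp add: peval_superset[OF finite_keys order_refl] sum_product mult_ac)
  qed
  ultimately show ?case by blast
qed

lemma polyf_iff: "f \<in> polyf V \<longleftrightarrow> (\<exists>p. pvars p \<subseteq> V \<and> f = peval p)"
  by (metis polyf_imp_peval peval_in_polyf)

lemma peval_polyf [polyf_intros]: "peval p \<in> polyf UNIV"
  by (rule peval_in_polyf) simp

lemma peval_subst [polyf_intros]:
  "(\<And>v. (\<lambda>a. s a v) \<in> polyf W) \<Longrightarrow> (\<lambda>a. peval p (s a)) \<in> polyf W"
  by (rule polyf_subst[OF peval_polyf])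

text \<open>The function is regarded as a polynomial in the single variable \<open>v\<close>. The
  vanishing of \<open>c k\<close> above \<open>d\<close> lets expansions of different degrees be
  added and multiplied termwise.\<close>

lemma polyf_expand:
  assumes "f \<in> polyf (insert v V)"
  shows "\<exists>c d. (\<forall>k. c k \<in> polyf (V - {v})) \<and> (\<forall>a. f a = (\<Sum>k\<le>d. c k a * a v ^ k)) \<and>
     (\<forall>k>d. c k = (\<lambda>a. 0))"
  using assms
proof (induction rule: polyf.induct)
  case (const b)
  have "b = (\<Sum>k\<le>0. (if k = 0 then b else 0) * a v ^ k)" for a :: "'a \<Rightarrow> complex" by simp
  then show ?case
    by (intro exI[of _ "\<lambda>k a. if k = 0 then b else 0"] exI[of _ 0]) (auto intro: polyf_intros)
next
  case (var w)
  show ?case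
  proof (cases "w = v")
    case True
    show ?thesis
      by (rule exI[of _ "\<lambda>k a. if k = 1 then 1 else 0"], rule exI[of _ 1])
        (auto simp: True intro: polyf_intros)
  next
    case False
    have "(\<lambda>a. if k = 0 then a w else 0) \<in> polyf (V - {v})" for k :: nat
      using False var by (cases "k = 0") (auto intro: polyf_intros)
    then show ?thesis
      by (intro exI[of _ "\<lambda>k a. if k = 0 then a w else 0"] exI[of _ 0]) auto
  qed
next
  case (add f g)
  then obtain c d c' d' where c: "\<forall>k. c k \<in> polyf (V - {v})" "\<forall>a. f a = (\<Sum>k\<le>d. c k a * a v ^ k)"
     "\<forall>k>d. c k = (\<lambda>a. 0)"
     "\<forall>k. c' k \<in> polyf (V - {v})" "\<forall>a. g a = (\<Sum>k\<le>d'. c' k a * a v ^ k)"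
     "\<forall>k>d'. c' k = (\<lambda>a. 0)" by blast
  have "f a + g a = (\<Sum>k\<le>max d d'. (c k a + c' k a) * a v ^ k)" for a
  proof -
    have "f a = (\<Sum>k\<le>max d d'. c k a * a v ^ k)"
      unfolding c(2)[rule_format] by (rule sum.mono_neutral_left) (auto simp: c(3))
    moreover have "g a = (\<Sum>k\<le>max d d'. c' k a * a v ^ k)"
      unfolding c(5)[rule_format] by (rule sum.mono_neutral_left) (auto simp: c(6))
    ultimately show ?thesis by (simp add: distrib_right sum.distrib)
  qed
  then show ?case using c
    by (intro exI[of _ "\<lambda>k a. c k a + c' k a"] exI[of _ "max d d'"]) (auto intro: polyf_intros)
next
  case (mult f g)
  then obtain c d c' d' where c: "\<forall>k. c k \<in> polyf (V - {v})" "\<forall>a. f a = (\<Sum>k\<le>d. c k a * a v ^ k)"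
     "\<forall>k>d. c k = (\<lambda>a. 0)"
     "\<forall>k. c' k \<in> polyf (V - {v})" "\<forall>a. g a = (\<Sum>k\<le>d'. c' k a * a v ^ k)"
     "\<forall>k>d'. c' k = (\<lambda>a. 0)" by blast
  let ?C = "\<lambda>k a. \<Sum>i\<le>k. c i a * c' (k - i) a"
  have "f a * g a = (\<Sum>k\<le>d + d'. ?C k a * a v ^ k)" for a
    unfolding c(2)[rule_format] c(5)[rule_format]
    by (rule polynomial_product) (auto simp: c(3,6))
  moreover have "?C k = (\<lambda>a. 0)" if "k > d + d'" for k
  proof
    fix a
    have "c i a * c' (k - i) a = 0" for i
      using that c(3)[rule_format, of i] c(6)[rule_format, of "k - i"]
      by (cases "i > d") auto
    then show "?C k a = 0" by (intro sum.neutral) blast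
  qed
  moreover have "?C k \<in> polyf (V - {v})" for k
    using c(1,4) by (intro polyf_intros) auto
  ultimately show ?case
    by (intro exI[of _ ?C] exI[of _ "d + d'"]) blast
qed

section \<open>Definable predicates and quantifier elimination\<close>

text \<open>Constructible conditions, kept as predicates and not as syntax. Closure under
  quantifiers is not built in: it is \<open>defb_ex1\<close>, the elimination theorem of Chevalley
  and Tarski.\<close>

inductive defb :: "(('v \<Rightarrow> complex) \<Rightarrow> bool) \<Rightarrow> bool" where
  zero: "f \<in> polyf UNIV \<Longrightarrow> defb (\<lambda>a. f a = 0)"
| neg: "defb P \<Longrightarrow> defb (\<lambda>a. \<not> P a)"
| conj: "defb P \<Longrightarrow> defb Q \<Longrightarrow> defb (\<lambda>a. P a \<and> Q a)"

named_theorems defb_intros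
declare defb.neg [defb_intros] defb.conj [defb_intros]

lemma defb_eq [defb_intros]:
  assumes "f \<in> polyf UNIV" "g \<in> polyf UNIV" shows "defb (\<lambda>a. f a = g a)"
  using defb.zero[OF polyf_diff[OF assms]] by simp

lemma defb_const [defb_intros]: "defb (\<lambda>a. b)"
proof (cases b)
  case True
  have "defb (\<lambda>a::'a \<Rightarrow> complex. (0::complex) = 0)" by (rule defb.zero) (rule polyf.const)
  then show ?thesis using True by simp
next
  case False
  have "defb (\<lambda>a::'a \<Rightarrow> complex. (1::complex) = 0)" by (rule defb.zero) (rule polyf.const)
  then show ?thesis using False by simp
qed

lemma defb_disj [defb_intros]:
  assumes "defb P" "defb Q" shows "defb (\<lambda>a. P a \<or> Q a)"
  using defb.neg[OF defb.conj[OF defb.neg[OF assms(1)] defb.neg[OF assms(2)]]] by simp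

lemma defb_imp [defb_intros]:
  assumes "defb P" "defb Q" shows "defb (\<lambda>a. P a \<longrightarrow> Q a)"
  using defb_disj[OF defb.neg[OF assms(1)] assms(2)] by simp

lemma defb_ball [defb_intros]:
  assumes "finite I" "\<And>i. i \<in> I \<Longrightarrow> defb (P i)"
  shows "defb (\<lambda>a. \<forall>i\<in>I. P i a)"
  using assms
proof (induction I rule: finite_induct)
  case (insert i I)
  then show ?case using defb.conj[of "P i" "\<lambda>a. \<forall>i\<in>I. P i a"] by simp
qed (simp add: defb_const)

lemma defb_bex [defb_intros]:
  assumes "finite I" "\<And>i. i \<in> I \<Longrightarrow> defb (P i)"
  shows "defb (\<lambda>a. \<exists>i\<in>I. P i a)"
  using assms
proof (induction I rule: finite_induct)
  case (insert i I)
  then show ?case using defb_disj[of "P i" "\<lambda>a. \<exists>i\<in>I. P i a"] by simp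
qed (simp add: defb_const)

lemma defb_subst:
  assumes "defb P" "\<And>v. (\<lambda>a. s a v) \<in> polyf UNIV"
  shows "defb (\<lambda>a. P (s a))"
  using assms(1)
proof (induction rule: defb.induct)
  case (zero f)
  then show ?case by (auto intro!: defb.zero polyf_subst[of f UNIV s] assms(2))
qed (simp_all add: defb.neg defb.conj)

text \<open>One inequation per disjunct is enough, because several inequations amount to one for the
  product. An existential quantifier passes through disjunctions, so only such a disjunct has to be
  treated.\<close>

inductive dnf :: "(('v \<Rightarrow> complex) \<Rightarrow> bool) \<Rightarrow> bool" where
  basic: "set Fs \<subseteq> polyf UNIV \<Longrightarrow> g \<in> polyf UNIV \<Longrightarrow> dnf (\<lambda>a. (\<forall>f\<in>set Fs. f a = 0) \<and> g a \<noteq> 0)"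
| disj: "dnf P \<Longrightarrow> dnf Q \<Longrightarrow> dnf (\<lambda>a. P a \<or> Q a)"

lemma dnf_conj_basic:
  assumes "dnf Q" "set Fs \<subseteq> polyf UNIV" "g \<in> polyf UNIV"
  shows "dnf (\<lambda>a. ((\<forall>f\<in>set Fs. f a = 0) \<and> g a \<noteq> 0) \<and> Q a)"
  using assms(1)
proof (induction rule: dnf.induct)
  case (basic Fs' g')
  have "dnf (\<lambda>a. (\<forall>f\<in>set (Fs @ Fs'). f a = 0) \<and> g a * g' a \<noteq> 0)"
    by (rule dnf.basic) (use basic assms in \<open>auto intro: polyf_intros\<close>)
  then show ?case by (rule back_subst[of dnf]) (auto simp: fun_eq_iff)
next
  case (disj P Q)
  have "dnf (\<lambda>a. ((\<forall>f\<in>set Fs. f a = 0) \<and> g a \<noteq> 0) \<and> P a \<or> ((\<forall>f\<in>set Fs. f a = 0) \<and> g a \<noteq> 0) \<and> Q a)"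
    by (rule dnf.disj) (use disj in auto)
  then show ?case by (rule back_subst[of dnf]) (auto simp: fun_eq_iff)
qed

lemma dnf_conj:
  assumes "dnf P" "dnf Q" shows "dnf (\<lambda>a. P a \<and> Q a)"
  using assms(1)
proof (induction rule: dnf.induct)
  case (basic Fs g)
  then show ?case by (rule dnf_conj_basic[OF assms(2)])
next
  case (disj P1 P2)
  have "dnf (\<lambda>a. P1 a \<and> Q a \<or> P2 a \<and> Q a)" by (rule dnf.disj) (use disj in auto)
  then show ?case by (rule back_subst[of dnf]) (auto simp: fun_eq_iff)
qed

lemma defb_imp_dnf: "defb P \<Longrightarrow> dnf P \<and> dnf (\<lambda>a. \<not> P a)"
proof (induction rule: defb.induct)
  case (zero f)
  have "dnf (\<lambda>a. (\<forall>h\<in>set [f]. h a = 0) \<and> (1::complex) \<noteq> 0)"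
    by (rule dnf.basic) (use zero in \<open>auto intro: polyf_intros\<close>)
  moreover have "dnf (\<lambda>a. (\<forall>h\<in>set []. h a = (0::complex)) \<and> f a \<noteq> 0)"
    by (rule dnf.basic) (use zero in \<open>auto intro: polyf_intros\<close>)
  ultimately show ?case by simp
next
  case (neg P)
  then show ?case by simp
next
  case (conj P Q)
  then show ?case using dnf_conj[of P Q] dnf.disj[of "\<lambda>a. \<not> P a" "\<lambda>a. \<not> Q a"] by simp
qed

section \<open>Univariate polynomials whose coefficients depend on parameters\<close>

definition polyP :: "(('v \<Rightarrow> complex) \<Rightarrow> complex poly) \<Rightarrow> bool" where
  "polyP P \<longleftrightarrow> (\<forall>k. (\<lambda>a. coeff (P a) k) \<in> polyf UNIV)"

text \<open>The bound is strict and uniform: \<open>degb 0\<close> forces the zero polynomial and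
  \<open>degb (Suc d)\<close> allows degree \<open>d\<close>. The true degree varies with the
  parameters and cannot control an induction.\<close>

definition degb :: "nat \<Rightarrow> (('v \<Rightarrow> complex) \<Rightarrow> complex poly) \<Rightarrow> bool" where
  "degb d P \<longleftrightarrow> (\<forall>a k. k \<ge> d \<longrightarrow> coeff (P a) k = 0)"

lemma polyP_coeff: "polyP P \<Longrightarrow> (\<lambda>a. coeff (P a) k) \<in> polyf UNIV"
  by (simp add: polyP_def)

lemma polyP_mult: "polyP P \<Longrightarrow> polyP Q \<Longrightarrow> polyP (\<lambda>a. P a * Q a)"
  unfolding polyP_def coeff_mult by (intro allI polyf_intros) auto

lemma polyP_diff: "polyP P \<Longrightarrow> polyP Q \<Longrightarrow> polyP (\<lambda>a. P a - Q a)"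
  unfolding polyP_def coeff_diff by (intro allI polyf_intros) auto

lemma polyP_monom: "f \<in> polyf UNIV \<Longrightarrow> polyP (\<lambda>a. monom (f a) n)"
  unfolding polyP_def coeff_monom by (intro allI polyf_if polyf_intros)

lemma polyP_power: "polyP P \<Longrightarrow> polyP (\<lambda>a. P a ^ n)"
proof (induction n)
  case 0
  have "polyP (\<lambda>a. monom ((\<lambda>a. 1) a) 0)" by (rule polyP_monom) (rule polyf.const)
  then show ?case by (simp add: monom_0 one_pCons)
qed (simp add: polyP_mult)

lemma degb_Suc_degree: "degb (Suc d) P \<Longrightarrow> degree (P a) \<le> d"
  by (auto simp: degb_def intro!: degree_le)

lemma degb_power:
  assumes "degb (Suc d) P" shows "degb (Suc (d * n)) (\<lambda>a. P a ^ n)"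
  unfolding degb_def
proof (intro allI impI)
  fix a k assume k: "Suc (d * n) \<le> k"
  have "degree (P a ^ n) \<le> d * n"
    using degree_power_le[of "P a" n] degb_Suc_degree[OF assms, of a]
    by (meson mult_le_mono1 order_trans)
  then show "coeff (P a ^ n) k = 0" using k by (intro coeff_eq_0) simp
qed

lemma degb_mono: "degb d P \<Longrightarrow> d \<le> e \<Longrightarrow> degb e P"
  by (auto simp: degb_def)

lemma degb_0: "degb 0 P \<Longrightarrow> P a = 0"
  by (auto simp: degb_def poly_eq_iff)

lemma defb_poly_zero:
  assumes "polyP P" "degb d P" shows "defb (\<lambda>a. P a = 0)"
proof -
  have "defb (\<lambda>a. \<forall>k\<in>{..<d}. coeff (P a) k = 0)"
    by (intro defb_intros defb.zero) (use assms in \<open>auto simp: polyP_def\<close>)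
  moreover have "P a = 0 \<longleftrightarrow> (\<forall>k\<in>{..<d}. coeff (P a) k = 0)" for a
    using assms(2) by (auto simp: degb_def poly_eq_iff) (metis lessThan_iff not_le)
  ultimately show ?thesis by simp
qed

text \<open>Used where the formal leading coefficient vanishes: there the polynomial is unchanged,
  but its degree bound drops.\<close>

definition cut :: "nat \<Rightarrow> (('v \<Rightarrow> complex) \<Rightarrow> complex poly) \<Rightarrow> ('v \<Rightarrow> complex) \<Rightarrow> complex poly" where
  "cut d P a = P a - monom (coeff (P a) d) d"

lemma cut: assumes "polyP P" "degb (Suc d) P" shows "polyP (cut d P)" "degb d (cut d P)"
proof -
  show "polyP (cut d P)"
    unfolding cut_def[abs_def] by (intro polyP_diff polyP_monom assms polyP_coeff)
  show "degb d (cut d P)" using assms(2) by (auto simp: degb_def cut_def coeff_monom)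
qed

lemma cut_eq: "coeff (P a) d = 0 \<Longrightarrow> cut d P a = P a"
  by (simp add: cut_def)

text \<open>One step of pseudo-division. Multiplying crosswise by the formal leading coefficients
  avoids a division, so that all coefficients remain polynomial in the parameters.\<close>

definition red :: "nat \<Rightarrow> nat \<Rightarrow> (('v \<Rightarrow> complex) \<Rightarrow> complex poly) \<Rightarrow> (('v \<Rightarrow> complex) \<Rightarrow> complex poly)
    \<Rightarrow> ('v \<Rightarrow> complex) \<Rightarrow> complex poly" where
  "red d e P R a = monom (coeff (P a) d) 0 * R a - monom (coeff (R a) e) (e - d) * P a"

lemma red:
  assumes "polyP P" "degb (Suc d) P" "polyP R" "degb (Suc e) R" "d \<le> e"
  shows "polyP (red d e P R)" "degb e (red d e P R)"
proof -
  show "polyP (red d e P R)"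
    unfolding red_def[abs_def] by (intro polyP_diff polyP_mult polyP_monom polyP_coeff assms)
  show "degb e (red d e P R)" unfolding degb_def
  proof (intro allI impI)
    fix a k assume k: "e \<le> k"
    show "coeff (red d e P R a) k = 0"
    proof (cases "k = e")
      case True
      then show ?thesis using assms(5) by (simp add: red_def coeff_monom_mult)
    next
      case False
      then have "coeff (R a) k = 0" "coeff (P a) (k - (e - d)) = 0"
        using assms k by (auto simp: degb_def)
      then show ?thesis by (simp add: red_def coeff_monom_mult)
    qed
  qed
qed

text \<open>Where the formal leading coefficient of \<open>P\<close> is nonzero, a pseudo-division
  step on \<open>R\<close> does not affect divisibility by \<open>P\<close>. Once the degree of
  \<open>R\<close> is below that of \<open>P\<close>, divisibility means that all coefficients of
  \<open>R\<close> vanish.\<close>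

lemma defb_dvd:
  assumes P: "polyP P" "degb (Suc d) P" and "polyP R" "degb e R"
  shows "defb (\<lambda>a. coeff (P a) d \<noteq> 0 \<and> P a dvd R a)"
  using assms(3,4)
proof (induction e arbitrary: R)
  case 0
  then have "R a = 0" for a using degb_0 by blast
  then show ?case by (simp, intro defb.neg defb_eq polyP_coeff P polyf.const)
next
  case (Suc e)
  have deg: "degree (P a) = d" if "coeff (P a) d \<noteq> 0" for a
    using that degb_Suc_degree[OF P(2), of a] le_degree[of "P a" d] by simp
  show ?case
  proof (cases "d \<le> e")
    case True
    have "coeff (P a) d \<noteq> 0 \<and> P a dvd R a \<longleftrightarrow> coeff (P a) d \<noteq> 0 \<and> P a dvd red d e P R a" for a
    proof -
      have "P a dvd red d e P R a \<longleftrightarrow> P a dvd monom (coeff (P a) d) 0 * R a"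
        unfolding red_def by (simp add: dvd_diff_left_iff)
      then show ?thesis by (auto simp: monom_0 dvd_smult_iff)
    qed
    then show ?thesis using Suc.IH[OF red[OF P Suc.prems True]] by simp
  next
    case False
    have "coeff (P a) d \<noteq> 0 \<and> P a dvd R a \<longleftrightarrow> coeff (P a) d \<noteq> 0 \<and> R a = 0" for a
    proof -
      have "degree (R a) < d" using degb_Suc_degree[OF Suc.prems(2), of a] False by simp
      then show ?thesis using deg[of a] dvd_imp_degree_le[of "P a" "R a"] by (cases "R a = 0") auto
    qed
    moreover have "defb (\<lambda>a. coeff (P a) d \<noteq> 0 \<and> R a = 0)"
      by (intro defb_intros polyP_coeff P defb_poly_zero[OF Suc.prems] polyf.const)
    ultimately show ?thesis by simp
  qed
qed

text \<open>By the univariate Nullstellensatz, all roots of a nonzero \<open>P\<close> are roots of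
  \<open>Q\<close> iff \<open>P\<close> divides a power of \<open>Q\<close> whose exponent is the
  degree of \<open>P\<close>. Where the formal leading coefficient of \<open>P\<close> vanishes, the
  degree bound is lowered; at bound 0 only \<open>Q a \<noteq> 0\<close> is left.\<close>

lemma defb_ex_single:
  assumes "polyP P" "degb d P" "polyP Q" "degb (Suc e) Q"
  shows "defb (\<lambda>a. \<exists>z. poly (P a) z = 0 \<and> poly (Q a) z \<noteq> 0)"
  using assms(1,2)
proof (induction d arbitrary: P)
  case 0
  then have P: "P a = 0" for a using degb_0 by blast
  have "(\<exists>z. poly (P a) z = 0 \<and> poly (Q a) z \<noteq> 0) \<longleftrightarrow> \<not> Q a = 0" for a
    using poly_eq_poly_eq_iff[of "Q a" 0] by (auto simp: P fun_eq_iff)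
  then show ?case using defb.neg[OF defb_poly_zero[OF assms(3,4)]] by simp
next
  case (Suc d)
  let ?E = "\<lambda>P a. \<exists>z. poly (P a) z = 0 \<and> poly (Q a) z \<noteq> 0"
  have 1: "defb (?E (cut d P))" using Suc.IH[OF cut[OF Suc.prems]] .
  have 2: "defb (\<lambda>a. coeff (P a) d \<noteq> 0 \<and> P a dvd Q a ^ d)"
    by (rule defb_dvd[OF Suc.prems polyP_power[OF assms(3)] degb_power[OF assms(4)]])
  have "?E P a \<longleftrightarrow> (coeff (P a) d = 0 \<and> ?E (cut d P) a) \<or>
      (coeff (P a) d \<noteq> 0 \<and> \<not> (coeff (P a) d \<noteq> 0 \<and> P a dvd Q a ^ d))" for a
  proof (cases "coeff (P a) d = 0")
    case True
    then show ?thesis by (simp add: cut_eq)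
  next
    case False
    then have "degree (P a) = d"
      using degb_Suc_degree[OF Suc.prems(2), of a] le_degree[of "P a" d] by simp
    then show ?thesis using nullstellensatz_univariate[of "P a" "Q a"] False by auto
  qed
  moreover have "defb (\<lambda>a. (coeff (P a) d = 0 \<and> ?E (cut d P) a) \<or>
      (coeff (P a) d \<noteq> 0 \<and> \<not> (coeff (P a) d \<noteq> 0 \<and> P a dvd Q a ^ d)))"
    by (intro defb_disj defb.conj defb.neg 1 2 defb_eq polyP_coeff[OF Suc.prems(1)] polyf.const)
  ultimately show ?case by simp
qed

abbreviation exz where
  "exz Ps Q a \<equiv> \<exists>z. (\<forall>P\<in>set Ps. poly (snd P a) z = 0) \<and> poly (Q a) z \<noteq> 0"

text \<open>A step of Euclid's algorithm with a case distinction. If the formal leading coefficient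
  of \<open>P1\<close> vanishes, \<open>P1\<close> is cut. Otherwise \<open>P1\<close> reduces
  \<open>P2\<close>, which on the roots of \<open>P1\<close> only multiplies \<open>P2\<close> by a
  nonzero number. In both cases the sum of the degree bounds drops.\<close>

lemma defb_exz_step:
  assumes Q: "polyP Q" "degb (Suc e) Q"
    and IH: "\<And>Rs. (\<forall>(d, P)\<in>set Rs. polyP P \<and> degb d P) \<Longrightarrow> length Rs \<le> n \<Longrightarrow>
      sum_list (map fst Rs) < s \<Longrightarrow> defb (exz Rs Q)"
    and Ps: "\<forall>(d, P)\<in>set ((d1, P1) # (d2, P2) # Ps). polyP P \<and> degb d P"
    and n: "length Ps + 2 \<le> n" and s: "d1 + d2 + sum_list (map fst Ps) = s" and d: "0 < d1" "d1 \<le> d2"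
  shows "defb (exz ((d1, P1) # (d2, P2) # Ps) Q)"
proof -
  obtain c1 c2 where c: "d1 = Suc c1" "d2 = Suc c2" using d by (cases d1; cases d2) auto
  have P: "polyP P1" "degb (Suc c1) P1" "polyP P2" "degb (Suc c2) P2" using Ps c by auto
  let ?A = "exz ((c1, cut c1 P1) # (d2, P2) # Ps) Q"
  let ?B = "exz ((d1, P1) # (c2, red c1 c2 P1 P2) # Ps) Q"
  have A: "defb ?A" by (rule IH) (use Ps n s cut[OF P(1,2)] c in auto)
  have B: "defb ?B" by (rule IH) (use Ps n s red[OF P] c d in auto)
  have "exz ((d1, P1) # (d2, P2) # Ps) Q a \<longleftrightarrow>
     (coeff (P1 a) c1 = 0 \<and> ?A a) \<or> (coeff (P1 a) c1 \<noteq> 0 \<and> ?B a)" for a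
  proof (cases "coeff (P1 a) c1 = 0")
    case True
    then show ?thesis by (simp add: cut_eq)
  next
    case False
    then have "poly (P1 a) z = 0 \<Longrightarrow> poly (red c1 c2 P1 P2 a) z = 0 \<longleftrightarrow> poly (P2 a) z = 0" for z
      by (simp add: red_def poly_monom)
    then show ?thesis using False by auto
  qed
  moreover have "defb (\<lambda>a. (coeff (P1 a) c1 = 0 \<and> ?A a) \<or> (coeff (P1 a) c1 \<noteq> 0 \<and> ?B a))"
    by (intro defb_disj defb.conj defb.neg A B defb_eq polyP_coeff[OF P(1)] polyf.const)
  ultimately show ?thesis by simp
qed

text \<open>The equations are reduced to at most one. A polynomial with bound 0 is dropped, and
  otherwise two of them undergo a Euclidean step; both decrease the number of polynomials plus the
  sum of their bounds.\<close>

lemma defb_exz: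
  assumes Q: "polyP Q" "degb (Suc e) Q"
  shows "(\<forall>(d, P)\<in>set Ps. polyP P \<and> degb d P) \<Longrightarrow> length Ps = n \<Longrightarrow>
    sum_list (map fst Ps) = s \<Longrightarrow> defb (exz Ps Q)"
proof (induction "n + s" arbitrary: Ps n s rule: less_induct)
  case less
  have IH: "defb (exz Rs Q)" if "\<forall>(d, P)\<in>set Rs. polyP P \<and> degb d P"
    "length Rs + sum_list (map fst Rs) < n + s" for Rs
    using less.hyps[OF that(2) that(1) refl refl] .
  have drop: "defb (exz (x # y) Q)" if "set (x # y) = set Ps" "length Ps = Suc (length y)" 
    "fst x = 0" "s = sum_list (map fst y)" for x y
  proof -
    have "degb 0 (snd x)" using that(1,3) less.prems(1) by (cases x) force
    then have x: "snd x a = 0" for a by (rule degb_0)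
    have "exz (x # y) Q = exz y Q" by (auto simp: x)
    moreover have "defb (exz y Q)" by (rule IH) (use that less.prems in auto)
    ultimately show ?thesis by simp
  qed
  show ?case
  proof (cases Ps)
    case Nil
    have "(\<lambda>a. \<not> Q a = 0) = exz Ps Q"
      using poly_eq_poly_eq_iff[of "Q _" 0] by (auto simp: Nil fun_eq_iff)
    then show ?thesis using defb.neg[OF defb_poly_zero[OF assms]] by simp
  next
    case (Cons x y)
    show ?thesis
    proof (cases y)
      case Nil
      then show ?thesis using defb_ex_single[OF _ _ assms, of "snd x" "fst x"] less.prems Cons
        by (cases x) auto
    next
      case (Cons x' y')
      then have Ps: "Ps = (fst x, snd x) # (fst x', snd x') # y'" using \<open>Ps = x # y\<close> by simp
      have swap: "exz Ps Q = exz ((fst x', snd x') # (fst x, snd x) # y') Q"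
        by (auto simp: Ps)
      consider "fst x = 0" | "fst x' = 0" | "0 < fst x" "fst x \<le> fst x'" | "0 < fst x'" "fst x' \<le> fst x"
        by linarith
      then show ?thesis
      proof cases
        case 1
        then show ?thesis using drop[of x y] less.prems \<open>Ps = x # y\<close> by auto
      next
        case 2
        show ?thesis unfolding swap prod.collapse
          by (rule drop) (use 2 less.prems \<open>Ps = x # y\<close> Cons in auto)
      next
        case 3
        show ?thesis unfolding Ps
          by (rule defb_exz_step[OF assms IH, where n = n and s = s])
            (use less.prems 3 in \<open>auto simp: Ps\<close>)
      next
        case 4
        show ?thesis unfolding swap
          by (rule defb_exz_step[OF assms IH, where n = n and s = s])
            (use less.prems 4 in \<open>auto simp: Ps\<close>)
      qed
    qed
  qed
qed

lemma polyf_fibre: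
  assumes "f \<in> polyf UNIV"
  shows "\<exists>P d. polyP P \<and> degb d P \<and> (\<forall>a z. f (a(v := z)) = poly (P a) z)"
proof -
  obtain c d where c: "\<And>k. c k \<in> polyf (UNIV - {v})" "\<And>a. f a = (\<Sum>k\<le>d. c k a * a v ^ k)"
    using polyf_expand[of f v UNIV] assms by auto
  let ?P = "\<lambda>a. \<Sum>k\<le>d. monom (c k a) k"
  have co: "coeff (?P a) k = (if k \<le> d then c k a else 0)" for a k
    by (simp add: coeff_sum coeff_monom)
  have "polyP ?P" unfolding polyP_def co
    by (intro allI polyf_if polyf_intros polyf_UNIV[OF c(1)])
  moreover have "degb (Suc d) ?P" unfolding degb_def co by simp
  moreover have "f (a(v := z)) = poly (?P a) z" for a z
  proof -
    have "c k (a(v := z)) = c k a" for k by (rule polyf_cong[OF c(1)]) auto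
    then show ?thesis by (simp add: c(2) poly_sum poly_monom)
  qed
  ultimately show ?thesis by blast
qed

lemma dnf_ex: "dnf P \<Longrightarrow> defb (\<lambda>a. \<exists>z. P (a(v := z)))"
proof (induction rule: dnf.induct)
  case (basic Fs g)
  define R where "R f = (SOME x. polyP (snd x) \<and> degb (fst x) (snd x) \<and>
    (\<forall>a z. f (a(v := z)) = poly (snd x a) z))" for f
  have R: "polyP (snd (R f)) \<and> degb (fst (R f)) (snd (R f)) \<and>
    (\<forall>a z. f (a(v := z)) = poly (snd (R f) a) z)" if f: "f \<in> polyf UNIV" for f
    unfolding R_def by (rule someI_ex) (use polyf_fibre[OF f, of v] in auto)
  have "defb (exz (map R Fs) (snd (R g)))"
    by (rule defb_exz[where e = "fst (R g)"])
      (use R basic in \<open>auto simp: case_prod_beta intro: degb_mono[of "fst (R g)"]\<close>)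
  moreover have "exz (map R Fs) (snd (R g)) =
     (\<lambda>a. \<exists>z. (\<forall>f\<in>set Fs. f (a(v := z)) = 0) \<and> g (a(v := z)) \<noteq> 0)"
    using R basic by (auto simp: fun_eq_iff subset_iff)
  ultimately show ?case by (simp only:)
next
  case (disj P Q)
  then show ?case using defb_disj[OF disj.IH] by (simp add: ex_disj_distrib)
qed

theorem defb_ex1: "defb P \<Longrightarrow> defb (\<lambda>a. \<exists>z. P (a(v := z)))"
  by (rule dnf_ex[OF conjunct1[OF defb_imp_dnf]])

section \<open>Quantifiers over blocks of variables, vectors and finite sets\<close>

lemma defb_ex_override:
  assumes "finite W" "defb P" shows "defb (\<lambda>a. \<exists>b. P (override_on a b W))"
  using assms(1)
proof (induction W rule: finite_induct)
  case empty
  then show ?case using assms(2) by simp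
next
  case (insert v W)
  have "(\<lambda>a. \<exists>z. \<exists>b. P (override_on (a(v := z)) b W)) = (\<lambda>a. \<exists>b. P (override_on a b (insert v W)))"
  proof (intro ext iffI; elim exE)
    fix a z b assume "P (override_on (a(v := z)) b W)"
    moreover have "override_on (a(v := z)) b W = override_on a (b(v := z)) (insert v W)"
      using insert(2) by (auto simp: override_on_def)
    ultimately show "\<exists>b. P (override_on a b (insert v W))" by auto
  next
    fix a b assume "P (override_on a b (insert v W))"
    moreover have "override_on (a(v := b v)) b W = override_on a b (insert v W)"
      using insert(2) by (auto simp: override_on_def)
    ultimately show "\<exists>z b. P (override_on (a(v := z)) b W)" by metis
  qed
  then show ?case using defb_ex1[OF insert.IH, of v] by (simp only:)
qed

lemma case_sum_polyf: "(\<lambda>a. case_sum a c v) \<in> polyf UNIV"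
  by (cases v) (auto intro: polyf_intros)

text \<open>Parameters sit in the left summand and quantified variables in the right one. Variables
  are eliminated one at a time, so only finitely many may matter; the remaining ones are set to
  0.\<close>

lemma defb_ex_sum:
  assumes "defb P" "finite W" "\<And>a x y. (\<And>w. w \<in> W \<Longrightarrow> x w = y w) \<Longrightarrow> P (case_sum a x) = P (case_sum a y)"
  shows "defb (\<lambda>a. \<exists>x. P (case_sum a x))"
proof -
  have "defb (\<lambda>a. (\<lambda>a. \<exists>b. P (override_on a b (Inr ` W))) (case_sum a (\<lambda>_. 0)))"
    by (rule defb_subst[OF defb_ex_override[OF _ assms(1)]]) (auto simp: assms(2) intro: case_sum_polyf)
  moreover have "(\<exists>b. P (override_on (case_sum a (\<lambda>_. 0)) b (Inr ` W))) \<longleftrightarrow> (\<exists>x. P (case_sum a x))" for a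
  proof
    assume "\<exists>b. P (override_on (case_sum a (\<lambda>_. 0)) b (Inr ` W))"
    then obtain b where "P (override_on (case_sum a (\<lambda>_. 0)) b (Inr ` W))" ..
    moreover have "override_on (case_sum a (\<lambda>_. 0)) b (Inr ` W) = case_sum a (\<lambda>w. if w \<in> W then b (Inr w) else 0)"
      by (auto simp: override_on_def split: sum.split)
    ultimately show "\<exists>x. P (case_sum a x)" by auto
  next
    assume "\<exists>x. P (case_sum a x)"
    then obtain x where x: "P (case_sum a x)" ..
    have "override_on (case_sum a (\<lambda>_. 0)) (case_sum a x) (Inr ` W) = case_sum a (\<lambda>w. if w \<in> W then x w else 0)"
      by (auto simp: override_on_def split: sum.split)
    moreover have "P (case_sum a (\<lambda>w. if w \<in> W then x w else 0))"
      using x assms(3)[of x "\<lambda>w. if w \<in> W then x w else 0" a] by simp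
    ultimately show "\<exists>b. P (override_on (case_sum a (\<lambda>_. 0)) b (Inr ` W))" by metis
  qed
  ultimately show ?thesis by simp
qed

lemma defb_ex_vec [defb_intros]:
  fixes \<Phi> :: "('v \<Rightarrow> complex) \<Rightarrow> complex ^ 'n::finite \<Rightarrow> bool"
  assumes "defb (\<lambda>a. \<Phi> (\<lambda>v. a (Inl v)) (\<chi> i. a (Inr i)))"
  shows "defb (\<lambda>a. \<exists>x. \<Phi> a x)"
proof -
  have "(\<exists>x. \<Phi> a (\<chi> i. x i)) \<longleftrightarrow> (\<exists>x. \<Phi> a x)" for a
    by (metis vec_lambda_eta)
  then show ?thesis using defb_ex_sum[OF assms, of UNIV] by simp
qed

lemma defb_all_vec [defb_intros]:
  fixes \<Phi> :: "('v \<Rightarrow> complex) \<Rightarrow> complex ^ 'n::finite \<Rightarrow> bool"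
  assumes "defb (\<lambda>a. \<Phi> (\<lambda>v. a (Inl v)) (\<chi> i. a (Inr i)))"
  shows "defb (\<lambda>a. \<forall>x. \<Phi> a x)"
  using defb.neg[OF defb_ex_vec[of "\<lambda>a x. \<not> \<Phi> a x", OF defb.neg[OF assms]]] by simp

lemma defb_ex_complex [defb_intros]:
  assumes "defb (\<lambda>a. \<Phi> (\<lambda>v. a (Inl v)) (a (Inr ())))"
  shows "defb (\<lambda>a. \<exists>z. \<Phi> a z)"
proof -
  have "(\<exists>x. \<Phi> a (x ())) \<longleftrightarrow> (\<exists>z. \<Phi> a z)" for a
    by (auto intro: exI[of _ "\<lambda>_. _"])
  then show ?thesis using defb_ex_sum[OF assms, of UNIV] by simp
qed

lemma defb_all_complex [defb_intros]:
  assumes "defb (\<lambda>a. \<Phi> (\<lambda>v. a (Inl v)) (a (Inr ())))"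
  shows "defb (\<lambda>a. \<forall>z. \<Phi> a z)"
  using defb.neg[OF defb_ex_complex[of "\<lambda>a x. \<not> \<Phi> a x", OF defb.neg[OF assms]]] by simp

text \<open>``At least \<open>N\<close> points'' is definable: quantify over injective enumerations.\<close>

lemma defb_card_ge:
  fixes \<Phi> :: "('v \<Rightarrow> complex) \<Rightarrow> ('n::finite \<Rightarrow> complex) \<Rightarrow> bool"
  assumes "defb (\<lambda>a. \<Phi> (\<lambda>v. a (Inl v)) (\<lambda>i. a (Inr i)))"
  shows "defb (\<lambda>a. \<exists>X :: nat \<Rightarrow> 'n \<Rightarrow> complex. inj_on X {..<N} \<and> (\<forall>k<N. \<Phi> a (X k)))"
proof -
  let ?P = "\<lambda>a :: 'v + nat \<times> 'n \<Rightarrow> complex.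
    (\<forall>k\<in>{..<N}. \<forall>l\<in>{..<N}. k = l \<or> (\<exists>i\<in>UNIV. \<not> a (Inr (k, i)) = a (Inr (l, i)))) \<and>
    (\<forall>k\<in>{..<N}. \<Phi> (\<lambda>v. a (Inl v)) (\<lambda>i. a (Inr (k, i))))"
  have "defb (\<lambda>a::'v + nat \<times> 'n \<Rightarrow> complex. \<Phi> (\<lambda>v. a (Inl v)) (\<lambda>i. a (Inr (k, i))))" for k
  proof -
    have "defb (\<lambda>a::'v + nat \<times> 'n \<Rightarrow> complex. (\<lambda>a. \<Phi> (\<lambda>v. a (Inl v)) (\<lambda>i. a (Inr i)))
       ((\<lambda>w. case w of Inl v \<Rightarrow> a (Inl v) | Inr i \<Rightarrow> a (Inr (k, i)))))"
    proof (rule defb_subst[OF assms])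
      fix v :: "'v + 'n"
      show "(\<lambda>a. case v of Inl v \<Rightarrow> a (Inl v) | Inr i \<Rightarrow> a (Inr (k, i))) \<in> polyf UNIV"
        by (cases v) (auto intro: polyf_intros)
    qed
    then show ?thesis by simp
  qed
  then have P: "defb ?P" by (intro defb_intros polyf_intros) auto
  have "defb (\<lambda>a. \<exists>x. ?P (case_sum a x))"
    by (rule defb_ex_sum[OF P, of "{..<N} \<times> UNIV"]) auto
  moreover have "?P (case_sum a x) \<longleftrightarrow>
      inj_on (\<lambda>k i. x (k, i)) {..<N} \<and> (\<forall>k<N. \<Phi> a (\<lambda>i. x (k, i)))" for a x
  proof -
    have "(\<forall>k\<in>{..<N}. \<forall>l\<in>{..<N}. k = l \<or> (\<exists>i\<in>UNIV. \<not> x (k, i) = x (l, i))) \<longleftrightarrow>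
        inj_on (\<lambda>k i. x (k, i)) {..<N}"
      unfolding inj_on_def fun_eq_iff by (intro ball_cong refl) auto
    then show ?thesis by (simp add: Ball_def)
  qed
  moreover have "(\<exists>X. inj_on X {..<N} \<and> (\<forall>k<N. \<Phi> a (X k))) \<longleftrightarrow>
      (\<exists>x. inj_on (\<lambda>k i. x (k, i)) {..<N} \<and> (\<forall>k<N. \<Phi> a (\<lambda>i. x (k, i))))" for a
  proof
    assume "\<exists>X. inj_on X {..<N} \<and> (\<forall>k<N. \<Phi> a (X k))"
    then obtain X where "inj_on X {..<N} \<and> (\<forall>k<N. \<Phi> a (X k))" ..
    then show "\<exists>x. inj_on (\<lambda>k i. x (k, i)) {..<N} \<and> (\<forall>k<N. \<Phi> a (\<lambda>i. x (k, i)))"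
      by (intro exI[of _ "\<lambda>(k, i). X k i"]) simp
  qed auto
  ultimately show ?thesis by simp
qed

section \<open>Genericity\<close>

lemma polyf_line:
  assumes "f \<in> polyf V" "\<And>v. \<exists>p. \<forall>t. s t v = poly p t"
  shows "\<exists>p. \<forall>t. f (s t) = poly p (t::complex)"
  using assms(1)
proof (induction rule: polyf.induct)
  case (const c)
  show ?case by (rule exI[of _ "[:c:]"]) simp
next
  case (var v)
  show ?case by (rule assms(2))
next
  case (add f g)
  then obtain p q where "\<forall>t. f (s t) = poly p t" "\<forall>t. g (s t) = poly q t" by blast
  then show ?case by (intro exI[of _ "p + q"]) simp
next
  case (mult f g)
  then obtain p q where "\<forall>t. f (s t) = poly p t" "\<forall>t. g (s t) = poly q t" by blast
  then show ?case by (intro exI[of _ "p * q"]) simp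
qed

text \<open>On the line through \<open>a\<close> and \<open>b\<close> both functions become nonzero
  univariate polynomials, and their product has a nonroot. This is why finitely many generic
  conditions can be satisfied together.\<close>

lemma polyf_mult_nonzero:
  assumes "f \<in> polyf UNIV" "g \<in> polyf UNIV" "f a \<noteq> 0" "g b \<noteq> 0"
  shows "\<exists>x. f x * g x \<noteq> 0"
proof -
  let ?s = "\<lambda>t v. a v + t * (b v - a v)"
  have s: "\<exists>p. \<forall>t. ?s t v = poly p t" for v
    by (rule exI[of _ "[:a v, b v - a v:]"]) simp
  obtain p where p: "\<And>t. f (?s t) = poly p t" using polyf_line[OF assms(1), of ?s, OF s] by blast
  obtain q where q: "\<And>t. g (?s t) = poly q t" using polyf_line[OF assms(2), of ?s, OF s] by blast
  have "p \<noteq> 0" using p[of 0] assms(3) by auto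
  moreover have "q \<noteq> 0" using q[of 1] assms(4) by auto
  ultimately have "p * q \<noteq> 0" by simp
  then obtain t where "poly (p * q) t \<noteq> 0"
    by (metis poly_0 poly_eq_poly_eq_iff ext)
  then show ?thesis using p q by (metis poly_mult)
qed

lemma polyf_continuous:
  assumes "f \<in> polyf V" "\<And>v. continuous_on S (\<lambda>x. s x v)"
  shows "continuous_on S (\<lambda>x. f (s x))"
  using assms(1) by (induction rule: polyf.induct) (auto intro!: continuous_intros assms(2))

lemma generically_iff:
  "generically V P \<longleftrightarrow> (\<exists>f\<in>polyf V. (\<exists>a. f a \<noteq> 0) \<and> (\<forall>a. f a \<noteq> 0 \<longrightarrow> P a))"
proof
  assume "generically V P"
  then obtain S a where S: "\<forall>p\<in>S. pvars p \<subseteq> V" "\<not> (\<forall>p\<in>S. peval p a = 0)"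
    "\<forall>a. \<not> (\<forall>p\<in>S. peval p a = 0) \<longrightarrow> P a" unfolding generically_def by blast
  then obtain p where p: "p \<in> S" "peval p a \<noteq> 0" by blast
  show "\<exists>f\<in>polyf V. (\<exists>a. f a \<noteq> 0) \<and> (\<forall>a. f a \<noteq> 0 \<longrightarrow> P a)"
    by (rule bexI[of _ "peval p"]) (use S p in \<open>auto intro: peval_in_polyf\<close>)
next
  assume "\<exists>f\<in>polyf V. (\<exists>a. f a \<noteq> 0) \<and> (\<forall>a. f a \<noteq> 0 \<longrightarrow> P a)"
  then obtain f a where f: "f \<in> polyf V" "f a \<noteq> 0" "\<forall>a. f a \<noteq> 0 \<longrightarrow> P a" by metis
  obtain p where p: "pvars p \<subseteq> V" "f = peval p" using f(1) unfolding polyf_iff by metis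
  have "peval p a \<noteq> 0" "\<forall>a. peval p a \<noteq> 0 \<longrightarrow> P a" using f p(2) by simp_all
  with p(1) show "generically V P" unfolding generically_def by (intro exI[of _ "{p}"]) auto
qed

lemma generically_mono: "generically V P \<Longrightarrow> (\<And>a. P a \<Longrightarrow> Q a) \<Longrightarrow> generically V Q"
  unfolding generically_iff by blast

lemma generically_superset: "generically V P \<Longrightarrow> V \<subseteq> W \<Longrightarrow> generically W P"
  unfolding generically_iff using polyf_mono[of V W] by blast

lemma generically_conj:
  assumes "generically V P" "generically V Q" shows "generically V (\<lambda>a. P a \<and> Q a)"
proof -
  obtain f g a b where fg: "f \<in> polyf V" "f a \<noteq> 0" "\<And>a. f a \<noteq> 0 \<Longrightarrow> P a"
     "g \<in> polyf V" "g b \<noteq> 0" "\<And>a. g a \<noteq> 0 \<Longrightarrow> Q a"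
    using assms unfolding generically_iff by metis
  have "\<exists>x. f x * g x \<noteq> 0"
    using polyf_mult_nonzero[OF polyf_UNIV polyf_UNIV] fg by metis
  then show ?thesis unfolding generically_iff
    by (intro bexI[of _ "\<lambda>a. f a * g a"]) (auto intro: fg polyf_intros)
qed

lemma generically_True: "(\<And>a. P a) \<Longrightarrow> generically V P"
  unfolding generically_iff by (intro bexI[of _ "\<lambda>a. 1"]) (auto intro: polyf_intros)

lemma generically_ball:
  assumes "finite I" "\<And>i. i \<in> I \<Longrightarrow> generically V (P i)"
  shows "generically V (\<lambda>a. \<forall>i\<in>I. P i a)"
  using assms
proof (induction I rule: finite_induct)
  case (insert i I)
  then show ?case using generically_conj[of V "P i" "\<lambda>a. \<forall>i\<in>I. P i a"] by simp
qed (simp add: generically_True)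

lemma generically_ex: "generically V P \<Longrightarrow> \<exists>a. P a"
  unfolding generically_iff by blast

lemma generically_not_both: "generically V P \<Longrightarrow> generically W (\<lambda>a. \<not> P a) \<Longrightarrow> False"
  using generically_conj[of "V \<union> W" P "\<lambda>a. \<not> P a"] generically_ex
    generically_superset[of V P "V \<union> W"] generically_superset[of W "\<lambda>a. \<not> P a" "V \<union> W"] by fastforce

text \<open>Moves a generic condition into a parameter space with further coordinates, such as the
  value of a function or the constants of a run.\<close>

lemma generically_pullback:
  assumes "generically V P" "inj_on h V"
  shows "generically (h ` V) (\<lambda>r. P (\<lambda>v. r (h v)))"
proof -
  obtain f a where f: "f \<in> polyf V" "f a \<noteq> 0" "\<And>a. f a \<noteq> 0 \<Longrightarrow> P a"
    using assms(1) unfolding generically_iff by metis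
  have "(\<lambda>r. f (\<lambda>v. r (h v))) \<in> polyf (h ` V)"
    by (rule polyf_subst[OF f(1)]) (auto intro: polyf_intros)
  moreover have "f (\<lambda>v. (\<lambda>w. a (inv_into V h w)) (h v)) = f a"
    by (rule polyf_cong[OF f(1)]) (simp add: assms(2) inv_into_f_f)
  then have "\<exists>r. f (\<lambda>v. r (h v)) \<noteq> 0"
    using f(2) by (intro exI[of _ "\<lambda>w. a (inv_into V h w)"]) simp
  ultimately show ?thesis unfolding generically_iff using f(3)
    by (intro bexI[of _ "\<lambda>r. f (\<lambda>v. r (h v))"]) auto
qed

text \<open>The complement of a proper subvariety is dense, so a definable property that is not generic
  fails generically.\<close>

theorem generically_zero_one:
  assumes "defb P" "\<And>a b. (\<And>v. v \<in> V \<Longrightarrow> a v = b v) \<Longrightarrow> P a = P b"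
  shows "generically V P \<or> generically V (\<lambda>a. \<not> P a)"
proof -
  have 1: "generically UNIV P \<or> generically UNIV (\<lambda>a. \<not> P a)"
    using assms(1)
  proof (induction rule: defb.induct)
    case (zero f)
    show ?case
    proof (cases "\<exists>a. f a \<noteq> 0")
      case True
      then have "generically UNIV (\<lambda>a. f a \<noteq> 0)" unfolding generically_iff using zero by auto
      then show ?thesis by simp
    next
      case False
      then show ?thesis by (simp add: generically_True)
    qed
  next
    case (neg P)
    then show ?case by auto
  next
    case (conj P Q)
    then show ?case
      using generically_conj[of UNIV P Q] generically_mono[of UNIV "\<lambda>a. \<not> P a" "\<lambda>a. \<not> (P a \<and> Q a)"]
        generically_mono[of UNIV "\<lambda>a. \<not> Q a" "\<lambda>a. \<not> (P a \<and> Q a)"] by blast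
  qed
  \<comment> \<open>The polynomial found may involve variables outside \<open>V\<close>. They are
    frozen at a point where it is nonzero, which does not affect \<open>Q\<close>.\<close>
  have restr: "generically V Q" if Q: "generically UNIV Q" "\<And>a b. (\<And>v. v \<in> V \<Longrightarrow> a v = b v) \<Longrightarrow> Q a = Q b" for Q
  proof -
    obtain f a0 where f: "f \<in> polyf UNIV" "f a0 \<noteq> 0" "\<And>a. f a \<noteq> 0 \<Longrightarrow> Q a"
      using Q(1) unfolding generically_iff by metis
    let ?s = "\<lambda>a v. if v \<in> V then a v else a0 v"
    have "(\<lambda>a. f (?s a)) \<in> polyf V"
      by (rule polyf_subst[OF f(1)]) (auto intro: polyf_if polyf_intros)
    moreover have "f (?s a0) \<noteq> 0" using f(2) by simp
    moreover have "Q a" if "f (?s a) \<noteq> 0" for a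
      using f(3)[OF that] Q(2)[of "?s a" a] by simp
    ultimately show ?thesis unfolding generically_iff
      by (intro bexI[of _ "\<lambda>a. f (?s a)"] conjI exI[of _ a0] allI impI)
  qed
  show ?thesis using 1 restr[of P, OF _ assms(2)] restr[of "\<lambda>a. \<not> P a"] assms(2) by blast
qed

text \<open>The zero-one law upgrades density to genericity. It remains to construct, for each
  hypersurface, a single good parameter off it.\<close>

lemma generically_dense:
  assumes "defb P" "\<And>a b. (\<And>v. v \<in> V \<Longrightarrow> a v = b v) \<Longrightarrow> P a = P b"
    and "\<And>f a. f \<in> polyf V \<Longrightarrow> f a \<noteq> 0 \<Longrightarrow> \<exists>a. f a \<noteq> 0 \<and> P a"
  shows "generically V P"
proof (rule ccontr)
  assume "\<not> generically V P"
  then have "generically V (\<lambda>a. \<not> P a)" using generically_zero_one[OF assms(1,2)] by blast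
  then obtain f a where "f \<in> polyf V" "f a \<noteq> 0" "\<And>a. f a \<noteq> 0 \<Longrightarrow> \<not> P a"
    unfolding generically_iff by metis
  then show False using assms(3) by blast
qed

lemma generically_UNIV_unit:
  assumes "generically UNIV (\<lambda>a :: unit \<Rightarrow> complex. P (a ()))" shows "finite {t. \<not> P t}"
proof -
  obtain f a where f: "f \<in> polyf UNIV" "f a \<noteq> 0" "\<And>a. f a \<noteq> 0 \<Longrightarrow> P (a ())"
    using assms unfolding generically_iff by metis
  obtain p where p: "\<And>t. f (\<lambda>_. t) = poly p t"
    using polyf_line[OF f(1), of "\<lambda>t _. t"] by (metis poly_pCons poly_0 mult_zero_left mult.right_neutral add_0 poly_1 mult_1_right poly_pCons add.left_neutral)
  have "a = (\<lambda>_. a ())" by (auto simp: fun_eq_iff)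
  then have "p \<noteq> 0" using p[of "a ()"] f(2) by auto
  then have "finite {t. poly p t = 0}" by (rule poly_roots_finite)
  moreover have "{t. \<not> P t} \<subseteq> {t. poly p t = 0}" using f(3)[of "\<lambda>_. _"] p by auto
  ultimately show ?thesis by (rule finite_subset[rotated])
qed

text \<open>The zero-one law in one variable, where proper subvarieties are finite sets.\<close>

lemma defb_finite_cofinite:
  assumes "defb (\<lambda>a :: unit \<Rightarrow> complex. P (a ()))"
  shows "finite {t. P t} \<or> finite {t. \<not> P t}"
proof -
  have "generically UNIV (\<lambda>a. P (a ())) \<or> generically UNIV (\<lambda>a. \<not> P (a ()))"
    by (rule generically_zero_one[OF assms]) simp
  then show ?thesis
    using generically_UNIV_unit[of P] generically_UNIV_unit[of "\<lambda>t. \<not> P t"] by auto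
qed

section \<open>The Hilbert basis theorem for polynomial functions\<close>

inductive_set idl :: "'v set \<Rightarrow> (('v \<Rightarrow> complex) \<Rightarrow> complex) set \<Rightarrow> (('v \<Rightarrow> complex) \<Rightarrow> complex) set"
  for V S where
  zero: "(\<lambda>a. 0) \<in> idl V S"
| step: "p \<in> idl V S \<Longrightarrow> h \<in> polyf V \<Longrightarrow> f \<in> S \<Longrightarrow> (\<lambda>a. p a + h a * f a) \<in> idl V S"

definition is_ideal :: "'v set \<Rightarrow> (('v \<Rightarrow> complex) \<Rightarrow> complex) set \<Rightarrow> bool" where
  "is_ideal V I \<longleftrightarrow> I \<subseteq> polyf V \<and> (\<lambda>a. 0) \<in> I \<and> (\<forall>f\<in>I. \<forall>g\<in>I. (\<lambda>a. f a + g a) \<in> I) \<and>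
     (\<forall>h\<in>polyf V. \<forall>f\<in>I. (\<lambda>a. h a * f a) \<in> I)"

lemma is_idealD:
  assumes "is_ideal V I"
  shows "f \<in> I \<Longrightarrow> f \<in> polyf V" "(\<lambda>a. 0) \<in> I" "f \<in> I \<Longrightarrow> g \<in> I \<Longrightarrow> (\<lambda>a. f a + g a) \<in> I"
    "h \<in> polyf V \<Longrightarrow> f \<in> I \<Longrightarrow> (\<lambda>a. h a * f a) \<in> I"
  using assms by (auto simp: is_ideal_def)

lemma idl_add: "q \<in> idl V S \<Longrightarrow> p \<in> idl V S \<Longrightarrow> (\<lambda>a. p a + q a) \<in> idl V S"
proof (induction q rule: idl.induct)
  case (step q h f)
  show ?case using idl.step[OF step.IH[OF step.prems] step.hyps(2,3)] by (simp add: add.assoc)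
qed simp

lemma idl_mult: "p \<in> idl V S \<Longrightarrow> g \<in> polyf V \<Longrightarrow> (\<lambda>a. g a * p a) \<in> idl V S"
proof (induction p rule: idl.induct)
  case (step q h f)
  show ?case
    using idl.step[OF step.IH[OF step.prems] polyf.mult[OF step.prems step.hyps(2)] step.hyps(3)]
    by (simp add: distrib_left mult.assoc)
qed (simp add: idl.zero)

lemma idl_superset: "f \<in> S \<Longrightarrow> f \<in> idl V S"
  using idl.step[OF idl.zero polyf.const[of 1], of f S V] by simp

lemma idl_subset_ideal: assumes "is_ideal V I" "S \<subseteq> I" shows "idl V S \<subseteq> I"
proof
  fix p assume "p \<in> idl V S"
  then show "p \<in> I" by (induction rule: idl.induct) (use assms in \<open>auto simp: is_ideal_def\<close>)
qed

lemma idl_eval: "p \<in> idl V S \<Longrightarrow> (\<And>f. f \<in> S \<Longrightarrow> f a = 0) \<Longrightarrow> p a = 0"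
  by (induction rule: idl.induct) auto

lemma polyf_empty_const: "f \<in> polyf {} \<Longrightarrow> \<exists>c. f = (\<lambda>a. c)"
  by (induction rule: polyf.induct) auto

text \<open>The coefficient at \<open>d\<close> may be zero. This makes the set an ideal and lets it
  grow with \<open>d\<close>.\<close>

definition lead_ideal :: "'v \<Rightarrow> 'v set \<Rightarrow> (('v \<Rightarrow> complex) \<Rightarrow> complex) set \<Rightarrow> nat \<Rightarrow> (('v \<Rightarrow> complex) \<Rightarrow> complex) set"
  where "lead_ideal v V I d = {l. \<exists>c. (\<forall>k. c k \<in> polyf V) \<and>
     (\<lambda>a. \<Sum>k\<le>d. c k a * a v ^ k) \<in> I \<and> c d = l}"

lemma lead_idealI:
  "(\<And>k. c k \<in> polyf V) \<Longrightarrow> (\<lambda>a. \<Sum>k\<le>d. c k a * a v ^ k) \<in> I \<Longrightarrow> c d = l \<Longrightarrow> l \<in> lead_ideal v V I d"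
  unfolding lead_ideal_def by (intro CollectI exI[of _ c]) simp

lemma lead_idealE:
  assumes "l \<in> lead_ideal v V I d"
  obtains c where "\<forall>k. c k \<in> polyf V" "(\<lambda>a. \<Sum>k\<le>d. c k a * a v ^ k) \<in> I" "c d = l"
  using assms by (auto simp: lead_ideal_def)

lemma lead_ideal_ideal:
  assumes I: "is_ideal (insert v V) I" shows "is_ideal V (lead_ideal v V I d)"
  unfolding is_ideal_def
proof (intro conjI ballI)
  show "lead_ideal v V I d \<subseteq> polyf V" by (auto elim: lead_idealE)
  show "(\<lambda>a. 0) \<in> lead_ideal v V I d"
    by (rule lead_idealI[of "\<lambda>_ _. 0"]) (use is_idealD(2)[OF I] in \<open>auto intro: polyf.const\<close>)
next
  fix f g assume fg: "f \<in> lead_ideal v V I d" "g \<in> lead_ideal v V I d"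
  obtain c where c: "\<forall>k. c k \<in> polyf V" "(\<lambda>a. \<Sum>k\<le>d. c k a * a v ^ k) \<in> I" "c d = f"
    by (rule lead_idealE[OF fg(1)])
  obtain c' where c': "\<forall>k. c' k \<in> polyf V" "(\<lambda>a. \<Sum>k\<le>d. c' k a * a v ^ k) \<in> I" "c' d = g"
    by (rule lead_idealE[OF fg(2)])
  have "(\<lambda>a. (\<Sum>k\<le>d. c k a * a v ^ k) + (\<Sum>k\<le>d. c' k a * a v ^ k)) \<in> I"
    by (rule is_idealD(3)[OF I c(2) c'(2)])
  then show "(\<lambda>a. f a + g a) \<in> lead_ideal v V I d"
    by (intro lead_idealI[of "\<lambda>k a. c k a + c' k a"])
      (simp_all add: c(3) c'(3) distrib_right sum.distrib polyf.add c(1)[rule_format] c'(1)[rule_format])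
next
  fix h f assume h: "h \<in> polyf V" and f: "f \<in> lead_ideal v V I d"
  obtain c where c: "\<forall>k. c k \<in> polyf V" "(\<lambda>a. \<Sum>k\<le>d. c k a * a v ^ k) \<in> I" "c d = f"
    by (rule lead_idealE[OF f])
  have "(\<lambda>a. h a * (\<Sum>k\<le>d. c k a * a v ^ k)) \<in> I"
    by (rule is_idealD(4)[OF I polyf_mono[OF subset_insertI h] c(2)])
  then show "(\<lambda>a. h a * f a) \<in> lead_ideal v V I d"
    by (intro lead_idealI[of "\<lambda>k a. h a * c k a"])
      (simp_all add: c(3) sum_distrib_left mult.assoc polyf.mult c(1)[rule_format] h)
qed

lemma lead_ideal_shift:
  assumes I: "is_ideal (insert v V) I" and l: "\<forall>k. c k \<in> polyf V" "(\<lambda>a. \<Sum>k\<le>d. c k a * a v ^ k) = f"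
  shows "\<exists>c'. (\<forall>k. c' k \<in> polyf V) \<and> (\<lambda>a. \<Sum>k\<le>d + e. c' k a * a v ^ k) = (\<lambda>a. a v ^ e * f a) \<and> c' (d + e) = c d"
proof -
  let ?c = "\<lambda>k. if k < e then (\<lambda>a. 0) else c (k - e)"
  have "(\<Sum>k\<le>d + e. ?c k a * a v ^ k) = a v ^ e * f a" for a
  proof -
    have "(\<Sum>k\<le>d + e. ?c k a * a v ^ k) = (\<Sum>k\<in>{e..d + e}. c (k - e) a * a v ^ k)"
      by (rule sum.mono_neutral_cong_right) auto
    also have "\<dots> = (\<Sum>k\<in>{0..d}. c k a * a v ^ (k + e))"
      by (rule sum.reindex_bij_witness[of _ "\<lambda>k. k + e" "\<lambda>k. k - e"]) auto
    also have "\<dots> = a v ^ e * f a" unfolding l(2)[symmetric]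
      by (simp add: sum_distrib_left power_add mult_ac atMost_atLeast0)
    finally show ?thesis .
  qed
  then show ?thesis using l(1) by (intro exI[of _ ?c]) (auto intro: polyf.const)
qed

text \<open>Induction on the number of variables through the ideals of leading coefficients with
  respect to \<open>v\<close>. They increase with the degree, and since their union is finitely
  generated, generators of it already occur at some degree \<open>D\<close>. Elements of
  \<open>I\<close> lifting generators in the degrees up to \<open>D\<close> generate
  \<open>I\<close>, by lowering the degree.\<close>

theorem hilbert_basis:
  assumes "finite V" "is_ideal V I"
  shows "\<exists>T. finite T \<and> T \<subseteq> I \<and> I \<subseteq> idl V T"
  using assms
proof (induction V arbitrary: I rule: finite_induct)
  case empty
  show ?case
  proof (cases "I \<subseteq> {\<lambda>a. 0}")
    case True
    then show ?thesis by (intro exI[of _ "{}"]) (auto intro: idl.zero)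
  next
    case False
    then obtain f where f: "f \<in> I" "f \<noteq> (\<lambda>a. 0)" by (auto simp: subset_iff)
    obtain c where c: "f = (\<lambda>a. c)" using polyf_empty_const[OF is_idealD(1)[OF empty f(1)]] ..
    have "g \<in> idl {} {f}" if g: "g \<in> I" for g
    proof -
      obtain b where b: "g = (\<lambda>a. b)" using polyf_empty_const[OF is_idealD(1)[OF empty g]] ..
      have "(\<lambda>a. (\<lambda>a. b / c) a * f a) \<in> idl {} {f}"
        by (rule idl_mult) (auto intro: idl_superset polyf.const)
      then show ?thesis using f(2) by (simp add: b c fun_eq_iff)
    qed
    then show ?thesis using f(1) by (intro exI[of _ "{f}"]) auto
  qed
next
  case (insert v V)
  let ?L = "lead_ideal v V I"
  note I = insert.prems
  have id: "is_ideal V (?L d)" for d by (rule lead_ideal_ideal[OF I])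
  have Lmono: "?L d \<subseteq> ?L (d + e)" for d e
  proof
    fix l assume "l \<in> ?L d"
    then obtain c where c: "\<forall>k. c k \<in> polyf V" "(\<lambda>a. \<Sum>k\<le>d. c k a * a v ^ k) \<in> I" "c d = l"
      by (rule lead_idealE)
    obtain c' where c': "\<forall>k. c' k \<in> polyf V"
      "(\<lambda>a. \<Sum>k\<le>d + e. c' k a * a v ^ k) = (\<lambda>a. a v ^ e * (\<Sum>k\<le>d. c k a * a v ^ k))"
      "c' (d + e) = c d"
      using lead_ideal_shift[OF I _ refl, of c d e] c(1) by auto
    have "(\<lambda>a. a v ^ e) \<in> polyf (insert v V)" by (intro polyf_intros) simp
    then have "(\<lambda>a. \<Sum>k\<le>d + e. c' k a * a v ^ k) \<in> I"
      unfolding c'(2) by (rule is_idealD(4)[OF I _ c(2)])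
    then show "l \<in> ?L (d + e)" by (intro lead_idealI[of c']) (use c' c(3) in auto)
  qed
  have Lle: "?L d \<subseteq> ?L e" if "d \<le> e" for d e using Lmono[of d "e - d"] that by simp
  have "is_ideal V (\<Union>d. ?L d)" unfolding is_ideal_def
  proof (intro conjI ballI)
    fix f g assume "f \<in> (\<Union>d. ?L d)" "g \<in> (\<Union>d. ?L d)"
    then obtain d e where "f \<in> ?L d" "g \<in> ?L e" by blast
    then have "f \<in> ?L (max d e)" "g \<in> ?L (max d e)" using Lle[of d "max d e"] Lle[of e "max d e"] by auto
    then have "(\<lambda>a. f a + g a) \<in> ?L (max d e)" by (rule is_idealD(3)[OF id])
    then show "(\<lambda>a. f a + g a) \<in> (\<Union>d. ?L d)" by (rule UN_I[OF UNIV_I])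
  next
    fix h f assume h: "h \<in> polyf V" and "f \<in> (\<Union>d. ?L d)"
    then obtain d where "f \<in> ?L d" by blast
    then have "(\<lambda>a. h a * f a) \<in> ?L d" by (rule is_idealD(4)[OF id h])
    then show "(\<lambda>a. h a * f a) \<in> (\<Union>d. ?L d)" by (rule UN_I[OF UNIV_I])
  next
    show "(\<lambda>a. 0) \<in> (\<Union>d. ?L d)" by (rule UN_I[of 0]) (simp_all add: is_idealD(2)[OF id])
    show "(\<Union>d. ?L d) \<subseteq> polyf V" using is_idealD(1)[OF id] by auto
  qed
  from insert.IH[OF this] obtain T' where T': "finite T'" "T' \<subseteq> (\<Union>d. ?L d)" "(\<Union>d. ?L d) \<subseteq> idl V T'"
    by (elim exE conjE)
  obtain D where D: "T' \<subseteq> ?L D"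
  proof -
    have "\<exists>D. T' \<subseteq> ?L D" using T'(1,2)
    proof (induction T' rule: finite_induct)
      case (insert x T')
      then obtain D d where "T' \<subseteq> ?L D" "x \<in> ?L d" by auto
      then have "insert x T' \<subseteq> ?L (max D d)" using Lle[of D "max D d"] Lle[of d "max D d"] by auto
      then show ?case by blast
    qed auto
    then show ?thesis using that by blast
  qed
  \<comment> \<open>\<open>T D\<close> takes care of the leading coefficients in all degrees from
    \<open>D\<close> on, whereas each smaller degree has generators of its own.\<close>
  have "\<forall>d. \<exists>T. finite T \<and> T \<subseteq> ?L d \<and> (if d = D then (\<Union>d. ?L d) else ?L d) \<subseteq> idl V T"
  proof
    fix d
    show "\<exists>T. finite T \<and> T \<subseteq> ?L d \<and> (if d = D then (\<Union>d. ?L d) else ?L d) \<subseteq> idl V T"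
      using T' D insert.IH[OF id[of d]] by (cases "d = D") auto
  qed
  then obtain T where T: "\<And>d. finite (T d)" "\<And>d. T d \<subseteq> ?L d"
    "\<And>d. (if d = D then (\<Union>d. ?L d) else ?L d) \<subseteq> idl V (T d)" by metis
  define Q where "Q d l w \<longleftrightarrow> w \<in> I \<and> (\<exists>c. (\<forall>k. c k \<in> polyf V) \<and>
     (\<lambda>a. \<Sum>k\<le>d. c k a * a v ^ k) = w \<and> c d = l)" for d l w
  define w where "w d l = (SOME w. Q d l w)" for d l
  have Qw: "Q d l (w d l)" if l: "l \<in> ?L d" for d l
  proof -
    obtain c where c: "\<forall>k. c k \<in> polyf V" "(\<lambda>a. \<Sum>k\<le>d. c k a * a v ^ k) \<in> I" "c d = l"
      by (rule lead_idealE[OF l])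
    then have "Q d l (\<lambda>a. \<Sum>k\<le>d. c k a * a v ^ k)" unfolding Q_def by auto
    then show ?thesis unfolding w_def by (rule someI[of "Q d l"])
  qed
  have w: "w d l \<in> I" "\<exists>c. (\<forall>k. c k \<in> polyf V) \<and>
     (\<lambda>a. \<Sum>k\<le>d. c k a * a v ^ k) = w d l \<and> c d = l" if "l \<in> ?L d" for d l
    using Qw[OF that] unfolding Q_def by simp_all
  define G where "G = (\<Union>d\<le>D. w d ` T d)"
  have G: "finite G" "G \<subseteq> I" unfolding G_def by (auto simp: T(1) intro!: w(1) subsetD[OF T(2)])
  then have GI: "idl (insert v V) G \<subseteq> I" by (intro idl_subset_ideal[OF I])
  \<comment> \<open>A lifted generator of degree \<open>e\<close> is multiplied by the power
    \<open>d - e\<close> of the variable \<open>v\<close>, so that its leading coefficient moves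
    from position \<open>e\<close> to position \<open>d\<close>.\<close>
  have lift: "\<exists>g c. g \<in> idl (insert v V) G \<and> (\<forall>k. c k \<in> polyf V) \<and>
     g = (\<lambda>a. \<Sum>k\<le>d. c k a * a v ^ k) \<and> c d = l"
    if "l \<in> idl V (T e)" "e \<le> D" "e \<le> d" for l d e
    using that(1)
  proof (induction rule: idl.induct)
    case zero
    show ?case
      by (rule exI[of _ "\<lambda>a. 0"], rule exI[of _ "\<lambda>k a. 0"]) (auto intro: idl.zero polyf_intros)
  next
    case (step p h f)
    obtain g c where g: "g \<in> idl (insert v V) G" "\<forall>k. c k \<in> polyf V"
      "g = (\<lambda>a. \<Sum>k\<le>d. c k a * a v ^ k)" "c d = p" using step.IH by (elim exE conjE)
    have f: "f \<in> ?L e" by (rule subsetD[OF T(2) step.hyps(3)])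
    obtain c1 where c1: "\<forall>k. c1 k \<in> polyf V" "(\<lambda>a. \<Sum>k\<le>e. c1 k a * a v ^ k) = w e f" "c1 e = f"
      using w(2)[OF f] by (elim exE conjE)
    have "w e f \<in> G" unfolding G_def using step.hyps(3) that(2) by auto
    obtain c2 where c2: "\<forall>k. c2 k \<in> polyf V"
      "(\<lambda>a. \<Sum>k\<le>e + (d - e). c2 k a * a v ^ k) = (\<lambda>a. a v ^ (d - e) * w e f a)" "c2 (e + (d - e)) = f"
      using lead_ideal_shift[OF I c1(1,2), of "d - e"] c1(3) by (elim exE conjE) simp
    have ed: "e + (d - e) = d" using that(3) by simp
    have "(\<lambda>a. h a * a v ^ (d - e)) \<in> polyf (insert v V)"
      by (intro polyf_intros polyf_mono[OF subset_insertI step.hyps(2)]) simp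
    then have "(\<lambda>a. g a + (h a * a v ^ (d - e)) * w e f a) \<in> idl (insert v V) G"
      by (rule idl.step[OF g(1)]) fact
    moreover have "g a + (h a * a v ^ (d - e)) * w e f a = (\<Sum>k\<le>d. (c k a + h a * c2 k a) * a v ^ k)" for a
      using fun_cong[OF c2(2), of a] unfolding ed g(3)
      by (simp add: distrib_right sum.distrib sum_distrib_left[symmetric] mult.assoc)
    moreover have "(\<lambda>a. c k a + h a * c2 k a) \<in> polyf V" for k
      using g(2) c2(1) step.hyps(2) by (intro polyf.add polyf.mult) auto
    ultimately show ?case
      by (intro exI[of _ "\<lambda>a. g a + (h a * a v ^ (d - e)) * w e f a"] exI[of _ "\<lambda>k a. c k a + h a * c2 k a"])
        (use g(4) c2(3) ed in auto)
  qed
  have main: "f \<in> idl (insert v V) G" if "f \<in> I" "\<forall>k. c k \<in> polyf V" "f = (\<lambda>a. \<Sum>k<n. c k a * a v ^ k)"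
    for f c n using that
  proof (induction n arbitrary: f c)
    case 0
    then show ?case by (simp add: idl.zero)
  next
    case (Suc d)
    have fd: "f = (\<lambda>a. \<Sum>k\<le>d. c k a * a v ^ k)" using Suc.prems(3) by (simp add: lessThan_Suc_atMost)
    have ld: "c d \<in> ?L d" by (rule lead_idealI[of c]) (use Suc.prems(1,2) fd in auto)
    obtain e where e: "e \<le> D" "e \<le> d" "c d \<in> idl V (T e)"
    proof (cases "d < D")
      case True
      then show ?thesis using that[of d] T(3)[of d] ld by auto
    next
      case False
      then show ?thesis using that[of D] T(3)[of D] ld by auto
    qed
    obtain g c' where g: "g \<in> idl (insert v V) G" "\<forall>k. c' k \<in> polyf V"
      "g = (\<lambda>a. \<Sum>k\<le>d. c' k a * a v ^ k)" "c' d = c d" using lift[OF e(3,1,2)] by (elim exE conjE)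
    have "(\<lambda>a. - g a) \<in> idl (insert v V) G" using idl_mult[OF g(1) polyf.const[of "-1"]] by simp
    then have ng: "(\<lambda>a. - g a) \<in> I" by (rule subsetD[OF GI])
    \<comment> \<open>The terms of degree \<open>d\<close> cancel, so one coefficient fewer is
      needed.\<close>
    let ?r = "\<lambda>a. f a + - g a"
    have "?r \<in> idl (insert v V) G"
    proof (rule Suc.IH)
      show "?r \<in> I" by (rule is_idealD(3)[OF I Suc.prems(1) ng])
      show "\<forall>k. (\<lambda>a. c k a - c' k a) \<in> polyf V" using Suc.prems(2) g(2) by (auto intro: polyf_intros)
      show "?r = (\<lambda>a. \<Sum>k<d. (c k a - c' k a) * a v ^ k)"
        unfolding fd g(3) using g(4)
        by (auto simp: fun_eq_iff lessThan_Suc_atMost[symmetric] left_diff_distrib sum_subtractf)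
    qed
    then have "(\<lambda>a. ?r a + g a) \<in> idl (insert v V) G" by (rule idl_add[OF g(1)])
    then show ?case by simp
  qed
  have "I \<subseteq> idl (insert v V) G"
  proof
    fix f assume f: "f \<in> I"
    obtain c d where c: "\<forall>k. c k \<in> polyf (V - {v})" "\<forall>a. f a = (\<Sum>k\<le>d. c k a * a v ^ k)"
      using polyf_expand[OF is_idealD(1)[OF I f]] by auto
    show "f \<in> idl (insert v V) G"
      by (rule main[OF f, of c "Suc d"])
        (use c insert.hyps(2) in \<open>auto simp: lessThan_Suc_atMost\<close>)
  qed
  then show ?case using G by blast
qed

section \<open>Algebraic sets and irreducible components\<close>

definition polyv :: "(complex ^ 'n \<Rightarrow> complex) set" where
  "polyv = (\<lambda>f x. f (\<lambda>v. x $ v)) ` polyf UNIV"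

lemma polyvI: "f \<in> polyf UNIV \<Longrightarrow> (\<lambda>x. f (\<lambda>v. x $ v)) \<in> polyv"
  by (simp add: polyv_def)

lemma polyvE:
  assumes "f \<in> polyv" obtains g where "g \<in> polyf UNIV" "f = (\<lambda>x. g (\<lambda>v. x $ v))"
  using assms by (auto simp: polyv_def)

lemma val_polyv: "(\<lambda>x. val p x) \<in> polyv"
  by (rule polyvI) (rule peval_polyf)

lemma polyv_imp_val: assumes "f \<in> polyv" shows "\<exists>p. f = val p"
proof -
  obtain g where g: "g \<in> polyf UNIV" "f = (\<lambda>x. g (\<lambda>v. x $ v))" by (rule polyvE[OF assms])
  obtain p where "g = peval p" using polyf_imp_peval[OF g(1)] by (elim exE conjE)
  then show ?thesis using g(2) by auto
qed

lemma polyv_const: "(\<lambda>x. c) \<in> polyv"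
  using polyvI[OF polyf.const[of c UNIV]] by simp

lemma polyv_nth: "(\<lambda>x. x $ v) \<in> polyv"
  using polyvI[OF polyf.var[of v UNIV]] by simp

lemma polyv_add:
  assumes "f \<in> polyv" "g \<in> polyv" shows "(\<lambda>x. f x + g x) \<in> polyv"
proof -
  obtain f' where f': "f' \<in> polyf UNIV" "f = (\<lambda>x. f' (\<lambda>v. x $ v))" by (rule polyvE[OF assms(1)])
  obtain g' where g': "g' \<in> polyf UNIV" "g = (\<lambda>x. g' (\<lambda>v. x $ v))" by (rule polyvE[OF assms(2)])
  show ?thesis using polyvI[OF polyf.add[OF f'(1) g'(1)]] by (simp add: f'(2) g'(2))
qed

lemma polyv_mult:
  assumes "f \<in> polyv" "g \<in> polyv" shows "(\<lambda>x. f x * g x) \<in> polyv"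
proof -
  obtain f' where f': "f' \<in> polyf UNIV" "f = (\<lambda>x. f' (\<lambda>v. x $ v))" by (rule polyvE[OF assms(1)])
  obtain g' where g': "g' \<in> polyf UNIV" "g = (\<lambda>x. g' (\<lambda>v. x $ v))" by (rule polyvE[OF assms(2)])
  show ?thesis using polyvI[OF polyf.mult[OF f'(1) g'(1)]] by (simp add: f'(2) g'(2))
qed

lemma polyf_subst_polyv:
  assumes "f \<in> polyf V" "\<And>v. v \<in> V \<Longrightarrow> (\<lambda>x. s x v) \<in> polyv"
  shows "(\<lambda>x. f (s x)) \<in> polyv"
  using assms(1)
  by (induction rule: polyf.induct) (simp_all add: polyv_const polyv_add polyv_mult assms(2))

lemma polyv_subst:
  assumes "f \<in> polyv" "\<And>v. (\<lambda>x. s x $ v) \<in> polyv" shows "(\<lambda>x. f (s x)) \<in> polyv"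
proof -
  obtain g where g: "g \<in> polyf UNIV" "f = (\<lambda>x. g (\<lambda>v. x $ v))" by (rule polyvE[OF assms(1)])
  show ?thesis unfolding g(2) by (rule polyf_subst_polyv[OF g(1)]) (rule assms(2))
qed

lemma polyv_subst_polyf:
  assumes "f \<in> polyv" "\<And>v. (\<lambda>a. s a $ v) \<in> polyf V" shows "(\<lambda>a. f (s a)) \<in> polyf V"
proof -
  obtain g where g: "g \<in> polyf UNIV" "f = (\<lambda>x. g (\<lambda>v. x $ v))" by (rule polyvE[OF assms(1)])
  show ?thesis unfolding g(2) by (rule polyf_subst[OF g(1)]) (rule assms(2))
qed

lemma polyv_diff: "f \<in> polyv \<Longrightarrow> g \<in> polyv \<Longrightarrow> (\<lambda>x. f x - g x) \<in> polyv"
  using polyv_add[OF _ polyv_mult[OF polyv_const[of "-1"]], of f g] by simp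

lemma polyv_sum: "(\<And>i. i \<in> I \<Longrightarrow> f i \<in> polyv) \<Longrightarrow> (\<lambda>x. \<Sum>i\<in>I. f i x) \<in> polyv"
  by (induction I rule: infinite_finite_induct) (auto intro: polyv_const polyv_add)

lemma polyv_prod: "(\<And>i. i \<in> I \<Longrightarrow> f i \<in> polyv) \<Longrightarrow> (\<lambda>x. \<Prod>i\<in>I. f i x) \<in> polyv"
  by (induction I rule: infinite_finite_induct) (auto intro: polyv_const polyv_mult)

lemma polyv_det:
  assumes "\<And>i j. (\<lambda>x. A x $ i $ j) \<in> polyv"
  shows "(\<lambda>x. det (A x :: complex^'m^'m)) \<in> polyv"
  unfolding det_def using assms by (intro polyv_sum polyv_mult polyv_const polyv_prod)

lemma polyv_continuous: assumes "f \<in> polyv" shows "continuous_on S f"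
proof -
  obtain g where g: "g \<in> polyf UNIV" "f = (\<lambda>x. g (\<lambda>v. x $ v))" by (rule polyvE[OF assms])
  show ?thesis unfolding g(2) by (rule polyf_continuous[OF g(1)]) (intro continuous_intros)
qed

lemma algebraic_setI: "S \<subseteq> polyv \<Longrightarrow> algebraic_set {x. \<forall>f\<in>S. f x = 0}"
proof -
  assume S: "S \<subseteq> polyv"
  have "{x. \<forall>f\<in>S. f x = 0} = {x. \<forall>p\<in>{p. val p \<in> S}. val p x = 0}"
  proof (intro Collect_cong iffI ballI)
    fix x f assume "\<forall>p\<in>{p. val p \<in> S}. val p x = 0" "f \<in> S"
    moreover obtain p where "f = val p" using polyv_imp_val[of f] S \<open>f \<in> S\<close> by auto
    ultimately show "f x = 0" by auto
  qed auto
  then show ?thesis unfolding algebraic_set_def by (rule exI)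
qed

definition vanish :: "(complex ^ 'n) set \<Rightarrow> (complex ^ 'n \<Rightarrow> complex) set" where
  "vanish V = {f \<in> polyv. \<forall>x\<in>V. f x = 0}"

lemma algebraic_set_vanish:
  assumes "algebraic_set A" "x \<notin> A" shows "\<exists>f\<in>vanish A. f x \<noteq> 0"
proof -
  obtain S where S: "A = {x. \<forall>p\<in>S. val p x = 0}" using assms(1) unfolding algebraic_set_def by auto
  then obtain p where "p \<in> S" "val p x \<noteq> 0" using assms(2) by auto
  then show ?thesis using S val_polyv by (intro bexI[of _ "val p"]) (auto simp: vanish_def)
qed

lemma algebraic_set_eq: "algebraic_set A \<Longrightarrow> A = {x. \<forall>f\<in>vanish A. f x = 0}"
  using algebraic_set_vanish[of A] by (auto simp: vanish_def)

lemma algebraic_set_zero: "f \<in> polyv \<Longrightarrow> algebraic_set {x. f x = 0}"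
  using algebraic_setI[of "{f}"] by simp

lemma algebraic_set_zeros: "algebraic_set (zeros G)"
  unfolding algebraic_set_def zeros_def by auto

lemma algebraic_set_empty: "algebraic_set {}"
  using algebraic_set_zero[OF polyv_const[of 1]] by simp

lemma algebraic_set_Int:
  assumes "algebraic_set A" "algebraic_set B" shows "algebraic_set (A \<inter> B)"
proof -
  have "A \<inter> B = {x. \<forall>f\<in>vanish A \<union> vanish B. f x = 0}"
    using algebraic_set_eq[OF assms(1)] algebraic_set_eq[OF assms(2)] by blast
  then show ?thesis using algebraic_setI[of "vanish A \<union> vanish B"] by (auto simp: vanish_def)
qed

lemma algebraic_set_Un:
  assumes "algebraic_set A" "algebraic_set B" shows "algebraic_set (A \<union> B)"
proof -
  let ?S = "(\<lambda>(f, g) x. f x * g x) ` (vanish A \<times> vanish B)"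
  have "A \<union> B = {x. \<forall>h\<in>?S. h x = 0}"
  proof (intro equalityI subsetI)
    fix x assume x: "x \<in> {x. \<forall>h\<in>?S. h x = 0}"
    show "x \<in> A \<union> B"
    proof (rule ccontr)
      assume "x \<notin> A \<union> B"
      then obtain f g where "f \<in> vanish A" "f x \<noteq> 0" "g \<in> vanish B" "g x \<noteq> 0"
        using algebraic_set_vanish[OF assms(1), of x] algebraic_set_vanish[OF assms(2), of x] by auto
      then show False using x by auto
    qed
  qed (auto simp: vanish_def)
  moreover have "?S \<subseteq> polyv" by (auto simp: vanish_def intro: polyv_mult)
  ultimately show ?thesis using algebraic_setI[of ?S] by simp
qed

lemma algebraic_set_Union: "finite F \<Longrightarrow> (\<And>V. V \<in> F \<Longrightarrow> algebraic_set V) \<Longrightarrow> algebraic_set (\<Union>F)"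
  by (induction F rule: finite_induct) (auto intro: algebraic_set_Un algebraic_set_empty)

lemma algebraic_set_closed: assumes "algebraic_set A" shows "closed A"
proof -
  have "A = (\<Inter>f\<in>vanish A. {x. f x = 0})" using algebraic_set_eq[OF assms] by auto
  moreover have "closed {x. f x = 0}" if "f \<in> vanish A" for f
  proof -
    have "closed (f -` {0})"
      using that by (intro continuous_closed_vimage)
        (auto simp: vanish_def intro!: continuous_on_eq_continuous_at[THEN iffD1, rule_format, OF open_UNIV] polyv_continuous)
    then show ?thesis by (simp add: vimage_def)
  qed
  ultimately show ?thesis using closed_INT[of "vanish A" "\<lambda>f. {x. f x = 0}"] by simp
qed

text \<open>The vanishing ideal once more, now inside \<open>polyf UNIV\<close>, where the basis
  theorem applies.\<close>

definition fvanish :: "(complex ^ 'n) set \<Rightarrow> (('n \<Rightarrow> complex) \<Rightarrow> complex) set" where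
  "fvanish V = {f \<in> polyf UNIV. \<forall>x\<in>V. f (\<lambda>v. x $ v) = 0}"

lemma is_ideal_fvanish: "is_ideal UNIV (fvanish V)"
  unfolding is_ideal_def fvanish_def by (auto intro: polyf.const polyf.add polyf.mult)

lemma algebraic_set_fvanish:
  assumes "algebraic_set A" "x \<notin> A" shows "\<exists>f\<in>fvanish A. f (\<lambda>v. x $ v) \<noteq> 0"
proof -
  obtain f where f: "f \<in> vanish A" "f x \<noteq> 0" using algebraic_set_vanish[OF assms] by blast
  then have "f \<in> polyv" by (simp add: vanish_def)
  obtain g where g: "g \<in> polyf UNIV" "f = (\<lambda>x. g (\<lambda>v. x $ v))" by (rule polyvE[OF \<open>f \<in> polyv\<close>])
  show ?thesis by (rule bexI[of _ g]) (use f g in \<open>auto simp: fvanish_def vanish_def\<close>)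
qed

text \<open>Generators of the vanishing ideal suffice as equations. Finiteness matters because a
  definable condition is a finite combination of equations, whereas \<open>algebraic_set\<close>
  allows infinite systems.\<close>

lemma algebraic_set_finite:
  assumes "algebraic_set (A :: (complex ^ 'n::finite) set)"
  shows "\<exists>T. finite T \<and> T \<subseteq> polyf UNIV \<and> A = {x. \<forall>f\<in>T. f (\<lambda>v. x $ v) = 0}"
proof -
  obtain T where T: "finite T" "T \<subseteq> fvanish A" "fvanish A \<subseteq> idl UNIV T"
    using hilbert_basis[OF finite_class.finite_UNIV is_ideal_fvanish[of A]] by (elim exE conjE)
  have "A = {x. \<forall>f\<in>T. f (\<lambda>v. x $ v) = 0}"
  proof (intro equalityI subsetI)
    fix x assume x: "x \<in> {x. \<forall>f\<in>T. f (\<lambda>v. x $ v) = 0}"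
    show "x \<in> A"
    proof (rule ccontr)
      assume "x \<notin> A"
      then obtain f where f: "f \<in> fvanish A" "f (\<lambda>v. x $ v) \<noteq> 0"
        using algebraic_set_fvanish[OF assms] by blast
      moreover have "f (\<lambda>v. x $ v) = 0"
        by (rule idl_eval[OF subsetD[OF T(3) f(1)]]) (use x in auto)
      ultimately show False by simp
    qed
  qed (use T(2) in \<open>auto simp: fvanish_def\<close>)
  moreover have "T \<subseteq> polyf UNIV" using T(2) by (auto simp: fvanish_def)
  ultimately show ?thesis using T(1) by auto
qed

lemma defb_algebraic:
  fixes A :: "(complex ^ 'n::finite) set"
  assumes "algebraic_set A" "\<And>i. (\<lambda>a. s a $ i) \<in> polyf UNIV"
  shows "defb (\<lambda>a. s a \<in> A)"
proof -
  obtain T where T: "finite T" "T \<subseteq> polyf UNIV" "A = {x. \<forall>f\<in>T. f (\<lambda>v. x $ v) = 0}"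
    using algebraic_set_finite[OF assms(1)] by auto
  have "defb (\<lambda>a. \<forall>f\<in>T. f (\<lambda>v. s a $ v) = 0)"
  proof (rule defb_ball[OF T(1)])
    fix f assume "f \<in> T"
    then have f: "f \<in> polyf UNIV" using T(2) by auto
    show "defb (\<lambda>a. f (\<lambda>v. s a $ v) = 0)" by (rule defb.zero, rule polyf_subst[OF f]) (rule assms(2))
  qed
  then show ?thesis unfolding T(3) by simp
qed

text \<open>Along a descending chain the vanishing ideals increase. Generators of their union all
  vanish on some \<open>A K\<close>, and then no function is left that separates a point of
  \<open>A K\<close> from \<open>A (Suc K)\<close>.\<close>

theorem algebraic_set_wf:
  "wf {(A, B :: (complex ^ 'n::finite) set). algebraic_set A \<and> algebraic_set B \<and> A \<subset> B}"
  unfolding wf_iff_no_infinite_down_chain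
proof (rule notI, elim exE)
  fix A :: "nat \<Rightarrow> (complex ^ 'n) set"
  assume "\<forall>i. (A (Suc i), A i) \<in> {(A, B). algebraic_set A \<and> algebraic_set B \<and> A \<subset> B}"
  then have A: "algebraic_set (A i)" "A (Suc i) \<subset> A i" for i by auto
  have dec: "A j \<subseteq> A i" if "i \<le> j" for i j
    using that A(2) by (induction rule: dec_induct) auto
  have inc: "fvanish (A i) \<subseteq> fvanish (A j)" if "i \<le> j" for i j
    using dec[OF that] by (auto simp: fvanish_def)
  let ?I = "\<Union>i. fvanish (A i)"
  have "is_ideal UNIV ?I" unfolding is_ideal_def
  proof (intro conjI ballI)
    fix f g assume "f \<in> ?I" "g \<in> ?I"
    then obtain i j where ij: "f \<in> fvanish (A i)" "g \<in> fvanish (A j)" by auto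
    have "f \<in> fvanish (A (max i j))" by (rule subsetD[OF inc ij(1)]) simp
    moreover have "g \<in> fvanish (A (max i j))" by (rule subsetD[OF inc ij(2)]) simp
    ultimately have "(\<lambda>a. f a + g a) \<in> fvanish (A (max i j))"
      by (rule is_idealD(3)[OF is_ideal_fvanish])
    then show "(\<lambda>a. f a + g a) \<in> ?I" by (rule UN_I[OF UNIV_I])
  next
    fix h :: "('n \<Rightarrow> complex) \<Rightarrow> complex" and f assume h: "h \<in> polyf UNIV" and "f \<in> ?I"
    then obtain i where "f \<in> fvanish (A i)" by auto
    then have "(\<lambda>a. h a * f a) \<in> fvanish (A i)" by (rule is_idealD(4)[OF is_ideal_fvanish h])
    then show "(\<lambda>a. h a * f a) \<in> ?I" by (rule UN_I[OF UNIV_I])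
  next
    show "(\<lambda>a. 0) \<in> ?I" by (rule UN_I[of 0]) (simp_all add: is_idealD(2)[OF is_ideal_fvanish])
  qed (auto simp: fvanish_def)
  then obtain T where T: "finite T" "T \<subseteq> ?I" "?I \<subseteq> idl UNIV T"
    using hilbert_basis[OF finite_class.finite_UNIV, of ?I] by auto 
  have "\<exists>K. T \<subseteq> fvanish (A K)" using T(1,2)
  proof (induction T rule: finite_induct)
    case (insert x T)
    then obtain K i where Ki: "T \<subseteq> fvanish (A K)" "x \<in> fvanish (A i)" by auto
    have "insert x T \<subseteq> fvanish (A (max K i))"
      using Ki inc[of K "max K i"] inc[of i "max K i"] by auto
    then show ?case ..
  qed auto
  then obtain K where K: "T \<subseteq> fvanish (A K)" ..
  obtain x where x: "x \<in> A K" "x \<notin> A (Suc K)" using A(2)[of K] by auto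
  obtain f where f: "f \<in> fvanish (A (Suc K))" "f (\<lambda>v. x $ v) \<noteq> 0"
    using algebraic_set_fvanish[OF A(1) x(2)] by auto
  have "f \<in> idl UNIV T" using T(3) f(1) by blast
  then have "f (\<lambda>v. x $ v) = 0" by (rule idl_eval) (use K x in \<open>auto simp: fvanish_def\<close>)
  then show False using f(2) by simp
qed

lemma algebraic_set_induct [consumes 1, case_names less]:
  fixes A :: "(complex ^ 'n::finite) set"
  assumes "algebraic_set A"
    and "\<And>A. algebraic_set A \<Longrightarrow> (\<And>B. algebraic_set B \<Longrightarrow> B \<subset> A \<Longrightarrow> P B) \<Longrightarrow> P A"
  shows "P A"
  using assms(1)
proof (induction A rule: wf_induct_rule[OF algebraic_set_wf])
  case (1 A)
  show ?case by (rule assms(2)[OF 1(2)]) (use 1 in auto)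
qed

section \<open>Irreducible varieties and components\<close>

lemma irreducible_vanish_mult:
  assumes "irreducible_variety V" "f \<in> polyv" "g \<in> polyv" "\<And>x. x \<in> V \<Longrightarrow> f x * g x = 0"
  shows "(\<forall>x\<in>V. f x = 0) \<or> (\<forall>x\<in>V. g x = 0)"
proof -
  have V: "algebraic_set V" using assms(1) by (simp add: irreducible_variety_def)
  have "algebraic_set (V \<inter> {x. f x = 0})" "algebraic_set (V \<inter> {x. g x = 0})"
    using assms(2,3) by (auto intro: algebraic_set_Int V algebraic_set_zero)
  moreover have "V = (V \<inter> {x. f x = 0}) \<union> (V \<inter> {x. g x = 0})" using assms(4) by auto
  ultimately have "V = V \<inter> {x. f x = 0} \<or> V = V \<inter> {x. g x = 0}"
    using assms(1) unfolding irreducible_variety_def by blast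
  then show ?thesis by blast
qed

lemma irreducible_subset_Union:
  assumes "irreducible_variety V" "finite F" "\<And>W. W \<in> F \<Longrightarrow> algebraic_set W" "V \<subseteq> \<Union>F"
  shows "\<exists>W\<in>F. V \<subseteq> W"
  using assms(2-4)
proof (induction F rule: finite_induct)
  case empty
  then show ?case using assms(1) by (auto simp: irreducible_variety_def)
next
  case (insert W F)
  have V: "algebraic_set V" using assms(1) by (simp add: irreducible_variety_def)
  have "algebraic_set (V \<inter> W)" "algebraic_set (V \<inter> \<Union>F)"
    using insert by (auto intro!: algebraic_set_Int V algebraic_set_Union)
  moreover have "V = (V \<inter> W) \<union> (V \<inter> \<Union>F)" using insert.prems(2) by auto
  ultimately have "V = V \<inter> W \<or> V = V \<inter> \<Union>F"
    using assms(1) unfolding irreducible_variety_def by blast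
  then show ?case
  proof
    assume "V = V \<inter> W"
    then show ?thesis by (intro bexI[of _ W]) auto
  next
    assume "V = V \<inter> \<Union>F"
    then have "V \<subseteq> \<Union>F" by auto
    then show ?thesis using insert.IH insert.prems(1) by auto
  qed
qed

theorem algebraic_set_decomp:
  fixes A :: "(complex ^ 'n::finite) set"
  assumes "algebraic_set A"
  shows "\<exists>F. finite F \<and> (\<forall>V\<in>F. irreducible_variety V) \<and> A = \<Union>F"
  using assms
proof (induction rule: algebraic_set_induct)
  case (less A)
  consider "A = {}" | "irreducible_variety A" | B C where "algebraic_set B" "algebraic_set C"
    "A = B \<union> C" "B \<subset> A" "C \<subset> A"
    using less(1) unfolding irreducible_variety_def by blast
  then show ?case
  proof cases
    case 1
    then show ?thesis by (intro exI[of _ "{}"]) auto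
  next
    case 2
    then show ?thesis by (intro exI[of _ "{A}"]) auto
  next
    case 3
    obtain F G where "finite F \<and> (\<forall>V\<in>F. irreducible_variety V) \<and> B = \<Union>F"
      "finite G \<and> (\<forall>V\<in>G. irreducible_variety V) \<and> C = \<Union>G"
      using less(2)[of B] less(2)[of C] 3 by auto
    then show ?thesis using 3(3) by (intro exI[of _ "F \<union> G"]) auto
  qed
qed

lemma irreducible_imp_algebraic: "irreducible_variety V \<Longrightarrow> algebraic_set V"
  by (simp add: irreducible_variety_def)

lemma component_exists:
  fixes A :: "(complex ^ 'n::finite) set"
  assumes "algebraic_set A" "irreducible_variety V" "V \<subseteq> A"
  shows "\<exists>Z. irreducible_component Z A \<and> V \<subseteq> Z"
proof -
  obtain F where F: "finite F" "\<And>V. V \<in> F \<Longrightarrow> irreducible_variety V" "A = \<Union>F"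
    using algebraic_set_decomp[OF assms(1)] by auto
  note alg = irreducible_imp_algebraic
  obtain W where W: "W \<in> F" "V \<subseteq> W"
    using irreducible_subset_Union[OF assms(2) F(1)] alg F assms(3) by blast
  obtain Z where Z: "Z \<in> F" "W \<subseteq> Z" "\<And>Y. Y \<in> F \<Longrightarrow> Z \<subseteq> Y \<Longrightarrow> Y = Z"
    using finite_has_maximal2[OF F(1) W(1)] by auto
  have "irreducible_component Z A" unfolding irreducible_component_def
  proof (intro conjI allI impI)
    fix U assume U: "irreducible_variety U \<and> Z \<subseteq> U \<and> U \<subseteq> A"
    then obtain Y where "Y \<in> F" "U \<subseteq> Y"
      using irreducible_subset_Union[OF _ F(1), of U] alg F(2,3) by blast
    then show "U = Z" using Z(3)[of Y] U by blast
  qed (use F Z in auto)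
  then show ?thesis using W Z by blast
qed

lemma finite_components:
  fixes A :: "(complex ^ 'n::finite) set"
  assumes "algebraic_set A" shows "finite {Z. irreducible_component Z A}"
proof -
  obtain F where F: "finite F" "\<And>V. V \<in> F \<Longrightarrow> irreducible_variety V" "A = \<Union>F"
    using algebraic_set_decomp[OF assms(1)] by auto
  have "Z \<in> F" if "irreducible_component Z A" for Z
  proof -
    have Z: "irreducible_variety Z" "Z \<subseteq> A" using that by (auto simp: irreducible_component_def)
    obtain W where W: "W \<in> F" "Z \<subseteq> W"
      using irreducible_subset_Union[OF Z(1) F(1)] irreducible_imp_algebraic F Z(2) by blast
    then have "W = Z" using that F unfolding irreducible_component_def by blast
    then show ?thesis using W by simp
  qed
  then show ?thesis using finite_subset[OF _ F(1), of "{Z. irreducible_component Z A}"] by auto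
qed

lemma Union_components:
  fixes A :: "(complex ^ 'n::finite) set"
  assumes "algebraic_set A" shows "A = \<Union>{Z. irreducible_component Z A}"
proof (intro equalityI subsetI)
  fix x assume "x \<in> A"
  obtain F where F: "finite F" "\<And>V. V \<in> F \<Longrightarrow> irreducible_variety V" "A = \<Union>F"
    using algebraic_set_decomp[OF assms(1)] by auto
  then obtain V where "V \<in> F" "x \<in> V" using \<open>x \<in> A\<close> by auto
  then obtain Z where "irreducible_component Z A" "V \<subseteq> Z"
    using component_exists[OF assms F(2)[of V]] F(3) by auto
  then show "x \<in> \<Union>{Z. irreducible_component Z A}" using \<open>x \<in> V\<close> by auto
qed (auto simp: irreducible_component_def)

section \<open>Generic linear sections and dimension\<close>

abbreviation lrows :: "nat \<Rightarrow> (nat \<times> 'n option) set" where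
  "lrows r \<equiv> {1..r} \<times> UNIV"

definition lin :: "(nat \<times> 'n::finite option \<Rightarrow> complex) \<Rightarrow> nat \<Rightarrow> complex ^ 'n \<Rightarrow> complex" where
  "lin a m x = a (m, None) + (\<Sum>v\<in>UNIV. a (m, Some v) * x $ v)"

lemma val_ell: "val (ell a m) x = lin a m x"
  by (simp add: ell_def lin_def peval_sum peval_single monom_val_single)

definition sect :: "(nat \<times> 'n::finite option \<Rightarrow> complex) \<Rightarrow> nat \<Rightarrow> (complex ^ 'n) set" where
  "sect a r = {x. \<forall>m\<in>{1..r}. lin a m x = 0}"

lemma zeros_ells: "zeros (ells a r) = sect a r"
  unfolding zeros_def ells_def sect_def by (auto simp: val_ell)

lemma flag_sect: "flag a j = sect (a :: nat \<times> 'n::finite option \<Rightarrow> complex) (CARD('n) - j)"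
  by (simp add: flag_def zeros_ells)

lemma sect_cong: "(\<And>v. v \<in> lrows r \<Longrightarrow> a v = b v) \<Longrightarrow> sect a r = sect b r"
  by (auto simp: sect_def lin_def)

lemma sect_0 [simp]: "sect a 0 = UNIV"
  by (simp add: sect_def)

lemma sect_Suc: "sect a (Suc r) = sect a r \<inter> {x. lin a (Suc r) x = 0}"
  by (auto simp: sect_def atLeastAtMostSuc_conv)

lemma lin_polyf: "(\<And>v. (\<lambda>b. s b $ v) \<in> polyf V) \<Longrightarrow> (\<And>o'. (\<lambda>b. a b (m, o')) \<in> polyf V) \<Longrightarrow>
  (\<lambda>b. lin (a b) m (s b)) \<in> polyf V"
  unfolding lin_def by (intro polyf_intros)

lemma lin_polyv: "(\<lambda>x. lin a m x) \<in> polyv"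
  unfolding lin_def by (intro polyv_add polyv_sum polyv_mult polyv_const polyv_nth)

lemma algebraic_set_sect: "algebraic_set (sect a r)"
  by (metis zeros_ells algebraic_set_zeros)

text \<open>For irreducible \<open>V\<close>, \<open>misses r V\<close> and \<open>meets r V\<close>
  turn out to express that the dimension of \<open>V\<close> is less than \<open>r\<close> and at
  least \<open>r\<close>. They make sense for arbitrary sets, and \<open>misses\<close> passes to
  subsets and finite unions.\<close>

definition misses :: "nat \<Rightarrow> (complex ^ 'n::finite) set \<Rightarrow> bool" where
  "misses r V \<longleftrightarrow> generically (lrows r :: (nat \<times> 'n option) set) (\<lambda>a. V \<inter> sect a r = {})"

definition meets :: "nat \<Rightarrow> (complex ^ 'n::finite) set \<Rightarrow> bool" where
  "meets r V \<longleftrightarrow> generically (lrows r :: (nat \<times> 'n option) set) (\<lambda>a. V \<inter> sect a r \<noteq> {})"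

definition defset :: "(complex ^ 'n) set \<Rightarrow> bool" where
  "defset V \<longleftrightarrow> defb (\<lambda>a. (\<chi> i. a i) \<in> V)"

lemma defset_algebraic: "algebraic_set (A :: (complex ^ 'n::finite) set) \<Longrightarrow> defset A"
  unfolding defset_def by (rule defb_algebraic) (auto intro: polyf_intros)

lemma defset_Diff: "defset A \<Longrightarrow> defset B \<Longrightarrow> defset (A - B)"
  unfolding defset_def Diff_iff by (intro defb_intros)

lemma defb_defset:
  assumes "defset V" "\<And>i. (\<lambda>a. s a $ i) \<in> polyf UNIV" shows "defb (\<lambda>a. s a \<in> V)"
proof -
  have "defb (\<lambda>a. (\<chi> i. s a $ i) \<in> V)"
    by (rule defb_subst[OF assms(1)[unfolded defset_def]]) (rule assms(2))
  then show ?thesis by simp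
qed

lemma defb_sect:
  assumes "\<And>v. (\<lambda>b. s b $ v) \<in> polyf UNIV" "\<And>v. (\<lambda>b. a b v) \<in> polyf UNIV"
  shows "defb (\<lambda>b. s b \<in> sect (a b) r)"
  unfolding sect_def mem_Collect_eq
  by (intro defb_ball defb.zero lin_polyf assms) simp

lemma meets_or_misses:
  fixes V :: "(complex ^ 'n::finite) set"
  assumes "defset V" shows "meets r V \<or> misses r V"
proof -
  have "defb (\<lambda>a :: nat \<times> 'n option \<Rightarrow> complex. \<exists>x. x \<in> V \<and> x \<in> sect a r)"
    by (rule defb_ex_vec, rule defb.conj) (auto intro!: defb_defset[OF assms] defb_sect polyf.var)
  then have "generically (lrows r) (\<lambda>a :: nat \<times> 'n option \<Rightarrow> complex. \<exists>x. x \<in> V \<and> x \<in> sect a r) \<or>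
     generically (lrows r) (\<lambda>a :: nat \<times> 'n option \<Rightarrow> complex. \<not> (\<exists>x. x \<in> V \<and> x \<in> sect a r))"
  proof (rule generically_zero_one)
    fix a b :: "nat \<times> 'n option \<Rightarrow> complex" assume "\<And>v. v \<in> lrows r \<Longrightarrow> a v = b v"
    then have "sect a r = sect b r" by (rule sect_cong)
    then show "(\<exists>x. x \<in> V \<and> x \<in> sect a r) = (\<exists>x. x \<in> V \<and> x \<in> sect b r)" by simp
  qed
  moreover have "V \<inter> sect a r = {} \<longleftrightarrow> \<not> (\<exists>x. x \<in> V \<and> x \<in> sect a r)"
    for a :: "nat \<times> 'n option \<Rightarrow> complex" by auto
  ultimately show ?thesis unfolding meets_def misses_def by simp
qed

lemma not_meets_misses: "meets r V \<Longrightarrow> misses r V \<Longrightarrow> False"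
  unfolding meets_def misses_def using generically_not_both[of _ "\<lambda>a. V \<inter> sect a r \<noteq> {}"] by auto

lemma misses_subset: "misses r W \<Longrightarrow> V \<subseteq> W \<Longrightarrow> misses r V"
  unfolding misses_def by (erule generically_mono) auto

lemma misses_le:
  assumes "misses r V" "r \<le> s" shows "misses s V"
proof -
  have "generically (lrows s) (\<lambda>a. V \<inter> sect a r = {})"
    using assms unfolding misses_def by (elim generically_superset) auto
  then show ?thesis unfolding misses_def
    by (rule generically_mono) (use assms(2) in \<open>auto simp: sect_def\<close>)
qed

lemma misses_Union: "finite F \<Longrightarrow> (\<And>V. V \<in> F \<Longrightarrow> misses r V) \<Longrightarrow> misses r (\<Union>F)"
proof -
  assume F: "finite F" "\<And>V. V \<in> F \<Longrightarrow> misses r V"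
  have "generically (lrows r) (\<lambda>a. \<forall>V\<in>F. V \<inter> sect a r = {})"
    by (rule generically_ball[OF F(1)]) (use F(2) in \<open>simp add: misses_def\<close>)
  then show ?thesis unfolding misses_def by (rule generically_mono) auto
qed

lemma not_misses_0: "V \<noteq> {} \<Longrightarrow> \<not> misses 0 V"
  unfolding misses_def using generically_ex[of "lrows 0" "\<lambda>a. V \<inter> sect a 0 = {}"] by auto

text \<open>Exchanges the coefficients of one equation, so that the last equation can vary while the
  others are kept, or conversely.\<close>

definition join :: "nat \<Rightarrow> (nat \<times> 'n option \<Rightarrow> complex) \<Rightarrow> ('n option \<Rightarrow> complex) \<Rightarrow> nat \<times> 'n option \<Rightarrow> complex"
  where "join r a l = (\<lambda>(m, o'). if m = r then l o' else a (m, o'))"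

definition lin1 :: "('n::finite option \<Rightarrow> complex) \<Rightarrow> complex ^ 'n \<Rightarrow> complex" where
  "lin1 l x = l None + (\<Sum>v\<in>UNIV. l (Some v) * x $ v)"

lemma lin_join: "lin (join r a l) m x = (if m = r then lin1 l x else lin a m x)"
  by (simp add: lin_def lin1_def join_def)

lemma lin_eq_lin1: "lin a m x = lin1 (\<lambda>o'. a (m, o')) x"
  by (simp add: lin_def lin1_def)

lemma sect_join: "sect (join (Suc r) a l) (Suc r) = sect a r \<inter> {x. lin1 l x = 0}"
proof -
  have "sect (join (Suc r) a l) r = sect a r" by (auto simp: sect_def lin_join)
  then show ?thesis by (simp add: sect_Suc lin_join)
qed

lemma join_same: "join r a (\<lambda>o'. a (r, o')) = a"
  by (auto simp: join_def fun_eq_iff)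

lemma polyf_join_left: "f \<in> polyf (lrows (Suc r)) \<Longrightarrow> (\<lambda>a. f (join (Suc r) a l)) \<in> polyf (lrows r)"
  by (erule polyf_subst) (auto simp: join_def le_Suc_eq intro!: polyf_if polyf_intros)

lemma polyf_join_right: "f \<in> polyf V \<Longrightarrow> (\<lambda>l. f (join r a l)) \<in> polyf UNIV"
  by (erule polyf_subst) (auto simp: join_def intro!: polyf_if polyf_intros)

text \<open>If a generic hyperplane misses \<open>D\<close>, then \<open>D\<close> is finite: with coefficients separating the
  points of \<open>D\<close>, the condition on the constant term is a polynomial that vanishes at as many numbers
  as there are points.\<close>

lemma misses_finite:
  fixes W :: "(complex ^ 'n::finite) set"
  assumes "misses (Suc r) W"
  shows "\<exists>K. generically (lrows r :: (nat \<times> 'n option) set)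
    (\<lambda>a. finite (W \<inter> sect a r) \<and> card (W \<inter> sect a r) \<le> K)"
proof -
  obtain f a0 where f: "f \<in> polyf (lrows (Suc r))" "f a0 \<noteq> 0"
    "\<And>a. f a \<noteq> 0 \<Longrightarrow> W \<inter> sect a (Suc r) = {}"
    using assms unfolding misses_def generically_iff by auto
  let ?v = "(Suc r, None :: 'n option)"
  have "f \<in> polyf (insert ?v (lrows (Suc r)))" by (rule polyf_mono[OF subset_insertI f(1)])
  \<comment> \<open>\<open>K\<close> bounds the degree of \<open>f\<close> in the constant term of
    the last equation. It does not depend on \<open>a\<close>, which makes the bound on the
    cardinality uniform.\<close>
  then obtain c K where c: "\<And>k. c k \<in> polyf (lrows (Suc r) - {?v})"
    "\<And>a. f a = (\<Sum>k\<le>K. c k a * a ?v ^ k)"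
    using polyf_expand[of f ?v "lrows (Suc r)"] by auto
  let ?l0 = "\<lambda>o'. a0 (Suc r, o')"
  have f': "(\<lambda>a. f (join (Suc r) a ?l0)) \<in> polyf (lrows r)" by (rule polyf_join_left[OF f(1)])
  have main: "card X \<le> K" if a: "f (join (Suc r) a ?l0) \<noteq> 0" and X: "finite X" "X \<subseteq> W \<inter> sect a r" for a X
  proof -
    have "generically UNIV (\<lambda>l. f (join (Suc r) a l) \<noteq> 0)"
      unfolding generically_iff using a by (intro bexI[OF _ polyf_join_right[OF f(1)]]) auto
    moreover have "generically UNIV (\<lambda>l. \<forall>p\<in>{p\<in>X \<times> X. fst p \<noteq> snd p}.
        (\<Sum>v\<in>UNIV. l (Some v) * (fst p $ v - snd p $ v)) \<noteq> 0)"
    proof (rule generically_ball)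
      fix p assume "p \<in> {p\<in>X \<times> X. fst p \<noteq> snd p}"
      then obtain v where v: "fst p $ v - snd p $ v \<noteq> 0" by (auto simp: vec_eq_iff)
      have "(\<Sum>w\<in>UNIV. (\<lambda>o'. if o' = Some v then 1 else 0) (Some w) * (fst p $ w - snd p $ w)) \<noteq> 0"
        using v by (simp add: if_distrib[of "\<lambda>x. x * _"] cong: if_cong)
      then show "generically UNIV (\<lambda>l. (\<Sum>v\<in>UNIV. l (Some v) * (fst p $ v - snd p $ v)) \<noteq> 0)"
        unfolding generically_iff
        by (intro bexI[of _ "\<lambda>l. \<Sum>v\<in>UNIV. l (Some v) * (fst p $ v - snd p $ v)"] conjI
              exI[of _ "\<lambda>o'. if o' = Some v then 1 else 0"] polyf_intros) auto
    qed (use X in auto)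
    ultimately obtain l where l1: "f (join (Suc r) a l) \<noteq> 0 \<and> (\<forall>p\<in>{p\<in>X \<times> X. fst p \<noteq> snd p}.
        (\<Sum>v\<in>UNIV. l (Some v) * (fst p $ v - snd p $ v)) \<noteq> 0)"
      by (rule generically_ex[OF generically_conj, THEN exE])
    then have l: "f (join (Suc r) a l) \<noteq> 0"
      "\<And>x y. x \<in> X \<Longrightarrow> y \<in> X \<Longrightarrow> x \<noteq> y \<Longrightarrow> (\<Sum>v\<in>UNIV. l (Some v) * (x $ v - y $ v)) \<noteq> 0"
      by auto
    define p where "p = (\<Sum>k\<le>K. monom (c k (join (Suc r) a l)) k)"
    have p: "poly p b = f (join (Suc r) a (l(None := b)))" for b
    proof -
      have "c k (join (Suc r) a l) = c k (join (Suc r) a (l(None := b)))" for k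
        by (rule polyf_cong[OF c(1)]) (auto simp: join_def split: if_splits option.splits)
      then show ?thesis by (simp add: p_def c(2) poly_sum poly_monom join_def)
    qed
    have "poly p (l None) \<noteq> 0" unfolding p using l(1) by simp
    then have p0: "p \<noteq> 0" by auto
    have dp: "degree p \<le> K" unfolding p_def
      by (rule degree_sum_le) (auto intro: order_trans[OF degree_monom_le])
    let ?b = "\<lambda>x. - (\<Sum>v\<in>UNIV. l (Some v) * x $ v)"
    have "inj_on ?b X"
    proof (rule inj_onI, rule ccontr)
      fix x y assume xy: "x \<in> X" "y \<in> X" "?b x = ?b y" "x \<noteq> y"
      then show False using l(2)[OF xy(1,2,4)] by (simp add: right_diff_distrib sum_subtractf)
    qed
    moreover have "?b ` X \<subseteq> {b. poly p b = 0}"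
    proof clarsimp
      fix x assume x: "x \<in> X"
      then have "x \<in> W \<inter> sect (join (Suc r) a (l(None := ?b x))) (Suc r)"
        using X by (auto simp: sect_join lin1_def)
      then show "poly p (?b x) = 0" unfolding p using f(3) by blast
    qed
    ultimately have "card X \<le> card {b. poly p b = 0}"
      by (rule card_inj_on_le) (rule poly_roots_finite[OF p0])
    also have "\<dots> \<le> K" using card_poly_roots_bound[OF p0] dp by simp
    finally show ?thesis .
  qed
  have "generically (lrows r) (\<lambda>a. f (join (Suc r) a ?l0) \<noteq> 0)"
    unfolding generically_iff
    by (rule bexI[OF _ f'], intro conjI exI[of _ a0]) (auto simp: join_same f(2))
  then have "generically (lrows r) (\<lambda>a. finite (W \<inter> sect a r) \<and> card (W \<inter> sect a r) \<le> K)"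
  proof (rule generically_mono)
    fix a assume a: "f (join (Suc r) a ?l0) \<noteq> 0"
    have "finite (W \<inter> sect a r)"
    proof (rule ccontr)
      assume "infinite (W \<inter> sect a r)"
      then obtain X where "X \<subseteq> W \<inter> sect a r" "finite X" "card X = Suc K"
        using infinite_arbitrarily_large by blast
      then show False using main[OF a, of X] by simp
    qed
    then show "finite (W \<inter> sect a r) \<and> card (W \<inter> sect a r) \<le> K" using main[OF a] by auto
  qed
  then show ?thesis ..
qed

lemma polyf_infinite_values:
  assumes "f \<in> polyf (UNIV :: ('p + unit) set)" "f (case_sum a (\<lambda>_. t0)) \<noteq> 0"
  shows "finite {t. f (case_sum a (\<lambda>_. t)) = 0}"
proof -
  have s: "\<exists>p. \<forall>t. case_sum a (\<lambda>_. t) v = poly p t" for v :: "'p + unit"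
  proof (cases v)
    case (Inl w)
    then show ?thesis by (intro exI[of _ "[:a w:]"]) simp
  next
    case (Inr w)
    then show ?thesis by (intro exI[of _ "[:0, 1:]"]) simp
  qed
  obtain p where p: "\<And>t. f (case_sum a (\<lambda>_. t)) = poly p t"
    using polyf_line[OF assms(1), of "\<lambda>t. case_sum a (\<lambda>_. t)", OF s] by auto
  have "p \<noteq> 0" using p[of t0] assms(2) by auto
  then show ?thesis unfolding p by (rule poly_roots_finite)
qed

text \<open>Let \<open>g\<close> vanish on \<open>V\<close> but not on \<open>W\<close>. The nonzero values of \<open>g\<close> on the finite sets
  \<open>W \<inter> sect a m\<close> satisfy a polynomial equation in \<open>(a, g)\<close> that is nontrivial at \<open>g = 0\<close>; as \<open>W\<close> is
  irreducible, this equation extends to \<open>V\<close>, where \<open>g = 0\<close>.\<close>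

theorem misses_proper_subset:
  fixes W :: "(complex ^ 'n::finite) set"
  assumes W: "irreducible_variety W" and V: "algebraic_set V" "V \<subset> W" and m: "misses (Suc m) W"
  shows "misses m V"
proof -
  obtain x0 where x0: "x0 \<in> W" "x0 \<notin> V" using V by auto
  obtain g where g: "g \<in> polyv" "\<And>x. x \<in> V \<Longrightarrow> g x = 0" "g x0 \<noteq> 0"
    using algebraic_set_vanish[OF V(1) x0(2)] by (auto simp: vanish_def)
  define R :: "((nat \<times> 'n option) + unit \<Rightarrow> complex) \<Rightarrow> bool" where
    "R b \<longleftrightarrow> (\<exists>x. x \<in> W \<and> x \<in> sect (\<lambda>v. b (Inl v)) m \<and> g x = b (Inr ()) \<and> \<not> g x = 0)" for b
  have R: "defb R" unfolding R_def[abs_def]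
    by (rule defb_ex_vec)
      (intro defb.conj defb.neg defb_eq defb_defset[OF defset_algebraic] irreducible_imp_algebraic[OF W]
        defb_sect polyv_subst_polyf[OF g(1)] polyf.const polyf.var UNIV_I,
        auto intro: polyf_intros)
  let ?Q = "Inl ` lrows m \<union> {Inr ()} :: ((nat \<times> 'n option) + unit) set"
  have "generically ?Q R \<or> generically ?Q (\<lambda>b. \<not> R b)"
  proof (rule generically_zero_one[OF R])
    fix a b :: "(nat \<times> 'n option) + unit \<Rightarrow> complex" assume ab: "\<And>v. v \<in> ?Q \<Longrightarrow> a v = b v"
    have "sect (\<lambda>v. a (Inl v)) m = sect (\<lambda>v. b (Inl v)) m" by (rule sect_cong) (use ab in auto)
    then show "R a = R b" using ab by (simp add: R_def)
  qed
  then show ?thesis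
  proof
    \<comment> \<open>For suitable fixed coefficients, all but finitely many complex numbers would
      be values of \<open>g\<close> on a finite set, which is absurd.\<close>
    assume "generically ?Q R"
    then have 1: "generically UNIV R" by (rule generically_superset) simp
    obtain K where K: "generically (lrows m :: (nat \<times> 'n option) set)
        (\<lambda>a. finite (W \<inter> sect a m) \<and> card (W \<inter> sect a m) \<le> K)"
      using misses_finite[OF m] ..
    have "generically (Inl ` lrows m) (\<lambda>r :: (nat \<times> 'n option) + unit \<Rightarrow> complex.
         finite (W \<inter> sect (\<lambda>v. r (Inl v)) m))"
    proof (rule generically_pullback)
      show "generically (lrows m) (\<lambda>a. finite (W \<inter> sect a m))" by (rule generically_mono[OF K]) simp
    qed simp
    then have 2: "generically UNIV (\<lambda>r :: (nat \<times> 'n option) + unit \<Rightarrow> complex.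
         finite (W \<inter> sect (\<lambda>v. r (Inl v)) m))" by (rule generically_superset) simp
    obtain f b0 where f: "f \<in> polyf UNIV" "f b0 \<noteq> 0"
      "\<And>b. f b \<noteq> 0 \<Longrightarrow> R b \<and> finite (W \<inter> sect (\<lambda>v. b (Inl v)) m)"
      using generically_conj[OF 1 2] unfolding generically_iff by auto
    let ?a = "\<lambda>v. b0 (Inl v)"
    have b0: "b0 = case_sum ?a (\<lambda>_. b0 (Inr ()))" by (auto simp: fun_eq_iff split: sum.split)
    have "finite {t. f (case_sum ?a (\<lambda>_. t)) = 0}"
      by (rule polyf_infinite_values[OF f(1), of _ "b0 (Inr ())"]) (use f(2) b0 in auto)
    moreover have "{t. f (case_sum ?a (\<lambda>_. t)) \<noteq> 0} \<subseteq> g ` (W \<inter> sect ?a m)"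
      using f(3)[of "case_sum ?a (\<lambda>_. _)"] unfolding R_def by auto
    then have "finite {t. f (case_sum ?a (\<lambda>_. t)) \<noteq> 0}"
      by (rule finite_subset) (use f(3)[OF f(2)] in simp)
    ultimately have "finite ({t. f (case_sum ?a (\<lambda>_. t)) = 0} \<union> {t. f (case_sum ?a (\<lambda>_. t)) \<noteq> 0})"
      by blast
    moreover have "{t. f (case_sum ?a (\<lambda>_. t)) = 0} \<union> {t. f (case_sum ?a (\<lambda>_. t)) \<noteq> 0} = (UNIV :: complex set)"
      by auto
    ultimately show ?thesis using infinite_UNIV_char_0[where 'a = complex] by simp
  next
    assume "generically ?Q (\<lambda>b. \<not> R b)"
    then obtain P b0 where P: "P \<in> polyf ?Q" "P b0 \<noteq> 0" "\<And>b. R b \<Longrightarrow> P b = 0"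
      unfolding generically_iff by auto
    have ins: "?Q = insert (Inr ()) (Inl ` lrows m)" by simp
    obtain c d where c: "\<And>k. c k \<in> polyf (Inl ` lrows m - {Inr ()})"
      "\<And>b. P b = (\<Sum>k\<le>d. c k b * b (Inr ()) ^ k)"
      using polyf_expand[OF P(1)[unfolded ins]] by auto
    have "Inl ` lrows m - {Inr ()} = (Inl ` lrows m :: ((nat \<times> 'n option) + unit) set)" by auto
    then have c1: "c k \<in> polyf (Inl ` lrows m)" for k using c(1)[of k] by simp
    have "\<exists>k. k \<le> d \<and> (\<exists>b. c k b \<noteq> 0)"
    proof (rule ccontr)
      assume "\<not> ?thesis"
      then have "P b0 = 0" unfolding c(2) by (intro sum.neutral) auto
      then show False using P(2) by simp
    qed
    \<comment> \<open>\<open>k0\<close> is the order of the relation \<open>P\<close> at value 0.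
      Dividing by this power of the value is harmless, since \<open>R\<close> only speaks of nonzero
      values, and it leaves a relation that does not vanish identically at 0.\<close>
    then obtain k0 where k0: "k0 \<le> d" "\<exists>b. c k0 b \<noteq> 0" "\<And>k b. k < k0 \<Longrightarrow> c k b = 0"
    proof -
      let ?p = "\<lambda>k. k \<le> d \<and> (\<exists>b. c k b \<noteq> 0)"
      assume ex: "\<exists>k. ?p k"
      have L: "?p (Least ?p)" using LeastI_ex[OF ex] .
      have "c k b = 0" if "k < Least ?p" for k b
        using not_less_Least[OF that] L that by auto
      then show thesis using L that by blast
    qed
    define P1 where "P1 b t = (\<Sum>k\<in>{k0..d}. c k b * t ^ (k - k0))" for b and t :: complex
    have P1: "P b = b (Inr ()) ^ k0 * P1 b (b (Inr ()))" for b
    proof -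
      have "P b = (\<Sum>k\<in>{k0..d}. c k b * b (Inr ()) ^ k)"
        unfolding c(2) by (rule sum.mono_neutral_right) (use k0(3) in auto)
      also have "\<dots> = b (Inr ()) ^ k0 * P1 b (b (Inr ()))"
        unfolding P1_def sum_distrib_left
        by (rule sum.cong) (simp_all add: mult_ac flip: power_add)
      finally show ?thesis .
    qed
    have P10: "P1 b 0 = c k0 b" for b
    proof -
      have "P1 b 0 = (\<Sum>k\<in>{k0}. c k b * 0 ^ (k - k0))"
        unfolding P1_def by (rule sum.mono_neutral_right) (use k0(1) in auto)
      then show ?thesis by simp
    qed
    let ?f = "\<lambda>a. c k0 (case_sum a (\<lambda>_. 0))"
    have f: "?f \<in> polyf (lrows m)"
      by (rule polyf_subst[OF c1]) (auto intro!: polyf.var)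
    obtain b where "c k0 b \<noteq> 0" using k0(2) ..
    moreover have "c k0 b = ?f (\<lambda>v. b (Inl v))" by (rule polyf_cong[OF c1]) auto
    ultimately have f0: "?f (\<lambda>v. b (Inl v)) \<noteq> 0" by simp
    have "V \<inter> sect a m = {}" if a: "?f a \<noteq> 0" for a
    proof (rule ccontr)
      assume "V \<inter> sect a m \<noteq> {}"
      then obtain x1 where x1: "x1 \<in> V" "x1 \<in> sect a m" by auto
      \<comment> \<open>Keeping the linear parts of \<open>a\<close> and adjusting the constant
        terms makes the section pass through \<open>x\<close>. The relation thereby becomes a
        polynomial function of \<open>x\<close>, and at \<open>x1\<close> the adjusted coefficients
        are those of \<open>a\<close>.\<close>
      let ?s = "\<lambda>x v. case v of (k, None) \<Rightarrow> - (\<Sum>v\<in>UNIV. a (k, Some v) * x $ v) | (k, Some i) \<Rightarrow> a (k, Some i)"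
      have s: "x \<in> sect (?s x) m" for x :: "complex ^ 'n" by (auto simp: sect_def lin_def)
      have sp: "(\<lambda>x. ?s x v) \<in> polyv" for v
        by (cases v; cases "snd v")
          (auto intro!: polyv_const polyv_diff[of "\<lambda>_. 0", simplified] polyv_sum polyv_mult polyv_nth)
      let ?h = "\<lambda>x. P1 (case_sum (?s x) (\<lambda>_. 0)) (g x)"
      have h: "?h \<in> polyv" unfolding P1_def
      proof (intro polyv_sum polyv_mult)
        fix k
        show "(\<lambda>x. c k (case_sum (?s x) (\<lambda>_. 0))) \<in> polyv"
        proof (rule polyf_subst_polyv[OF c1])
          fix v :: "(nat \<times> 'n option) + unit" assume "v \<in> Inl ` lrows m"
          then obtain w where "v = Inl w" by auto
          then show "(\<lambda>x. case_sum (?s x) (\<lambda>_. 0) v) \<in> polyv" using sp[of w] by (simp only: sum.case)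
        qed
        have "(\<lambda>x. (\<Prod>i<k - k0. g x)) \<in> polyv" by (intro polyv_prod g(1))
        then show "(\<lambda>x. g x ^ (k - k0)) \<in> polyv" by simp
      qed
      have "g x * ?h x = 0" if x: "x \<in> W" for x
      proof (cases "g x = 0")
        case False
        let ?b = "case_sum (?s x) (\<lambda>_. g x)"
        have "R ?b" unfolding R_def using x s[of x] False by auto
        then have "P ?b = 0" by (rule P(3))
        then have "P1 ?b (g x) = 0" using False P1[of ?b] by simp
        moreover have "P1 ?b (g x) = ?h x" unfolding P1_def
          by (intro sum.cong refl arg_cong2[of _ _ _ _ "(*)"] polyf_cong[OF c1]) auto
        ultimately show ?thesis by simp
      qed simp
      then have "(\<forall>x\<in>W. g x = 0) \<or> (\<forall>x\<in>W. ?h x = 0)"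
        by (rule irreducible_vanish_mult[OF W g(1) h])
      then have "?h x1 = 0" using g(3) x0(1) x1(1) V(2) by auto
      then have "c k0 (case_sum (?s x1) (\<lambda>_. 0)) = 0" using g(2)[OF x1(1)] P10 by simp
      moreover have "c k0 (case_sum (?s x1) (\<lambda>_. 0)) = ?f a"
      proof (rule polyf_cong[OF c1])
        fix v :: "(nat \<times> 'n option) + unit" assume "v \<in> Inl ` lrows m"
        then obtain k o' where v: "v = Inl (k, o')" "k \<in> {1..m}" by auto
        have "lin a k x1 = 0" using x1(2) v(2) by (auto simp: sect_def)
        then show "case_sum (?s x1) (\<lambda>_. 0) v = case_sum a (\<lambda>_. 0) v"
          unfolding v(1) lin_def by (cases o') (auto simp: add_eq_0_iff)
      qed
      ultimately show False using a by simp
    qed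
    then show ?thesis unfolding misses_def generically_iff using f f0 by (intro bexI[OF _ f]) auto
  qed
qed

section \<open>Krull dimension in terms of generic sections\<close>

lemma meets_component:
  fixes A :: "(complex ^ 'n::finite) set"
  assumes "finite F" "\<And>V. V \<in> F \<Longrightarrow> algebraic_set V" "\<not> misses m (\<Union>F)"
  shows "\<exists>V\<in>F. meets m (V :: (complex ^ 'n::finite) set)"
proof (rule ccontr)
  assume "\<not> ?thesis"
  then have "misses m V" if "V \<in> F" for V
    using meets_or_misses[OF defset_algebraic[OF assms(2)[OF that]]] that by auto
  then show False using misses_Union[OF assms(1)] assms(3) by blast
qed

text \<open>The last equation is fixed at a generic value, so that its hyperplane avoids
  \<open>x0\<close> while its intersection with \<open>W\<close> still meets generic sections by
  \<open>m\<close> equations. Some component of the intersection inherits this, and it is proper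
  because it omits \<open>x0\<close>.\<close>

lemma meets_hyperplane:
  fixes W :: "(complex ^ 'n::finite) set"
  assumes W: "irreducible_variety W" and m: "meets (Suc m) W"
  shows "\<exists>V. irreducible_variety V \<and> V \<subset> W \<and> meets m V"
proof -
  obtain x0 where x0: "x0 \<in> W" using W by (auto simp: irreducible_variety_def)
  have "generically (lrows (Suc m) :: (nat \<times> 'n option) set) (\<lambda>a. lin a (Suc m) x0 \<noteq> 0)"
    unfolding generically_iff
  proof (intro bexI conjI exI allI impI)
    show "(\<lambda>a :: nat \<times> 'n option \<Rightarrow> complex. lin a (Suc m) x0) \<in> polyf (lrows (Suc m))"
      by (rule lin_polyf) (auto intro: polyf_intros)
    show "lin (\<lambda>v. if v = (Suc m, None :: 'n option) then 1 else 0) (Suc m) x0 \<noteq> 0"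
      by (simp add: lin_def)
  qed
  from generically_conj[OF m[unfolded meets_def] this]
  obtain f a1 where f: "f \<in> polyf (lrows (Suc m))" "f a1 \<noteq> 0"
    "\<And>a. f a \<noteq> 0 \<Longrightarrow> W \<inter> sect a (Suc m) \<noteq> {} \<and> lin a (Suc m) x0 \<noteq> 0"
    unfolding generically_iff by auto
  let ?l = "\<lambda>o'. a1 (Suc m, o')"
  let ?H = "{x. lin1 ?l x = 0}"
  have H: "algebraic_set ?H" using algebraic_set_zero[OF lin_polyv[of a1 "Suc m"]] by (simp add: lin_eq_lin1)
  have WH: "algebraic_set (W \<inter> ?H)" by (intro algebraic_set_Int irreducible_imp_algebraic[OF W] H)
  have "meets m (W \<inter> ?H)" unfolding meets_def generically_iff
  proof (intro bexI conjI exI allI impI)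
    show "(\<lambda>a. f (join (Suc m) a ?l)) \<in> polyf (lrows m)" by (rule polyf_join_left[OF f(1)])
    show "f (join (Suc m) a1 ?l) \<noteq> 0" using f(2) by (simp add: join_same)
    fix a assume "f (join (Suc m) a ?l) \<noteq> 0"
    then have "W \<inter> sect (join (Suc m) a ?l) (Suc m) \<noteq> {}" using f(3) by blast
    then show "W \<inter> ?H \<inter> sect a m \<noteq> {}" unfolding sect_join by auto
  qed
  then have nm: "\<not> misses m (W \<inter> ?H)" using not_meets_misses by blast
  obtain F where F: "finite F" "\<And>V. V \<in> F \<Longrightarrow> irreducible_variety V" "W \<inter> ?H = \<Union>F"
    using algebraic_set_decomp[OF WH] by auto
  obtain V where V: "V \<in> F" "meets m V"
    using meets_component[OF F(1), of m] irreducible_imp_algebraic[OF F(2)] nm F(3) by auto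
  have "x0 \<notin> V" using V F(3) f(3)[OF f(2)] by (auto simp: lin_eq_lin1)
  then have "V \<subset> W" using V F(3) x0 by blast
  then show ?thesis using V F(2) by blast
qed

lemma chain_of_meets:
  fixes W :: "(complex ^ 'n::finite) set"
  assumes "irreducible_variety W" "meets m W"
  shows "\<exists>C :: nat \<Rightarrow> (complex ^ 'n) set. (\<forall>r\<le>m. irreducible_variety (C r) \<and> C r \<subseteq> W) \<and> (\<forall>r<m. C r \<subset> C (Suc r))"
  using assms
proof (induction m arbitrary: W)
  case 0
  then show ?case by (intro exI[of _ "\<lambda>_. W"]) auto
next
  case (Suc m)
  obtain V where V: "irreducible_variety V" "V \<subset> W" "meets m V"
    using meets_hyperplane[OF Suc.prems] by auto
  obtain C where C: "\<forall>r\<le>m. irreducible_variety (C r) \<and> C r \<subseteq> V" "\<forall>r<m. C r \<subset> C (Suc r)"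
    using Suc.IH[OF V(1,3)] by auto
  have "C r \<subseteq> W" if "r \<le> m" for r using C(1) V(2) that by (meson psubset_imp_subset subset_trans)
  moreover have "C m \<subset> W" using C(1) V(2) by (meson order_refl subset_psubset_trans)
  ultimately show ?case
    by (intro exI[of _ "C(Suc m := W)"]) (use C V Suc.prems(1) in \<open>auto simp: le_Suc_eq less_Suc_eq\<close>)
qed

text \<open>Each step down the chain lowers the number of equations needed to miss the variety, and
  a nonempty set is never missed by zero equations.\<close>

lemma misses_chain:
  fixes C :: "nat \<Rightarrow> (complex ^ 'n::finite) set"
  assumes "\<forall>r\<le>l. irreducible_variety (C r)" "\<forall>r<l. C r \<subset> C (Suc r)" "misses (Suc m) (C l)"
  shows "l \<le> m"
  using assms
proof (induction l arbitrary: m)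
  case (Suc l)
  have "misses m (C l)"
    by (rule misses_proper_subset[of "C (Suc l)"]) (use Suc.prems in \<open>auto intro: irreducible_imp_algebraic\<close>)
  moreover have "C l \<noteq> {}" using Suc.prems(1) by (auto simp: irreducible_variety_def)
  ultimately obtain m' where "m = Suc m'" using not_misses_0 by (cases m) auto
  then show ?case using Suc.IH[of m'] Suc.prems \<open>misses m (C l)\<close> by auto
qed simp

theorem alg_dim_eq:
  fixes V :: "(complex ^ 'n::finite) set"
  assumes "irreducible_variety V" "meets m V" "misses (Suc m) V"
  shows "alg_dim V = m"
  unfolding alg_dim_def
proof (rule Greatest_equality)
  show "\<exists>C. (\<forall>r\<le>m. irreducible_variety (C r) \<and> C r \<subseteq> V) \<and> (\<forall>r<m. C r \<subset> C (Suc r))"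
    by (rule chain_of_meets[OF assms(1,2)])
  fix l assume "\<exists>C. (\<forall>r\<le>l. irreducible_variety (C r) \<and> C r \<subseteq> V) \<and> (\<forall>r<l. C r \<subset> C (Suc r))"
  then obtain C where C: "\<forall>r\<le>l. irreducible_variety (C r) \<and> C r \<subseteq> V" "\<forall>r<l. C r \<subset> C (Suc r)" by auto
  show "l \<le> m" by (rule misses_chain[of l C]) (use C misses_subset[OF assms(3)] in auto)
qed

section \<open>Gradients and regular points\<close>

text \<open>There is no conjugation, unlike in the inner product: derivatives of polynomials are
  complex linear in the direction, and the pairing has to be polynomial in both arguments to be
  definable.\<close>

definition bil :: "complex ^ 'n::finite \<Rightarrow> complex ^ 'n \<Rightarrow> complex" where
  "bil u h = (\<Sum>v\<in>UNIV. u $ v * h $ v)"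

lemma bil_axis [simp]: "bil u (axis v c) = u $ v * c"
  by (simp add: bil_def axis_def if_distrib cong: if_cong)

lemma bil_axis_left [simp]: "bil (axis v c) u = c * u $ v"
  by (simp add: bil_def axis_def if_distrib[of "\<lambda>x. x * _"] cong: if_cong)

lemma bil_add_left: "bil (u + w) h = bil u h + bil w h"
  by (simp add: bil_def distrib_right sum.distrib)

lemma bil_scale_left: "bil (c *s u) h = c * bil u h"
  by (simp add: bil_def sum_distrib_left mult.assoc)

lemma bil_scale_right: "bil u (c *s h) = c * bil u h"
  by (simp add: bil_def sum_distrib_left mult.left_commute)

lemma bil_zero_left [simp]: "bil 0 h = 0"
  by (simp add: bil_def)

lemma bil_zero_right [simp]: "bil u 0 = 0"
  by (simp add: bil_def)

lemma bil_sum_left: "bil (\<Sum>i\<in>I. u i) h = (\<Sum>i\<in>I. bil (u i) h)"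
  by (induction I rule: infinite_finite_induct) (auto simp: bil_add_left)

lemma matrix_vector_bil: "(A *v h) $ i = bil (A $ i) h"
  by (simp add: matrix_vector_mult_def bil_def)

lemma bil_span_zero:
  assumes "u \<in> vec.span S" "\<And>w. w \<in> S \<Longrightarrow> bil w h = 0" shows "bil u h = 0"
  using assms(1) by (induction rule: vec.span_induct_alt) (auto simp: bil_add_left bil_scale_left assms(2))

lemma has_derivative_nth [derivative_intros]: "((\<lambda>x. x $ v) has_derivative (\<lambda>h. h $ v)) F"
  by (rule bounded_linear.has_derivative[OF bounded_linear_vec_nth has_derivative_ident])

text \<open>The counterpart of \<open>gradient\<close> for functions, applicable also to Jacobian
  determinants and to the equations of a homotopy.\<close>

definition grad :: "(complex ^ 'n \<Rightarrow> complex) \<Rightarrow> complex ^ 'n \<Rightarrow> complex ^ 'n::finite" where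
  "grad f x = (\<chi> v. deriv (\<lambda>z. f (\<chi> w. if w = v then z else x $ w)) (x $ v))"

lemma gradient_grad: "gradient g x = grad (\<lambda>x. val g x) x"
proof -
  have *: "(\<lambda>w. x $ w)(v := z) = (\<lambda>w. (\<chi> w. if w = v then z else x $ w) $ w)" for v z
    by (auto simp: fun_eq_iff)
  show ?thesis unfolding gradient_def grad_def * ..
qed

lemma polyv_derivative:
  assumes "f \<in> polyv"
  shows "\<exists>D. (\<forall>v. D v \<in> polyv) \<and> (\<forall>x. (f has_derivative (\<lambda>h. \<Sum>v\<in>UNIV. D v x * h $ v)) (at x))"
proof -
  obtain g where g: "g \<in> polyf UNIV" "f = (\<lambda>x. g (\<lambda>v. x $ v))" by (rule polyvE[OF assms])
  have "\<exists>D. (\<forall>v. D v \<in> polyv) \<and>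
     (\<forall>x. ((\<lambda>x. g (\<lambda>v. x $ v)) has_derivative (\<lambda>h. \<Sum>v\<in>UNIV. D v x * h $ v)) (at x))"
    using g(1)
  proof (induction rule: polyf.induct)
    case (const c)
    show ?case by (rule exI[of _ "\<lambda>v x. 0"]) (simp add: polyv_const)
  next
    case (var w)
    show ?case
      by (rule exI[of _ "\<lambda>v x. if v = w then 1 else 0"])
        (auto simp: polyv_const if_distrib[of "\<lambda>x. x * _"] has_derivative_nth cong: if_cong)
  next
    case (add f g)
    obtain D where D: "\<And>v. D v \<in> polyv" "\<And>x. ((\<lambda>x. f (\<lambda>v. x $ v)) has_derivative (\<lambda>h. \<Sum>v\<in>UNIV. D v x * h $ v)) (at x)"
      using add.IH(1) by auto
    obtain E where E: "\<And>v. E v \<in> polyv" "\<And>x. ((\<lambda>x. g (\<lambda>v. x $ v)) has_derivative (\<lambda>h. \<Sum>v\<in>UNIV. E v x * h $ v)) (at x)"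
      using add.IH(2) by auto
    show ?case
      using has_derivative_add[OF D(2) E(2)]
      by (intro exI[of _ "\<lambda>v x. D v x + E v x"]) (auto intro: polyv_add D E simp: distrib_right sum.distrib)
  next
    case (mult f g)
    obtain D where D: "\<And>v. D v \<in> polyv" "\<And>x. ((\<lambda>x. f (\<lambda>v. x $ v)) has_derivative (\<lambda>h. \<Sum>v\<in>UNIV. D v x * h $ v)) (at x)"
      using mult.IH(1) by auto
    obtain E where E: "\<And>v. E v \<in> polyv" "\<And>x. ((\<lambda>x. g (\<lambda>v. x $ v)) has_derivative (\<lambda>h. \<Sum>v\<in>UNIV. E v x * h $ v)) (at x)"
      using mult.IH(2) by auto
    have "((\<lambda>x. f (\<lambda>v. x $ v) * g (\<lambda>v. x $ v)) has_derivative
        (\<lambda>h. \<Sum>v\<in>UNIV. (f (\<lambda>v. x $ v) * E v x + D v x * g (\<lambda>v. x $ v)) * h $ v)) (at x)" for x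
      by (rule has_derivative_eq_rhs[OF has_derivative_mult[OF D(2) E(2)]])
        (simp add: fun_eq_iff sum_distrib_left sum_distrib_right sum.distrib[symmetric] algebra_simps)
    moreover have "(\<lambda>x. f (\<lambda>v. x $ v) * E v x + D v x * g (\<lambda>v. x $ v)) \<in> polyv" for v
      by (intro polyv_add polyv_mult D E polyvI mult.hyps)
    ultimately show ?case
      by (intro exI[of _ "\<lambda>v x. f (\<lambda>v. x $ v) * E v x + D v x * g (\<lambda>v. x $ v)"] conjI allI)
  qed
  then show ?thesis unfolding g(2) .
qed

lemma
  assumes f: "f \<in> polyv"
  shows has_derivative_grad: "(f has_derivative bil (grad f x)) (at x)"
    and polyv_grad: "(\<lambda>x. grad f x $ v) \<in> polyv"
proof -
  obtain D where D: "\<And>v. D v \<in> polyv" "\<And>x. (f has_derivative (\<lambda>h. \<Sum>v\<in>UNIV. D v x * h $ v)) (at x)"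
    using polyv_derivative[OF f] by auto
  have eq: "grad f x $ v = D v x" for x v
  proof -
    let ?c = "\<lambda>z. \<chi> w. if w = v then z else x $ w"
    have c: "?c = (\<lambda>z. (x - axis v (x $ v)) + axis v z)"
      by (auto simp: fun_eq_iff vec_eq_iff axis_def)
    have bl: "bounded_linear (axis v :: complex \<Rightarrow> _)"
      by (rule linear_conv_bounded_linear[THEN iffD1]) (auto simp: linear_iff vec_eq_iff axis_def)
    have "(?c has_derivative axis v) (at (x $ v))" unfolding c
      by (rule has_derivative_eq_rhs[OF has_derivative_add[OF has_derivative_const
            bounded_linear.has_derivative[OF bl has_derivative_ident]]]) simp
    moreover have "?c (x $ v) = x" by (auto simp: vec_eq_iff)
    then have "(f has_derivative (\<lambda>h. \<Sum>v\<in>UNIV. D v x * h $ v)) (at (?c (x $ v)))" using D(2) by simp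
    ultimately have "(f \<circ> ?c has_derivative (\<lambda>h. \<Sum>v\<in>UNIV. D v x * h $ v) \<circ> axis v) (at (x $ v))"
      by (rule diff_chain_at)
    moreover have "(\<lambda>h. \<Sum>v\<in>UNIV. D v x * h $ v) \<circ> axis v = (*) (D v x)"
      by (auto simp: fun_eq_iff axis_def if_distrib cong: if_cong)
    ultimately have "((\<lambda>z. f (?c z)) has_field_derivative D v x) (at (x $ v))"
      unfolding has_field_derivative_def comp_def by simp
    then show ?thesis unfolding grad_def by (simp add: DERIV_imp_deriv)
  qed
  show "(\<lambda>x. grad f x $ v) \<in> polyv" unfolding eq by (rule D(1))
  show "(f has_derivative bil (grad f x)) (at x)"
    using D(2)[of x] by (simp add: bil_def[abs_def] eq)
qed

lemma grad_eqI:
  assumes "f \<in> polyv" "(f has_derivative bil u) (at x)" shows "grad f x = u"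
proof -
  have "bil (grad f x) = bil u" by (rule has_derivative_unique[OF has_derivative_grad[OF assms(1)] assms(2)])
  then have "bil (grad f x) (axis v 1) = bil u (axis v 1)" for v by simp
  then show ?thesis by (simp add: vec_eq_iff)
qed

lemma grad_lin: "grad (\<lambda>x. lin a m x) x = (\<chi> v. a (m, Some v))"
proof (rule grad_eqI[OF lin_polyv])
  show "((\<lambda>x. lin a m x) has_derivative bil (\<chi> v. a (m, Some v))) (at x)"
    unfolding lin_def bil_def[abs_def] by (auto intro!: derivative_eq_intros)
qed

section \<open>Square systems and local coordinates\<close>

definition jac :: "('n \<Rightarrow> complex ^ 'n \<Rightarrow> complex) \<Rightarrow> complex ^ 'n \<Rightarrow> complex ^ 'n ^ 'n::finite" where
  "jac g x = (\<chi> i. grad (g i) x)"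

lemma jac_det_polyv: "(\<And>i. g i \<in> polyv) \<Longrightarrow> (\<lambda>x. det (jac g x)) \<in> polyv"
  by (rule polyv_det) (simp add: jac_def polyv_grad)

lemma has_derivative_jac:
  fixes g :: "'n::finite \<Rightarrow> complex ^ 'n \<Rightarrow> complex"
  assumes "\<And>i. g i \<in> polyv"
  shows "((\<lambda>x. \<chi> i. g i x) has_derivative ((*v) (jac g x))) (at x)"
proof (subst has_derivative_componentwise_within, rule ballI)
  fix b :: "complex ^ 'n" assume "b \<in> Basis"
  then obtain i c where b: "b = axis i c" "c \<in> Basis" by (auto simp: Basis_vec_def)
  have "((\<lambda>x. g i x \<bullet> c) has_derivative (\<lambda>h. bil (grad (g i) x) h \<bullet> c)) (at x)"
    by (rule has_derivative_inner_left[OF has_derivative_grad[OF assms]])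
  then show "((\<lambda>x. (\<chi> i. g i x) \<bullet> b) has_derivative (\<lambda>h. (jac g x *v h) \<bullet> b)) (at x)"
    unfolding b by (simp add: inner_axis matrix_vector_bil jac_def)
qed

lemma matrix_inv_mult_vec:
  fixes A :: "complex ^ 'n ^ 'n::finite"
  assumes "det A \<noteq> 0"
  shows "A *v (matrix_inv A *v y) = y" "matrix_inv A *v (A *v x) = x"
proof -
  have "invertible A" using assms by (simp add: invertible_det_nz)
  then have "A ** matrix_inv A = mat 1 \<and> matrix_inv A ** A = mat 1"
    unfolding invertible_def matrix_inv_def by (rule someI_ex)
  then show "A *v (matrix_inv A *v y) = y" "matrix_inv A *v (A *v x) = x"
    by (simp_all add: matrix_vector_mul_assoc)
qed

text \<open>The functions \<open>g i\<close> serve as local coordinates near \<open>x0\<close>. The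
  explicit derivative of the inverse map is what later allows differentiation along lines in these
  coordinates.\<close>

lemma poly_inverse_function:
  fixes g :: "'n::finite \<Rightarrow> complex ^ 'n \<Rightarrow> complex"
  assumes g: "\<And>i. g i \<in> polyv" and det: "det (jac g x0) \<noteq> 0" and S: "open S" "x0 \<in> S"
  obtains U V \<Psi> where "open U" "x0 \<in> U" "U \<subseteq> S" "open V"
    "homeomorphism U V (\<lambda>x. \<chi> i. g i x) \<Psi>" "\<And>x. x \<in> U \<Longrightarrow> det (jac g x) \<noteq> 0"
    "\<And>y. y \<in> V \<Longrightarrow> (\<Psi> has_derivative ((*v) (matrix_inv (jac g (\<Psi> y))))) (at y)"
proof -
  let ?f = "\<lambda>x. \<chi> i. g i x"
  define f' where "f' x = Blinfun ((*v) (jac g x))" for x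
  have bl: "bounded_linear ((*v) A)" for A :: "complex ^ 'n ^ 'n"
    by (rule linear_conv_bounded_linear[THEN iffD1])
      (auto simp: linear_iff vec_eq_iff matrix_vector_mult_def scaleR_sum_right distrib_left sum.distrib)
  have f': "blinfun_apply (f' x) = (*v) (jac g x)" for x
    unfolding f'_def by (rule bounded_linear_Blinfun_apply[OF bl])
  define T where "T = S \<inter> {x. det (jac g x) \<noteq> 0}"
  have "closed {x. det (jac g x) = 0}"
    by (rule algebraic_set_closed[OF algebraic_set_zero[OF jac_det_polyv[OF g]]])
  moreover have "T = S - {x. det (jac g x) = 0}" by (auto simp: T_def)
  ultimately have T: "open T" using S by (simp add: open_Diff)
  have cont: "continuous_on T f'"
  proof (rule continuous_at_imp_continuous_on, rule ballI, rule continuous_blinfun_componentwiseI1)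
    fix x i
    have c: "continuous_on UNIV (\<lambda>x. jac g x $ i' $ j)" for i' j
      by (simp add: jac_def polyv_continuous polyv_grad g)
    have "continuous_on UNIV (\<lambda>x. jac g x *v i)"
      unfolding matrix_vector_mult_def
      by (intro continuous_on_vec_lambda continuous_on_sum continuous_on_mult continuous_on_const c)
    then show "isCont (\<lambda>x. blinfun_apply (f' x) i) x"
      unfolding f' by (simp add: continuous_on_eq_continuous_at)
  qed
  have invf: "Blinfun ((*v) (matrix_inv (jac g x0))) o\<^sub>L f' x0 = id_blinfun"
    by (rule blinfun_eqI) (simp add: bounded_linear_Blinfun_apply[OF bl] f' matrix_inv_mult_vec[OF det])
  have x0: "x0 \<in> T" using S det by (simp add: T_def)
  have der: "(?f has_derivative blinfun_apply (f' x)) (at x)" for x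
    unfolding f' by (rule has_derivative_jac[OF g])
  obtain U V \<Psi> g' where U: "open U" "U \<subseteq> T" "x0 \<in> U" "open V" "?f x0 \<in> V" "homeomorphism U V ?f \<Psi>"
    "\<And>y. y \<in> V \<Longrightarrow> (\<Psi> has_derivative (g' y)) (at y)"
    "\<And>y. y \<in> V \<Longrightarrow> g' y = inv (blinfun_apply (f' (\<Psi> y)))"
    "\<And>y. y \<in> V \<Longrightarrow> bij (blinfun_apply (f' (\<Psi> y)))"
    using inverse_function_theorem[OF T der cont x0 invf] by metis
  have d: "det (jac g x) \<noteq> 0" if "x \<in> U" for x using U(2) that by (auto simp: T_def)
  show thesis
  proof (rule that[OF U(1,3) _ U(4,6) d])
    show "U \<subseteq> S" using U(2) by (auto simp: T_def)
    fix y assume y: "y \<in> V"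
    have "\<Psi> y \<in> U" using U(6) y by (auto simp: homeomorphism_def)
    then have dy: "det (jac g (\<Psi> y)) \<noteq> 0" by (rule d)
    have "inv ((*v) (jac g (\<Psi> y))) = (*v) (matrix_inv (jac g (\<Psi> y)))"
      by (rule inv_equality) (simp_all add: matrix_inv_mult_vec[OF dy])
    then show "(\<Psi> has_derivative ((*v) (matrix_inv (jac g (\<Psi> y))))) (at y)"
      using U(7,8)[OF y] by (simp add: f')
  qed
qed

text \<open>The codimension of the Zariski tangent space of \<open>Y\<close> at \<open>x\<close>;
  its maximum \<open>rk\<close> is taken at the smooth points of an irreducible
  \<open>Y\<close>.\<close>

definition rkv :: "(complex ^ 'n::finite) set \<Rightarrow> complex ^ 'n \<Rightarrow> nat" where
  "rkv Y x = vec.dim ((\<lambda>f. grad f x) ` vanish Y)"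

definition rk :: "(complex ^ 'n::finite) set \<Rightarrow> nat" where
  "rk Y = Max (rkv Y ` Y)"

lemma vec_dim_le: "vec.dim (S :: (complex ^ 'n::finite) set) \<le> CARD('n)"
  using vec.dim_subset_UNIV[of S] by (simp add: vec.dimension_def card_cart_basis)

lemma finite_rkv: "finite (rkv Y ` Y)"
  by (rule finite_subset[of _ "{..CARD('n)}" for n]) (auto simp: rkv_def intro: vec_dim_le)

lemma rkv_le_rk: "x \<in> Y \<Longrightarrow> rkv Y x \<le> rk Y"
  unfolding rk_def by (rule Max_ge[OF finite_rkv]) simp

lemma rk_attained: "Y \<noteq> {} \<Longrightarrow> \<exists>x\<in>Y. rkv Y x = rk Y"
  unfolding rk_def using Max_in[OF finite_rkv, of Y] by auto

text \<open>The columns of the inverse matrix form a basis dual to the rows.\<close>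

lemma independent_rows:
  fixes A :: "complex ^ 'n ^ 'n::finite"
  assumes "det A \<noteq> 0"
  shows "inj (\<lambda>i. A $ i)" "vec.independent ((\<lambda>i. A $ i) ` I)"
proof -
  let ?u = "\<lambda>k. matrix_inv A *v axis k 1"
  have u: "bil (A $ i) (?u k) = (if i = k then 1 else 0)" for i k
    unfolding matrix_vector_bil[symmetric] matrix_inv_mult_vec[OF assms] by (simp add: axis_def)
  show inj: "inj (\<lambda>i. A $ i)"
  proof (rule injI)
    fix i k assume "A $ i = A $ k"
    then show "i = k" using u[of i k] u[of k k] by (auto split: if_splits)
  qed
  show "vec.independent ((\<lambda>i. A $ i) ` I)"
    unfolding vec.dependent_def
  proof (clarify)
    fix i assume i: "i \<in> I" "A $ i \<in> vec.span ((\<lambda>i. A $ i) ` I - {A $ i})"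
    have "bil (A $ i) (?u i) = 0"
    proof (rule bil_span_zero[OF i(2)])
      fix w assume "w \<in> (\<lambda>i. A $ i) ` I - {A $ i}"
      then show "bil w (?u i) = 0" by (auto simp: u)
    qed
    then show False by (simp add: u)
  qed
qed

lemma det_zero_kernel:
  fixes A :: "complex ^ 'n ^ 'n::finite"
  assumes "A *v v = 0" "v \<noteq> 0" shows "det A = 0"
  using assms matrix_inv_mult_vec(2)[of A v] by fastforce

text \<open>Replacing row \<open>k\<close> of the Jacobian by the gradient of \<open>p\<close> and taking determinants is a
  derivation along \<open>{g\<^sub>I = 0}\<close>. It maps the ideal of \<open>Y\<close> to itself, so every function of
  this ideal vanishes to infinite order along \<open>{g\<^sub>I = 0}\<close> at a regular point of \<open>Y\<close>.\<close>

definition tder :: "('n \<Rightarrow> complex ^ 'n \<Rightarrow> complex) \<Rightarrow> 'n \<Rightarrow> (complex ^ 'n \<Rightarrow> complex) \<Rightarrow> complex ^ 'n \<Rightarrow> complex"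
  where "tder g k p x = det ((\<chi> i. if i = k then grad p x else grad (g i) x) :: complex ^ 'n ^ 'n::finite)"

lemma tder_jac: "det ((\<chi> i. if i = k then grad p x else jac g x $ i) :: complex ^ 'n ^ 'n) = tder g k p x"
  by (simp add: tder_def jac_def cong: if_cong)

lemma tder_polyv:
  assumes "\<And>i. g i \<in> polyv" "p \<in> polyv" shows "tder g k p \<in> polyv"
  unfolding tder_def[abs_def] proof (rule polyv_det)
  fix i j
  show "(\<lambda>x. (\<chi> i. if i = k then grad p x else grad (g i) x) $ i $ j) \<in> polyv"
    by (cases "i = k") (simp_all add: polyv_grad assms)
qed

text \<open>Where the Jacobian is invertible, the gradients of the \<open>g i\<close> with
  \<open>i \<in> I\<close> are \<open>rk Y\<close> independent vectors and hence span the gradients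
  of all functions in the ideal, so the matrix with row \<open>k\<close> replaced is singular.
  Multiplying by the Jacobian determinant covers the other points, and irreducibility removes this
  factor again.\<close>

lemma tder_vanish:
  assumes Y: "irreducible_variety Y" and g: "\<And>i. g i \<in> polyv" "\<And>i. i \<in> I \<Longrightarrow> g i \<in> vanish Y"
    and I: "card I = rk Y" "k \<notin> I" and x0: "x0 \<in> Y" "det (jac g x0) \<noteq> 0" and p: "p \<in> vanish Y"
  shows "tder g k p \<in> vanish Y"
proof -
  have pp: "p \<in> polyv" using p by (simp add: vanish_def)
  have "tder g k p x * det (jac g x) = 0" if x: "x \<in> Y" for x
  proof (rule ccontr)
    assume "tder g k p x * det (jac g x) \<noteq> 0"
    then have d: "det (jac g x) \<noteq> 0" and t: "tder g k p x \<noteq> 0" by auto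
    let ?R = "(\<lambda>i. jac g x $ i) ` I"
    have ind: "vec.independent ?R" by (rule independent_rows(2)[OF d])
    have card: "card ?R = rk Y"
      using independent_rows(1)[OF d] I(1) by (simp add: card_image inj_on_subset)
    let ?G = "(\<lambda>f. grad f x) ` vanish Y"
    have "?G \<subseteq> vec.span ?R"
    proof (rule vec.card_ge_dim_independent[OF _ ind])
      show "?R \<subseteq> ?G" using g(2) by (auto simp: jac_def)
      show "vec.dim ?G \<le> card ?R" using rkv_le_rk[OF x] by (simp add: rkv_def card)
    qed
    then have sp: "grad p x \<in> vec.span ?R" using p by auto
    let ?v = "matrix_inv (jac g x) *v axis k 1"
    have u: "bil (jac g x $ i) ?v = (if i = k then 1 else 0)" for i
      unfolding matrix_vector_bil[symmetric] matrix_inv_mult_vec[OF d] by (simp add: axis_def)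
    have "bil (grad p x) ?v = 0" by (rule bil_span_zero[OF sp]) (use I(2) u in auto)
    then have "(\<chi> i. if i = k then grad p x else grad (g i) x) *v ?v = 0"
      using u by (auto simp: vec_eq_iff matrix_vector_bil jac_def)
    moreover have "?v \<noteq> 0" using u[of k] by auto
    ultimately show False using t unfolding tder_def by (simp add: det_zero_kernel)
  qed
  then have "(\<forall>x\<in>Y. tder g k p x = 0) \<or> (\<forall>x\<in>Y. det (jac g x) = 0)"
    by (rule irreducible_vanish_mult[OF Y tder_polyv[OF g(1) pp] jac_det_polyv[OF g(1)]])
  then show ?thesis using x0 tder_polyv[OF g(1) pp] by (auto simp: vanish_def)
qed

text \<open>Cramer's rule. It expresses derivatives along the coordinate directions of a chart
  through the determinants \<open>tder\<close>, up to the Jacobian determinant.\<close>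

lemma bil_matrix_inv:
  fixes A :: "complex ^ 'n ^ 'n::finite"
  assumes "det A \<noteq> 0"
  shows "bil u (matrix_inv A *v w) * det A = (\<Sum>k\<in>UNIV. w $ k * det ((\<chi> i. if i = k then u else A $ i) :: complex ^ 'n ^ 'n))"
proof -
  define m where "m = transpose (matrix_inv A) *v u"
  have "(\<Sum>i\<in>UNIV. m $ i *s row i A) = transpose A *v m"
    by (simp add: matrix_mult_sum column_transpose)
  also have "\<dots> = transpose (matrix_inv A ** A) *v u"
    unfolding m_def by (simp only: matrix_vector_mul_assoc matrix_transpose_mul)
  also have "matrix_inv A ** A = mat 1"
    using matrix_inv_mult_vec(2)[OF assms] by (simp add: matrix_eq matrix_vector_mul_assoc)
  finally have u: "(\<Sum>i\<in>UNIV. m $ i *s row i A) = u" by (simp add: transpose_mat)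
  have row: "row i A = A $ i" for i by (simp add: row_def vec_eq_iff)
  have "det ((\<chi> i. if i = k then u else A $ i) :: complex ^ 'n ^ 'n) = m $ k * det A" for k
    using cramer_lemma_transpose[of k m A, unfolded u, unfolded row] .
  moreover have "bil u (matrix_inv A *v w) = (\<Sum>k\<in>UNIV. m $ k * w $ k)"
    unfolding u[symmetric] bil_sum_left bil_scale_left row
    by (simp add: matrix_vector_bil[symmetric] matrix_inv_mult_vec[OF assms])
  ultimately show ?thesis by (simp add: sum_distrib_left sum_distrib_right mult_ac)
qed

text \<open>A point near \<open>x0\<close> satisfying the equations of \<open>I\<close> is joined to
  \<open>x0\<close> by a segment in the chart that moves only the coordinates outside
  \<open>I\<close>. Along this segment each function of the ideal has zero Taylor series at
  \<open>x0\<close>, so by the identity theorem it also vanishes at the other end.\<close>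

theorem regular_local:
  fixes Y :: "(complex ^ 'n::finite) set"
  assumes Y: "irreducible_variety Y" and g: "\<And>i. g i \<in> polyv" "\<And>i. i \<in> I \<Longrightarrow> g i \<in> vanish Y"
    and I: "card I = rk Y" and x0: "x0 \<in> Y" "det (jac g x0) \<noteq> 0"
  obtains U where "open U" "x0 \<in> U" "\<And>x. x \<in> U \<Longrightarrow> (\<And>i. i \<in> I \<Longrightarrow> g i x = 0) \<Longrightarrow> x \<in> Y"
proof -
  let ?\<Phi> = "\<lambda>x. \<chi> i. g i x"
  obtain U V \<Psi> where U: "open U" "x0 \<in> U" "open V" "homeomorphism U V ?\<Phi> \<Psi>"
    "\<And>x. x \<in> U \<Longrightarrow> det (jac g x) \<noteq> 0"
    "\<And>y. y \<in> V \<Longrightarrow> (\<Psi> has_derivative ((*v) (matrix_inv (jac g (\<Psi> y))))) (at y)"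
    using poly_inverse_function[OF g(1) x0(2) open_UNIV UNIV_I] by metis
  have UV: "?\<Phi> x \<in> V" "\<Psi> (?\<Phi> x) = x" if "x \<in> U" for x using U(4) that by (auto simp: homeomorphism_def)
  have VU: "\<Psi> y \<in> U" if "y \<in> V" for y using U(4) that by (auto simp: homeomorphism_def)
  obtain r where r: "0 < r" "ball (?\<Phi> x0) r \<subseteq> V"
    using U(3) UV(1)[OF U(2)] openE by blast
  define U' where "U' = U \<inter> ?\<Phi> -` ball (?\<Phi> x0) r"
  have cont: "continuous_on UNIV ?\<Phi>"
    by (intro continuous_on_vec_lambda polyv_continuous g)
  have "open U'" unfolding U'_def
    by (intro open_Int U(1) open_vimage[OF open_ball cont])
  moreover have "x0 \<in> U'" using U(2) r(1) by (simp add: U'_def)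
  moreover have "x \<in> Y" if x: "x \<in> U'" "\<And>i. i \<in> I \<Longrightarrow> g i x = 0" for x
  proof -
    let ?y = "?\<Phi> x0"
    define w where "w = ?\<Phi> x - ?\<Phi> x0"
    have w0: "w $ i = 0" if "i \<in> I" for i using x(2)[OF that] g(2)[OF that] x0(1) by (simp add: w_def vanish_def)
    have wr: "norm w < r" using x(1) by (simp add: U'_def w_def dist_norm norm_minus_commute)
    \<comment> \<open>A radius larger than 1 puts the far end \<open>t = 1\<close> of the segment
      inside the disc on which the curve is holomorphic.\<close>
    obtain \<rho> where \<rho>: "1 < \<rho>" "\<rho> * norm w \<le> r"
    proof (cases "w = 0")
      case True
      then show ?thesis using that[of 2] r(1) by simp
    next
      case False
      then show ?thesis using that[of "r / norm w"] wr by simp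
    qed
    define D where "D = ball (0::complex) \<rho>"
    have D: "open D" "0 \<in> D" "1 \<in> D" using \<rho> by (auto simp: D_def)
    define \<gamma> where "\<gamma> t = ?y + t *s w" for t :: complex
    have norm_sc: "norm (t *s w) = norm t * norm w" for t :: complex
      by (simp add: norm_vec_def L2_set_def norm_mult power_mult_distrib sum_distrib_left[symmetric] real_sqrt_mult)
    have \<gamma>: "\<gamma> t \<in> V" if "t \<in> D" for t
    proof -
      have "norm t * norm w < r"
      proof (cases "w = 0")
        case False
        then have "norm t * norm w < \<rho> * norm w" using that by (simp add: D_def)
        then show ?thesis using \<rho>(2) by simp
      qed (use r in simp)
      then have "\<gamma> t \<in> ball ?y r" by (simp add: \<gamma>_def dist_norm norm_sc)
      then show ?thesis using r(2) by auto
    qed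
    define X where "X t = \<Psi> (\<gamma> t)" for t
    have XU: "X t \<in> U" if "t \<in> D" for t unfolding X_def by (rule VU[OF \<gamma>[OF that]])
    have dX: "det (jac g (X t)) \<noteq> 0" if "t \<in> D" for t by (rule U(5)[OF XU[OF that]])
    have dh: "((\<lambda>t. p (X t)) has_field_derivative (\<Sum>k\<in>UNIV. w $ k * tder g k p (X t)) * (1 / det (jac g (X t)))) (at t)"
      if p: "p \<in> polyv" and t: "t \<in> D" for p t
    proof -
      have bl: "bounded_linear (\<lambda>t :: complex. t *s w)"
        by (rule linear_conv_bounded_linear[THEN iffD1]) (auto simp: linear_iff vec_eq_iff distrib_right)
      have "(\<gamma> has_derivative (\<lambda>t. t *s w)) (at t)"
        unfolding \<gamma>_def
        by (rule has_derivative_eq_rhs[OF has_derivative_add[OF has_derivative_const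
              bounded_linear.has_derivative[OF bl has_derivative_ident]]]) simp
      from diff_chain_at[OF this U(6)[OF \<gamma>[OF t]]]
      have "(X has_derivative (*v) (matrix_inv (jac g (X t))) \<circ> (\<lambda>t. t *s w)) (at t)"
        by (simp add: X_def[abs_def] comp_def)
      from diff_chain_at[OF this has_derivative_grad[OF p]]
      have dp: "((\<lambda>t. p (X t)) has_derivative (\<lambda>s. bil (grad p (X t)) (matrix_inv (jac g (X t)) *v (s *s w)))) (at t)"
        by (simp add: comp_def)
      moreover have "matrix_inv (jac g (X t)) *v (s *s w) = s *s (matrix_inv (jac g (X t)) *v w)" for s
        by (simp add: vec.scale)
      moreover have "bil (grad p (X t)) (matrix_inv (jac g (X t)) *v w) =
         (\<Sum>k\<in>UNIV. w $ k * tder g k p (X t)) * (1 / det (jac g (X t)))"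
        using bil_matrix_inv[OF dX[OF t], of "grad p (X t)" w] dX[OF t]
        by (simp add: tder_jac field_simps)
      ultimately show ?thesis
        unfolding has_field_derivative_def
        by (intro has_derivative_eq_rhs[OF dp]) (simp add: fun_eq_iff bil_scale_right)
    qed
    have hol: "(\<lambda>t. p (X t)) holomorphic_on D" if "p \<in> polyv" for p
      unfolding holomorphic_on_open[OF D(1)] using dh[OF that] by blast
    have hold: "(\<lambda>t. 1 / det (jac g (X t))) holomorphic_on D"
      using dX by (intro holomorphic_on_divide hol[OF jac_det_polyv[OF g(1)]]) auto
    have X0: "X 0 = x0" unfolding X_def \<gamma>_def using UV(2)[OF U(2)] by simp
    have der0: "(deriv ^^ n) (\<lambda>t. p (X t)) 0 = 0" if "p \<in> vanish Y" for n p
      using that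
    proof (induction n arbitrary: p rule: less_induct)
      case (less n)
      have pp: "p \<in> polyv" using less.prems by (simp add: vanish_def)
      show ?case
      proof (cases n)
        case 0
        then show ?thesis using less.prems x0 by (simp add: X0 vanish_def)
      next
        case (Suc m)
        \<comment> \<open>Since \<open>w\<close> has no component in \<open>I\<close>, the function
          \<open>?q\<close> lies in the ideal again. The derivative of \<open>p\<close> along the
          curve is \<open>?q\<close> over the Jacobian determinant, and the Leibniz rule reduces its
          derivatives to those of \<open>?q\<close> of lower order.\<close>
        let ?q = "\<lambda>x. \<Sum>k\<in>UNIV. w $ k * tder g k p x"
        have qp: "?q \<in> polyv" by (intro polyv_sum polyv_mult polyv_const tder_polyv g pp)
        have "w $ k * tder g k p x = 0" if "x \<in> Y" for k x
          using tder_vanish[OF Y g I _ x0 less.prems, of k] w0[of k] that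
          by (cases "k \<in> I") (auto simp: vanish_def)
        then have "?q x = 0" if "x \<in> Y" for x using that by (intro sum.neutral) blast
        then have q: "?q \<in> vanish Y" using qp by (simp add: vanish_def)
        have "(deriv ^^ n) (\<lambda>t. p (X t)) 0 = (deriv ^^ m) (deriv (\<lambda>t. p (X t))) 0"
          unfolding Suc by (simp add: funpow_Suc_right del: funpow.simps)
        also have "\<dots> = (deriv ^^ m) (\<lambda>t. ?q (X t) * (1 / det (jac g (X t)))) 0"
        proof (rule higher_deriv_transform_within_open[OF _ _ D(1,2)])
          show "deriv (\<lambda>t. p (X t)) holomorphic_on D" by (rule holomorphic_deriv[OF hol[OF pp] D(1)])
          show "(\<lambda>t. ?q (X t) * (1 / det (jac g (X t)))) holomorphic_on D"
            by (rule holomorphic_on_mult[OF hol[OF qp] hold])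
          show "deriv (\<lambda>t. p (X t)) t = ?q (X t) * (1 / det (jac g (X t)))" if "t \<in> D" for t
            by (rule DERIV_imp_deriv[OF dh[OF pp that]])
        qed
        also have "\<dots> = (\<Sum>i = 0..m. of_nat (m choose i) * (deriv ^^ i) (\<lambda>t. ?q (X t)) 0 *
            (deriv ^^ (m - i)) (\<lambda>t. 1 / det (jac g (X t))) 0)"
          by (rule higher_deriv_mult[OF hol[OF qp] hold D(1,2)])
        also have "\<dots> = 0"
        proof (intro sum.neutral ballI)
          fix i assume "i \<in> {0..m}"
          then have "(deriv ^^ i) (\<lambda>t. ?q (X t)) 0 = 0" by (intro less.IH[OF _ q]) (simp add: Suc)
          then show "of_nat (m choose i) * (deriv ^^ i) (\<lambda>t. ?q (X t)) 0 *
            (deriv ^^ (m - i)) (\<lambda>t. 1 / det (jac g (X t))) 0 = 0" by simp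
        qed
        finally show ?thesis .
      qed
    qed
    have X1: "X 1 = x" using UV(2)[of x] x(1) by (simp add: X_def \<gamma>_def w_def U'_def)
    have "p x = 0" if p: "p \<in> vanish Y" for p
    proof -
      have pp: "p \<in> polyv" using p by (simp add: vanish_def)
      have "p (X 1) = 0"
        by (rule holomorphic_fun_eq_0_on_ball[OF hol[OF pp, unfolded D_def] D(3)[unfolded D_def] der0[OF p]])
      then show ?thesis by (simp add: X1)
    qed
    then show "x \<in> Y" using algebraic_set_eq[OF irreducible_imp_algebraic[OF Y]] by blast
  qed
  ultimately show thesis using that by blast
qed

section \<open>Transversality and codimension\<close>

abbreviation grads :: "(complex ^ 'n \<Rightarrow> complex) set \<Rightarrow> complex ^ 'n \<Rightarrow> (complex ^ 'n::finite) set" where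
  "grads G x \<equiv> (\<lambda>f. grad f x) ` G"

lemma vec_dim_UNIV: "vec.dim (UNIV :: (complex ^ 'n::finite) set) = CARD('n)"
  by (simp add: vec.dimension_def card_cart_basis vec.dim_UNIV)

text \<open>A basis of the gradients of \<open>G\<close> is extended by gradients from
  \<open>H\<close>. The size of \<open>I\<close> is thus the rank of \<open>G\<close> at
  \<open>x\<close>, and the whole family can serve as a chart.\<close>

lemma complete_rows:
  fixes G H :: "(complex ^ 'n::finite \<Rightarrow> complex) set"
  assumes sp: "vec.span (grads (G \<union> H) x) = UNIV"
  obtains g :: "'n \<Rightarrow> complex ^ 'n \<Rightarrow> complex" and I where
    "card I = vec.dim (grads G x)" "\<And>i. i \<in> I \<Longrightarrow> g i \<in> G" "\<And>i. i \<notin> I \<Longrightarrow> g i \<in> H" "det (jac g x) \<noteq> 0"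
proof -
  obtain B1 where B1: "B1 \<subseteq> grads G x" "vec.independent B1" "grads G x \<subseteq> vec.span B1"
    "card B1 = vec.dim (grads G x)"
    using vec.basis_exists by metis
  obtain B where B: "B1 \<subseteq> B" "B \<subseteq> grads (G \<union> H) x" "vec.independent B" "grads (G \<union> H) x \<subseteq> vec.span B"
    using vec.maximal_independent_subset_extend[of B1 "grads (G \<union> H) x"] B1 by blast
  have spB: "vec.span B = UNIV" using sp vec.span_minimal[OF B(4)] by auto
  have fB: "finite B" using vec.finiteI_independent B(3) by blast
  have cB: "card B = CARD('n)"
    using vec.dim_span_eq_card_independent[OF B(3)] by (simp only: spB vec_dim_UNIV)
  obtain h where h: "bij_betw h (UNIV :: 'n set) B"
    using finite_same_card_bij[OF finite_class.finite_UNIV fB] cB by metis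
  define I where "I = {i. h i \<in> B1}"
  have hI: "h ` I = B1" using h B(1) unfolding I_def bij_betw_def by auto
  have "inj_on h I" using h unfolding bij_betw_def by (auto intro: inj_on_subset)
  then have cI: "card I = vec.dim (grads G x)" using card_image[of h I] hI B1(4) by simp
  have ex: "\<exists>f. (if i \<in> I then f \<in> G else f \<in> H) \<and> grad f x = h i" for i
  proof (cases "i \<in> I")
    case True
    then have "h i \<in> grads G x" using hI B1(1) by auto
    then show ?thesis using True by auto
  next
    case False
    have hB: "h i \<in> B" using h by (auto simp: bij_betw_def)
    have "h i \<notin> grads G x"
    proof
      assume "h i \<in> grads G x"
      then have "h i \<in> vec.span B1" using B1(3) by auto
      moreover have "B1 \<subseteq> B - {h i}" using False B(1) by (auto simp: I_def)
      ultimately have "h i \<in> vec.span (B - {h i})" using vec.span_mono by blast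
      then show False using B(3) hB by (auto simp: vec.dependent_def)
    qed
    then have "h i \<in> grads H x" using hB B(2) by auto
    then show ?thesis using False by auto
  qed
  define g where "g i = (SOME f. (if i \<in> I then f \<in> G else f \<in> H) \<and> grad f x = h i)" for i
  have g: "(if i \<in> I then g i \<in> G else g i \<in> H) \<and> grad (g i) x = h i" for i
    unfolding g_def by (rule someI_ex[OF ex])
  have row: "row i (jac g x) = h i" for i using g[of i] by (simp add: row_def jac_def vec_eq_iff)
  have "rows (jac g x) = B" using h by (auto simp: rows_def row bij_betw_def)
  then have "\<exists>B. B ** jac g x = mat 1" by (simp add: matrix_left_invertible_span_rows_gen spB)
  then have "invertible (jac g x)" by (simp add: invertible_left_inverse)
  then have "det (jac g x) \<noteq> 0" by (simp add: invertible_det_nz)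
  then show thesis
    by (rule that[OF cI, rotated 2]) (use g in presburger)+
qed

text \<open>Their gradients are the unit vectors, so they can complete any system to a
  chart.\<close>

definition coords :: "(complex ^ 'n \<Rightarrow> complex) set" where
  "coords = range (\<lambda>v x. x $ v)"

lemma coords_polyv: "coords \<subseteq> polyv"
  by (auto simp: coords_def polyv_nth)

lemma span_coords: "vec.span (grads (G \<union> coords) x) = (UNIV :: (complex ^ 'n::finite) set)"
proof -
  have "grad (\<lambda>x. x $ v) x = axis v 1" for v :: 'n
  proof (rule grad_eqI[OF polyv_nth])
    have "bil (axis v 1) = (\<lambda>h. h $ v)" by (auto simp: fun_eq_iff)
    then show "((\<lambda>x. x $ v) has_derivative bil (axis v 1)) (at x)" by (simp add: has_derivative_nth)
  qed
  then have "axis v 1 \<in> grads (G \<union> coords) x" for v :: 'n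
    unfolding coords_def by (metis (mono_tags, lifting) UnCI image_eqI rangeI)
  then have "cart_basis \<subseteq> grads (G \<union> coords) x"
    unfolding cart_basis_def by auto
  then show ?thesis using vec.span_mono span_cart_basis by blast
qed

lemma differentiable_vecI:
  fixes f :: "'a::real_normed_vector \<Rightarrow> complex ^ 'n::finite"
  assumes "\<And>i. (\<lambda>w. f w $ i) differentiable F" shows "f differentiable F"
proof -
  have bl: "bounded_linear (axis v :: complex \<Rightarrow> complex ^ 'n)" for v
    by (rule linear_conv_bounded_linear[THEN iffD1]) (auto simp: linear_iff vec_eq_iff axis_def)
  have "(\<lambda>w. \<Sum>v\<in>UNIV. axis v (f w $ v)) differentiable F"
  proof (rule differentiable_sum[OF finite_class.finite_UNIV], rule ballI)
    fix v
    obtain D where "((\<lambda>w. f w $ v) has_derivative D) F" using assms unfolding differentiable_def by blast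
    from bounded_linear.has_derivative[OF bl this] show "(\<lambda>w. axis v (f w $ v)) differentiable F"
      unfolding differentiable_def by blast
  qed
  moreover have "(\<Sum>v\<in>UNIV. axis v (f w $ v)) = f w" for w
    by (simp add: vec_eq_iff axis_def if_distrib cong: if_cong)
  ultimately show ?thesis by simp
qed

text \<open>Points of \<open>D\<close> depend on \<open>n - q\<close> parameters and the conormal vectors at a point on \<open>q\<close>
  parameters, so the hyperplanes tangent to \<open>D\<close> form an \<open>n\<close>-dimensional family in a space of
  dimension \<open>n + 1\<close>.\<close>

definition tangent_planes :: "(complex ^ 'n::finite \<Rightarrow> complex) set \<Rightarrow> (complex ^ 'n) set \<Rightarrow> ((complex ^ 'n) \<times> complex) set"
  where "tangent_planes G D = {(l, b). \<exists>x\<in>D. bil l x + b = 0 \<and> l \<in> vec.span (grads G x)}"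

lemma negligible_tangent_planes:
  fixes D :: "(complex ^ 'n::finite) set"
  assumes G: "G \<subseteq> polyv" and D: "\<And>x f. x \<in> D \<Longrightarrow> f \<in> G \<Longrightarrow> f x = 0"
    and q: "\<And>x. x \<in> D \<Longrightarrow> vec.dim (grads G x) = q"
  shows "negligible (tangent_planes G D)"
proof -
  have loc: "\<exists>U. open U \<and> x0 \<in> U \<and> negligible (tangent_planes G (D \<inter> U))" if x0: "x0 \<in> D" for x0
  proof -
    obtain g :: "'n \<Rightarrow> complex ^ 'n \<Rightarrow> complex" and I where g: "card I = vec.dim (grads G x0)"
      "\<And>i. i \<in> I \<Longrightarrow> g i \<in> G" "\<And>i. i \<notin> I \<Longrightarrow> g i \<in> coords" "det (jac g x0) \<noteq> 0"
      using complete_rows[OF span_coords] by metis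
    have gp: "g i \<in> polyv" for i using g(2,3)[of i] G coords_polyv by (cases "i \<in> I") auto
    obtain U V \<Psi> where U: "open U" "x0 \<in> U" "open V" "homeomorphism U V (\<lambda>x. \<chi> i. g i x) \<Psi>"
      "\<And>x. x \<in> U \<Longrightarrow> det (jac g x) \<noteq> 0"
      "\<And>y. y \<in> V \<Longrightarrow> (\<Psi> has_derivative ((*v) (matrix_inv (jac g (\<Psi> y))))) (at y)"
      using poly_inverse_function[OF gp g(4) open_UNIV UNIV_I] by metis
    \<comment> \<open>A single vector \<open>w\<close> carries both kinds of parameters: its entries
      in \<open>I\<close> are the coefficients of the conormal vector, and the others are the chart
      coordinates of a point at which all functions of \<open>I\<close> vanish. Hence
      \<open>F\<close> maps an n-dimensional space into one of dimension n + 1.\<close>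
    define pr where "pr w = (\<chi> i. if i \<in> I then 0 else w $ i)" for w :: "complex ^ 'n"
    define F where "F w = (\<lambda>(l, x). (l, - bil l x)) (\<Sum>i\<in>I. w $ i *s grad (g i) (\<Psi> (pr w)), \<Psi> (pr w))" for w
    let ?S = "pr -` V"
    have nth: "(\<lambda>w :: complex ^ 'n. w $ i) differentiable at w within ?S" for i w
      unfolding differentiable_def using has_derivative_nth by blast
    have pv: "(\<lambda>w. f (\<Psi> (pr w))) differentiable at w within ?S" if f: "f \<in> polyv" and w: "w \<in> ?S" for f w
    proof -
      have "(\<lambda>w. pr w $ i) differentiable at w within ?S" for i
      proof -
        have "(\<lambda>w. pr w $ i) = (if i \<in> I then (\<lambda>w. 0) else (\<lambda>w. w $ i))" by (auto simp: pr_def)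
        then show ?thesis by (simp add: nth)
      qed
      then have "pr differentiable at w within ?S" by (rule differentiable_vecI)
      then obtain E where E: "(pr has_derivative E) (at w within ?S)" unfolding differentiable_def by blast
      have "pr w \<in> V" using w by simp
      from diff_chain_within[OF E has_derivative_at_withinI[OF U(6)[OF this]]]
      have "(\<Psi> \<circ> pr has_derivative (*v) (matrix_inv (jac g (\<Psi> (pr w)))) \<circ> E) (at w within ?S)" .
      from diff_chain_within[OF this has_derivative_at_withinI[OF has_derivative_grad[OF f]]]
      show ?thesis unfolding differentiable_def comp_def by blast
    qed
    have "F differentiable_on ?S" unfolding differentiable_on_def
    proof
      fix w assume w: "w \<in> ?S"
      have 1: "(\<lambda>w. \<Sum>i\<in>I. w $ i *s grad (g i) (\<Psi> (pr w))) differentiable at w within ?S" (is "?l differentiable _")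
      proof (rule differentiable_vecI)
        fix j
        have "(\<lambda>w. \<Sum>i\<in>I. w $ i * grad (g i) (\<Psi> (pr w)) $ j) differentiable at w within ?S"
          by (rule differentiable_sum[OF finite], intro ballI differentiable_mult nth pv[OF polyv_grad[OF gp] w])
        then show "(\<lambda>w. (\<Sum>i\<in>I. w $ i *s grad (g i) (\<Psi> (pr w))) $ j) differentiable at w within ?S"
          by simp
      qed
      have "(\<lambda>w. ?l w $ j) differentiable at w within ?S" for j
      proof -
        obtain E where "(?l has_derivative E) (at w within ?S)" using 1 unfolding differentiable_def by blast
        from bounded_linear.has_derivative[OF bounded_linear_vec_nth this]
        show ?thesis unfolding differentiable_def by blast
      qed
      then have "(\<lambda>w. - (\<Sum>j\<in>UNIV. ?l w $ j * \<Psi> (pr w) $ j)) differentiable at w within ?S"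
        by (intro differentiable_minus differentiable_sum[OF finite] ballI differentiable_mult pv[OF polyv_nth w])
      then obtain E1 E2 where "(?l has_derivative E1) (at w within ?S)"
        "((\<lambda>w. - (\<Sum>j\<in>UNIV. ?l w $ j * \<Psi> (pr w) $ j)) has_derivative E2) (at w within ?S)"
        using 1 unfolding differentiable_def by blast
      from has_derivative_Pair[OF this] show "F differentiable at w within ?S"
        unfolding differentiable_def F_def bil_def by auto
    qed
    then have neg: "negligible (F ` ?S)"
      by (rule negligible_differentiable_image_lowdim[rotated]) simp
    have "tangent_planes G (D \<inter> U) \<subseteq> F ` ?S"
    proof
      fix z assume "z \<in> tangent_planes G (D \<inter> U)"
      then obtain l b x where z: "z = (l, b)" "x \<in> D" "x \<in> U" "bil l x + b = 0" "l \<in> vec.span (grads G x)"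
        unfolding tangent_planes_def by auto
      let ?R = "(\<lambda>i. jac g x $ i) ` I"
      have d: "det (jac g x) \<noteq> 0" by (rule U(5)[OF z(3)])
      have inj: "inj_on (\<lambda>i. jac g x $ i) I" using independent_rows(1)[OF d] by (rule inj_on_subset) simp
      have ind: "vec.independent ?R" by (rule independent_rows(2)[OF d])
      have "grads G x \<subseteq> vec.span ?R"
      proof (rule vec.card_ge_dim_independent[OF _ ind])
        show "?R \<subseteq> grads G x" using g(2) by (auto simp: jac_def)
        show "vec.dim (grads G x) \<le> card ?R"
          using q[OF z(2)] q[OF x0] g(1) card_image[OF inj] by simp
      qed
      then have "l \<in> vec.span ?R" using z(5) vec.span_minimal[OF _ vec.subspace_span] by blast
      then obtain u where "l = (\<Sum>w\<in>?R. u w *s w)" unfolding vec.span_finite[OF finite_imageI[OF finite]] by auto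
      then have l: "l = (\<Sum>i\<in>I. u (jac g x $ i) *s grad (g i) x)"
        by (subst (asm) sum.reindex[OF inj]) (simp add: jac_def)
      define w where "w = (\<chi> i. if i \<in> I then u (jac g x $ i) else g i x)"
      have prw: "pr w = (\<chi> i. g i x)" using D[OF z(2) g(2)] by (auto simp: pr_def w_def vec_eq_iff)
      have "(\<chi> i. g i x) \<in> V" "\<Psi> (\<chi> i. g i x) = x" using U(4) z(3) by (auto simp: homeomorphism_def)
      then have w: "w \<in> ?S" "\<Psi> (pr w) = x" by (simp_all add: prw)
      have "(\<Sum>i\<in>I. w $ i *s grad (g i) x) = l" unfolding l by (rule sum.cong) (auto simp: w_def)
      then have "F w = (l, - bil l x)" by (simp add: F_def w(2))
      also have "- bil l x = b" using z(4) by (simp add: add_eq_0_iff)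
      finally show "z \<in> F ` ?S" using w(1) z(1) by (intro image_eqI[of _ _ w]) simp_all
    qed
    then show ?thesis using U(1,2) negligible_subset[OF neg] by blast
  qed
  \<comment> \<open>Countably many charts cover \<open>D\<close>, so the local null sets add up to a
    null set.\<close>
  define UU where "UU = {U. open U \<and> negligible (tangent_planes G (D \<inter> U))}"
  obtain UU' where UU': "UU' \<subseteq> UU" "countable UU'" "\<Union>UU' = \<Union>UU"
    using Lindelof[of UU] unfolding UU_def by blast
  have "D \<subseteq> \<Union>UU'" unfolding UU'(3) using loc unfolding UU_def by blast
  then have "tangent_planes G D \<subseteq> \<Union>((\<lambda>U. tangent_planes G (D \<inter> U)) ` UU')"
    unfolding tangent_planes_def by blast
  moreover have "negligible (\<Union>((\<lambda>U. tangent_planes G (D \<inter> U)) ` UU'))"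
    using UU'(1,2) by (intro negligible_countable_Union) (auto simp: UU_def)
  ultimately show ?thesis by (rule negligible_subset[rotated])
qed

definition lins :: "(nat \<times> 'n::finite option \<Rightarrow> complex) \<Rightarrow> nat \<Rightarrow> (complex ^ 'n \<Rightarrow> complex) set" where
  "lins a r = (\<lambda>m x. lin a m x) ` {1..r}"

lemma lins_polyv: "lins a r \<subseteq> polyv"
  by (auto simp: lins_def lin_polyv)

text \<open>The equations are added one at a time. The coefficients of the next one are taken
  outside the null set of hyperplanes tangent to the present section, within the nonempty open set
  where \<open>f\<close> is nonzero; its gradient then leaves the span of the previous ones at every
  point of the section.\<close>

theorem transversal_dense:
  fixes D :: "(complex ^ 'n::finite) set"
  assumes G: "G \<subseteq> polyv" and D: "\<And>x f. x \<in> D \<Longrightarrow> f \<in> G \<Longrightarrow> f x = 0"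
    and q: "\<And>x. x \<in> D \<Longrightarrow> vec.dim (grads G x) = q"
    and f: "f \<in> polyf (lrows r)" "f a0 \<noteq> 0"
  shows "\<exists>a. f a \<noteq> 0 \<and> (\<forall>x\<in>D \<inter> sect a r. vec.dim (grads (G \<union> lins a r) x) = q + r)"
  using f
proof (induction r arbitrary: f a0)
  case 0
  then show ?case using q by (intro exI[of _ a0]) (auto simp: lins_def)
next
  case (Suc r)
  let ?l0 = "\<lambda>o'. a0 (Suc r, o')"
  have "f (join (Suc r) a0 ?l0) \<noteq> 0" using Suc.prems(2) by (simp add: join_same)
  from Suc.IH[OF polyf_join_left[OF Suc.prems(1)] this]
  obtain a where a: "f (join (Suc r) a ?l0) \<noteq> 0"
    "\<And>x. x \<in> D \<inter> sect a r \<Longrightarrow> vec.dim (grads (G \<union> lins a r) x) = q + r" by blast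
  have neg: "negligible (tangent_planes (G \<union> lins a r) (D \<inter> sect a r))"
    by (rule negligible_tangent_planes[OF _ _ a(2)])
      (use G lins_polyv[of a r] D in \<open>auto simp: sect_def lins_def\<close>)
  define c where "c z o' = (case o' of None \<Rightarrow> snd z | Some v \<Rightarrow> fst z $ v)"
    for z :: "(complex ^ 'n) \<times> complex" and o' 
  have cont: "continuous_on UNIV (\<lambda>z. f (join (Suc r) a (c z)))"
  proof (rule polyf_continuous[OF Suc.prems(1)])
    fix v :: "nat \<times> 'n option"
    have "continuous_on UNIV (\<lambda>z. c z o')" for o'
      unfolding c_def by (cases o') (auto intro!: continuous_intros)
    then show "continuous_on UNIV (\<lambda>z. join (Suc r) a (c z) v)"
      by (cases v; cases "fst v = Suc r") (auto simp: join_def)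
  qed
  let ?N = "{z. f (join (Suc r) a (c z)) \<noteq> 0}"
  have "open ?N"
  proof -
    have "open ((\<lambda>z. f (join (Suc r) a (c z))) -` (- {0}))"
      by (rule open_vimage[OF _ cont]) auto
    then show ?thesis by (simp add: vimage_def)
  qed
  moreover have c0: "c (\<chi> v. ?l0 (Some v), ?l0 None) = ?l0" by (auto simp: c_def fun_eq_iff split: option.split)
  have "(\<chi> v. ?l0 (Some v), ?l0 None) \<in> ?N" unfolding mem_Collect_eq c0 by (rule a(1))
  ultimately have "\<not> negligible ?N" using open_not_negligible[of ?N] by blast
  then have "\<not> ?N \<subseteq> tangent_planes (G \<union> lins a r) (D \<inter> sect a r)" using negligible_subset[OF neg] by blast
  then obtain z where z: "z \<in> ?N" "z \<notin> tangent_planes (G \<union> lins a r) (D \<inter> sect a r)" by blast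
  obtain l b where "z = (l, b)" by (cases z)
  note lb = z[unfolded this]
  let ?a = "join (Suc r) a (c (l, b))"
  have bl: "lin1 (c (l, b)) x = bil l x + b" for x by (simp add: lin1_def bil_def c_def)
  have lins: "lins ?a (Suc r) = insert (\<lambda>x. lin ?a (Suc r) x) (lins a r)"
  proof -
    have "(\<lambda>x. lin ?a m x) = (\<lambda>x. lin a m x)" if "m \<in> {1..r}" for m using that by (auto simp: lin_join)
    then show ?thesis unfolding lins_def by (auto simp: atLeastAtMostSuc_conv)
  qed
  have gl: "grad (\<lambda>x. lin ?a (Suc r) x) x = l" for x
    unfolding grad_lin by (simp add: join_def vec_eq_iff c_def)
  have "vec.dim (grads (G \<union> lins ?a (Suc r)) x) = q + Suc r" if x: "x \<in> D \<inter> sect ?a (Suc r)" for x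
  proof -
    have x': "x \<in> D \<inter> sect a r" "bil l x + b = 0" using x by (auto simp: sect_join bl)
    then have "l \<notin> vec.span (grads (G \<union> lins a r) x)" using lb(2) unfolding tangent_planes_def by auto
    moreover have "grads (G \<union> lins ?a (Suc r)) x = insert l (grads (G \<union> lins a r) x)"
      unfolding lins Un_insert_right image_insert gl ..
    ultimately show ?thesis using a(2)[OF x'(1)] by (simp add: vec.dim_insert)
  qed
  then show ?case using lb(1) by (intro exI[of _ ?a]) auto
qed

text \<open>At a point of a transversal section the rank would be \<open>q + r\<close>, exceeding
  the number of variables.\<close>

lemma misses_of_rank:
  fixes D :: "(complex ^ 'n::finite) set"
  assumes "defset D" and G: "G \<subseteq> polyv" "\<And>x f. x \<in> D \<Longrightarrow> f \<in> G \<Longrightarrow> f x = 0"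
    "\<And>x. x \<in> D \<Longrightarrow> vec.dim (grads G x) = q" and r: "q + r > CARD('n)"
  shows "misses r D"
proof (rule ccontr)
  assume "\<not> misses r D"
  then have "meets r D" using meets_or_misses[OF assms(1)] by blast
  then obtain f a0 where f: "f \<in> polyf (lrows r)" "f a0 \<noteq> 0" "\<And>a. f a \<noteq> 0 \<Longrightarrow> D \<inter> sect a r \<noteq> {}"
    unfolding meets_def generically_iff by auto
  have "\<exists>a. f a \<noteq> 0 \<and> (\<forall>x\<in>D \<inter> sect a r. vec.dim (grads (G \<union> lins a r) x) = q + r)"
    by (rule transversal_dense[where G = G]) (fact G f)+
  then obtain a where a: "f a \<noteq> 0" "\<And>x. x \<in> D \<inter> sect a r \<Longrightarrow> vec.dim (grads (G \<union> lins a r) x) = q + r"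
    by blast
  obtain x where "x \<in> D \<inter> sect a r" using f(3)[OF a(1)] by blast
  then show False using a(2)[of x] vec_dim_le[of "grads (G \<union> lins a r) x"] r by simp
qed

lemma defset_UNIV: "defset UNIV"
  unfolding defset_def by (simp add: defb_const)

lemma misses_top: "misses (Suc CARD('n)) (V :: (complex ^ 'n::finite) set)"
  by (rule misses_subset[OF misses_of_rank[OF defset_UNIV, of "{}" 0]]) auto

lemma polyf_open_nonzero:
  assumes h: "h \<in> polyf UNIV" "h w0 \<noteq> 0" and S: "open S" "w1 \<in> S"
  shows "\<exists>w\<in>S. h (\<lambda>v. w $ v :: complex) \<noteq> 0"
proof -
  let ?s = "\<lambda>t v. w1 $ v + t * (w0 v - w1 $ v)"
  have s: "\<exists>p. \<forall>t. ?s t v = poly p t" for v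
    by (rule exI[of _ "[:w1 $ v, w0 v - w1 $ v:]"]) simp
  obtain p where p: "\<And>t. h (?s t) = poly p t" using polyf_line[OF h(1), of ?s, OF s] by blast
  have "p \<noteq> 0" using p[of 1] h(2) by auto
  then have fin: "finite {t. poly p t = 0}" by (rule poly_roots_finite)
  let ?T = "{t. (\<chi> v. ?s t v) \<in> S}"
  have cont: "continuous_on UNIV (\<lambda>t. \<chi> v. ?s t v)" by (intro continuous_on_vec_lambda continuous_intros)
  have "open ?T" using open_vimage[OF S(1) cont] by (simp add: vimage_def)
  moreover have "0 \<in> ?T" using S(2) by simp
  ultimately have "0 islimpt ?T" by (intro interior_limit_point) (simp add: interior_open)
  then have "infinite ?T" using islimpt_finite by blast
  then obtain t where "t \<in> ?T" "poly p t \<noteq> 0" using finite_subset[of ?T "{t. poly p t = 0}"] fin by blast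
  then show ?thesis using p[of t] by (intro bexI[of _ "\<chi> v. ?s t v"]) auto
qed

text \<open>Sections through points near a regular point: the linear parts can be taken transversal, and
  then the constant terms fill an open set.\<close>

theorem regular_not_misses:
  fixes D :: "(complex ^ 'n::finite) set"
  assumes g: "\<And>i. g i \<in> polyv" "det (jac g x0) \<noteq> 0" "\<And>i. i \<in> I \<Longrightarrow> g i x0 = 0"
    and U0: "open U0" "x0 \<in> U0" "\<And>x. x \<in> U0 \<Longrightarrow> (\<And>i. i \<in> I \<Longrightarrow> g i x = 0) \<Longrightarrow> x \<in> D"
  shows "\<not> misses (CARD('n) - card I) D"
proof
  let ?m = "CARD('n) - card I"
  assume "misses ?m D"
  then obtain f a0 where f: "f \<in> polyf (lrows ?m)" "f a0 \<noteq> 0" "\<And>a. f a \<noteq> 0 \<Longrightarrow> D \<inter> sect a ?m = {}"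
    unfolding misses_def generically_iff by auto
  have "card (- I) = ?m" by (simp add: Compl_eq_Diff_UNIV card_Diff_subset)
  then obtain s where s: "bij_betw s (- I) {1..?m}"
    using finite_same_card_bij[of "- I" "{1..?m}"] by auto
  have s1: "s i \<in> {1..?m}" if "i \<notin> I" for i using s that by (auto simp: bij_betw_def)
  define t where "t = inv_into (- I) s"
  have t: "t k \<notin> I" "s (t k) = k" if "k \<in> {1..?m}" for k
    using s that bij_betw_inv_into_right[OF s, of k] inv_into_into[of k s "- I"] by (auto simp: t_def bij_betw_def)
  have ts: "t (s i) = i" if "i \<notin> I" for i unfolding t_def using bij_betw_inv_into_left[OF s, of i] that by simp
  \<comment> \<open>The gradients of the equations in \<open>I\<close> at \<open>x0\<close> together
    with the linear parts of the \<open>?m\<close> section equations, with \<open>s\<close>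
    numbering the rows outside \<open>I\<close>. An invertible \<open>M a\<close> means that the
    linear space is transversal at \<open>x0\<close>.\<close>
  define M where "M a = (\<chi> i. if i \<in> I then grad (g i) x0 else \<chi> v. a (s i, Some v))" for a :: "nat \<times> 'n option \<Rightarrow> complex"
  have M: "(\<lambda>a. det (M a)) \<in> polyf UNIV"
  proof (rule polyf_det)
    fix i j
    show "(\<lambda>a. M a $ i $ j) \<in> polyf UNIV" by (cases "i \<in> I") (auto simp: M_def intro: polyf_intros)
  qed
  have "M (\<lambda>(k, o'). case o' of None \<Rightarrow> 0 | Some v \<Rightarrow> grad (g (t k)) x0 $ v) = jac g x0"
    by (auto simp: M_def jac_def vec_eq_iff ts)
  then have "det (M (\<lambda>(k, o'). case o' of None \<Rightarrow> 0 | Some v \<Rightarrow> grad (g (t k)) x0 $ v)) \<noteq> 0" using g(2) by simp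
  from polyf_mult_nonzero[of f "\<lambda>a. det (M a)", OF polyf_UNIV[OF f(1)] M f(2) this]
  obtain a where a: "f a \<noteq> 0" "det (M a) \<noteq> 0" by auto
  define g' where "g' i = (if i \<in> I then g i else (\<lambda>x. lin a (s i) x - a (s i, None)))" for i
  have g': "g' i \<in> polyv" for i
    unfolding g'_def by (cases "i \<in> I") (auto intro: g polyv_diff lin_polyv polyv_const)
  have "grad (\<lambda>x. lin a k x - a (k, None)) x = (\<chi> v. a (k, Some v))" for k x
  proof (rule grad_eqI)
    show "(\<lambda>x. lin a k x - a (k, None)) \<in> polyv" by (intro polyv_diff lin_polyv polyv_const)
    show "((\<lambda>x. lin a k x - a (k, None)) has_derivative bil (\<chi> v. a (k, Some v))) (at x)"
      unfolding lin_def bil_def[abs_def] by (auto intro!: derivative_eq_intros)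
  qed
  then have "jac g' x0 = M a" by (auto simp: jac_def M_def g'_def vec_eq_iff)
  then have d': "det (jac g' x0) \<noteq> 0" using a(2) by simp
  obtain U V \<Psi> where U: "open U" "x0 \<in> U" "U \<subseteq> U0" "open V" "homeomorphism U V (\<lambda>x. \<chi> i. g' i x) \<Psi>"
    using poly_inverse_function[OF g' d' U0(1,2)] by metis
  define pr where "pr w = (\<chi> i. if i \<in> I then 0 else w $ i)" for w :: "complex ^ 'n"
  have "continuous_on UNIV pr" unfolding pr_def
  proof (intro continuous_on_vec_lambda)
    fix i show "continuous_on UNIV (\<lambda>w. if i \<in> I then 0 else w $ i)"
      by (cases "i \<in> I") (auto intro: continuous_intros)
  qed
  then have opr: "open (pr -` V)" by (rule open_vimage[OF U(4)])
  have "pr (\<chi> i. g' i x0) = (\<chi> i. g' i x0)" using g(3) by (auto simp: pr_def g'_def vec_eq_iff)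
  moreover have "(\<chi> i. g' i x0) \<in> V" using U(2,5) by (auto simp: homeomorphism_def)
  ultimately have w1: "(\<chi> i. g' i x0) \<in> pr -` V" by simp
  \<comment> \<open>The linear parts are kept, and the constant terms are the negatives of the chart
    coordinates \<open>w\<close>. The section then contains the point with these coordinates, while
    \<open>w\<close> ranges over an open set, on which \<open>f\<close> cannot vanish
    identically.\<close>
  let ?a = "\<lambda>w (k, o'). case o' of None \<Rightarrow> - w (t k) | Some v \<Rightarrow> a (k, Some v)"
  have h: "(\<lambda>w. f (?a w)) \<in> polyf UNIV"
  proof (rule polyf_subst[OF f(1)])
    fix v :: "nat \<times> 'n option"
    show "(\<lambda>w. ?a w v) \<in> polyf UNIV" by (cases v; cases "snd v") (simp_all add: polyf.const polyf_uminus[OF polyf.var])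
  qed
  have "f (?a (\<lambda>i. - a (s i, None))) = f a"
    by (rule polyf_cong[OF f(1)]) (auto simp: t split: option.split)
  then have "f (?a (\<lambda>i. - a (s i, None))) \<noteq> 0" using a(1) by simp
  from polyf_open_nonzero[OF h this opr w1]
  obtain w where w: "pr w \<in> V" "f (?a (\<lambda>v. w $ v)) \<noteq> 0" by auto
  define x where "x = \<Psi> (pr w)"
  have x: "x \<in> U" "(\<chi> i. g' i x) = pr w" using U(5) w(1) by (auto simp: homeomorphism_def x_def)
  have xi: "g' i x = pr w $ i" for i using x(2) by (simp add: vec_eq_iff)
  have "x \<in> D"
  proof (rule U0(3))
    show "x \<in> U0" using x(1) U(3) by auto
    show "g i x = 0" if "i \<in> I" for i using xi[of i] that by (simp add: g'_def pr_def)
  qed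
  moreover have "x \<in> sect (?a (\<lambda>v. w $ v)) ?m" unfolding sect_def
  proof (clarify)
    fix k assume k: "k \<in> {1..?m}"
    have "lin a k x - a (k, None) = w $ t k" using xi[of "t k"] t[OF k] by (simp add: g'_def pr_def)
    then show "lin (?a (\<lambda>v. w $ v)) k x = 0" by (simp add: lin_def)
  qed
  ultimately show False using f(3)[OF w(2)] by blast
qed

section \<open>Codimension equals rank\<close>

lemma rk_rows:
  fixes Y :: "(complex ^ 'n::finite) set"
  assumes "x \<in> Y" "G \<subseteq> vanish Y" "vec.dim (grads G x) = rk Y"
  obtains g :: "'n \<Rightarrow> complex ^ 'n \<Rightarrow> complex" and I where "card I = rk Y" "\<And>i. g i \<in> polyv"
    "\<And>i. i \<in> I \<Longrightarrow> g i \<in> G" "det (jac g x) \<noteq> 0"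
proof -
  obtain g :: "'n \<Rightarrow> complex ^ 'n \<Rightarrow> complex" and I where g: "card I = vec.dim (grads G x)"
    "\<And>i. i \<in> I \<Longrightarrow> g i \<in> G" "\<And>i. i \<notin> I \<Longrightarrow> g i \<in> coords" "det (jac g x) \<noteq> 0"
    using complete_rows[OF span_coords] by metis
  have "g i \<in> polyv" for i using g(2,3)[of i] assms(2) coords_polyv by (cases "i \<in> I") (auto simp: vanish_def)
  then show thesis using that g assms(3) by metis
qed

text \<open>Near a point of maximal rank \<open>Y\<close> is cut out by \<open>rk Y\<close>
  independent equations, so generic sections meet it. The part with nonzero Jacobian determinant is
  missed one equation later by transversality, and the rest of \<open>Y\<close> is a proper
  subvariety.\<close>

theorem irreducible_meets_misses:
  fixes Y :: "(complex ^ 'n::finite) set"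
  assumes Y: "irreducible_variety Y"
  shows "rk Y \<le> CARD('n)" "meets (CARD('n) - rk Y) Y" "misses (Suc (CARD('n) - rk Y)) Y"
proof -
  let ?n = "CARD('n)"
  have ne: "Y \<noteq> {}" and alg: "algebraic_set Y" using Y by (auto simp: irreducible_variety_def)
  obtain x0 where x0: "x0 \<in> Y" "rkv Y x0 = rk Y" using rk_attained[OF ne] by blast
  show le: "rk Y \<le> ?n" using x0(2) vec_dim_le[of "grads (vanish Y) x0"] by (simp add: rkv_def)
  obtain g :: "'n \<Rightarrow> complex ^ 'n \<Rightarrow> complex" and I where g: "card I = rk Y" "\<And>i. g i \<in> polyv"
    "\<And>i. i \<in> I \<Longrightarrow> g i \<in> vanish Y" "det (jac g x0) \<noteq> 0"
    using rk_rows[OF x0(1) order_refl] x0(2) unfolding rkv_def by metis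
  obtain U where U: "open U" "x0 \<in> U" "\<And>x. x \<in> U \<Longrightarrow> (\<And>i. i \<in> I \<Longrightarrow> g i x = 0) \<Longrightarrow> x \<in> Y"
    using regular_local[OF Y g(2,3,1) x0(1) g(4)] by metis
  have "\<not> misses (?n - card I) Y"
    by (rule regular_not_misses[OF g(2,4) _ U]) (use g(3) x0(1) in \<open>auto simp: vanish_def\<close>)
  then show meets: "meets (?n - rk Y) Y" using meets_or_misses[OF defset_algebraic[OF alg]] g(1) by auto
  let ?Z = "{x. det (jac g x) = 0}"
  have Z: "algebraic_set ?Z" by (rule algebraic_set_zero[OF jac_det_polyv[OF g(2)]])
  let ?D = "Y - ?Z"
  have D: "misses (Suc (?n - rk Y)) ?D"
  proof (rule misses_of_rank)
    show "defset ?D" by (intro defset_Diff defset_algebraic alg Z)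
    show "g ` I \<subseteq> polyv" using g(2) by auto
    show "f x = 0" if "x \<in> ?D" "f \<in> g ` I" for x f using that g(3) by (auto simp: vanish_def)
    show "vec.dim (grads (g ` I) x) = rk Y" if "x \<in> ?D" for x
    proof -
      have d: "det (jac g x) \<noteq> 0" using that by simp
      have "grads (g ` I) x = (\<lambda>i. jac g x $ i) ` I" by (auto simp: jac_def)
      moreover have "card ((\<lambda>i. jac g x $ i) ` I) = card I"
        using independent_rows(1)[OF d] by (simp add: card_image inj_on_subset)
      ultimately show ?thesis using vec.dim_eq_card_independent[OF independent_rows(2)[OF d]] g(1) by simp
    qed
    show "?n < rk Y + Suc (?n - rk Y)" using le by simp
  qed
  show "misses (Suc (?n - rk Y)) Y"
  proof (rule ccontr)
    assume nm: "\<not> misses (Suc (?n - rk Y)) Y"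
    \<comment> \<open>If \<open>Y\<close> were not missed at the asserted number, the least number
      \<open>m\<close> missing it would be larger. The proper subvariety is already missed by
      \<open>m - 1\<close> equations, and so is the regular part, contradicting minimality.\<close>
    define m where "m = (LEAST m. misses m Y)"
    have m: "misses m Y" unfolding m_def by (rule LeastI[of _ "Suc ?n"]) (rule misses_top)
    have "m \<noteq> 0" using m not_misses_0[OF ne] by metis
    then obtain m' where m': "m = Suc m'" by (cases m) auto
    have nm': "\<not> misses m' Y" using not_less_Least[of m' "\<lambda>m. misses m Y"] m' by (simp add: m_def)
    have "\<not> m \<le> Suc (?n - rk Y)" using misses_le[OF m] nm by blast
    then have "misses m' ?D" using misses_le[OF D, of m'] m' by simp
    moreover have "misses m' (Y \<inter> ?Z)"
      by (rule misses_proper_subset[OF Y]) (use alg Z x0 g(4) m m' in \<open>auto intro: algebraic_set_Int\<close>)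
    ultimately have "misses m' (\<Union>{?D, Y \<inter> ?Z})" by (intro misses_Union) auto
    moreover have "\<Union>{?D, Y \<inter> ?Z} = Y" by auto
    ultimately show False using nm' by simp
  qed
qed

corollary codim_eq_rk: "irreducible_variety Y \<Longrightarrow> codim (Y :: (complex ^ 'n::finite) set) = rk Y"
  using alg_dim_eq irreducible_meets_misses[of Y] by (fastforce simp: codim_def)

lemma misses_proper:
  fixes Y :: "(complex ^ 'n::finite) set"
  assumes "irreducible_variety Y" "algebraic_set A" "A \<subset> Y"
  shows "misses (CARD('n) - rk Y) A"
  by (rule misses_proper_subset[OF assms irreducible_meets_misses(3)[OF assms(1)]])

lemma rk_strict:
  fixes V W :: "(complex ^ 'n::finite) set"
  assumes "irreducible_variety V" "irreducible_variety W" "V \<subset> W" shows "rk W < rk V"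
proof (rule ccontr)
  assume "\<not> rk W < rk V"
  then have "CARD('n) - rk W \<le> CARD('n) - rk V" by simp
  then have "misses (CARD('n) - rk V) V"
    by (rule misses_le[OF misses_proper[OF assms(2) irreducible_imp_algebraic[OF assms(1)] assms(3)]])
  then show False using irreducible_meets_misses(2)[OF assms(1)] not_meets_misses by blast
qed

section \<open>Jacobian ranks on components\<close>

abbreviation vals :: "'n cpoly list \<Rightarrow> (complex ^ 'n \<Rightarrow> complex) set" where
  "vals G \<equiv> (\<lambda>p x. val p x) ` set G"

lemma jac_rank_eq: "jac_rank G x = vec.dim (grads (vals G) x)"
  unfolding jac_rank_def by (simp add: image_image gradient_grad)

lemma vals_polyv: "vals G \<subseteq> polyv"
  by (auto intro: val_polyv)

lemma vals_vanish: "Y \<subseteq> zeros G \<Longrightarrow> vals G \<subseteq> vanish Y"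
  by (auto simp: vanish_def zeros_def val_polyv)

lemma jac_rank_le_rk: "x \<in> Y \<Longrightarrow> Y \<subseteq> zeros G \<Longrightarrow> jac_rank G x \<le> rk Y"
  unfolding jac_rank_eq
  by (rule order_trans[OF vec.dim_subset[OF image_mono[OF vals_vanish]] rkv_le_rk[unfolded rkv_def]])

text \<open>After removing the finitely many components not through \<open>x\<close>, the solutions
  of the equations of \<open>I\<close> near \<open>x\<close> lie on the components through
  \<open>x\<close>. Generic sections by \<open>CARD('n) - card I\<close> equations therefore meet
  one of these, which bounds its \<open>rk\<close> from above; the rank of its gradients bounds it
  from below.\<close>

theorem component_at_regular_point:
  fixes G :: "'n::finite cpoly list"
  assumes g: "\<And>i. g i \<in> polyv" "det (jac g x) \<noteq> 0" "card I = jac_rank G x" "\<And>i. i \<in> I \<Longrightarrow> g i \<in> vals G"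
    and U: "open U" "x \<in> U" "\<And>y. y \<in> U \<Longrightarrow> (\<And>i. i \<in> I \<Longrightarrow> g i y = 0) \<Longrightarrow> y \<in> zeros G"
    and x: "x \<in> zeros G"
  shows "\<exists>Z. irreducible_component Z (zeros G) \<and> x \<in> Z \<and> rk Z = jac_rank G x"
proof -
  let ?C = "{Z. irreducible_component Z (zeros G)}"
  let ?F = "{Z \<in> ?C. x \<in> Z}"
  have fin: "finite ?C" by (rule finite_components[OF algebraic_set_zeros])
  have irr: "irreducible_variety Z" if "Z \<in> ?C" for Z using that by (simp add: irreducible_component_def)
  have "closed (\<Union>(?C - ?F))"
    by (rule closed_Union) (use fin irr in \<open>auto intro!: algebraic_set_closed irreducible_imp_algebraic\<close>)
  then have U1: "open (U - \<Union>(?C - ?F))" using U(1) by (simp add: open_Diff)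
  have "\<not> misses (CARD('n) - card I) (\<Union>?F)"
  proof (rule regular_not_misses[OF g(1,2) _ U1])
    show "g i x = 0" if "i \<in> I" for i using g(4)[OF that] x by (auto simp: zeros_def)
    show "x \<in> U - \<Union>(?C - ?F)" using U(2) by auto
    fix y assume y: "y \<in> U - \<Union>(?C - ?F)" "\<And>i. i \<in> I \<Longrightarrow> g i y = 0"
    then have "y \<in> zeros G" using U(3) by blast
    then have "y \<in> \<Union>?C" using Union_components[OF algebraic_set_zeros[of G]] by simp
    then show "y \<in> \<Union>?F" using y(1) by blast
  qed
  then obtain Z where Z: "Z \<in> ?F" "meets (CARD('n) - card I) Z"
    using meets_component[of ?F "CARD('n) - card I"] fin irr irreducible_imp_algebraic by auto
  have iZ: "irreducible_variety Z" using Z irr by auto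
  have "\<not> Suc (CARD('n) - rk Z) \<le> CARD('n) - card I"
    using misses_le[OF irreducible_meets_misses(3)[OF iZ]] Z(2) not_meets_misses by blast
  then have "rk Z \<le> jac_rank G x" using g(3) irreducible_meets_misses(1)[OF iZ] by simp
  moreover have "jac_rank G x \<le> rk Z"
    by (rule jac_rank_le_rk) (use Z in \<open>auto simp: irreducible_component_def\<close>)
  ultimately show ?thesis using Z by auto
qed

section \<open>Generic sections of reduced components\<close>

lemma vec_dim_mono_card:
  assumes "vec.independent B" "B \<subseteq> S" shows "card B \<le> vec.dim (S :: (complex ^ 'n::finite) set)"
  using vec.dim_subset[OF assms(2)] vec.dim_eq_card_independent[OF assms(1)] by simp

lemma det_imp_dim_ge:
  assumes "det (jac g x) \<noteq> 0" "\<And>i. i \<in> I \<Longrightarrow> g i \<in> G" shows "card I \<le> vec.dim (grads G x)"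
proof -
  have "card ((\<lambda>i. jac g x $ i) ` I) = card I"
    using independent_rows(1)[OF assms(1)] by (simp add: card_image inj_on_subset)
  moreover have "card ((\<lambda>i. jac g x $ i) ` I) \<le> vec.dim (grads G x)"
    by (rule vec_dim_mono_card[OF independent_rows(2)[OF assms(1)]]) (use assms(2) in \<open>auto simp: jac_def\<close>)
  ultimately show ?thesis by simp
qed

text \<open>Points of smaller rank lie in the zero set of a minor that is nonzero at
  \<open>x0\<close>. This is a proper subvariety of \<open>Z\<close>, so sections of complementary
  dimension avoid it.\<close>

lemma jac_rank_less_misses:
  fixes Z :: "(complex ^ 'n::finite) set"
  assumes Z: "irreducible_variety Z" "Z \<subseteq> zeros G" and x0: "x0 \<in> Z" "jac_rank G x0 = rk Z"
  shows "generically (lrows (CARD('n) - rk Z)) (\<lambda>a. \<forall>x\<in>Z \<inter> sect a (CARD('n) - rk Z). jac_rank G x = rk Z)"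
proof -
  have d0: "vec.dim (grads (vals G) x0) = rk Z" using x0(2) by (simp add: jac_rank_eq)
  obtain g :: "'n \<Rightarrow> complex ^ 'n \<Rightarrow> complex" and I where g: "card I = rk Z" "\<And>i. g i \<in> polyv"
    "\<And>i. i \<in> I \<Longrightarrow> g i \<in> vals G" "det (jac g x0) \<noteq> 0"
    using rk_rows[OF x0(1) vals_vanish[OF Z(2)] d0] by metis
  let ?A = "Z \<inter> {x. det (jac g x) = 0}"
  have "misses (CARD('n) - rk Z) ?A"
    by (rule misses_proper[OF Z(1)])
      (use g(4) x0(1) in \<open>auto intro!: algebraic_set_Int irreducible_imp_algebraic[OF Z(1)] algebraic_set_zero jac_det_polyv g(2)\<close>)
  then show ?thesis unfolding misses_def
  proof (rule generically_mono, intro ballI)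
    fix a x assume a: "?A \<inter> sect a (CARD('n) - rk Z) = {}" and x: "x \<in> Z \<inter> sect a (CARD('n) - rk Z)"
    then have "det (jac g x) \<noteq> 0" by auto
    then have "rk Z \<le> jac_rank G x" using det_imp_dim_ge[of g x I "vals G"] g(1,3) by (simp add: jac_rank_eq)
    then show "jac_rank G x = rk Z" using jac_rank_le_rk[of x Z G] x Z(2) by auto
  qed
qed

text \<open>Trades the generic condition for one at a single point. One direction uses that the
  generic section is nonempty, the other that it avoids the locus of smaller rank.\<close>

theorem reduced_component_iff:
  fixes Z :: "(complex ^ 'n::finite) set"
  assumes Z: "irreducible_component Z (zeros G)"
  shows "reduced_component G Z \<longleftrightarrow> (\<exists>x\<in>Z. jac_rank G x = rk Z)"
proof -
  have irr: "irreducible_variety Z" and sub: "Z \<subseteq> zeros G" using Z by (auto simp: irreducible_component_def)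
  have fl: "flag a (rk Z) = sect a (CARD('n) - rk Z)" for a :: "nat \<times> 'n option \<Rightarrow> complex" by (rule flag_sect)
  show ?thesis
  proof
    assume "reduced_component G Z"
    then have 1: "generically (lrows (CARD('n) - rk Z)) (\<lambda>a. \<forall>x\<in>Z \<inter> sect a (CARD('n) - rk Z). jac_rank G x = rk Z)"
      unfolding reduced_component_def reduced_witness_def codim_eq_rk[OF irr] fl by simp
    from generically_ex[OF generically_conj[OF 1 irreducible_meets_misses(2)[OF irr, unfolded meets_def]]]
    show "\<exists>x\<in>Z. jac_rank G x = rk Z" by blast
  next
    assume "\<exists>x\<in>Z. jac_rank G x = rk Z"
    then show "reduced_component G Z"
      using jac_rank_less_misses[OF irr sub] unfolding reduced_component_def reduced_witness_def codim_eq_rk[OF irr] fl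
      by auto
  qed
qed

section \<open>Nondegenerate points of sections\<close>

lemma full_rank_span: "vec.dim (S :: (complex ^ 'n::finite) set) = CARD('n) \<longleftrightarrow> vec.span S = UNIV"
  using vec.dim_eq_full[of S] by (simp add: vec.dimension_def card_cart_basis)

text \<open>A trivial kernel is a condition quantifying over vectors, hence definable, which a
  dimension is not on its face.\<close>

lemma full_rank_iff:
  "vec.dim (grads G x) = CARD('n) \<longleftrightarrow> (\<forall>v. (\<forall>f\<in>G. bil (grad f x) v = 0) \<longrightarrow> v = (0 :: complex ^ 'n::finite))"
proof
  assume "vec.dim (grads G x) = CARD('n)"
  then have sp: "vec.span (grads G x) = UNIV" by (simp add: full_rank_span)
  show "\<forall>v. (\<forall>f\<in>G. bil (grad f x) v = 0) \<longrightarrow> v = 0"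
  proof (intro allI impI)
    fix v assume v: "\<forall>f\<in>G. bil (grad f x) v = 0"
    have "bil (axis i 1) v = 0" for i by (rule bil_span_zero[of _ "grads G x"]) (use sp v in auto)
    then show "v = 0" by (simp add: vec_eq_iff)
  qed
next
  assume ker: "\<forall>v. (\<forall>f\<in>G. bil (grad f x) v = 0) \<longrightarrow> v = 0"
  obtain g :: "'n \<Rightarrow> complex ^ 'n \<Rightarrow> complex" and I where g: "card I = vec.dim (grads G x)"
    "\<And>i. i \<in> I \<Longrightarrow> g i \<in> G" "\<And>i. i \<notin> I \<Longrightarrow> g i \<in> coords" "det (jac g x) \<noteq> 0"
    using complete_rows[OF span_coords] by metis
  let ?R = "(\<lambda>i. jac g x $ i) ` I"
  have "I = UNIV"
  proof (rule ccontr)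
    assume "I \<noteq> UNIV"
    then obtain k where k: "k \<notin> I" by auto
    let ?v = "matrix_inv (jac g x) *v axis k 1"
    have u: "bil (jac g x $ i) ?v = (if i = k then 1 else 0)" for i
      unfolding matrix_vector_bil[symmetric] matrix_inv_mult_vec[OF g(4)] by (simp add: axis_def)
    have sub: "grads G x \<subseteq> vec.span ?R"
    proof (rule vec.card_ge_dim_independent[OF _ independent_rows(2)[OF g(4)]])
      show "?R \<subseteq> grads G x" using g(2) by (auto simp: jac_def)
      show "vec.dim (grads G x) \<le> card ?R"
        using g(1) independent_rows(1)[OF g(4)] by (simp add: card_image inj_on_subset)
    qed
    have "bil (grad f x) ?v = 0" if f: "f \<in> G" for f
    proof (rule bil_span_zero[of _ ?R])
      show "grad f x \<in> vec.span ?R" using sub f by blast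
      fix w assume "w \<in> ?R"
      then obtain i where i: "i \<in> I" "w = jac g x $ i" by blast
      then have "i \<noteq> k" using k by blast
      then show "bil w ?v = 0" using u[of i] i(2) by simp
    qed
    then have "?v = 0" using ker by blast
    then show False using u[of k] by simp
  qed
  then show "vec.dim (grads G x) = CARD('n)" using g(1) by simp
qed

definition nondeg :: "'n::finite cpoly list \<Rightarrow> (nat \<times> 'n option \<Rightarrow> complex) \<Rightarrow> nat \<Rightarrow> complex ^ 'n \<Rightarrow> bool" where
  "nondeg G a m x \<longleftrightarrow> vec.dim (grads (vals G \<union> lins a m) x) = CARD('n)"

lemma nondeg_iff:
  "nondeg G a m x \<longleftrightarrow> (\<forall>v. (\<forall>p\<in>set G. bil (grad (\<lambda>x. val p x) x) v = 0) \<and>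
     (\<forall>k\<in>{1..m}. bil (\<chi> i. a (k, Some i)) v = 0) \<longrightarrow> v = 0)"
  unfolding nondeg_def full_rank_iff by (auto simp: lins_def grad_lin ball_Un)

lemma bil_polyf:
  "(\<And>i. (\<lambda>b. u b $ i) \<in> polyf V) \<Longrightarrow> (\<And>i. (\<lambda>b. v b $ i) \<in> polyf V) \<Longrightarrow> (\<lambda>b. bil (u b) (v b)) \<in> polyf V"
  unfolding bil_def by (intro polyf_intros)

lemma grad_polyf:
  "f \<in> polyv \<Longrightarrow> (\<And>i. (\<lambda>b. s b $ i) \<in> polyf V) \<Longrightarrow> (\<lambda>b. grad f (s b) $ i) \<in> polyf V"
  using polyv_subst_polyf[OF polyv_grad] by blast

lemma defb_nondeg:
  fixes s :: "('v \<Rightarrow> complex) \<Rightarrow> complex ^ 'n::finite"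
  assumes "\<And>i. (\<lambda>b. s b $ i) \<in> polyf UNIV" "\<And>v. (\<lambda>b. a b v) \<in> polyf UNIV"
  shows "defb (\<lambda>b. nondeg G (a b) m (s b))"
proof -
  have s: "(\<lambda>b :: 'v + 'n \<Rightarrow> complex. s (\<lambda>v. b (Inl v)) $ i) \<in> polyf UNIV" for i
    by (rule polyf_subst[OF assms(1)]) (rule polyf.var[OF UNIV_I])
  have a: "(\<lambda>b :: 'v + 'n \<Rightarrow> complex. a (\<lambda>v. b (Inl v)) w) \<in> polyf UNIV" for w
    by (rule polyf_subst[OF assms(2)]) (rule polyf.var[OF UNIV_I])
  have v: "(\<lambda>b :: 'v + 'n \<Rightarrow> complex. (\<chi> i. b (Inr i)) $ i) \<in> polyf UNIV" for i
    by (simp add: polyf.var)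
  have z: "defb (\<lambda>b :: 'v + 'n \<Rightarrow> complex. (\<chi> i. b (Inr i)) = (0 :: complex ^ 'n))"
  proof -
    have "defb (\<lambda>b :: 'v + 'n \<Rightarrow> complex. \<forall>i\<in>(UNIV :: 'n set). b (Inr i) = 0)"
      by (intro defb_ball defb.zero polyf.var) auto
    then show ?thesis by (simp add: vec_eq_iff)
  qed
  show ?thesis unfolding nondeg_iff
  proof (rule defb_all_vec, intro defb_imp defb.conj defb_ball defb.zero z bil_polyf v)
    fix p and i :: 'n
    show "(\<lambda>b :: 'v + 'n \<Rightarrow> complex. grad (\<lambda>x. val p x) (s (\<lambda>v. b (Inl v))) $ i) \<in> polyf UNIV"
      by (rule grad_polyf[OF val_polyv s])
  next
    fix k and i :: 'n
    show "(\<lambda>b :: 'v + 'n \<Rightarrow> complex. (\<chi> i. a (\<lambda>v. b (Inl v)) (k, Some i)) $ i) \<in> polyf UNIV"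
      by (simp add: a)
  qed auto
qed

lemma nondeg_cong: "(\<And>v. v \<in> lrows m \<Longrightarrow> a v = b v) \<Longrightarrow> nondeg G a m x = nondeg G b m x"
proof -
  assume "\<And>v. v \<in> lrows m \<Longrightarrow> a v = b v"
  then have *: "(\<chi> i. a (k, Some i)) = (\<chi> i. b (k, Some i))" if "k \<in> {1..m}" for k
    using that by (simp add: vec_eq_iff)
  have "(\<forall>k\<in>{1..m}. bil (\<chi> i. a (k, Some i)) v = 0) = (\<forall>k\<in>{1..m}. bil (\<chi> i. b (k, Some i)) v = 0)" for v
    by (rule ball_cong[OF refl]) (simp only: *)
  then show ?thesis unfolding nondeg_iff by (simp only:)
qed

text \<open>Transversality gives rank \<open>rk Z + m\<close>, the number of variables, for suitable
  coefficients off any hypersurface; since nondegeneracy is definable, density implies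
  genericity.\<close>

theorem generically_nondeg:
  fixes Z :: "(complex ^ 'n::finite) set"
  assumes Z: "irreducible_variety Z" "Z \<subseteq> zeros G" and x0: "x0 \<in> Z" "jac_rank G x0 = rk Z"
  defines "m \<equiv> CARD('n) - rk Z"
  shows "generically (lrows m) (\<lambda>a. \<forall>x\<in>Z \<inter> sect a m. jac_rank G x = rk Z \<and> nondeg G a m x)"
proof -
  note 1 = jac_rank_less_misses[OF Z x0, folded m_def]
  have "generically (lrows m) (\<lambda>a. \<forall>x. x \<in> Z \<and> x \<in> sect a m \<longrightarrow> nondeg G a m x)"
  proof (rule generically_dense)
    show "defb (\<lambda>a. \<forall>x. x \<in> Z \<and> x \<in> sect a m \<longrightarrow> nondeg G a m x)"
      by (rule defb_all_vec, intro defb_imp defb.conj defb_nondeg defb_sect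
          defb_defset[OF defset_algebraic[OF irreducible_imp_algebraic[OF Z(1)]]])
        (simp_all add: polyf.var)
    show "(\<forall>x. x \<in> Z \<and> x \<in> sect a m \<longrightarrow> nondeg G a m x) = (\<forall>x. x \<in> Z \<and> x \<in> sect b m \<longrightarrow> nondeg G b m x)"
      if ab: "\<And>v. v \<in> lrows m \<Longrightarrow> a v = b v" for a b
      using sect_cong[of m a b] nondeg_cong[of m a b] ab by simp
    fix f :: "(nat \<times> 'n option \<Rightarrow> complex) \<Rightarrow> complex" and a0 assume f: "f \<in> polyf (lrows m)" "f a0 \<noteq> 0"
    obtain h b0 where h: "h \<in> polyf (lrows m)" "h b0 \<noteq> 0"
      "\<And>a. h a \<noteq> 0 \<Longrightarrow> \<forall>x\<in>Z \<inter> sect a m. jac_rank G x = rk Z"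
      using 1 unfolding generically_iff by auto
    obtain c0 where c0: "f c0 * h c0 \<noteq> 0"
      using polyf_mult_nonzero[of f h, OF polyf_UNIV[OF f(1)] polyf_UNIV[OF h(1)] f(2) h(2)] by auto
    let ?D = "Z \<inter> {x. jac_rank G x = rk Z}"
    have "\<exists>a. f a * h a \<noteq> 0 \<and> (\<forall>x\<in>?D \<inter> sect a m. vec.dim (grads (vals G \<union> lins a m) x) = rk Z + m)"
    proof (rule transversal_dense[OF vals_polyv])
      show "p x = 0" if "x \<in> ?D" "p \<in> vals G" for x p using that Z(2) by (auto simp: zeros_def)
      show "vec.dim (grads (vals G) x) = rk Z" if "x \<in> ?D" for x using that by (simp add: jac_rank_eq)
      show "(\<lambda>a. f a * h a) \<in> polyf (lrows m)" by (rule polyf.mult[OF f(1) h(1)])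
    qed (rule c0)
    then obtain a where a: "f a \<noteq> 0" "h a \<noteq> 0" 
      "\<And>x. x \<in> ?D \<inter> sect a m \<Longrightarrow> vec.dim (grads (vals G \<union> lins a m) x) = rk Z + m" by auto
    have "nondeg G a m x" if x: "x \<in> Z" "x \<in> sect a m" for x
    proof -
      have "x \<in> ?D \<inter> sect a m" using h(3)[OF a(2)] x by auto
      from a(3)[OF this] show ?thesis unfolding nondeg_def m_def
        using irreducible_meets_misses(1)[OF Z(1)] by simp
    qed
    then show "\<exists>a. f a \<noteq> 0 \<and> (\<forall>x. x \<in> Z \<and> x \<in> sect a m \<longrightarrow> nondeg G a m x)" using a(1) by blast
  qed
  from generically_conj[OF 1 this] show ?thesis by (rule generically_mono) blast
qed

lemma card_ge_iff:
  "finite S \<Longrightarrow> (\<exists>X :: nat \<Rightarrow> 'a. inj_on X {..<N} \<and> (\<forall>k<N. X k \<in> S)) \<longleftrightarrow> N \<le> card S"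
proof
  assume S: "finite S" and "\<exists>X :: nat \<Rightarrow> 'a. inj_on X {..<N} \<and> (\<forall>k<N. X k \<in> S)"
  then obtain X :: "nat \<Rightarrow> 'a" where "inj_on X {..<N}" "X ` {..<N} \<subseteq> S" by auto
  from card_inj_on_le[OF this S] show "N \<le> card S" by simp
next
  assume S: "finite S" and "N \<le> card S"
  then obtain T where T: "T \<subseteq> S" "card T = N" "finite T" by (meson obtain_subset_with_card_n)
  obtain X where "bij_betw X {0..<N} T" using ex_bij_betw_nat_finite[OF T(3)] T(2) by auto
  then show "\<exists>X :: nat \<Rightarrow> 'a. inj_on X {..<N} \<and> (\<forall>k<N. X k \<in> S)"
    using T(1) by (intro exI[of _ X]) (auto simp: bij_betw_def atLeast0LessThan)
qed

lemma card_ge_vec_iff: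
  fixes S :: "(complex ^ 'n::finite) set"
  assumes "finite S"
  shows "(\<exists>X :: nat \<Rightarrow> 'n \<Rightarrow> complex. inj_on X {..<N} \<and> (\<forall>k<N. (\<chi> i. X k i) \<in> S)) \<longleftrightarrow> N \<le> card S"
proof -
  have "(\<exists>X :: nat \<Rightarrow> 'n \<Rightarrow> complex. inj_on X {..<N} \<and> (\<forall>k<N. (\<chi> i. X k i) \<in> S)) \<longleftrightarrow>
     (\<exists>X :: nat \<Rightarrow> complex ^ 'n. inj_on X {..<N} \<and> (\<forall>k<N. X k \<in> S))"
  proof
    assume "\<exists>X :: nat \<Rightarrow> 'n \<Rightarrow> complex. inj_on X {..<N} \<and> (\<forall>k<N. (\<chi> i. X k i) \<in> S)"
    then obtain X :: "nat \<Rightarrow> 'n \<Rightarrow> complex" where "inj_on X {..<N}" "\<forall>k<N. (\<chi> i. X k i) \<in> S" by auto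
    then show "\<exists>X :: nat \<Rightarrow> complex ^ 'n. inj_on X {..<N} \<and> (\<forall>k<N. X k \<in> S)"
      by (intro exI[of _ "\<lambda>k. \<chi> i. X k i"]) (auto simp: inj_on_def vec_eq_iff fun_eq_iff)
  next
    assume "\<exists>X :: nat \<Rightarrow> complex ^ 'n. inj_on X {..<N} \<and> (\<forall>k<N. X k \<in> S)"
    then obtain X :: "nat \<Rightarrow> complex ^ 'n" where "inj_on X {..<N}" "\<forall>k<N. X k \<in> S" by auto
    then show "\<exists>X :: nat \<Rightarrow> 'n \<Rightarrow> complex. inj_on X {..<N} \<and> (\<forall>k<N. (\<chi> i. X k i) \<in> S)"
      by (intro exI[of _ "\<lambda>k i. X k $ i"]) (auto simp: inj_on_def vec_eq_iff fun_eq_iff)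
  qed
  then show ?thesis using card_ge_iff[OF assms] by simp
qed

text \<open>For each \<open>N\<close>, having at least \<open>N\<close> points is definable, hence
  generic or generically false. The generic cardinality is the largest \<open>N\<close> of the first
  kind, which exists by the uniform bound.\<close>

theorem generically_card:
  fixes W :: "(complex ^ 'n::finite) set"
  assumes "defset W" "misses (Suc m) W"
  shows "\<exists>N. generically (lrows m :: (nat \<times> 'n option) set) (\<lambda>a. finite (W \<inter> sect a m) \<and> card (W \<inter> sect a m) = N)"
proof -
  obtain K where K: "generically (lrows m :: (nat \<times> 'n option) set) (\<lambda>a. finite (W \<inter> sect a m) \<and> card (W \<inter> sect a m) \<le> K)"
    using misses_finite[OF assms(2)] by auto
  let ?P = "\<lambda>N (a :: nat \<times> 'n option \<Rightarrow> complex). \<exists>X :: nat \<Rightarrow> 'n \<Rightarrow> complex. inj_on X {..<N} \<and>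
    (\<forall>k<N. (\<chi> i. X k i) \<in> W \<inter> sect a m)"
  have zo: "generically (lrows m) (?P N) \<or> generically (lrows m) (\<lambda>a. \<not> ?P N a)" for N
  proof (rule generically_zero_one)
    show "defb (?P N)" unfolding Int_iff
      by (rule defb_card_ge, intro defb.conj defb_defset[OF assms(1)] defb_sect) (simp_all add: polyf.var)
    show "?P N a = ?P N b" if "\<And>v. v \<in> lrows m \<Longrightarrow> a v = b v" for a b
      using sect_cong[of m a b] that by simp
  qed
  let ?Q = "\<lambda>N. generically (lrows m) (?P N)"
  have Q0: "?Q 0" by (rule generically_True) simp
  have bound: "N \<le> K" if "?Q N" for N
  proof -
    from generically_ex[OF generically_conj[OF that K]]
    obtain a where "?P N a" "finite (W \<inter> sect a m)" "card (W \<inter> sect a m) \<le> K" by auto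
    then show ?thesis using card_ge_vec_iff[of "W \<inter> sect a m" N] by simp
  qed
  have fin: "finite {N. ?Q N}" by (rule finite_subset[of _ "{..K}"]) (use bound in auto)
  define N where "N = Max {N. ?Q N}"
  have "N \<in> {N. ?Q N}" unfolding N_def by (rule Max_in[OF fin]) (use Q0 in blast)
  then have N: "?Q N" by simp
  have "Suc N \<notin> {N. ?Q N}" using Max_ge[OF fin, of "Suc N"] by (auto simp: N_def)
  then have "\<not> ?Q (Suc N)" by simp
  then have "generically (lrows m) (\<lambda>a. \<not> ?P (Suc N) a)" using zo by blast
  from generically_conj[OF generically_conj[OF N this] K]
  have "generically (lrows m) (\<lambda>a. finite (W \<inter> sect a m) \<and> card (W \<inter> sect a m) = N)"
  proof (rule generically_mono)
    fix a assume a: "(?P N a \<and> \<not> ?P (Suc N) a) \<and> finite (W \<inter> sect a m) \<and> card (W \<inter> sect a m) \<le> K"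
    then have f: "finite (W \<inter> sect a m)" by blast
    show "finite (W \<inter> sect a m) \<and> card (W \<inter> sect a m) = N"
      using a f card_ge_vec_iff[OF f, of N] card_ge_vec_iff[OF f, of "Suc N"] by auto
  qed
  then show ?thesis ..
qed

text \<open>Only the linear part of equation \<open>m\<close> is changed: a point \<open>x\<close>
  can be forced into the section by a change of size \<open>norm (lin a m x) / norm x\<close>, which
  is small for distant points.\<close>

definition pert :: "(nat \<times> 'n::finite option \<Rightarrow> complex) \<Rightarrow> nat \<Rightarrow> complex ^ 'n \<Rightarrow> nat \<times> 'n option \<Rightarrow> complex" where
  "pert a m \<eta> = (\<lambda>(k, o'). a (k, o') + (case o' of None \<Rightarrow> 0 | Some v \<Rightarrow> if k = m then \<eta> $ v else 0))"

lemma lin_pert: "lin (pert a m \<eta>) k x = lin a k x + (if k = m then bil \<eta> x else 0)"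
  by (simp add: lin_def pert_def bil_def distrib_right sum.distrib)

lemma norm_bil_le: "norm (bil u x) \<le> CARD('n) * norm u * norm (x :: complex ^ 'n::finite)"
proof -
  have "norm (bil u x) \<le> (\<Sum>v\<in>UNIV. norm (u $ v) * norm (x $ v))"
    unfolding bil_def by (rule order_trans[OF norm_sum]) (simp add: norm_mult)
  also have "\<dots> \<le> (\<Sum>v\<in>(UNIV :: 'n set). norm u * norm x)"
    by (intro sum_mono mult_mono Finite_Cartesian_Product.norm_nth_le) auto
  finally show ?thesis by simp
qed

text \<open>An invertible Jacobian has at most \<open>rk Y\<close> rows from \<open>G\<close>, and
  \<open>m\<close> rows remain for at most \<open>m\<close> linear equations. By counting, each of
  these occurs exactly once.\<close>

lemma nondeg_rows:
  fixes Y :: "(complex ^ 'n::finite) set"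
  assumes Y: "irreducible_variety Y" "Y \<subseteq> zeros G" and p: "p \<in> Y" "jac_rank G p = rk Y"
    "nondeg G a m p" and m: "m = CARD('n) - rk Y"
  obtains g :: "'n \<Rightarrow> complex ^ 'n \<Rightarrow> complex" and I where "card I = rk Y" "\<And>i. i \<in> I \<Longrightarrow> g i \<in> vals G"
    "det (jac g p) \<noteq> 0" "\<And>i. g i \<in> polyv" "bij_betw g (- I) (lins a m)" "inj_on (\<lambda>k x. lin a k x) {1..m}"
proof -
  have "vec.span (grads (vals G \<union> lins a m) p) = UNIV" using p(3) by (simp add: nondeg_def full_rank_span)
  then obtain g :: "'n \<Rightarrow> complex ^ 'n \<Rightarrow> complex" and I where g: "card I = vec.dim (grads (vals G) p)"
    "\<And>i. i \<in> I \<Longrightarrow> g i \<in> vals G" "\<And>i. i \<notin> I \<Longrightarrow> g i \<in> lins a m" "det (jac g p) \<noteq> 0"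
    using complete_rows by metis
  have cI: "card I = rk Y" using g(1) p(2) by (simp add: jac_rank_eq)
  have gp: "g i \<in> polyv" for i using g(2,3)[of i] vals_polyv[of G] lins_polyv[of a m] by (cases "i \<in> I") auto
  have inj: "inj_on g (- I)"
  proof (rule inj_onI)
    fix i j assume "g i = g j"
    then have "jac g p $ i = jac g p $ j" by (simp add: jac_def)
    then show "i = j" using independent_rows(1)[OF g(4)] by (auto dest: injD)
  qed
  have "card (g ` (- I)) = m"
    using card_image[OF inj] cI m by (simp add: Compl_eq_Diff_UNIV card_Diff_subset)
  moreover have sub: "g ` (- I) \<subseteq> lins a m" using g(3) by auto
  moreover have fl: "finite (lins a m)" by (simp add: lins_def)
  ultimately have ge: "m \<le> card (lins a m)" using card_mono by metis
  have le: "card (lins a m) \<le> card {1..m}" unfolding lins_def by (rule card_image_le) simp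
  have "g ` (- I) = lins a m"
    by (rule card_subset_eq[OF fl sub]) (use \<open>card (g ` (- I)) = m\<close> ge le in simp)
  then have "bij_betw g (- I) (lins a m)" using inj by (simp add: bij_betw_def)
  moreover have "inj_on (\<lambda>k x. lin a k x) {1..m}"
    by (rule eq_card_imp_inj_on) (use ge le in \<open>simp_all add: lins_def\<close>)
  ultimately show thesis using that cI g(2,4) gp by metis
qed

text \<open>Brouwer's fixed point theorem solves the perturbed equations near a nondegenerate point.\<close>

lemma section_persists:
  fixes Y :: "(complex ^ 'n::finite) set"
  assumes Y: "irreducible_variety Y" "Y \<subseteq> zeros G" and p: "p \<in> Y \<inter> sect a m" "jac_rank G p = rk Y"
    "nondeg G a m p" and m: "m = CARD('n) - rk Y" "1 \<le> m" and \<delta>: "0 < \<delta>"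
  shows "\<exists>\<epsilon>>0. \<forall>\<eta>. norm \<eta> < \<epsilon> \<longrightarrow> (\<exists>q\<in>Y \<inter> sect (pert a m \<eta>) m. dist p q < \<delta>)"
proof -
  have pY: "p \<in> Y" using p by auto
  obtain g :: "'n \<Rightarrow> complex ^ 'n \<Rightarrow> complex" and I where g: "card I = rk Y" "\<And>i. i \<in> I \<Longrightarrow> g i \<in> vals G"
    "det (jac g p) \<noteq> 0" "\<And>i. g i \<in> polyv" "bij_betw g (- I) (lins a m)" "inj_on (\<lambda>k x. lin a k x) {1..m}"
    using nondeg_rows[OF Y pY p(2,3) m(1)] by metis
  have gv: "g i \<in> vanish Y" if "i \<in> I" for i using g(2)[OF that] vals_vanish[OF Y(2)] by auto
  obtain U1 where U1: "open U1" "p \<in> U1" "\<And>x. x \<in> U1 \<Longrightarrow> (\<And>i. i \<in> I \<Longrightarrow> g i x = 0) \<Longrightarrow> x \<in> Y"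
    using regular_local[OF Y(1) g(4) gv g(1) pY g(3)] by metis
  obtain U V \<Psi> where U: "open U" "p \<in> U" "U \<subseteq> U1" "open V" "homeomorphism U V (\<lambda>x. \<chi> i. g i x) \<Psi>"
    using poly_inverse_function[OF g(4,3) U1(1,2)] by metis
  let ?\<Phi> = "\<lambda>x. \<chi> i. g i x"
  have \<Psi>: "continuous_on V \<Psi>" "\<And>y. y \<in> V \<Longrightarrow> \<Psi> y \<in> U \<and> ?\<Phi> (\<Psi> y) = y" "?\<Phi> p \<in> V" "\<Psi> (?\<Phi> p) = p"
    using U(5,2) by (auto simp: homeomorphism_def)
  have "isCont \<Psi> (?\<Phi> p)" using \<Psi>(1,3) U(4) continuous_on_eq_continuous_at by blast
  then obtain r1 where r1: "0 < r1" "\<And>y. dist y (?\<Phi> p) < r1 \<Longrightarrow> dist (\<Psi> y) p < \<delta> / 2"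
    using \<delta> \<Psi>(4) unfolding continuous_at_eps_delta by (metis half_gt_zero)
  obtain r2 where r2: "0 < r2" "ball (?\<Phi> p) r2 \<subseteq> V" using U(4) \<Psi>(3) openE by blast
  define r where "r = min r1 r2"
  define E where "E \<eta> x = (\<chi> i. if i \<notin> I \<and> g i = (\<lambda>x. lin a m x) then bil \<eta> x else 0)" for \<eta> x :: "complex ^ 'n"
  define C where "C = real CARD('n) * (real CARD('n) * (norm p + \<delta>))"
  have C0: "0 \<le> C" using \<delta> by (simp add: C_def)
  have E: "norm (E \<eta> x) \<le> C * norm \<eta>" if "x \<in> cball p (\<delta> / 2)" for \<eta> x
  proof -
    have "norm x \<le> norm p + dist p x" by (metis dist_norm norm_minus_commute norm_triangle_sub add.commute)
    then have nx: "norm x \<le> norm p + \<delta>" using that \<delta> by (simp add: mem_cball)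
    have "norm (E \<eta> x) \<le> (\<Sum>i\<in>UNIV. norm (E \<eta> x $ i))" unfolding norm_vec_def by (rule L2_set_le_sum) simp
    also have "\<dots> \<le> (\<Sum>i\<in>(UNIV :: 'n set). real CARD('n) * norm \<eta> * (norm p + \<delta>))"
    proof (rule sum_mono)
      fix i
      have "norm (E \<eta> x $ i) \<le> norm (bil \<eta> x)" by (simp add: E_def)
      also have "\<dots> \<le> real CARD('n) * norm \<eta> * norm x" by (rule norm_bil_le)
      also have "\<dots> \<le> real CARD('n) * norm \<eta> * (norm p + \<delta>)" by (rule mult_left_mono[OF nx]) simp
      finally show "norm (E \<eta> x $ i) \<le> real CARD('n) * norm \<eta> * (norm p + \<delta>)" .
    qed
    also have "\<dots> = C * norm \<eta>" by (simp add: C_def)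
    finally show ?thesis .
  qed
  let ?\<epsilon> = "r / (C + 1)"
  have "0 < ?\<epsilon>" using r1(1) r2(1) C0 by (simp add: r_def)
  moreover have "\<exists>q\<in>Y \<inter> sect (pert a m \<eta>) m. dist p q < \<delta>" if \<eta>: "norm \<eta> < ?\<epsilon>" for \<eta>
  proof -
    let ?S = "cball p (\<delta> / 2)"
    \<comment> \<open>At a fixed point the chart coordinates are those of \<open>p\<close> minus the
      perturbation evaluated at that very point. This says that the perturbed last equation and all
      other equations hold there.\<close>
    let ?T = "\<lambda>x. \<Psi> (?\<Phi> p - E \<eta> x)"
    have small: "norm (E \<eta> x) < r" if "x \<in> ?S" for x
    proof -
      have "C * norm \<eta> \<le> (C + 1) * norm \<eta>" by (rule mult_right_mono) auto
      also have "\<dots> < r" using \<eta> C0 by (simp add: pos_less_divide_eq mult.commute)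
      finally show ?thesis using E[OF that, of \<eta>] by simp
    qed
    have inV: "?\<Phi> p - E \<eta> x \<in> V" if "x \<in> ?S" for x
      using small[OF that] r2(2) by (auto simp: r_def dist_norm subset_iff)
    have cE: "continuous_on ?S (\<lambda>x. ?\<Phi> p - E \<eta> x)"
    proof (intro continuous_on_diff continuous_on_const)
      show "continuous_on ?S (E \<eta>)" unfolding E_def bil_def
      proof (rule continuous_on_vec_lambda)
        fix i
        have "continuous_on ?S (\<lambda>x. if b then \<Sum>v\<in>UNIV. \<eta> $ v * x $ v else 0)" for b
          by (cases b) (auto intro!: continuous_intros)
        then show "continuous_on ?S (\<lambda>x. if i \<notin> I \<and> g i = (\<lambda>x. lin a m x) then \<Sum>v\<in>UNIV. \<eta> $ v * x $ v else 0)" .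
      qed
    qed
    have cT: "continuous_on ?S ?T"
      by (rule continuous_on_compose2[OF \<Psi>(1) cE]) (use inV in auto)
    have "?T \<in> ?S \<rightarrow> ?S"
    proof
      fix x assume "x \<in> ?S"
      then have "dist (?T x) p < \<delta> / 2" by (intro r1(2)) (use small in \<open>simp add: dist_norm r_def\<close>)
      then show "?T x \<in> ?S" by (simp add: dist_commute)
    qed
    moreover have "?S \<noteq> {}" using \<delta> by simp
    ultimately obtain q where q: "q \<in> ?S" "?T q = q"
      using brouwer[OF compact_cball convex_cball _ cT] by auto
    have qU: "q \<in> U" "?\<Phi> q = ?\<Phi> p - E \<eta> q" using \<Psi>(2)[OF inV[OF q(1)]] q(2) by auto
    have qi: "g i q = g i p - E \<eta> q $ i" for i using arg_cong[OF qU(2), of "\<lambda>v. v $ i"] by simp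
    have "q \<in> Y"
    proof (rule U1(3))
      show "q \<in> U1" using qU(1) U(3) by auto
      show "g i q = 0" if "i \<in> I" for i
        using qi[of i] gv[OF that] pY that by (auto simp: E_def vanish_def)
    qed
    moreover have "q \<in> sect (pert a m \<eta>) m" unfolding sect_def
    proof (clarify)
      fix k assume k: "k \<in> {1..m}"
      then have "(\<lambda>x. lin a k x) \<in> g ` (- I)" using g(5) by (simp add: bij_betw_def lins_def)
      then obtain i where i: "i \<notin> I" "g i = (\<lambda>x. lin a k x)" by auto
      have "g i p = 0" using p(1) k i(2) by (auto simp: sect_def)
      moreover have "g i = (\<lambda>x. lin a m x) \<longleftrightarrow> k = m"
        using inj_onD[OF g(6), of k m] k m(2) i(2) by auto
      ultimately show "lin (pert a m \<eta>) k q = 0" using qi[of i] i by (auto simp: lin_pert E_def)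
    qed
    moreover have "dist p q < \<delta>" using q(1) \<delta> by simp
    ultimately show ?thesis by blast
  qed
  ultimately show ?thesis by blast
qed

text \<open>As the number of intersection points is locally constant and none of them disappears, none comes
  in from infinity. A point \<open>x\<close> with \<open>lin a m x\<close> much smaller than \<open>x\<close> would be such a point for a
  small perturbation of the last equation.\<close>

theorem section_growth:
  fixes Y :: "(complex ^ 'n::finite) set"
  assumes Y: "irreducible_variety Y" "Y \<subseteq> zeros G" and m: "Suc m' = CARD('n) - rk Y"
    and f: "f \<in> polyf (lrows (Suc m'))" "f a \<noteq> 0"
    and N: "\<And>a. f a \<noteq> 0 \<Longrightarrow> finite (Y \<inter> sect a (Suc m')) \<and> card (Y \<inter> sect a (Suc m')) = N"
    and nd: "\<And>x. x \<in> Y \<inter> sect a (Suc m') \<Longrightarrow> jac_rank G x = rk Y \<and> nondeg G a (Suc m') x"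
  shows "\<exists>C. \<forall>x\<in>Y \<inter> sect a m'. norm x \<le> C * (1 + norm (lin a (Suc m') x))"
proof (rule ccontr)
  let ?m = "Suc m'"
  let ?P = "Y \<inter> sect a ?m"
  assume "\<not> ?thesis"
  then have neg: "\<exists>x\<in>Y \<inter> sect a m'. C * (1 + norm (lin a ?m x)) < norm x" for C by (meson not_le)
  have P: "finite ?P" "card ?P = N" using N[OF f(2)] by auto
  obtain \<delta> where \<delta>: "0 < \<delta>" "\<And>x y. x \<in> ?P \<Longrightarrow> y \<in> ?P \<Longrightarrow> x \<noteq> y \<Longrightarrow> 2 * \<delta> \<le> dist x y"
  proof -
    let ?D = "insert 1 ((\<lambda>(x, y). dist x y) ` {(x, y) \<in> ?P \<times> ?P. x \<noteq> y})"
    have fin: "finite ?D" using P(1) by (auto intro: finite_subset[of _ "?P \<times> ?P"])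
    have "0 < Min ?D" using fin by (subst Min_gr_iff) auto
    moreover have "Min ?D \<le> dist x y" if "x \<in> ?P" "y \<in> ?P" "x \<noteq> y" for x y
      by (rule Min_le[OF fin]) (use that in auto)
    ultimately show thesis using that[of "Min ?D / 2"] by auto
  qed
  have "\<exists>\<epsilon>>0. \<forall>\<eta>. norm \<eta> < \<epsilon> \<longrightarrow> (\<exists>q\<in>Y \<inter> sect (pert a ?m \<eta>) ?m. dist p q < \<delta>)" if "p \<in> ?P" for p
    by (rule section_persists[OF Y that]) (use nd[OF that] m \<delta> in auto)
  then obtain e where e: "\<And>p. p \<in> ?P \<Longrightarrow> e p > 0"
    "\<And>p \<eta>. p \<in> ?P \<Longrightarrow> norm \<eta> < e p \<Longrightarrow> \<exists>q\<in>Y \<inter> sect (pert a ?m \<eta>) ?m. dist p q < \<delta>" by metis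
  have cont: "continuous_on UNIV (\<lambda>\<eta>. f (pert a ?m \<eta>))"
  proof (rule polyf_continuous[OF f(1)])
    fix v :: "nat \<times> 'n option"
    show "continuous_on UNIV (\<lambda>\<eta>. pert a ?m \<eta> v)"
      by (cases v; cases "snd v"; cases "fst v = ?m") (auto simp: pert_def intro!: continuous_intros)
  qed
  have p0: "pert a ?m 0 = a" by (auto simp: pert_def fun_eq_iff split: option.split)
  let ?O = "(\<lambda>\<eta>. f (pert a ?m \<eta>)) -` (- {0})"
  have O: "open ?O" by (rule open_vimage[OF _ cont]) auto
  have "0 \<in> ?O" using f(2) by (simp add: p0)
  then obtain e0 where e0': "e0 > 0" "ball 0 e0 \<subseteq> ?O" using openE[OF O] by blast
  have e0: "e0 > 0" "\<And>\<eta>. norm \<eta> < e0 \<Longrightarrow> f (pert a ?m \<eta>) \<noteq> 0"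
    using e0' by (auto simp: subset_iff)
  define \<epsilon> where "\<epsilon> = Min (insert e0 (e ` ?P))"
  have \<epsilon>: "\<epsilon> > 0" "\<epsilon> \<le> e0" "\<And>p. p \<in> ?P \<Longrightarrow> \<epsilon> \<le> e p"
    unfolding \<epsilon>_def using P(1) e0(1) e(1) by (simp_all add: Min_gr_iff)
  define R where "R = Max (insert 0 (norm ` ?P)) + \<delta>"
  have R: "norm p + \<delta> \<le> R" if "p \<in> ?P" for p
    unfolding R_def using P(1) that by (intro add_right_mono Max_ge) auto
  have R0: "0 \<le> R" unfolding R_def using P(1) \<delta>(1) by (intro add_nonneg_nonneg Max_ge) auto
  \<comment> \<open>A constant larger than \<open>R\<close> puts \<open>x\<close> away from all
    points continuing the section, and one larger than \<open>1 / \<epsilon>\<close> makes the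
    required perturbation smaller than \<open>\<epsilon>\<close>.\<close>
  define C where "C = max (2 / \<epsilon>) R + 1"
  obtain x where x: "x \<in> Y" "x \<in> sect a m'" "C * (1 + norm (lin a ?m x)) < norm x" using neg[of C] by auto
  have C: "C > 0" "C > R" "C > 1 / \<epsilon>" using \<epsilon>(1) R0 by (auto simp: C_def max_def field_simps)
  have "C * 1 \<le> C * (1 + norm (lin a ?m x))" using C(1) by (intro mult_left_mono) auto
  then have xR: "R < norm x" using x(3) C(2) by simp
  then have x0: "norm x > 0" using R0 by linarith
  \<comment> \<open>The vector of least norm with \<open>bil \<eta> x = - lin a ?m x\<close>, so
    that \<open>x\<close> satisfies the perturbed last equation.\<close>
  define \<eta> where "\<eta> = (\<chi> v. - (lin a ?m x / (norm x)\<^sup>2) * cnj (x $ v))"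
  have "(\<Sum>v\<in>UNIV. cnj (x $ v) * x $ v) = of_real ((norm x)\<^sup>2)"
  proof -
    have "(norm x)\<^sup>2 = (\<Sum>v\<in>UNIV. (norm (x $ v))\<^sup>2)"
      by (simp add: norm_vec_def L2_set_def sum_nonneg)
    then show ?thesis
      by (simp add: complex_norm_square[symmetric] of_real_power[symmetric] mult.commute del: of_real_power)
  qed
  then have "bil (\<chi> v. cnj (x $ v)) x = of_real ((norm x)\<^sup>2)" by (simp add: bil_def)
  moreover have \<eta>_eq: "\<eta> = (- (lin a ?m x / (norm x)\<^sup>2)) *s (\<chi> v. cnj (x $ v))" by (simp add: \<eta>_def vec_eq_iff)
  ultimately have b: "bil \<eta> x = - lin a ?m x"
    using x0 by (simp only: bil_scale_left) simp
  note \<eta>_eq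
  moreover have norm_sc: "norm (t *s w) = norm t * norm w" for t :: complex and w :: "complex ^ 'n"
    by (simp add: norm_vec_def L2_set_def norm_mult power_mult_distrib sum_distrib_left[symmetric] real_sqrt_mult)
  moreover have "norm (\<chi> v. cnj (x $ v)) = norm x" by (simp add: norm_vec_def)
  ultimately have "norm \<eta> = norm (lin a ?m x) / norm x"
    using x0 by (simp add: norm_divide norm_power norm_mult power2_eq_square)
  also have "\<dots> < \<epsilon>"
  proof -
    have "norm (lin a ?m x) \<le> \<epsilon> * (C * norm (lin a ?m x))"
    proof -
      have "1 \<le> \<epsilon> * C" using C(3) \<epsilon>(1) by (simp add: field_simps)
      then have "1 * norm (lin a ?m x) \<le> (\<epsilon> * C) * norm (lin a ?m x)" by (rule mult_right_mono) simp
      then show ?thesis by (simp add: mult.assoc)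
    qed
    also have "\<epsilon> * (C * norm (lin a ?m x)) < \<epsilon> * norm x"
      using x(3) C(1) \<epsilon>(1) by (intro mult_strict_left_mono) (auto simp: algebra_simps)
    finally show ?thesis using x0 by (simp add: field_simps)
  qed
  finally have \<eta>: "norm \<eta> < \<epsilon>" .
  let ?b = "pert a ?m \<eta>"
  have xb: "x \<in> Y \<inter> sect ?b ?m"
    using x(1,2) b by (auto simp: sect_Suc lin_pert) (auto simp: sect_def lin_pert)
  have fb: "finite (Y \<inter> sect ?b ?m)" "card (Y \<inter> sect ?b ?m) = N"
    using N[of ?b] e0(2)[of \<eta>] \<eta> \<epsilon>(2) by auto
  have "\<exists>q\<in>Y \<inter> sect ?b ?m. dist p q < \<delta>" if "p \<in> ?P" for p using e(2)[OF that, of \<eta>] \<eta> \<epsilon>(3)[OF that] by simp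
  then obtain h where h: "\<And>p. p \<in> ?P \<Longrightarrow> h p \<in> Y \<inter> sect ?b ?m \<and> dist p (h p) < \<delta>" by metis
  have "inj_on h ?P"
  proof (rule inj_onI, rule ccontr)
    fix p q assume pq: "p \<in> ?P" "q \<in> ?P" "h p = h q" "p \<noteq> q"
    have "dist p q \<le> dist p (h p) + dist q (h q)" using dist_triangle2[of p q "h p"] pq(3) by simp
    then show False using h[OF pq(1)] h[OF pq(2)] \<delta>(2)[OF pq(1,2,4)] by linarith
  qed
  then have "card (h ` ?P) = N" using P(2) by (simp add: card_image)
  moreover have "x \<notin> h ` ?P"
  proof
    assume "x \<in> h ` ?P"
    then obtain p where p: "p \<in> ?P" "x = h p" by auto
    have "norm x \<le> norm p + dist p x" by (metis dist_norm norm_minus_commute norm_triangle_sub add.commute)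
    then show False using h[OF p(1)] R[OF p(1)] xR p(2) by simp
  qed
  ultimately have "card (insert x (h ` ?P)) = Suc N" using P(1) by simp
  moreover have "card (insert x (h ` ?P)) \<le> card (Y \<inter> sect ?b ?m)"
    by (rule card_mono[OF fb(1)]) (use h xb in auto)
  ultimately show False using fb(2) by simp
qed

section \<open>Lifting paths to families of finite sets\<close>

text \<open>Near \<open>(t0, z0)\<close> the family is the graph of one continuous function. The set
  \<open>W\<close> will be that of nondegenerate solutions, so that points of nearby fibres within
  \<open>N\<close> are again nondegenerate.\<close>

definition locgraph :: "('t::metric_space \<Rightarrow> 'z::heine_borel set) \<Rightarrow> ('t \<times> 'z) set \<Rightarrow> 't \<Rightarrow> 'z \<Rightarrow> bool" where
  "locgraph E W t0 z0 \<longleftrightarrow> (\<exists>N \<epsilon> \<sigma>. open N \<and> N \<subseteq> W \<and> (t0, z0) \<in> N \<and> \<epsilon> > 0 \<and> continuous_on (ball t0 \<epsilon>) \<sigma> \<and>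
     \<sigma> t0 = z0 \<and> (\<forall>t\<in>ball t0 \<epsilon>. (t, \<sigma> t) \<in> N \<and> \<sigma> t \<in> E t) \<and>
     (\<forall>t\<in>ball t0 \<epsilon>. \<forall>z\<in>E t. (t, z) \<in> N \<longrightarrow> z = \<sigma> t))"

definition locbdd :: "('t::metric_space \<Rightarrow> 'z::metric_space set) \<Rightarrow> 't \<Rightarrow> bool" where
  "locbdd E t0 \<longleftrightarrow> (\<exists>\<epsilon>>0. bounded (\<Union>t\<in>ball t0 \<epsilon>. E t))"

text \<open>The part of the family outside \<open>W\<close> over a small ball is compact by local
  boundedness, so its projection is closed and keeps a distance from \<open>t0\<close>.\<close>

lemma fibre_tube:
  fixes E :: "'t::heine_borel \<Rightarrow> 'z::heine_borel set"
  assumes cl: "closed (SIGMA t:UNIV. E t)" and bd: "locbdd E t0" and W: "open W" "\<And>z. z \<in> E t0 \<Longrightarrow> (t0, z) \<in> W"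
  shows "\<exists>\<epsilon>>0. \<forall>t\<in>ball t0 \<epsilon>. \<forall>z\<in>E t. (t, z) \<in> W"
proof -
  obtain \<epsilon> where \<epsilon>: "\<epsilon> > 0" "bounded (\<Union>t\<in>ball t0 \<epsilon>. E t)" using bd by (auto simp: locbdd_def)
  let ?K = "((SIGMA t:UNIV. E t) \<inter> cball t0 (\<epsilon> / 2) \<times> UNIV) - W"
  have "?K \<subseteq> cball t0 (\<epsilon> / 2) \<times> (\<Union>t\<in>ball t0 \<epsilon>. E t)" using \<epsilon>(1) by force
  then have "bounded ?K" using bounded_Times[OF bounded_cball \<epsilon>(2)] bounded_subset by blast
  moreover have "closed ?K" using cl W(1) by (intro closed_Diff closed_Int closed_Times) auto
  ultimately have "compact ?K" by (simp add: compact_eq_bounded_closed)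
  then have "compact (fst ` ?K)" by (rule compact_continuous_image[OF continuous_on_fst[OF continuous_on_id]])
  then have "open (ball t0 (\<epsilon> / 2) - fst ` ?K)" by (simp add: compact_imp_closed open_Diff)
  moreover have "t0 \<in> ball t0 (\<epsilon> / 2) - fst ` ?K" using W(2) \<epsilon>(1) by auto
  ultimately obtain r where r: "r > 0" "ball t0 r \<subseteq> ball t0 (\<epsilon> / 2) - fst ` ?K" using openE by blast
  have "(t, z) \<in> W" if t: "t \<in> ball t0 r" "z \<in> E t" for t z
  proof (rule ccontr)
    assume "(t, z) \<notin> W"
    then have "(t, z) \<in> ?K" using t r(2) by auto
    then have "t \<in> fst ` ?K" by force
    then show False using t(1) r(2) by blast
  qed
  then show ?thesis using r(1) by blast
qed

lemma locgraph_finite: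
  fixes E :: "'t::heine_borel \<Rightarrow> 'z::heine_borel set"
  assumes cl: "closed (SIGMA t:UNIV. E t)" and bd: "locbdd E t0" and lg: "\<And>z. z \<in> E t0 \<Longrightarrow> locgraph E W t0 z"
  shows "finite (E t0)"
proof -
  have "bounded (E t0)" using bd unfolding locbdd_def
    by (metis UN_upper bounded_subset centre_in_ball)
  moreover have "closed (E t0)"
  proof -
    have "closed ((\<lambda>z. (t0, z)) -` (SIGMA t:UNIV. E t))"
      by (rule closed_vimage[OF cl]) (intro continuous_intros)
    then show ?thesis by (simp add: vimage_def)
  qed
  ultimately have c: "compact (E t0)" by (simp add: compact_eq_bounded_closed)
  have "\<not> z islimpt E t0" if z: "z \<in> E t0" for z
  proof
    assume lim: "z islimpt E t0"
    obtain N \<epsilon> \<sigma> where N: "open N" "(t0, z) \<in> N" "\<epsilon> > 0" "\<sigma> t0 = z"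
      "\<forall>t\<in>ball t0 \<epsilon>. \<forall>z\<in>E t. (t, z) \<in> N \<longrightarrow> z = \<sigma> t"
      using lg[OF z] unfolding locgraph_def by metis
    have "open ((\<lambda>z. (t0, z)) -` N)" by (rule open_vimage[OF N(1)]) (intro continuous_intros)
    then obtain y where "y \<in> E t0" "y \<in> (\<lambda>z. (t0, z)) -` N" "y \<noteq> z"
      using lim N(2) unfolding islimpt_def by blast
    then show False using N(3,4,5) by auto
  qed
  then show ?thesis using finite_not_islimpt_in_compact[OF c, of "E t0"] by simp
qed

lemma locgraph_persist:
  fixes E :: "'t::metric_space \<Rightarrow> 'z::heine_borel set"
  assumes fin: "finite (E t0)" and lg: "\<And>z. z \<in> E t0 \<Longrightarrow> locgraph E W t0 z"
  obtains \<epsilon> \<sigma> N where "\<epsilon> > 0" "\<forall>z\<in>E t0. open (N z) \<and> N z \<subseteq> W \<and> (t0, z) \<in> N z"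
    "\<forall>t\<in>ball t0 \<epsilon>. \<forall>z\<in>E t0. \<sigma> z t \<in> E t \<and> dist (\<sigma> z t) z < 1"
    "\<forall>t\<in>ball t0 \<epsilon>. inj_on (\<lambda>z. \<sigma> z t) (E t0)"
    "\<forall>t\<in>ball t0 \<epsilon>. \<forall>z\<in>E t0. \<forall>y\<in>E t. (t, y) \<in> N z \<longrightarrow> y = \<sigma> z t"
proof -
  define Q where "Q z x \<longleftrightarrow> (case x of (N, \<epsilon>, \<sigma>) \<Rightarrow> open N \<and> N \<subseteq> W \<and> (t0, z) \<in> N \<and> \<epsilon> > 0 \<and>
     continuous_on (ball t0 \<epsilon>) \<sigma> \<and> \<sigma> t0 = z \<and> (\<forall>t\<in>ball t0 \<epsilon>. (t, \<sigma> t) \<in> N \<and> \<sigma> t \<in> E t) \<and>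
     (\<forall>t\<in>ball t0 \<epsilon>. \<forall>y\<in>E t. (t, y) \<in> N \<longrightarrow> y = \<sigma> t))" for z x
  have "\<forall>z\<in>E t0. \<exists>x. Q z x"
  proof
    fix z assume "z \<in> E t0"
    from lg[OF this, unfolded locgraph_def] show "\<exists>x. Q z x" unfolding Q_def split_paired_Ex by simp
  qed
  from bchoice[OF this] obtain X where X: "\<forall>z\<in>E t0. Q z (X z)" ..
  define N where "N z = fst (X z)" for z
  define e where "e z = fst (snd (X z))" for z
  define \<sigma> where "\<sigma> z = snd (snd (X z))" for z
  have N: "open (N z) \<and> N z \<subseteq> W \<and> (t0, z) \<in> N z \<and> e z > 0 \<and>
     continuous_on (ball t0 (e z)) (\<sigma> z) \<and> \<sigma> z t0 = z \<and> (\<forall>t\<in>ball t0 (e z). (t, \<sigma> z t) \<in> N z \<and> \<sigma> z t \<in> E t) \<and>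
     (\<forall>t\<in>ball t0 (e z). \<forall>y\<in>E t. (t, y) \<in> N z \<longrightarrow> y = \<sigma> z t)" if "z \<in> E t0" for z
    using X[rule_format, OF that] unfolding Q_def N_def e_def \<sigma>_def by (simp add: case_prod_beta)
  obtain \<delta> where \<delta>: "0 < \<delta>" "\<delta> \<le> 1" "\<And>x y. x \<in> E t0 \<Longrightarrow> y \<in> E t0 \<Longrightarrow> x \<noteq> y \<Longrightarrow> 2 * \<delta> \<le> dist x y"
  proof -
    let ?D = "insert 1 ((\<lambda>(x, y). dist x y) ` {(x, y) \<in> E t0 \<times> E t0. x \<noteq> y})"
    have f: "finite ?D" using fin by (auto intro: finite_subset[of _ "E t0 \<times> E t0"])
    have 1: "0 < Min ?D" using f by (subst Min_gr_iff) auto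
    have 2: "Min ?D \<le> 1" by (rule Min_le[OF f]) simp
    have "Min ?D \<le> dist x y" if "x \<in> E t0" "y \<in> E t0" "x \<noteq> y" for x y
      by (rule Min_le[OF f]) (use that in auto)
    then show thesis using that[of "Min ?D / 2"] 1 2 by auto
  qed
  have "\<exists>r>0. \<forall>t\<in>ball t0 r. t \<in> ball t0 (e z) \<and> dist (\<sigma> z t) z < \<delta>" if z: "z \<in> E t0" for z
  proof -
    have "isCont (\<sigma> z) t0" using N[OF z] by (auto simp: continuous_on_eq_continuous_at)
    then obtain r where "r > 0" "\<And>t. dist t t0 < r \<Longrightarrow> dist (\<sigma> z t) z < \<delta>"
      using \<delta>(1) N[OF z] unfolding continuous_at_eps_delta by metis
    then show ?thesis using N[OF z] by (intro exI[of _ "min r (e z)"]) (auto simp: dist_commute)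
  qed
  then obtain r where r: "\<And>z. z \<in> E t0 \<Longrightarrow> r z > 0 \<and> (\<forall>t\<in>ball t0 (r z). t \<in> ball t0 (e z) \<and> dist (\<sigma> z t) z < \<delta>)"
    by metis
  define \<epsilon> where "\<epsilon> = Min (insert 1 (r ` E t0))"
  have \<epsilon>: "\<epsilon> > 0" "\<And>z. z \<in> E t0 \<Longrightarrow> \<epsilon> \<le> r z" unfolding \<epsilon>_def using fin r by (auto simp: Min_gr_iff)
  have tr: "t \<in> ball t0 (e z)" "dist (\<sigma> z t) z < \<delta>" if "t \<in> ball t0 \<epsilon>" "z \<in> E t0" for t z
    using r[OF that(2)] \<epsilon>(2)[OF that(2)] that(1) by auto
  show thesis
  proof (rule that[OF \<epsilon>(1), of N \<sigma>]; intro ballI impI)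
    show "open (N z) \<and> N z \<subseteq> W \<and> (t0, z) \<in> N z" if "z \<in> E t0" for z using N[OF that] by blast
    show "\<sigma> z t \<in> E t \<and> dist (\<sigma> z t) z < 1" if "t \<in> ball t0 \<epsilon>" "z \<in> E t0" for t z
      using N[OF that(2)] tr[OF that] \<delta>(2) by auto
    show "y = \<sigma> z t" if "t \<in> ball t0 \<epsilon>" "z \<in> E t0" "y \<in> E t" "(t, y) \<in> N z" for t z y
      using N[OF that(2)] tr(1)[OF that(1,2)] that(3,4) by blast
    show "inj_on (\<lambda>z. \<sigma> z t) (E t0)" if t: "t \<in> ball t0 \<epsilon>" for t
    proof (rule inj_onI, rule ccontr)
      fix x y assume xy: "x \<in> E t0" "y \<in> E t0" "\<sigma> x t = \<sigma> y t" "x \<noteq> y"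
      have "dist x y \<le> dist (\<sigma> x t) x + dist (\<sigma> y t) y"
        using dist_triangle3[of x y "\<sigma> x t"] xy(3) by simp
      then show False using tr(2)[OF t xy(1)] tr(2)[OF t xy(2)] \<delta>(3)[OF xy(1,2,4)] by linarith
    qed
  qed
qed

text \<open>Local graphs through the finitely many points of the fibre stay disjoint nearby, and by
  the tube argument they account for all points of the neighbouring fibres.\<close>

lemma locgraph_card:
  fixes E :: "'t::heine_borel \<Rightarrow> 'z::heine_borel set"
  assumes cl: "closed (SIGMA t:UNIV. E t)" and bd: "locbdd E t0" and lg: "\<And>z. z \<in> E t0 \<Longrightarrow> locgraph E W t0 z"
  shows "\<exists>\<epsilon>>0. \<forall>t\<in>ball t0 \<epsilon>. finite (E t) \<and> card (E t) = card (E t0) \<and> (\<forall>z\<in>E t. (t, z) \<in> W)"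
proof -
  have fin: "finite (E t0)" by (rule locgraph_finite[OF cl bd lg])
  obtain \<epsilon> \<sigma> N where N: "\<epsilon> > 0" "\<forall>z\<in>E t0. open (N z) \<and> N z \<subseteq> W \<and> (t0, z) \<in> N z"
    "\<forall>t\<in>ball t0 \<epsilon>. \<forall>z\<in>E t0. \<sigma> z t \<in> E t \<and> dist (\<sigma> z t) z < 1"
    "\<forall>t\<in>ball t0 \<epsilon>. inj_on (\<lambda>z. \<sigma> z t) (E t0)"
    "\<forall>t\<in>ball t0 \<epsilon>. \<forall>z\<in>E t0. \<forall>y\<in>E t. (t, y) \<in> N z \<longrightarrow> y = \<sigma> z t"
    by (rule locgraph_persist[OF fin lg])
  have "open (\<Union>z\<in>E t0. N z)" using N(2) by blast
  moreover have "(t0, z) \<in> (\<Union>z\<in>E t0. N z)" if "z \<in> E t0" for z using N(2) that by blast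
  ultimately obtain r where r: "r > 0" "\<forall>t\<in>ball t0 r. \<forall>z\<in>E t. (t, z) \<in> (\<Union>z\<in>E t0. N z)"
    using fibre_tube[OF cl bd] by metis
  have "finite (E t) \<and> card (E t) = card (E t0) \<and> (\<forall>z\<in>E t. (t, z) \<in> W)" if t: "t \<in> ball t0 (min \<epsilon> r)" for t
  proof -
    have tt: "t \<in> ball t0 \<epsilon>" "t \<in> ball t0 r" using t by auto
    have "E t = (\<lambda>z. \<sigma> z t) ` E t0"
    proof (intro equalityI subsetI)
      fix y assume y: "y \<in> E t"
      then obtain z where "z \<in> E t0" "(t, y) \<in> N z" using r(2) tt(2) by blast
      then show "y \<in> (\<lambda>z. \<sigma> z t) ` E t0" using N(5) tt(1) y by blast
    qed (use N(3) tt(1) in auto)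
    moreover have "(t, z) \<in> W" if "z \<in> E t" for z using r(2) tt(2) that N(2) by blast
    ultimately show ?thesis using card_image[OF N(4)[rule_format, OF tt(1)]] fin by auto
  qed
  then have "\<forall>t\<in>ball t0 (min \<epsilon> r). finite (E t) \<and> card (E t) = card (E t0) \<and> (\<forall>z\<in>E t. (t, z) \<in> W)" ..
  moreover have "0 < min \<epsilon> r" using N(1) r(1) by simp
  ultimately show ?thesis by (intro exI[of _ "min \<epsilon> r"] conjI)
qed

text \<open>A converse to the preceding count: the points continuing the fibre at \<open>t0\<close>
  stay close to it and are already as many as each neighbouring fibre has, so nothing can come in
  from infinity.\<close>

lemma card_const_locbdd:
  fixes E :: "'t::heine_borel \<Rightarrow> 'z::heine_borel set"
  assumes fin: "finite (E t0)" and lg: "\<And>z. z \<in> E t0 \<Longrightarrow> locgraph E W t0 z"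
    and const: "r > 0" "\<And>t. t \<in> ball t0 r \<Longrightarrow> finite (E t) \<and> card (E t) = card (E t0)"
  shows "locbdd E t0"
proof -
  obtain \<epsilon> \<sigma> N where N: "\<epsilon> > 0" "\<forall>z\<in>E t0. open (N z) \<and> N z \<subseteq> W \<and> (t0, z) \<in> N z"
    "\<forall>t\<in>ball t0 \<epsilon>. \<forall>z\<in>E t0. \<sigma> z t \<in> E t \<and> dist (\<sigma> z t) z < 1"
    "\<forall>t\<in>ball t0 \<epsilon>. inj_on (\<lambda>z. \<sigma> z t) (E t0)"
    "\<forall>t\<in>ball t0 \<epsilon>. \<forall>z\<in>E t0. \<forall>y\<in>E t. (t, y) \<in> N z \<longrightarrow> y = \<sigma> z t"
    by (rule locgraph_persist[OF fin lg])
  have "E t \<subseteq> (\<Union>z\<in>E t0. ball z 1)" if t: "t \<in> ball t0 (min \<epsilon> r)" for t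
  proof -
    have tt: "t \<in> ball t0 \<epsilon>" "t \<in> ball t0 r" using t by auto
    have "(\<lambda>z. \<sigma> z t) ` E t0 = E t"
      by (rule card_subset_eq) (use const(2)[OF tt(2)] N(3)[rule_format, OF tt(1)] card_image[OF N(4)[rule_format, OF tt(1)]] in auto)
    then show ?thesis using N(3)[rule_format, OF tt(1)] by (force simp: dist_commute)
  qed
  then have "(\<Union>t\<in>ball t0 (min \<epsilon> r). E t) \<subseteq> (\<Union>z\<in>E t0. ball z 1)" by blast
  moreover have "bounded (\<Union>z\<in>E t0. ball z 1)" using fin by auto
  ultimately have "bounded (\<Union>t\<in>ball t0 (min \<epsilon> r). E t)" by (rule bounded_subset[rotated])
  moreover have "0 < min \<epsilon> r" using N(1) const(1) by simp
  ultimately show ?thesis unfolding locbdd_def by (intro exI[of _ "min \<epsilon> r"] conjI)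
qed

text \<open>The set of \<open>s\<close> from which a lift to the prescribed end exists contains its
  infimum, by compactness of nearby fibres, and local graphs extend a lift beyond any positive
  infimum.\<close>

theorem path_lifting:
  fixes E :: "'t::heine_borel \<Rightarrow> 'z::heine_borel set" and \<tau> :: "real \<Rightarrow> 't"
  assumes cl: "closed (SIGMA t:UNIV. E t)" and \<tau>: "continuous_on {0..1} \<tau>"
    and e: "e \<in> E (\<tau> 1)" "locgraph E W (\<tau> 1) e"
    and bd: "\<And>s. s \<in> {0..<1} \<Longrightarrow> locbdd E (\<tau> s)"
    and lg: "\<And>s z. s \<in> {0..<1} \<Longrightarrow> z \<in> E (\<tau> s) \<Longrightarrow> locgraph E W (\<tau> s) z"
  shows "\<exists>z. continuous_on {0..1} z \<and> z 1 = e \<and> (\<forall>s\<in>{0..1}. z s \<in> E (\<tau> s))"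
proof -
  define lift where "lift s z \<longleftrightarrow> continuous_on {s..1} z \<and> z 1 = e \<and> (\<forall>s'\<in>{s..1}. z s' \<in> E (\<tau> s'))" for s z
  define A where "A = {s\<in>{0..1}. \<exists>z. lift s z}"
  have 1: "1 \<in> A" using e(1) by (auto simp: A_def lift_def intro!: exI[of _ "\<lambda>_. e"])
  have bdd: "bdd_below A" by (auto simp: A_def bdd_below_def)
  define s0 where "s0 = Inf A"
  have "0 \<le> s0" unfolding s0_def by (rule cInf_greatest) (use 1 in \<open>auto simp: A_def\<close>)
  moreover have "s0 \<le> 1" unfolding s0_def by (rule cInf_lower[OF 1 bdd])
  ultimately have s0: "0 \<le> s0" "s0 \<le> 1" .
  \<comment> \<open>At \<open>s = 1\<close> other points of the fibre may be degenerate; a lift ends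
    in \<open>e\<close>, for which a local graph is assumed.\<close>
  have lg': "locgraph E W (\<tau> s) z" if "s \<in> {0..1}" "z \<in> E (\<tau> s)" "lift s h" "h s = z" for s z h
    using that lg[of s z] e by (cases "s = 1") (auto simp: lift_def)
  have near: "\<exists>\<eta>>0. \<forall>s'\<in>{0..1}. \<bar>s' - s\<bar> < \<eta> \<longrightarrow> \<tau> s' \<in> ball (\<tau> s) r" if sr: "s \<in> {0..1}" "r > 0" for s r
  proof -
    obtain d where "d > 0" "\<And>s'. s' \<in> {0..1} \<Longrightarrow> dist s' s < d \<Longrightarrow> dist (\<tau> s') (\<tau> s) < r"
      using \<tau> sr unfolding continuous_on_iff by blast
    then show ?thesis by (intro exI[of _ d]) (simp add: dist_real_def dist_commute[of "\<tau> s"])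
  qed
  have glue: "\<exists>z. lift s z" if s: "0 \<le> s" "s \<le> s'" "s' \<le> 1" and h: "lift s' h"
    and \<sigma>: "continuous_on (ball p r) \<sigma>" "\<And>x. x \<in> {s..s'} \<Longrightarrow> \<tau> x \<in> ball p r"
      "\<And>x. x \<in> {s..s'} \<Longrightarrow> \<sigma> (\<tau> x) \<in> E (\<tau> x)" "\<sigma> (\<tau> s') = h s'" for s s' h p r and \<sigma> :: "'t \<Rightarrow> 'z"
  proof -
    let ?z = "\<lambda>x. if x \<le> s' then \<sigma> (\<tau> x) else h x"
    have "continuous_on ({s..s'} \<union> {s'..1}) ?z"
    proof (rule continuous_on_If)
      have "continuous_on {s..s'} \<tau>" by (rule continuous_on_subset[OF \<tau>]) (use s in auto)
      then show "continuous_on {s..s'} (\<lambda>x. \<sigma> (\<tau> x))"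
        by (rule continuous_on_compose2[OF \<sigma>(1)]) (use \<sigma>(2) in auto)
      show "continuous_on {s'..1} h" using h by (simp add: lift_def)
    qed (use \<sigma>(4) in auto)
    moreover have "{s..s'} \<union> {s'..1} = {s..1}" using s by auto
    ultimately have "lift s ?z" using h s \<sigma>(3,4) by (auto simp: lift_def)
    then show ?thesis by blast
  qed
  have s0A: "s0 \<in> A"
  proof (rule ccontr)
    assume n: "s0 \<notin> A"
    then have s1: "s0 < 1" using 1 s0 by (cases "s0 = 1") auto
    have s01: "s0 \<in> {0..<1}" using s0 s1 by auto
    have "\<exists>s\<in>A. s < s0 + 1 / real (Suc k)" for k
      using cInf_less_iff[of A "s0 + 1 / real (Suc k)"] 1 bdd by (auto simp: s0_def)
    then obtain q where q: "\<And>k. q k \<in> A" "\<And>k. q k < s0 + 1 / real (Suc k)" by metis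
    have qge: "s0 \<le> q k" for k unfolding s0_def by (rule cInf_lower[OF q(1) bdd])
    have qlim: "q \<longlonglongrightarrow> s0"
    proof (rule tendsto_sandwich[of "\<lambda>_. s0" q sequentially "\<lambda>k. s0 + 1 / real (Suc k)"])
      show "(\<lambda>k. s0 + 1 / real (Suc k)) \<longlonglongrightarrow> s0"
        using tendsto_add[OF tendsto_const LIMSEQ_inverse_real_of_nat, of s0] by (simp add: inverse_eq_divide)
    qed (use qge q(2) in \<open>auto intro!: always_eventually less_imp_le\<close>)
    obtain h where h: "\<And>k. lift (q k) (h k)" using q(1) unfolding A_def by (simp; metis)
    have q01: "q k \<in> {0..1}" for k using q(1)[of k] by (auto simp: A_def)
    have tlim: "(\<lambda>k. \<tau> (q k)) \<longlonglongrightarrow> \<tau> s0"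
      by (rule continuous_on_tendsto_compose[OF \<tau> qlim]) (use s0 q01 in auto)
    obtain r0 where r0: "r0 > 0" "bounded (\<Union>t\<in>ball (\<tau> s0) r0. E t)" using bd[OF s01] by (auto simp: locbdd_def)
    have hE: "h k (q k) \<in> E (\<tau> (q k))" for k using h[of k] q01[of k] by (auto simp: lift_def)
    obtain K where K: "\<And>k. k \<ge> K \<Longrightarrow> \<tau> (q k) \<in> ball (\<tau> s0) r0"
      using tlim r0(1) unfolding lim_sequentially by (auto simp: dist_commute)
    \<comment> \<open>The initial points of lifts starting closer and closer to \<open>s0\<close>
      have a limit in the fibre over \<open>s0\<close>. The local graph there takes over one of
      these lifts and continues it down to \<open>s0\<close>.\<close>
    have "bounded (range (\<lambda>k. h (k + K) (q (k + K))))"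
      by (rule bounded_subset[OF r0(2)]) (use hE K in fastforce)
    then obtain w \<phi> where w: "strict_mono \<phi>" "((\<lambda>k. h (k + K) (q (k + K))) \<circ> \<phi>) \<longlonglongrightarrow> w"
      using bounded_imp_convergent_subsequence by blast
    define \<psi> where "\<psi> k = \<phi> k + K" for k
    have \<psi>: "strict_mono \<psi>" using w(1) by (auto simp: \<psi>_def strict_mono_def)
    have wl: "(\<lambda>k. h (\<psi> k) (q (\<psi> k))) \<longlonglongrightarrow> w" using w(2) by (simp add: comp_def \<psi>_def)
    have tl: "(\<lambda>k. \<tau> (q (\<psi> k))) \<longlonglongrightarrow> \<tau> s0" using LIMSEQ_subseq_LIMSEQ[OF tlim \<psi>] by (simp add: comp_def)
    have ql: "(\<lambda>k. q (\<psi> k)) \<longlonglongrightarrow> s0" using LIMSEQ_subseq_LIMSEQ[OF qlim \<psi>] by (simp add: comp_def)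
    have pl: "(\<lambda>k. (\<tau> (q (\<psi> k)), h (\<psi> k) (q (\<psi> k)))) \<longlonglongrightarrow> (\<tau> s0, w)" by (rule tendsto_Pair[OF tl wl])
    have "(\<tau> s0, w) \<in> (SIGMA t:UNIV. E t)"
      by (rule closed_sequentially[OF cl _ pl]) (use hE in auto)
    then have "w \<in> E (\<tau> s0)" by simp
    from lg[OF s01 this] obtain N \<epsilon> \<sigma> where N: "open N" "(\<tau> s0, w) \<in> N" "\<epsilon> > 0" "continuous_on (ball (\<tau> s0) \<epsilon>) \<sigma>"
      "\<forall>t\<in>ball (\<tau> s0) \<epsilon>. (t, \<sigma> t) \<in> N \<and> \<sigma> t \<in> E t" "\<forall>t\<in>ball (\<tau> s0) \<epsilon>. \<forall>z\<in>E t. (t, z) \<in> N \<longrightarrow> z = \<sigma> t"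
      unfolding locgraph_def by metis
    have s0m: "s0 \<in> {0..1}" using s0 by simp
    obtain \<eta> where \<eta>: "\<eta> > 0" "\<And>s'. s' \<in> {0..1} \<Longrightarrow> \<bar>s' - s0\<bar> < \<eta> \<Longrightarrow> \<tau> s' \<in> ball (\<tau> s0) \<epsilon>"
      using near[OF s0m N(3)] by metis
    have ev1: "\<forall>\<^sub>F k in sequentially. (\<tau> (q (\<psi> k)), h (\<psi> k) (q (\<psi> k))) \<in> N"
      by (rule topological_tendstoD[OF pl N(1,2)])
    have ev2: "\<forall>\<^sub>F k in sequentially. dist (q (\<psi> k)) s0 < \<eta>" by (rule tendstoD[OF ql \<eta>(1)])
    obtain k where k: "(\<tau> (q (\<psi> k)), h (\<psi> k) (q (\<psi> k))) \<in> N" "dist (q (\<psi> k)) s0 < \<eta>"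
      using eventually_happens[OF eventually_conj[OF ev1 ev2]] by auto
    let ?s = "q (\<psi> k)"
    have in_ball: "\<tau> x \<in> ball (\<tau> s0) \<epsilon>" if "x \<in> {s0..?s}" for x
      by (rule \<eta>(2)) (use that s0 q01[of "\<psi> k"] k(2) in \<open>auto simp: dist_real_def\<close>)
    have "\<exists>z. lift s0 z"
    proof (rule glue[OF s0(1) qge _ h N(4) in_ball])
      show "?s \<le> 1" using q01[of "\<psi> k"] by simp
      show "\<sigma> (\<tau> x) \<in> E (\<tau> x)" if "x \<in> {s0..?s}" for x using N(5) in_ball[OF that] by blast
      have "\<tau> ?s \<in> ball (\<tau> s0) \<epsilon>" by (rule in_ball) (use qge in auto)
      then show "\<sigma> (\<tau> ?s) = h (\<psi> k) ?s" using N(6) hE k(1) by metis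
    qed
    then show False using n s0 by (auto simp: A_def)
  qed
  then obtain h where h: "lift s0 h" by (auto simp: A_def)
  have "s0 = 0"
  proof (rule ccontr)
    assume "s0 \<noteq> 0"
    then have pos: "s0 > 0" using s0 by simp
    have s0m: "s0 \<in> {0..1}" using s0 by simp
    have hE: "h s0 \<in> E (\<tau> s0)" using h s0 by (auto simp: lift_def)
    from lg'[OF s0m hE h refl] obtain N \<epsilon> \<sigma> where N: "\<epsilon> > 0" "continuous_on (ball (\<tau> s0) \<epsilon>) \<sigma>"
      "\<sigma> (\<tau> s0) = h s0" "\<forall>t\<in>ball (\<tau> s0) \<epsilon>. (t, \<sigma> t) \<in> N \<and> \<sigma> t \<in> E t"
      unfolding locgraph_def by metis
    obtain \<eta> where \<eta>: "\<eta> > 0" "\<And>s'. s' \<in> {0..1} \<Longrightarrow> \<bar>s' - s0\<bar> < \<eta> \<Longrightarrow> \<tau> s' \<in> ball (\<tau> s0) \<epsilon>"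
      using near[OF s0m N(1)] by metis
    let ?s = "max 0 (s0 - \<eta> / 2)"
    have in_ball: "\<tau> x \<in> ball (\<tau> s0) \<epsilon>" if "x \<in> {?s..s0}" for x
      by (rule \<eta>(2)) (use that s0 \<eta>(1) in auto)
    have "\<exists>z. lift ?s z"
    proof (rule glue[OF _ _ s0(2) h N(2) in_ball _ N(3)])
      show "\<sigma> (\<tau> x) \<in> E (\<tau> x)" if "x \<in> {?s..s0}" for x using N(4) in_ball[OF that] by blast
    qed (use pos \<eta>(1) in auto)
    then have "?s \<in> A" using s0 \<eta>(1) by (auto simp: A_def)
    then have "s0 \<le> ?s" unfolding s0_def by (rule cInf_lower[OF _ bdd])
    then show False using pos \<eta>(1) by auto
  qed
  then show ?thesis using h by (auto simp: lift_def)
qed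

section \<open>The homotopy\<close>

lemma bil_grad_eq:
  assumes "f \<in> polyv" "(f has_derivative D) (at x)" shows "bil (grad f x) h = D h"
  using has_derivative_unique[OF has_derivative_grad[OF assms(1)] assms(2)] by simp

lemma polyv_power: "f \<in> polyv \<Longrightarrow> (\<lambda>x. f x ^ k) \<in> polyv"
  using polyv_prod[of "{..<k}" "\<lambda>_. f"] by simp

lemma peval_growth:
  fixes p :: "'n::finite cpoly"
  shows "\<exists>K\<ge>0. \<forall>x. norm (val p x) \<le> K * (1 + norm x) ^ total_degree p"
proof (intro exI conjI allI)
  let ?K = "\<Sum>m\<in>Poly_Mapping.keys p. norm (Poly_Mapping.lookup p m)"
  show "0 \<le> ?K" by (rule sum_nonneg) simp
  fix x :: "complex ^ 'n"
  have "norm (val p x) \<le> (\<Sum>m\<in>Poly_Mapping.keys p. norm (Poly_Mapping.lookup p m) * (1 + norm x) ^ total_degree p)"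
    unfolding peval_def
  proof (rule sum_norm_le)
    fix m assume m: "m \<in> Poly_Mapping.keys p"
    let ?s = "\<Sum>v\<in>Poly_Mapping.keys m. Poly_Mapping.lookup m v"
    have "?s \<le> total_degree p" unfolding total_degree_def using m by (intro Max_ge) auto
    have "(\<Prod>v\<in>Poly_Mapping.keys m. norm (x $ v) ^ Poly_Mapping.lookup m v) \<le>
        (\<Prod>v\<in>Poly_Mapping.keys m. (1 + norm x) ^ Poly_Mapping.lookup m v)"
    proof (rule prod_mono, intro conjI)
      fix v
      have "norm (x $ v) \<le> 1 + norm x" using Finite_Cartesian_Product.norm_nth_le[of x v] by simp
      then show "norm (x $ v) ^ Poly_Mapping.lookup m v \<le> (1 + norm x) ^ Poly_Mapping.lookup m v"
        by (rule power_mono) simp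
    qed simp
    also have "\<dots> = (1 + norm x) ^ ?s" by (simp add: power_sum)
    also have "\<dots> \<le> (1 + norm x) ^ total_degree p" by (rule power_increasing) (use \<open>?s \<le> _\<close> in auto)
    finally show "norm (Poly_Mapping.lookup p m * (\<Prod>v\<in>Poly_Mapping.keys m. x $ v ^ Poly_Mapping.lookup m v)) \<le>
        norm (Poly_Mapping.lookup p m) * (1 + norm x) ^ total_degree p"
      unfolding norm_mult prod_norm[symmetric] norm_power by (rule mult_left_mono) simp
  qed
  then show "norm (val p x) \<le> ?K * (1 + norm x) ^ total_degree p" by (simp add: sum_distrib_right)
qed

text \<open>Points \<open>(t, x, u)\<close> are packed into one vector, with index
  \<open>None\<close> for \<open>t\<close>, \<open>Some None\<close> for \<open>u\<close> and
  \<open>Some (Some i)\<close> for \<open>x\<close>, so that the results on square systems apply to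
  the homotopy.\<close>

abbreviation xp :: "complex ^ 'n option option \<Rightarrow> complex ^ 'n" where
  "xp \<xi> \<equiv> \<chi> i. \<xi> $ Some (Some i)"

abbreviation mk :: "complex \<Rightarrow> complex ^ 'n \<Rightarrow> complex \<Rightarrow> complex ^ 'n option option" where
  "mk t x u \<equiv> \<chi> k. case k of None \<Rightarrow> t | Some None \<Rightarrow> u | Some (Some i) \<Rightarrow> x $ i"

lemma xp_mk: "xp (mk t x u) = x"
  by (simp add: vec_eq_iff)

lemma vec_opt_eq_iff: "\<xi> = \<zeta> \<longleftrightarrow> \<xi> $ None = \<zeta> $ None \<and> \<xi> $ Some None = \<zeta> $ Some None \<and> xp \<xi> = xp \<zeta>"
  by (simp add: vec_eq_iff split_option_all)

lemma has_derivative_xp: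
  fixes f :: "complex ^ 'n::finite \<Rightarrow> complex"
  assumes "f \<in> polyv"
  shows "((\<lambda>\<xi>. f (xp \<xi>)) has_derivative (\<lambda>h. bil (grad f (xp \<xi>)) (xp h))) (at \<xi>)"
proof -
  have "bounded_linear (xp :: complex ^ 'n option option \<Rightarrow> complex ^ 'n)"
    by (rule linear_conv_bounded_linear[THEN iffD1]) (auto simp: linear_iff vec_eq_iff)
  from diff_chain_at[OF bounded_linear.has_derivative[OF this has_derivative_ident] has_derivative_grad[OF assms]]
  show ?thesis by (simp add: comp_def)
qed

locale homotopy =
  fixes Y :: "(complex ^ 'n::finite) set" and G :: "'n cpoly list"
    and a :: "nat \<times> 'n option \<Rightarrow> complex" and m' :: nat and p :: "'n cpoly" and d :: nat and c :: complex
  assumes Y: "irreducible_variety Y" "Y \<subseteq> zeros G" and m: "Suc m' = CARD('n) - rk Y"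
    and d: "d = total_degree p" "1 \<le> d"
    and nd: "\<And>x. x \<in> Y \<inter> sect a (Suc m') \<Longrightarrow> nondeg G a (Suc m') x"
    and growth: "\<exists>C. \<forall>x\<in>Y \<inter> sect a m'. norm x \<le> C * (1 + norm (lin a (Suc m') x))"
begin

text \<open>The solutions on \<open>Y\<close> only, whereas the tracker follows solutions on all of
  \<open>zeros G\<close>.\<close>

definition E :: "complex \<Rightarrow> ((complex ^ 'n) \<times> complex) set" where
  "E t = {(x, u). x \<in> Y \<and> x \<in> sect a m' \<and> (1 - t) * (u ^ d - 1) + t * val p x = 0 \<and>
     (1 - t) * lin a (Suc m') x + t * (u - c) = 0}"

text \<open>The Jacobian matrix of the homotopy with respect to \<open>(x,u)\<close> has trivial kernel.\<close>

definition hreg :: "complex \<Rightarrow> complex ^ 'n \<Rightarrow> complex \<Rightarrow> bool" where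
  "hreg t x u \<longleftrightarrow> (\<forall>v w. (\<forall>q\<in>set G. bil (grad (\<lambda>x. val q x) x) v = 0) \<and>
     (\<forall>k\<in>{1..m'}. bil (\<chi> i. a (k, Some i)) v = 0) \<and>
     (1 - t) * (of_nat d * u ^ (d - 1) * w) + t * bil (grad (\<lambda>x. val p x) x) v = 0 \<and>
     (1 - t) * bil (\<chi> i. a (Suc m', Some i)) v + t * w = 0 \<longrightarrow> v = 0 \<and> w = 0)"

definition eq1 :: "complex ^ 'n option option \<Rightarrow> complex" where
  "eq1 \<xi> = (1 - \<xi> $ None) * (\<xi> $ Some None ^ d - 1) + \<xi> $ None * val p (xp \<xi>)"

definition eq2 :: "complex ^ 'n option option \<Rightarrow> complex" where
  "eq2 \<xi> = (1 - \<xi> $ None) * lin a (Suc m') (xp \<xi>) + \<xi> $ None * (\<xi> $ Some None - c)"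

text \<open>The parameter \<open>t\<close> is included as an equation of its own. A local inverse of
  the square system is then an implicit function of \<open>t\<close>.\<close>

definition HH :: "(complex ^ 'n option option \<Rightarrow> complex) set" where
  "HH = (\<lambda>k \<xi>. lin a k (xp \<xi>)) ` {1..m'} \<union> {eq1, eq2, \<lambda>\<xi>. \<xi> $ None}"

lemma lift_polyv: "f \<in> polyv \<Longrightarrow> (\<lambda>\<xi>. f (xp \<xi>)) \<in> polyv"
  by (erule polyv_subst) (simp add: polyv_nth)

lemma eq1_polyv: "eq1 \<in> polyv"
  unfolding eq1_def[abs_def]
  by (intro polyv_add polyv_mult polyv_diff polyv_power polyv_const polyv_nth lift_polyv val_polyv)

lemma eq2_polyv: "eq2 \<in> polyv"
  unfolding eq2_def[abs_def]
  by (intro polyv_add polyv_mult polyv_diff polyv_const polyv_nth lift_polyv lin_polyv)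

lemma HH_polyv: "HH \<subseteq> polyv"
  unfolding HH_def using eq1_polyv eq2_polyv by (auto intro: polyv_nth lift_polyv lin_polyv)

lemma card_HH: "finite HH" "card HH \<le> m' + 3"
proof -
  show "finite HH" by (simp add: HH_def)
  have "card HH \<le> card ((\<lambda>k (\<xi> :: complex ^ 'n option option). lin a k (xp \<xi>)) ` {1..m'}) +
      card {eq1, eq2, \<lambda>\<xi>. \<xi> $ None}"
    unfolding HH_def by (rule card_Un_le)
  also have "\<dots> \<le> m' + 3"
    using card_image_le[of "{1..m'}" "\<lambda>k (\<xi> :: complex ^ 'n option option). lin a k (xp \<xi>)"]
    by (intro add_mono) (auto simp: card_insert_if)
  finally show "card HH \<le> m' + 3" .
qed

lemma bil_lift: "f \<in> polyv \<Longrightarrow> bil (grad (\<lambda>\<xi>. f (xp \<xi>)) \<xi>) h = bil (grad f (xp \<xi>)) (xp h)"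
  by (rule bil_grad_eq[OF lift_polyv has_derivative_xp])

lemma bil_eq1: "bil (grad eq1 \<xi>) h = h $ None * (val p (xp \<xi>) - (\<xi> $ Some None ^ d - 1)) +
   (1 - \<xi> $ None) * (of_nat d * \<xi> $ Some None ^ (d - 1) * h $ Some None) + \<xi> $ None * bil (grad (\<lambda>x. val p x) (xp \<xi>)) (xp h)"
proof (rule bil_grad_eq[OF eq1_polyv])
  show "(eq1 has_derivative (\<lambda>h. h $ None * (val p (xp \<xi>) - (\<xi> $ Some None ^ d - 1)) +
     (1 - \<xi> $ None) * (of_nat d * \<xi> $ Some None ^ (d - 1) * h $ Some None) +
     \<xi> $ None * bil (grad (\<lambda>x. val p x) (xp \<xi>)) (xp h))) (at \<xi>)"
    unfolding eq1_def[abs_def]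
    by (rule has_derivative_eq_rhs,
        (rule has_derivative_add has_derivative_mult has_derivative_diff has_derivative_const
          has_derivative_power has_derivative_nth has_derivative_xp val_polyv)+)
      (simp add: fun_eq_iff algebra_simps vec_lambda_inverse)
qed

lemma bil_eq2: "bil (grad eq2 \<xi>) h = h $ None * ((\<xi> $ Some None - c) - lin a (Suc m') (xp \<xi>)) +
   (1 - \<xi> $ None) * bil (\<chi> i. a (Suc m', Some i)) (xp h) + \<xi> $ None * h $ Some None"
proof (rule bil_grad_eq[OF eq2_polyv])
  show "(eq2 has_derivative (\<lambda>h. h $ None * ((\<xi> $ Some None - c) - lin a (Suc m') (xp \<xi>)) +
     (1 - \<xi> $ None) * bil (\<chi> i. a (Suc m', Some i)) (xp h) + \<xi> $ None * h $ Some None)) (at \<xi>)"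
    unfolding eq2_def[abs_def]
    by (rule has_derivative_eq_rhs,
        (rule has_derivative_add has_derivative_mult has_derivative_diff has_derivative_const
          has_derivative_nth has_derivative_xp lin_polyv)+)
      (simp add: fun_eq_iff algebra_simps grad_lin)
qed

lemma bil_None: "bil (grad (\<lambda>\<xi>. \<xi> $ None) \<xi>) h = (h :: complex ^ 'n option option) $ None"
  by (rule bil_grad_eq[OF polyv_nth has_derivative_nth])

lemma kernel_HH:
  "(\<forall>g\<in>HH. bil (grad g \<xi>) h = 0) \<longleftrightarrow> h $ None = 0 \<and> (\<forall>k\<in>{1..m'}. bil (\<chi> i. a (k, Some i)) (xp h) = 0) \<and>
    (1 - \<xi> $ None) * (of_nat d * \<xi> $ Some None ^ (d - 1) * h $ Some None) + \<xi> $ None * bil (grad (\<lambda>x. val p x) (xp \<xi>)) (xp h) = 0 \<and>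
    (1 - \<xi> $ None) * bil (\<chi> i. a (Suc m', Some i)) (xp h) + \<xi> $ None * h $ Some None = 0"
  unfolding HH_def by (auto simp: ball_Un bil_eq1 bil_eq2 bil_None bil_lift[OF lin_polyv] grad_lin)

lemma hreg_kernel:
  "hreg (\<xi> $ None) (xp \<xi>) (\<xi> $ Some None) \<longleftrightarrow>
    (\<forall>h. (\<forall>q\<in>set G. bil (grad (\<lambda>x. val q x) (xp \<xi>)) (xp h) = 0) \<and> (\<forall>g\<in>HH. bil (grad g \<xi>) h = 0) \<longrightarrow> h = 0)"
  (is "?l = ?r")
proof
  assume l: ?l
  show ?r
  proof (intro allI impI)
    fix h assume h: "(\<forall>q\<in>set G. bil (grad (\<lambda>x. val q x) (xp \<xi>)) (xp h) = 0) \<and> (\<forall>g\<in>HH. bil (grad g \<xi>) h = 0)"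
    then have "xp h = 0 \<and> h $ Some None = 0" "h $ None = 0"
      using l[unfolded hreg_def, rule_format, of "xp h" "h $ Some None"] unfolding kernel_HH by auto
    then show "h = 0" unfolding vec_opt_eq_iff[of h 0] by (simp add: vec_eq_iff)
  qed
next
  assume r: ?r
  show ?l unfolding hreg_def
  proof (intro allI impI)
    fix v w
    assume vw: "(\<forall>q\<in>set G. bil (grad (\<lambda>x. val q x) (xp \<xi>)) v = 0) \<and> (\<forall>k\<in>{1..m'}. bil (\<chi> i. a (k, Some i)) v = 0) \<and>
     (1 - \<xi> $ None) * (of_nat d * \<xi> $ Some None ^ (d - 1) * w) + \<xi> $ None * bil (grad (\<lambda>x. val p x) (xp \<xi>)) v = 0 \<and>
     (1 - \<xi> $ None) * bil (\<chi> i. a (Suc m', Some i)) v + \<xi> $ None * w = 0"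
    have "mk 0 v w = 0"
      by (rule r[rule_format]) (use vw in \<open>simp add: kernel_HH xp_mk\<close>)
    then have "xp (mk 0 v w) = 0" "(mk 0 v w) $ Some None = 0" by (simp_all add: vec_eq_iff)
    then show "v = 0 \<and> w = 0" unfolding xp_mk by simp
  qed
qed

text \<open>Besides the chart for the homotopy, regularity yields that the equations
  \<open>G\<close> have rank \<open>rk Y\<close> at the point: a smaller rank would leave too few
  rows.\<close>

lemma hreg_rows:
  assumes x: "xp \<xi> \<in> Y" and reg: "hreg (\<xi> $ None) (xp \<xi>) (\<xi> $ Some None)"
  obtains g :: "'n option option \<Rightarrow> complex ^ 'n option option \<Rightarrow> complex" and I
    and g0 :: "'n \<Rightarrow> complex ^ 'n \<Rightarrow> complex" and I0
  where "det (jac g0 (xp \<xi>)) \<noteq> 0" "\<forall>i. g0 i \<in> polyv" "\<forall>i\<in>I0. g0 i \<in> vals G" "card I0 = rk Y"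
    "det (jac g \<xi>) \<noteq> 0" "\<forall>i. g i \<in> polyv" "g ` I = (\<lambda>i \<xi>. g0 i (xp \<xi>)) ` I0" "g ` (- I) = HH" "inj g"
    "jac_rank G (xp \<xi>) = rk Y"
proof -
  obtain g0 :: "'n \<Rightarrow> complex ^ 'n \<Rightarrow> complex" and I0 where g0: "card I0 = vec.dim (grads (vals G) (xp \<xi>))"
    "\<And>i. i \<in> I0 \<Longrightarrow> g0 i \<in> vals G" "\<And>i. i \<notin> I0 \<Longrightarrow> g0 i \<in> coords" "det (jac g0 (xp \<xi>)) \<noteq> 0"
    using complete_rows[OF span_coords] by metis
  have g0p: "g0 i \<in> polyv" for i using g0(2,3)[of i] vals_polyv[of G] coords_polyv by (cases "i \<in> I0") auto
  let ?R = "(\<lambda>i. jac g0 (xp \<xi>) $ i) ` I0"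
  have cR: "card ?R = card I0" using independent_rows(1)[OF g0(4)] by (simp add: card_image inj_on_subset)
  have spR: "grads (vals G) (xp \<xi>) \<subseteq> vec.span ?R"
  proof (rule vec.card_ge_dim_independent[OF _ independent_rows(2)[OF g0(4)]])
    show "?R \<subseteq> grads (vals G) (xp \<xi>)" using g0(2) by (auto simp: jac_def)
  qed (simp add: cR g0(1))
  let ?L = "(\<lambda>i \<xi>. g0 i (xp \<xi>)) ` I0"
  have "vec.dim (grads (?L \<union> HH) \<xi>) = CARD('n option option)" unfolding full_rank_iff
  proof (intro allI impI)
    fix h assume h: "\<forall>f\<in>?L \<union> HH. bil (grad f \<xi>) h = 0"
    have "bil (grad (g0 i) (xp \<xi>)) (xp h) = 0" if "i \<in> I0" for i
      using h that bil_lift[OF g0p, of i \<xi> h] by auto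
    then have "bil w (xp h) = 0" if "w \<in> ?R" for w using that by (auto simp: jac_def)
    then have "bil (grad (\<lambda>x. val q x) (xp \<xi>)) (xp h) = 0" if "q \<in> set G" for q
      using bil_span_zero[of "grad (\<lambda>x. val q x) (xp \<xi>)" ?R "xp h"] spR that by blast
    then show "h = 0" using reg h unfolding hreg_kernel by blast
  qed
  then have sp: "vec.span (grads (?L \<union> HH) \<xi>) = UNIV" by (simp only: full_rank_span)
  have "\<exists>(g :: 'n option option \<Rightarrow> complex ^ 'n option option \<Rightarrow> complex) I.
      (\<forall>i\<in>I. g i \<in> ?L) \<and> (\<forall>i. i \<notin> I \<longrightarrow> g i \<in> HH) \<and> det (jac g \<xi>) \<noteq> 0"
  proof (rule complete_rows[OF sp])
    fix g :: "'n option option \<Rightarrow> complex ^ 'n option option \<Rightarrow> complex" and I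
    assume "\<And>i. i \<in> I \<Longrightarrow> g i \<in> ?L" "\<And>i. i \<notin> I \<Longrightarrow> g i \<in> HH" "det (jac g \<xi>) \<noteq> 0"
    then show ?thesis by (intro exI[of _ g] exI[of _ I] conjI ballI allI impI) assumption+
  qed
  then obtain g :: "'n option option \<Rightarrow> complex ^ 'n option option \<Rightarrow> complex" and I where
    g': "\<forall>i\<in>I. g i \<in> ?L" "\<forall>i. i \<notin> I \<longrightarrow> g i \<in> HH" "det (jac g \<xi>) \<noteq> 0" by (elim exE conjE)
  have g: "\<And>i. i \<in> I \<Longrightarrow> g i \<in> ?L" "\<And>i. i \<notin> I \<Longrightarrow> g i \<in> HH" "det (jac g \<xi>) \<noteq> 0"
    using g' by simp_all
  have gp: "g i \<in> polyv" for i
  proof (cases "i \<in> I")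
    case True
    then obtain j where "g i = (\<lambda>\<xi>. g0 j (xp \<xi>))" using g(1)[of i] by blast
    then show ?thesis by (simp only: lift_polyv[OF g0p])
  next
    case False
    then show ?thesis using g(2)[of i] HH_polyv by blast
  qed
  have inj: "inj g"
  proof (rule injI)
    fix i j assume "g i = g j"
    then have "jac g \<xi> $ i = jac g \<xi> $ j" by (simp add: jac_def)
    then show "i = j" using independent_rows(1)[OF g(3)] by (auto dest: injD)
  qed
  have cI: "card (g ` J) = card J" for J using inj by (simp add: card_image inj_on_subset)
  have subI: "g ` I \<subseteq> ?L" using g(1) by auto
  have subH: "g ` (- I) \<subseteq> HH" using g(2) by auto
  have le1: "card I \<le> card ?L" using card_mono[OF _ subI] cI[of I] by simp
  have le2: "card ?L \<le> card I0" by (rule card_image_le) simp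
  have le3: "card I0 \<le> rk Y" using jac_rank_le_rk[OF x Y(2)] g0(1) by (simp add: jac_rank_eq)
  \<comment> \<open>The \<open>CARD('n) + 2\<close> rows equal \<open>rk Y\<close> plus
    \<open>m' + 3\<close>. At most \<open>rk Y\<close> of them come from \<open>G\<close> and at
    most \<open>m' + 3\<close> from \<open>HH\<close>, so all estimates are equalities.\<close>
  have cN: "CARD('n option option) = CARD('n) + 2" by simp
  have "card (- I) = CARD('n option option) - card I"
    by (simp add: Compl_eq_Diff_UNIV card_Diff_subset)
  moreover have "card I \<le> CARD('n option option)" by (rule card_mono) auto
  moreover have leH: "card (- I) \<le> card HH" using card_mono[OF card_HH(1) subH] cI[of "- I"] by simp
  ultimately have ge: "rk Y \<le> card I" "card HH \<le> card (- I) + (card I - rk Y)"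
    using card_HH(2) m cN by linarith+
  have eq: "card I = rk Y" "card I0 = rk Y" "card ?L = rk Y" using le1 le2 le3 ge(1) by linarith+
  have "g ` I = ?L" by (rule card_subset_eq[OF _ subI]) (use cI[of I] eq in auto)
  moreover have "g ` (- I) = HH"
    by (rule card_subset_eq[OF card_HH(1) subH]) (use cI[of "- I"] eq ge(2) leH in auto)
  moreover have "jac_rank G (xp \<xi>) = rk Y" using g0(1) eq(2) by (simp add: jac_rank_eq)
  ultimately show thesis
    using that[of g0 I0 g I] g0(2,4) g0p eq(2) g(3) gp inj by blast
qed

lemma regular_nbhd:
  assumes x: "x \<in> Y" "jac_rank G x = rk Y"
  shows "\<exists>U. open U \<and> x \<in> U \<and> zeros G \<inter> U \<subseteq> Y"
proof -
  have "vec.dim (grads (vals G) x) = rk Y" using x(2) by (simp add: jac_rank_eq)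
  then obtain g :: "'n \<Rightarrow> complex ^ 'n \<Rightarrow> complex" and I where g: "card I = rk Y" "\<And>i. g i \<in> polyv"
    "\<And>i. i \<in> I \<Longrightarrow> g i \<in> vals G" "det (jac g x) \<noteq> 0"
    using rk_rows[OF x(1) vals_vanish[OF Y(2)]] by metis
  have gv: "g i \<in> vanish Y" if "i \<in> I" for i using g(3)[OF that] vals_vanish[OF Y(2)] by auto
  obtain U where U: "open U" "x \<in> U" "\<And>y. y \<in> U \<Longrightarrow> (\<And>i. i \<in> I \<Longrightarrow> g i y = 0) \<Longrightarrow> y \<in> Y"
    using regular_local[OF Y(1) g(2) gv g(1) x(1) g(4)] by metis
  have "zeros G \<inter> U \<subseteq> Y"
  proof
    fix y assume y: "y \<in> zeros G \<inter> U"
    show "y \<in> Y"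
    proof (rule U(3))
      fix i assume "i \<in> I"
      then show "g i y = 0" using g(3)[of i] y by (auto simp: zeros_def)
    qed (use y in auto)
  qed
  then show ?thesis using U(1,2) by blast
qed

abbreviation WW :: "(complex \<times> (complex ^ 'n) \<times> complex) set" where
  "WW \<equiv> {(t, x, u). hreg t x u}"

lemma continuous_mk: "continuous_on UNIV (\<lambda>(t, x :: complex ^ 'n, u). mk t x u)"
proof -
  have "continuous_on UNIV (\<lambda>z :: complex \<times> (complex ^ 'n) \<times> complex. mk (fst z) (fst (snd z)) (snd (snd z)))"
  proof (rule continuous_on_vec_lambda)
    fix k :: "'n option option"
    show "continuous_on UNIV (\<lambda>z :: complex \<times> (complex ^ 'n) \<times> complex.
        case k of None \<Rightarrow> fst z | Some None \<Rightarrow> snd (snd z) | Some (Some i) \<Rightarrow> fst (snd z) $ i)"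
      by (cases k; cases "the k") (auto intro!: continuous_intros)
  qed
  then show ?thesis by (simp add: case_prod_beta)
qed

text \<open>The local graph is the image of the line \<open>y t\<close> under the inverse of the
  chart. Its points remain on \<open>Y\<close> because near \<open>x0\<close> the equations chosen
  from \<open>G\<close> already define \<open>Y\<close>.\<close>

lemma locgraph_E:
  assumes z0: "(x0, u0) \<in> E t0" and reg: "hreg t0 x0 u0"
  shows "locgraph E WW t0 (x0, u0)"
proof -
  let ?\<xi> = "mk t0 x0 u0"
  have xi: "xp ?\<xi> = x0" "?\<xi> $ None = t0" "?\<xi> $ Some None = u0" by (simp_all add: xp_mk)
  have x0: "x0 \<in> Y" using z0 by (simp add: E_def)
  have x': "xp ?\<xi> \<in> Y" and r': "hreg (?\<xi> $ None) (xp ?\<xi>) (?\<xi> $ Some None)" using x0 reg unfolding xi by simp_all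
  obtain g :: "'n option option \<Rightarrow> complex ^ 'n option option \<Rightarrow> complex" and I
    and g0 :: "'n \<Rightarrow> complex ^ 'n \<Rightarrow> complex" and I0
  where g: "det (jac g0 (xp ?\<xi>)) \<noteq> 0" "\<forall>i. g0 i \<in> polyv" "\<forall>i\<in>I0. g0 i \<in> vals G" "card I0 = rk Y"
    "det (jac g ?\<xi>) \<noteq> 0" "\<forall>i. g i \<in> polyv" "g ` I = (\<lambda>i \<xi>. g0 i (xp \<xi>)) ` I0" "g ` (- I) = HH" "inj g"
    "jac_rank G (xp ?\<xi>) = rk Y"
    by (rule hreg_rows[OF x' r'])
  have gv: "g0 i \<in> vanish Y" if "i \<in> I0" for i using g(3) that vals_vanish[OF Y(2)] by blast
  have g0p: "g0 i \<in> polyv" and gp: "g k \<in> polyv" for i k using g(2,6) by auto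
  obtain U1 where U1: "open U1" "x0 \<in> U1" "\<And>x. x \<in> U1 \<Longrightarrow> (\<And>i. i \<in> I0 \<Longrightarrow> g0 i x = 0) \<Longrightarrow> x \<in> Y"
    using regular_local[OF Y(1) g0p gv g(4) x0 g(1)[unfolded xi]] by metis
  have cxp: "continuous_on UNIV (xp :: complex ^ 'n option option \<Rightarrow> complex ^ 'n)"
    by (intro continuous_on_vec_lambda continuous_intros)
  have S: "open (xp -` U1)" by (rule open_vimage[OF U1(1) cxp])
  have S0: "?\<xi> \<in> xp -` U1" using U1(2) unfolding vimage_eq xi .
  obtain U V \<Psi> where U: "open U" "?\<xi> \<in> U" "U \<subseteq> xp -` U1" "open V"
    "homeomorphism U V (\<lambda>\<xi>. \<chi> i. g i \<xi>) \<Psi>" "\<And>\<xi>. \<xi> \<in> U \<Longrightarrow> det (jac g \<xi>) \<noteq> 0"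
    using poly_inverse_function[OF gp g(5) S S0] by metis
  let ?\<Phi> = "\<lambda>\<xi>. \<chi> i. g i \<xi>"
  have \<Psi>: "continuous_on V \<Psi>" "\<And>y. y \<in> V \<Longrightarrow> \<Psi> y \<in> U \<and> ?\<Phi> (\<Psi> y) = y" "\<And>\<xi>. \<xi> \<in> U \<Longrightarrow> ?\<Phi> \<xi> \<in> V \<and> \<Psi> (?\<Phi> \<xi>) = \<xi>"
    using U(5) by (auto simp: homeomorphism_def)
  have "(\<lambda>\<xi>. \<xi> $ None) \<in> g ` (- I)" unfolding g(8) by (simp add: HH_def)
  then obtain \<kappa> where \<kappa>: "\<kappa> \<notin> I" "g \<kappa> = (\<lambda>\<xi>. \<xi> $ None)" by auto
  define y where "y t = (\<chi> i. if i = \<kappa> then t else (0 :: complex))" for t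
  have sol: "?\<Phi> (mk t x u) = y t" if "(x, u) \<in> E t" for t x u
  proof -
    have 1: "g i (mk t x u) = 0" if "i \<in> I" for i
    proof -
      obtain j where "j \<in> I0" "g i = (\<lambda>\<xi>. g0 j (xp \<xi>))" using g(7) \<open>i \<in> I\<close> by blast
      then show ?thesis using gv[of j] \<open>(x, u) \<in> E t\<close> by (simp add: xp_mk E_def vanish_def)
    qed
    have 2: "g i (mk t x u) = 0" if "i \<notin> I" "i \<noteq> \<kappa>" for i
    proof -
      have "g i \<in> HH" using g(8) \<open>i \<notin> I\<close> by blast
      moreover have "g i \<noteq> (\<lambda>\<xi>. \<xi> $ None)" using injD[OF g(9), of i \<kappa>] \<kappa>(2) \<open>i \<noteq> \<kappa>\<close> by auto
      ultimately show ?thesis using \<open>(x, u) \<in> E t\<close>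
        by (auto simp: HH_def E_def sect_def eq1_def eq2_def xp_mk)
    qed
    show ?thesis using 1 2 \<kappa> by (auto simp: y_def vec_eq_iff)
  qed
  have ycont: "continuous_on UNIV y" unfolding y_def
  proof (rule continuous_on_vec_lambda)
    fix i show "continuous_on UNIV (\<lambda>t. if i = \<kappa> then t else 0 :: complex)"
      by (cases "i = \<kappa>") (auto intro: continuous_intros)
  qed
  have "y t0 \<in> V" using sol[OF z0] \<Psi>(3)[OF U(2)] by simp
  moreover have "open (y -` V)" by (rule open_vimage[OF U(4) ycont])
  ultimately obtain \<epsilon> where \<epsilon>: "\<epsilon> > 0" "ball t0 \<epsilon> \<subseteq> y -` V" using openE[of "y -` V" t0] by auto
  define \<sigma> where "\<sigma> t = (xp (\<Psi> (y t)), \<Psi> (y t) $ Some None)" for t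
  define N where "N = (\<lambda>(t, x, u). mk t x u) -` U"
  have "open N" unfolding N_def by (rule open_vimage[OF U(1) continuous_mk])
  moreover have "N \<subseteq> WW"
  proof
    fix z assume "z \<in> N"
    then obtain t x u where z: "z = (t, x, u)" "mk t x u \<in> U" by (cases z) (auto simp: N_def)
    let ?\<zeta> = "mk t x u"
    have dz: "det (jac g ?\<zeta>) \<noteq> 0" by (rule U(6)[OF z(2)])
    have "hreg (?\<zeta> $ None) (xp ?\<zeta>) (?\<zeta> $ Some None)" unfolding hreg_kernel
    proof (intro allI impI)
      fix h assume h: "(\<forall>q\<in>set G. bil (grad (\<lambda>x. val q x) (xp ?\<zeta>)) (xp h) = 0) \<and> (\<forall>g\<in>HH. bil (grad g ?\<zeta>) h = 0)"
      have "bil (grad (g i) ?\<zeta>) h = 0" for i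
      proof (cases "i \<in> I")
        case True
        then obtain j where j: "j \<in> I0" "g i = (\<lambda>\<xi>. g0 j (xp \<xi>))" using g(7) by blast
        obtain q where q: "q \<in> set G" "g0 j = (\<lambda>x. val q x)" using g(3) j(1) by blast
        show ?thesis unfolding j(2) bil_lift[OF g0p] unfolding q(2) using h q(1) by blast
      next
        case False
        then show ?thesis using h g(8) by blast
      qed
      then have "jac g ?\<zeta> *v h = 0" by (simp add: vec_eq_iff matrix_vector_bil jac_def)
      then show "h = 0" using det_zero_kernel dz by blast
    qed
    then show "z \<in> WW" unfolding z(1) xp_mk by simp
  qed
  moreover have "(t0, x0, u0) \<in> N" using U(2) by (simp add: N_def)
  moreover have "continuous_on (ball t0 \<epsilon>) \<sigma>"
  proof -
    have 1: "continuous_on (ball t0 \<epsilon>) (\<lambda>t. \<Psi> (y t))"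
      by (rule continuous_on_compose2[OF \<Psi>(1) continuous_on_subset[OF ycont]]) (use \<epsilon>(2) in auto)
    show ?thesis unfolding \<sigma>_def
      by (intro continuous_on_Pair continuous_on_vec_lambda continuous_on_component 1)
  qed
  moreover have unique: "(x, u) = \<sigma> t" if "(x, u) \<in> E t" "(t, x, u) \<in> N" for t x u
  proof -
    have "\<Psi> (y t) = mk t x u" using \<Psi>(3)[of "mk t x u"] that(2) sol[OF that(1)] by (simp add: N_def)
    then show ?thesis unfolding \<sigma>_def by (simp add: xp_mk)
  qed
  then have "\<sigma> t0 = (x0, u0)" using z0 \<open>(t0, x0, u0) \<in> N\<close> by simp
  moreover have "(t, \<sigma> t) \<in> N \<and> \<sigma> t \<in> E t" if "t \<in> ball t0 \<epsilon>" for t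
  proof -
    let ?\<zeta> = "\<Psi> (y t)"
    have yV: "y t \<in> V" using \<epsilon>(2) that by blast
    have z: "?\<zeta> \<in> U" "?\<Phi> ?\<zeta> = y t" using \<Psi>(2)[OF yV] by auto
    have gi: "g i ?\<zeta> = (if i = \<kappa> then t else 0)" for i using arg_cong[OF z(2), of "\<lambda>v. v $ i"] by (simp add: y_def)
    have t: "?\<zeta> $ None = t" using gi[of \<kappa>] \<kappa>(2) by simp
    have mk: "mk t (fst (\<sigma> t)) (snd (\<sigma> t)) = ?\<zeta>"
      unfolding vec_opt_eq_iff by (simp add: xp_mk \<sigma>_def t)
    have "(t, \<sigma> t) \<in> N" using z(1) mk by (simp add: N_def case_prod_beta)
    moreover have H: "h ?\<zeta> = 0" if "h \<in> HH" "h \<noteq> (\<lambda>\<xi>. \<xi> $ None)" for h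
    proof -
      obtain i where "i \<notin> I" "h = g i" using g(8) \<open>h \<in> HH\<close> by blast
      then show ?thesis using gi[of i] \<kappa>(2) that(2) by auto
    qed
    have "xp ?\<zeta> \<in> Y"
    proof (rule U1(3))
      show "xp ?\<zeta> \<in> U1" using z(1) U(3) by auto
      fix j assume "j \<in> I0"
      then have "(\<lambda>\<xi>. g0 j (xp \<xi>)) \<in> g ` I" unfolding g(7) by blast
      then obtain i where i: "i \<in> I" "(\<lambda>\<xi>. g0 j (xp \<xi>)) = g i" by blast
      have "g0 j (xp ?\<zeta>) = g i ?\<zeta>" by (rule fun_cong[OF i(2)])
      then show "g0 j (xp ?\<zeta>) = 0" using gi[of i] i(1) \<kappa>(1) by auto
    qed
    moreover have "lin a k (xp ?\<zeta>) = 0" if "k \<in> {1..m'}" for k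
    proof -
      \<comment> \<open>\<open>HH\<close> is a set of functions, so an equation has to be
        distinguished from the coordinate \<open>t\<close>, the only row whose value is not 0 along
        \<open>y t\<close>.\<close>
      have ne: "(\<lambda>\<xi>. lin a k (xp \<xi>)) \<noteq> (\<lambda>\<xi> :: complex ^ 'n option option. \<xi> $ None)"
      proof
        assume eq: "(\<lambda>\<xi>. lin a k (xp \<xi>)) = (\<lambda>\<xi> :: complex ^ 'n option option. \<xi> $ None)"
        have "lin a k (xp (mk 0 0 0)) = (mk 0 0 0 :: complex ^ 'n option option) $ None"
          "lin a k (xp (mk 1 0 0)) = (mk 1 0 0 :: complex ^ 'n option option) $ None"
          by (rule fun_cong[OF eq])+
        then show False unfolding xp_mk by simp
      qed
      have "(\<lambda>\<xi>. lin a k (xp \<xi>)) \<in> HH" using that by (auto simp: HH_def)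
      from H[OF this ne] show ?thesis .
    qed
    moreover have "eq1 ?\<zeta> = 0"
    proof (rule H)
      show "eq1 \<in> HH" by (simp add: HH_def)
      show "eq1 \<noteq> (\<lambda>\<xi>. \<xi> $ None)"
      proof
        assume "eq1 = (\<lambda>\<xi>. \<xi> $ None)"
        then have "eq1 (mk 0 0 0) = 0" by simp
        then show False using d(2) by (simp add: eq1_def power_0_left)
      qed
    qed
    moreover have "eq2 ?\<zeta> = 0"
    proof (rule H)
      show "eq2 \<in> HH" by (simp add: HH_def)
      show "eq2 \<noteq> (\<lambda>\<xi>. \<xi> $ None)"
      proof
        assume e: "eq2 = (\<lambda>\<xi>. \<xi> $ None)"
        have "eq2 (mk 1 0 (c + 2)) = 1" "eq2 (mk 1 0 (c + 1)) = 1" by (simp_all add: e)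
        then show False by (simp add: eq2_def)
      qed
    qed
    ultimately show ?thesis unfolding \<sigma>_def E_def eq1_def eq2_def by (auto simp: sect_def t)
  qed
  moreover have "z = \<sigma> t" if "z \<in> E t" "(t, z) \<in> N" for t z
    using unique[of "fst z" "snd z" t] that by simp
  ultimately show ?thesis unfolding locgraph_def using \<epsilon>(1)
    by (intro exI[of _ N] exI[of _ \<epsilon>] exI[of _ \<sigma>] conjI ballI impI) simp_all
qed

section \<open>Fibres near the start of the homotopy\<close>

lemma closed_E: "closed (SIGMA t:UNIV. E t)"
proof -
  let ?T = "\<lambda>z :: complex \<times> (complex ^ 'n) \<times> complex. fst z" and ?X = "\<lambda>z :: complex \<times> (complex ^ 'n) \<times> complex. fst (snd z)"
    and ?U = "\<lambda>z :: complex \<times> (complex ^ 'n) \<times> complex. snd (snd z)"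
  have f: "continuous_on UNIV (\<lambda>z. h (?X z))" if "h \<in> polyv" for h :: "complex ^ 'n \<Rightarrow> complex"
    by (rule continuous_on_compose2[OF polyv_continuous[OF that, of UNIV]]) (auto intro!: continuous_intros)
  have A: "closed (?X -` A)" if "algebraic_set A" for A
    by (rule closed_vimage[OF algebraic_set_closed[OF that]]) (intro continuous_intros)
  have Z: "closed {z. h z = 0}" if "continuous_on UNIV h" for h :: "complex \<times> (complex ^ 'n) \<times> complex \<Rightarrow> complex"
    using closed_vimage[OF closed_singleton that, of 0] by (simp add: vimage_def)
  have "(SIGMA t:UNIV. E t) = ?X -` Y \<inter> ?X -` sect a m' \<inter> {z. (1 - ?T z) * (?U z ^ d - 1) + ?T z * val p (?X z) = 0}
     \<inter> {z. (1 - ?T z) * lin a (Suc m') (?X z) + ?T z * (?U z - c) = 0}"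
    by (auto simp: E_def)
  moreover have "closed \<dots>"
  proof (intro closed_Int)
    show "closed (?X -` Y)" by (rule A[OF irreducible_imp_algebraic[OF Y(1)]])
    show "closed (?X -` sect a m')" by (rule A[OF algebraic_set_sect])
    have h1: "continuous_on UNIV (\<lambda>z. val p (?X z))" by (rule f[OF val_polyv])
    have h2: "continuous_on UNIV (\<lambda>z. lin a (Suc m') (?X z))" by (rule f[OF lin_polyv])
    show "closed {z. (1 - ?T z) * (?U z ^ d - 1) + ?T z * val p (?X z) = 0}"
      by (rule Z) (intro continuous_on_add continuous_on_mult continuous_on_diff continuous_on_power
          continuous_on_const continuous_on_fst continuous_on_snd continuous_on_id h1)
    show "closed {z. (1 - ?T z) * lin a (Suc m') (?X z) + ?T z * (?U z - c) = 0}"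
      by (rule Z) (intro continuous_on_add continuous_on_mult continuous_on_diff
          continuous_on_const continuous_on_fst continuous_on_snd continuous_on_id h2)
  qed
  ultimately show ?thesis by simp
qed

text \<open>The growth bound and the linear equation control \<open>x\<close> linearly by
  \<open>u\<close>. As \<open>d\<close> is the degree of \<open>p\<close>, the term
  \<open>u ^ d\<close> dominates \<open>t * val p x\<close> for small \<open>t\<close>, which bounds
  \<open>u\<close>.\<close>

lemma locbdd_0: "locbdd E 0"
proof -
  obtain C0 where C0: "\<And>x. x \<in> Y \<inter> sect a m' \<Longrightarrow> norm x \<le> C0 * (1 + norm (lin a (Suc m') x))" using growth by blast
  define C where "C = max C0 0"
  have C: "0 \<le> C" "\<And>x. x \<in> Y \<inter> sect a m' \<Longrightarrow> norm x \<le> C * (1 + norm (lin a (Suc m') x))"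
  proof -
    fix x assume "x \<in> Y \<inter> sect a m'"
    then have "norm x \<le> C0 * (1 + norm (lin a (Suc m') x))" by (rule C0)
    also have "\<dots> \<le> C * (1 + norm (lin a (Suc m') x))" by (rule mult_right_mono) (simp_all add: C_def)
    finally show "norm x \<le> C * (1 + norm (lin a (Suc m') x))" .
  qed (simp add: C_def)
  obtain K where K: "K \<ge> 0" "\<And>x. norm (val p x) \<le> K * (1 + norm x) ^ d" using peval_growth[of p] d(1) by auto
  define A where "A = 1 + C + norm c"
  define M where "M = max A 2"
  \<comment> \<open>The three terms keep the norm of \<open>1 - t\<close> at least 1/2, the
    coefficient of \<open>norm u\<close> in the bound for \<open>norm x\<close> at most 1, and the
    contribution of \<open>val p x\<close> at most half of \<open>norm u ^ d\<close>.\<close>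
  define \<epsilon> where "\<epsilon> = min (1 / 2) (min (1 / (2 * C + 1)) (1 / (4 * K * 2 ^ d + 1)))"
  have pos: "0 < 4 * K * 2 ^ d + 1" using K(1) by (intro add_nonneg_pos) auto
  have \<epsilon>: "\<epsilon> > 0" using C(1) pos by (simp add: \<epsilon>_def)
  have A: "A \<ge> 1" using C(1) by (simp add: A_def)
  have bound: "norm u \<le> M \<and> norm x \<le> A + M" if t: "norm t < \<epsilon>" and z: "(x, u) \<in> E t" for t x u
  proof -
    have t1: "norm t \<le> 1 / 2" "norm t * (2 * C + 1) \<le> 1" "norm t * (4 * K * 2 ^ d + 1) \<le> 1"
      using t C(1) pos by (auto simp: \<epsilon>_def field_simps)
    have "2 * norm t * C = norm t * (2 * C + 1) - norm t" by (simp add: algebra_simps)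
    then have t2: "2 * norm t * C \<le> 1" using t1(2) norm_ge_zero[of t] by linarith
    have "2 * (2 * norm t * K * 2 ^ d) = norm t * (4 * K * 2 ^ d + 1) - norm t" by (simp add: algebra_simps)
    then have t3: "2 * norm t * K * 2 ^ d \<le> 1 / 2" using t1(3) norm_ge_zero[of t] by linarith
    have n1: "1 / 2 \<le> norm (1 - t)" using norm_triangle_ineq2[of 1 t] t1(1) by simp
    have x: "x \<in> Y \<inter> sect a m'" and e1: "(1 - t) * (u ^ d - 1) = - (t * val p x)"
      and e2: "(1 - t) * lin a (Suc m') x = - (t * (u - c))" using z by (auto simp: E_def add_eq_0_iff2)
    have "1 / 2 * norm (lin a (Suc m') x) \<le> norm (1 - t) * norm (lin a (Suc m') x)"
      using n1 by (rule mult_right_mono) simp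
    also have "\<dots> = norm t * norm (u - c)" using arg_cong[OF e2, of norm] by (simp add: norm_mult)
    also have "\<dots> \<le> norm t * (norm u + norm c)" by (intro mult_left_mono norm_triangle_ineq4) simp
    finally have l: "norm (lin a (Suc m') x) \<le> 2 * norm t * (norm u + norm c)" by simp
    have "norm x \<le> C * (1 + norm (lin a (Suc m') x))" by (rule C(2)[OF x])
    also have "\<dots> \<le> C * (1 + 2 * norm t * (norm u + norm c))" using l C(1) by (intro mult_left_mono) auto
    also have "\<dots> = C + (2 * norm t * C) * (norm u + norm c)" by (simp add: algebra_simps)
    also have "\<dots> \<le> C + 1 * (norm u + norm c)" using t2 by (intro add_left_mono mult_right_mono) auto
    finally have nx: "1 + norm x \<le> A + norm u" by (simp add: A_def)
    have nu: "norm u \<le> M"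
    proof (rule ccontr)
      assume "\<not> norm u \<le> M"
      then have u: "A < norm u" "2 < norm u" by (auto simp: M_def)
      have "1 / 2 * norm (u ^ d - 1) \<le> norm (1 - t) * norm (u ^ d - 1)" using n1 by (rule mult_right_mono) simp
      also have "\<dots> = norm t * norm (val p x)" using arg_cong[OF e1, of norm] by (simp add: norm_mult)
      also have "\<dots> \<le> norm t * (K * (1 + norm x) ^ d)" by (intro mult_left_mono K(2)) simp
      also have "\<dots> \<le> norm t * (K * (2 * norm u) ^ d)"
        using nx u(1) K(1) by (intro mult_left_mono power_mono) auto
      finally have "norm (u ^ d - 1) \<le> (2 * norm t * K * 2 ^ d) * norm u ^ d" by (simp add: power_mult_distrib mult_ac)
      also have "\<dots> \<le> 1 / 2 * norm u ^ d" using t3 by (rule mult_right_mono) simp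
      finally have "norm (u ^ d) - 1 \<le> 1 / 2 * norm u ^ d" using norm_triangle_ineq2[of "u ^ d" 1] by simp
      then have "norm u ^ d \<le> 2" by (simp add: norm_power)
      moreover have "norm u ^ 1 \<le> norm u ^ d" by (rule power_increasing[OF d(2)]) (use u in auto)
      ultimately show False using u(2) by simp
    qed
    then show ?thesis using nx by simp
  qed
  have "(\<Union>t\<in>ball 0 \<epsilon>. E t) \<subseteq> cball 0 (A + M) \<times> cball 0 M"
  proof
    fix z assume "z \<in> (\<Union>t\<in>ball 0 \<epsilon>. E t)"
    then obtain t where t: "norm t < \<epsilon>" "z \<in> E t" by auto
    then show "z \<in> cball 0 (A + M) \<times> cball 0 M" using bound[of t "fst z" "snd z"] by (simp add: mem_Times_iff)
  qed
  then have "bounded (\<Union>t\<in>ball 0 \<epsilon>. E t)"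
    by (rule bounded_subset[OF bounded_Times[OF bounded_cball bounded_cball]])
  then show ?thesis unfolding locbdd_def using \<epsilon> by blast
qed

text \<open>At \<open>t = 0\<close> the system decouples: the roots of unity are simple, and the
  section of \<open>Y\<close> is nondegenerate.\<close>

lemma hreg_0:
  assumes "(x, u) \<in> E 0" shows "hreg 0 x u"
  unfolding hreg_def
proof (intro allI impI)
  fix v w
  assume vw: "(\<forall>q\<in>set G. bil (grad (\<lambda>x. val q x) x) v = 0) \<and> (\<forall>k\<in>{1..m'}. bil (\<chi> i. a (k, Some i)) v = 0) \<and>
     (1 - 0) * (of_nat d * u ^ (d - 1) * w) + 0 * bil (grad (\<lambda>x. val p x) x) v = 0 \<and>
     (1 - 0) * bil (\<chi> i. a (Suc m', Some i)) v + 0 * w = 0"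
  have z: "x \<in> Y \<inter> sect a (Suc m')" "u ^ d = 1" using assms by (auto simp: E_def sect_Suc)
  have "u \<noteq> 0" using z(2) d(2) by (auto simp: power_0_left)
  then have "w = 0" using vw d(2) by auto
  moreover have "v = 0" using nd[OF z(1)] vw unfolding nondeg_iff
    by (simp add: atLeastAtMostSuc_conv)
  ultimately show "v = 0 \<and> w = 0" by simp
qed

lemma defb_E:
  assumes "\<And>i. (\<lambda>b. s b $ i) \<in> polyf UNIV" "t \<in> polyf UNIV" "u \<in> polyf UNIV"
  shows "defb (\<lambda>b. (s b, u b) \<in> E (t b))"
  unfolding E_def mem_Collect_eq prod.case
  by (intro defb.conj defb_defset[OF defset_algebraic[OF irreducible_imp_algebraic[OF Y(1)]]] defb_sect
      defb.zero polyf_intros lin_polyf peval_subst assms)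

lemma defb_hreg:
  fixes s :: "('v \<Rightarrow> complex) \<Rightarrow> complex ^ 'n"
  assumes "\<And>i. (\<lambda>b. s b $ i) \<in> polyf UNIV" "t \<in> polyf UNIV" "u \<in> polyf UNIV"
  shows "defb (\<lambda>b. hreg (t b) (s b) (u b))"
proof -
  let ?r = "\<lambda>(b :: ('v + 'n) + unit \<Rightarrow> complex) v. b (Inl (Inl v))"
  have s: "(\<lambda>b. s (?r b) $ i) \<in> polyf UNIV" for i by (rule polyf_subst[OF assms(1)]) (rule polyf.var[OF UNIV_I])
  have t: "(\<lambda>b. t (?r b)) \<in> polyf UNIV" by (rule polyf_subst[OF assms(2)]) (rule polyf.var[OF UNIV_I])
  have u: "(\<lambda>b. u (?r b)) \<in> polyf UNIV" by (rule polyf_subst[OF assms(3)]) (rule polyf.var[OF UNIV_I])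
  have v: "(\<lambda>b :: ('v + 'n) + unit \<Rightarrow> complex. (\<chi> i. b (Inl (Inr i))) $ i) \<in> polyf UNIV" for i
    by (simp add: polyf.var)
  have co: "(\<lambda>b :: ('v + 'n) + unit \<Rightarrow> complex. (\<chi> i. a (k, Some i)) $ i) \<in> polyf UNIV" for k i
    by (simp add: polyf.const)
  have gr: "(\<lambda>b. grad (\<lambda>x. val q x) (s (?r b)) $ i) \<in> polyf UNIV" for q i
    by (rule grad_polyf[OF val_polyv s])
  have z: "defb (\<lambda>b :: ('v + 'n) + unit \<Rightarrow> complex. (\<chi> i. b (Inl (Inr i))) = (0 :: complex ^ 'n))"
  proof -
    have "defb (\<lambda>b :: ('v + 'n) + unit \<Rightarrow> complex. \<forall>i\<in>(UNIV :: 'n set). b (Inl (Inr i)) = 0)"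
      by (intro defb_ball defb.zero polyf.var) auto
    then show ?thesis by (simp add: vec_eq_iff)
  qed
  show ?thesis unfolding hreg_def
    by (rule defb_all_vec, rule defb_all_complex, intro defb_imp defb.conj defb_ball defb.zero z bil_polyf v gr co
        polyf_intros t u finite_set) auto
qed

text \<open>Two definable sets of parameters are excluded: those with a degenerate solution, and
  those whose fibre does not have exactly the cardinality of the starting fibre. Off both, the
  cardinality is locally constant, which excludes solutions escaping to infinity.\<close>

theorem finitely_many_exceptions:
  "\<exists>B. finite B \<and> 0 \<notin> B \<and> (\<forall>t. t \<notin> B \<longrightarrow> locbdd E t \<and> (\<forall>(x, u)\<in>E t. hreg t x u))"
proof -
  have "locgraph E WW 0 z" if "z \<in> E 0" for z using that hreg_0 locgraph_E by (cases z) auto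
  from locgraph_card[OF closed_E locbdd_0 this]
  obtain \<epsilon> where \<epsilon>: "\<epsilon> > 0" "\<And>t. t \<in> ball 0 \<epsilon> \<Longrightarrow> finite (E t) \<and> card (E t) = card (E 0) \<and> (\<forall>z\<in>E t. (t, z) \<in> WW)"
    by blast
  define N where "N = card (E 0)"
  let ?v = "\<lambda>X :: 'n option \<Rightarrow> complex. (\<chi> i. X (Some i), X None)"
  define ge where "ge k t \<longleftrightarrow> (\<exists>X :: nat \<Rightarrow> 'n option \<Rightarrow> complex. inj_on X {..<k} \<and> (\<forall>l<k. ?v (X l) \<in> E t))" for k t
  have ge: "ge k t \<longleftrightarrow> infinite (E t) \<or> k \<le> card (E t)" for k t
  proof -
    let ?S = "?v -` E t"
    have bij: "bij_betw ?v ?S (E t)"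
    proof (rule bij_betwI[of _ _ _ "\<lambda>z. case_option (snd z) (\<lambda>i. fst z $ i)"])
      show "case_option (snd (?v X)) (\<lambda>i. fst (?v X) $ i) = X" for X :: "'n option \<Rightarrow> complex"
        by (auto simp: fun_eq_iff split: option.split)
    qed auto
    show ?thesis
    proof (cases "finite (E t)")
      case True
      then have "finite ?S" using bij_betw_finite[OF bij] by simp
      from card_ge_iff[OF this, of k] show ?thesis using True bij_betw_same_card[OF bij] by (simp add: ge_def)
    next
      case False
      then have "infinite ?S" using bij_betw_finite[OF bij] by simp
      then obtain T where T: "T \<subseteq> ?S" "finite T" "card T = k" using infinite_arbitrarily_large by blast
      have "\<exists>X :: nat \<Rightarrow> 'n option \<Rightarrow> complex. inj_on X {..<k} \<and> (\<forall>l<k. X l \<in> T)"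
        using card_ge_iff[OF T(2), of k] T(3) by simp
      then have "ge k t" unfolding ge_def using T(1) by (elim exE) (auto intro!: exI)
      then show ?thesis using False by simp
    qed
  qed
  define B2 where "B2 = {t. \<exists>x u. (x, u) \<in> E t \<and> \<not> hreg t x u}"
  define B3 where "B3 = {t. \<not> (ge N t \<and> \<not> ge (Suc N) t)}"
  have "defb (\<lambda>b :: unit \<Rightarrow> complex. \<exists>x u. (x, u) \<in> E (b ()) \<and> \<not> hreg (b ()) x u)"
    by (rule defb_ex_vec, rule defb_ex_complex, intro defb.conj defb.neg defb_E defb_hreg)
      (simp_all add: polyf.var)
  from defb_finite_cofinite[OF this] have f2: "finite B2 \<or> finite (- B2)"
    by (simp add: B2_def Compl_eq)
  have dge: "defb (\<lambda>b :: unit \<Rightarrow> complex. ge k (b ()))" for k unfolding ge_def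
    by (rule defb_card_ge, intro defb_E) (simp_all add: polyf.var)
  have "defb (\<lambda>b :: unit \<Rightarrow> complex. \<not> (ge N (b ()) \<and> \<not> ge (Suc N) (b ())))"
    by (intro defb.conj defb.neg dge)
  from defb_finite_cofinite[OF this] have f3: "finite B3 \<or> finite (- B3)"
    by (simp add: B3_def Compl_eq)
  have inf: "infinite (ball (0 :: complex) \<epsilon>)"
  proof
    assume "finite (ball (0 :: complex) \<epsilon>)"
    then have "\<not> (0 :: complex) islimpt ball 0 \<epsilon>" by (rule islimpt_finite)
    moreover have "(0 :: complex) islimpt ball 0 \<epsilon>" by (rule interior_limit_point) (use \<epsilon>(1) in \<open>simp add: interior_open\<close>)
    ultimately show False by simp
  qed
  have b2: "ball 0 \<epsilon> \<subseteq> - B2" using \<epsilon>(2) by (fastforce simp: B2_def)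
  have b3: "ball 0 \<epsilon> \<subseteq> - B3" using \<epsilon>(2) by (auto simp: B3_def ge N_def)
  \<comment> \<open>Neither set can be cofinite, since both avoid the infinite ball around
    0.\<close>
  have fin2: "finite B2" using f2 finite_subset[OF b2] inf by blast
  have fin3: "finite B3" using f3 finite_subset[OF b3] inf by blast
  let ?B = "B2 \<union> B3"
  have "0 \<in> ball (0 :: complex) \<epsilon>" using \<epsilon>(1) by simp
  then have "0 \<notin> ?B" using b2 b3 by blast
  moreover have "locbdd E t \<and> (\<forall>(x, u)\<in>E t. hreg t x u)" if t: "t \<notin> ?B" for t
  proof -
    have reg: "\<forall>(x, u)\<in>E t. hreg t x u" using t by (auto simp: B2_def)
    have cardN: "finite (E s) \<and> card (E s) = N" if "s \<notin> ?B" for s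
    proof -
      have "ge N s" "\<not> ge (Suc N) s" using that by (auto simp: B3_def)
      then show ?thesis unfolding ge by auto
    qed
    have "open (- ?B)" using fin2 fin3 by (intro open_Compl finite_imp_closed) simp
    then obtain r where r: "r > 0" "ball t r \<subseteq> - ?B" using t openE[of "- ?B" t] by blast
    have "locbdd E t"
    proof (rule card_const_locbdd[OF _ _ r(1)])
      show "finite (E t)" using cardN[OF t] by simp
      show "locgraph E WW t z" if "z \<in> E t" for z using that reg locgraph_E by (cases z) auto
      show "finite (E s) \<and> card (E s) = card (E t)" if "s \<in> ball t r" for s
      proof -
        have "s \<notin> ?B" using that r(2) by blast
        then show ?thesis using cardN[OF t] cardN[of s] by simp
      qed
    qed
    then show ?thesis using reg by simp
  qed
  ultimately show ?thesis using fin2 fin3 by (intro exI[of _ ?B]) blast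
qed

text \<open>Nondegeneracy of \<open>e\<close> for the enlarged system makes the homotopy regular at
  \<open>t = 1\<close>, even if 1 is exceptional, so the path can be lifted backwards from
  \<open>(e, c)\<close>.\<close>

theorem track_complete:
  assumes B: "\<And>t. t \<notin> B \<Longrightarrow> locbdd E t \<and> (\<forall>(x, u)\<in>E t. hreg t x u)" and \<tau>: "tracking_path B \<tau>"
    and e: "e \<in> Y" "e \<in> sect a m'" "val p e = 0" "nondeg (G @ [p]) a m' e"
  shows "\<exists>z. path z \<and> pathfinish z = (e, c) \<and> (\<forall>s\<in>{0..1}. z s \<in> E (\<tau> s))"
proof -
  have t: "continuous_on {0..1} \<tau>" "\<tau> 0 = 0" "\<tau> 1 = 1" "\<And>s. s \<in> {0..<1} \<Longrightarrow> \<tau> s \<notin> B"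
    using \<tau> by (auto simp: tracking_path_def path_def pathstart_def pathfinish_def)
  have eE: "(e, c) \<in> E (\<tau> 1)" using e by (simp add: E_def t(3))
  have "hreg 1 e c" unfolding hreg_def
  proof (intro allI impI)
    fix v w
    assume vw: "(\<forall>q\<in>set G. bil (grad (\<lambda>x. val q x) e) v = 0) \<and> (\<forall>k\<in>{1..m'}. bil (\<chi> i. a (k, Some i)) v = 0) \<and>
      (1 - 1) * (of_nat d * c ^ (d - 1) * w) + 1 * bil (grad (\<lambda>x. val p x) e) v = 0 \<and>
      (1 - 1) * bil (\<chi> i. a (Suc m', Some i)) v + 1 * w = 0"
    then have "v = 0" using e(4) unfolding nondeg_iff by simp
    then show "v = 0 \<and> w = 0" using vw by simp
  qed
  then have lg1: "locgraph E WW (\<tau> 1) (e, c)" using locgraph_E[of e c 1] eE by (simp add: t(3))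
  have "\<exists>z. continuous_on {0..1} z \<and> z 1 = (e, c) \<and> (\<forall>s\<in>{0..1}. z s \<in> E (\<tau> s))"
  proof (rule path_lifting[OF closed_E t(1) eE lg1])
    show "locbdd E (\<tau> s)" if "s \<in> {0..<1}" for s using B[OF t(4)[OF that]] by blast
    show "locgraph E WW (\<tau> s) z" if "s \<in> {0..<1}" "z \<in> E (\<tau> s)" for s z
      using B[OF t(4)[OF that(1)]] that(2) locgraph_E by (cases z) auto
  qed
  then show ?thesis by (auto simp: path_def pathfinish_def)
qed

text \<open>The times before 1 at which the path is on \<open>Y\<close> form a closed set, as
  \<open>Y\<close> is closed, and an open one, as regularity gives rank \<open>rk Y\<close>, and
  then \<open>zeros G\<close> and \<open>Y\<close> agree nearby. Closedness also covers the
  end.\<close>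

theorem track_sound:
  assumes B: "\<And>t. t \<notin> B \<Longrightarrow> \<forall>(x, u)\<in>E t. hreg t x u" and \<tau>: "tracking_path B \<tau>"
    and z: "path z" "fst (z 0) \<in> Y"
    and sol: "\<And>s. s \<in> {0..1} \<Longrightarrow> fst (z s) \<in> zeros G \<and> fst (z s) \<in> sect a m' \<and>
      (1 - \<tau> s) * (snd (z s) ^ d - 1) + \<tau> s * val p (fst (z s)) = 0 \<and>
      (1 - \<tau> s) * lin a (Suc m') (fst (z s)) + \<tau> s * (snd (z s) - c) = 0"
  shows "fst (z 1) \<in> Y"
proof -
  have nB: "\<tau> s \<notin> B" if "s \<in> {0..<1}" for s using \<tau> that by (auto simp: tracking_path_def)
  have cz: "continuous_on {0..1} (\<lambda>s. fst (z s))" using z(1) unfolding path_def by (intro continuous_intros)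
  have cY: "closed Y" by (rule algebraic_set_closed[OF irreducible_imp_algebraic[OF Y(1)]])
  let ?S = "{s \<in> {0..1}. fst (z s) \<in> Y}"
  let ?S' = "{s \<in> {0..<1}. fst (z s) \<in> Y}"
  have "closedin (top_of_set {0..1}) ?S"
    using continuous_closedin_preimage[OF cz cY] by (simp add: vimage_def Int_def)
  then have clS: "closed ?S" by (rule closedin_closed_trans) simp
  have cl': "closedin (top_of_set {0..<1}) ?S'"
  proof -
    have *: "?S' = {0..<1} \<inter> ?S" by auto
    show ?thesis unfolding * by (rule closedin_closed_Int[OF clS])
  qed
  have op': "openin (top_of_set {0..<1}) ?S'"
  proof (subst openin_subopen, intro ballI)
    fix s assume s: "s \<in> ?S'"
    then have s1: "s \<in> {0..1}" by auto
    have zE: "z s \<in> E (\<tau> s)" using sol[OF s1] s by (auto simp: E_def case_prod_beta)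
    then have "hreg (\<tau> s) (fst (z s)) (snd (z s))" using B[OF nB[of s]] s by auto
    then have r: "hreg (mk (\<tau> s) (fst (z s)) (snd (z s)) $ None) (xp (mk (\<tau> s) (fst (z s)) (snd (z s))))
       (mk (\<tau> s) (fst (z s)) (snd (z s)) $ Some None)" unfolding xp_mk by simp
    have y: "xp (mk (\<tau> s) (fst (z s)) (snd (z s))) \<in> Y" unfolding xp_mk using s by simp
    have "jac_rank G (xp (mk (\<tau> s) (fst (z s)) (snd (z s)))) = rk Y"
      by (rule hreg_rows[OF y r])
    then have jr: "jac_rank G (fst (z s)) = rk Y" unfolding xp_mk .
    have "fst (z s) \<in> Y" using s by simp
    from regular_nbhd[OF this jr] obtain U where U: "open U" "fst (z s) \<in> U" "zeros G \<inter> U \<subseteq> Y" by blast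
    have cz': "continuous_on {0..<1} (\<lambda>s. fst (z s))" by (rule continuous_on_subset[OF cz]) auto
    let ?T = "{0..<1} \<inter> (\<lambda>s. fst (z s)) -` U"
    have "openin (top_of_set {0..<1}) ?T" by (rule continuous_openin_preimage_gen[OF cz' U(1)])
    moreover have "s \<in> ?T" using s U(2) by auto
    moreover have "?T \<subseteq> ?S'" using U(3) sol by fastforce
    ultimately show "\<exists>T. openin (top_of_set {0..<1}) T \<and> s \<in> T \<and> T \<subseteq> ?S'" by blast
  qed
  have "connected {0..<1::real}" by (rule convex_connected) auto
  then have "?S' = {} \<or> ?S' = {0..<1}" using cl' op' unfolding connected_clopen by blast
  moreover have "0 \<in> ?S'" using z(2) by simp
  ultimately have S': "{0..<1} = ?S'" by blast
  have "?S' \<subseteq> ?S" by auto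
  then have "{0..<1} \<subseteq> ?S" by (rule order_trans[OF equalityD1[OF S']])
  then have "closure {0..<1} \<subseteq> ?S" using clS by (rule closure_minimal)
  then have "{0..1} \<subseteq> ?S" by simp
  then show ?thesis by (auto dest: subsetD[of _ _ 1])
qed

end

section \<open>The regeneration algorithm\<close>

lemma base_digits_unique:
  fixes d e :: "nat \<Rightarrow> nat"
  assumes "\<And>i. i < n \<Longrightarrow> d i < N \<and> e i < N" "(\<Sum>i<n. d i * N ^ i) = (\<Sum>i<n. e i * N ^ i)" "i < n"
  shows "d i = e i"
  using assms
proof (induction n arbitrary: d e i)
  case (Suc n)
  have *: "(\<Sum>i<Suc n. f i * N ^ i) = f 0 + N * (\<Sum>i<n. f (Suc i) * N ^ i)" for f :: "nat \<Rightarrow> nat"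
    by (simp add: sum.lessThan_Suc_shift sum_distrib_left mult_ac del: sum.lessThan_Suc)
  have b: "d 0 < N" "e 0 < N" using Suc.prems(1)[of 0] by auto
  from Suc.prems(2) have eq: "d 0 + N * (\<Sum>i<n. d (Suc i) * N ^ i) = e 0 + N * (\<Sum>i<n. e (Suc i) * N ^ i)"
    unfolding * .
  from arg_cong[OF eq, of "\<lambda>k. k mod N"] have 0: "d 0 = e 0" using b by simp
  with eq b have "(\<Sum>i<n. d (Suc i) * N ^ i) = (\<Sum>i<n. e (Suc i) * N ^ i)" by simp
  then have "i < n \<Longrightarrow> d (Suc i) = e (Suc i)" for i
    using Suc.IH[of "\<lambda>i. d (Suc i)" "\<lambda>i. e (Suc i)" i] Suc.prems(1)[of "Suc _"] by auto
  with 0 Suc.prems(3) show ?case by (cases i) auto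
qed simp

text \<open>Kronecker substitution: \<open>x\<^sub>v = t ^ N ^ h v\<close> with large \<open>N\<close> maps distinct monomials of \<open>p\<close>
  to distinct powers of \<open>t\<close>.\<close>

lemma val_nonzero:
  fixes p :: "'n::finite cpoly"
  assumes "p \<noteq> 0" shows "\<exists>x. val p x \<noteq> 0"
proof (rule ccontr)
  assume "\<not> ?thesis"
  then have z: "val p x = 0" for x by blast
  obtain h :: "'n \<Rightarrow> nat" where h: "bij_betw h UNIV {..<CARD('n)}"
    using ex_bij_betw_finite_nat[of "UNIV :: 'n set"] by (auto simp: atLeast0LessThan)
  define N where "N = Suc (\<Sum>m\<in>Poly_Mapping.keys p. \<Sum>v\<in>UNIV. Poly_Mapping.lookup m v)"
  have N: "Poly_Mapping.lookup m v < N" if "m \<in> Poly_Mapping.keys p" for m v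
  proof -
    have "Poly_Mapping.lookup m v \<le> (\<Sum>v\<in>UNIV. Poly_Mapping.lookup m v)" by (rule member_le_sum) auto
    also have "\<dots> \<le> (\<Sum>m\<in>Poly_Mapping.keys p. \<Sum>v\<in>UNIV. Poly_Mapping.lookup m v)"
      by (rule member_le_sum) (use that in auto)
    finally show ?thesis by (simp add: N_def)
  qed
  define w where "w m = (\<Sum>v\<in>UNIV. Poly_Mapping.lookup m v * N ^ h v)" for m :: "'n \<Rightarrow>\<^sub>0 nat"
  have w: "w m = (\<Sum>i<CARD('n). Poly_Mapping.lookup m (inv_into UNIV h i) * N ^ i)" for m
    unfolding w_def sum.reindex_bij_betw[OF h, symmetric]
    using bij_betw_inv_into_left[OF h] by (intro sum.cong) auto
  have inj: "inj_on w (Poly_Mapping.keys p)"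
  proof (rule inj_onI)
    fix m m' assume m: "m \<in> Poly_Mapping.keys p" "m' \<in> Poly_Mapping.keys p" "w m = w m'"
    have "Poly_Mapping.lookup m (inv_into UNIV h i) = Poly_Mapping.lookup m' (inv_into UNIV h i)" if "i < CARD('n)" for i
      by (rule base_digits_unique[where n = "CARD('n)" and N = N]) (use N m w that in auto)
    moreover have "h v < CARD('n)" "inv_into UNIV h (h v) = v" for v
      using h bij_betw_inv_into_left[OF h] by (auto simp: bij_betw_def)
    ultimately show "m = m'" by (intro poly_mapping_eqI) metis
  qed
  define P where "P = (\<Sum>m\<in>Poly_Mapping.keys p. monom (Poly_Mapping.lookup p m) (w m))"
  have "poly P t = 0" for t
  proof -
    have "val p (\<chi> v. t ^ N ^ h v) = poly P t"
      unfolding P_def poly_sum poly_monom peval_superset[OF finite_keys order_refl]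
    proof (rule sum.cong[OF refl])
      fix m
      have "monom_val m (\<lambda>v. (\<chi> v. t ^ N ^ h v) $ v) = (\<Prod>v\<in>UNIV. t ^ (Poly_Mapping.lookup m v * N ^ h v))"
        by (subst monom_val_superset[of UNIV]) (auto simp: power_mult[symmetric] mult.commute)
      also have "\<dots> = t ^ w m" by (simp add: power_sum w_def)
      finally show "Poly_Mapping.lookup p m * monom_val m (\<lambda>v. (\<chi> v. t ^ N ^ h v) $ v) = Poly_Mapping.lookup p m * t ^ w m" by simp
    qed
    then show ?thesis using z[of "\<chi> v. t ^ N ^ h v"] by simp
  qed
  then have "P = 0" using poly_all_0_iff_0 by blast
  obtain m where m: "m \<in> Poly_Mapping.keys p" using assms by (metis keys_eq_empty ex_in_conv)
  have "coeff P (w m) = (\<Sum>m'\<in>Poly_Mapping.keys p. if m' = m then Poly_Mapping.lookup p m' else 0)"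
    unfolding P_def coeff_sum using inj m by (intro sum.cong) (auto simp: inj_on_def)
  also have "\<dots> = Poly_Mapping.lookup p m" using m by simp
  finally show False using \<open>P = 0\<close> m by (simp add: in_keys_iff)
qed

lemma nonconstant_val: "nonconstant p \<Longrightarrow> \<exists>x :: complex ^ 'n::finite. val p x \<noteq> 0"
  by (rule val_nonzero) (metis nonconstant_def single_zero)

lemma nonconstant_degree:
  assumes "nonconstant (p :: 'n::finite cpoly)" shows "1 \<le> total_degree p"
proof (rule ccontr)
  assume "\<not> ?thesis"
  then have d: "total_degree p = 0" by simp
  have "m = 0" if m: "m \<in> Poly_Mapping.keys p" for m
  proof -
    have "(\<Sum>v\<in>Poly_Mapping.keys m. Poly_Mapping.lookup m v) \<le> total_degree p"
      unfolding total_degree_def using m by (intro Max_ge) auto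
    then have "\<forall>v\<in>Poly_Mapping.keys m. Poly_Mapping.lookup m v = 0" by (simp add: d)
    then show ?thesis by (intro poly_mapping_eqI) (metis in_keys_iff lookup_zero)
  qed
  then have "p = Poly_Mapping.single 0 (Poly_Mapping.lookup p 0)"
    by (intro poly_mapping_eqI) (metis in_keys_iff lookup_single_eq lookup_single_not_eq)
  then show False using assms unfolding nonconstant_def by blast
qed

text \<open>With \<open>rk Y = 0\<close> the regular points would be interior points of
  \<open>Y\<close>, where a nonzero polynomial cannot vanish identically.\<close>

lemma rk_pos:
  fixes Y :: "(complex ^ 'n::finite) set"
  assumes Y: "irreducible_variety Y" and f: "f \<in> vanish Y" "f x1 \<noteq> 0"
  shows "1 \<le> rk Y"
proof (rule ccontr)
  assume "\<not> ?thesis"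
  then have r: "rk Y = 0" by simp
  obtain x where x: "x \<in> Y" using Y by (auto simp: irreducible_variety_def)
  obtain g :: "'n \<Rightarrow> complex ^ 'n \<Rightarrow> complex" and I where g: "card I = rk Y" "\<And>i. g i \<in> polyv"
    "\<And>i. i \<in> I \<Longrightarrow> g i \<in> {}" "det (jac g x) \<noteq> 0"
    by (rule rk_rows[OF x, of "{}"]) (auto simp: r)
  then have I: "I = {}" by auto
  obtain U where U: "open U" "x \<in> U" "\<And>y. y \<in> U \<Longrightarrow> (\<And>i. i \<in> I \<Longrightarrow> g i y = 0) \<Longrightarrow> y \<in> Y"
    by (rule regular_local[OF Y g(2) _ g(1) x g(4)]) (use I in auto)
  obtain h where h: "h \<in> polyf UNIV" "f = (\<lambda>x. h (\<lambda>v. x $ v))"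
    using f(1) by (auto simp: vanish_def polyv_def)
  have "\<exists>w\<in>U. h (\<lambda>v. w $ v) \<noteq> 0"
    by (rule polyf_open_nonzero[OF h(1) _ U(1,2)]) (use f(2) h(2) in simp)
  then show False using U(3) I f(1) h(2) by (auto simp: vanish_def)
qed

lemma roots_of_unity_eq:
  assumes "1 \<le> d" shows "roots_of_unity d = {u. u ^ d = 1}"
proof -
  have "roots_of_unity d = {exp (2 * of_real pi * \<i> * of_nat j / of_nat d) | j. j < d}"
    unfolding roots_of_unity_def by (auto simp: image_def)
  then show ?thesis using complex_roots_unity[OF assms] by simp
qed

text \<open>The linear parts are completed by unit rows to a square matrix. Where it is invertible,
  the section is a translate of the image of a coordinate subspace under the inverse.\<close>

lemma generically_affine:
  assumes "r \<le> CARD('n)"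
  shows "generically (lrows r) (\<lambda>a. affine_linear_space (CARD('n) - r) (sect a r :: (complex ^ 'n::finite) set))"
proof -
  obtain h :: "'n \<Rightarrow> nat" where h: "bij_betw h UNIV {..<CARD('n)}"
    using ex_bij_betw_finite_nat[of "UNIV :: 'n set"] by (auto simp: atLeast0LessThan)
  define A :: "(nat \<times> 'n option \<Rightarrow> complex) \<Rightarrow> complex ^ 'n ^ 'n" where
    "A a = (\<chi> i v. if h i < r then a (Suc (h i), Some v) else axis i 1 $ v)" for a
  have pol: "(\<lambda>a. det (A a)) \<in> polyf (lrows r)"
  proof (rule polyf_det)
    fix i j show "(\<lambda>a. A a $ i $ j) \<in> polyf (lrows r)"
      by (cases "h i < r") (auto simp: A_def intro: polyf.var polyf.const)
  qed
  have "A (\<lambda>(m, o'). case o' of None \<Rightarrow> 0 | Some v \<Rightarrow> if Suc (h v) = m then 1 else 0) = mat 1"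
    using h by (auto simp: A_def mat_def axis_def vec_eq_iff bij_betw_def inj_on_def)
  then have ex: "\<exists>a. det (A a) \<noteq> 0" by (metis det_I zero_neq_one)
  have aff: "affine_linear_space (CARD('n) - r) (sect a r)" if "det (A a) \<noteq> 0" for a
  proof -
    define M where "M = matrix_inv (A a)"
    have M: "A a *v (M *v y) = y" "M *v (A a *v y) = y" for y
      using matrix_inv_mult_vec[OF that] by (auto simp: M_def)
    define S :: "(complex ^ 'n) set" where "S = {y. \<forall>i. i \<notin> {i. r \<le> h i} \<longrightarrow> y $ i = 0}"
    define y0 :: "complex ^ 'n" where "y0 = (\<chi> i. if h i < r then - a (Suc (h i), None) else 0)"
    have mem: "x \<in> sect a r \<longleftrightarrow> A a *v x - y0 \<in> S" for x
    proof -
      have row: "(A a *v x - y0) $ i = lin a (Suc (h i)) x" if "h i < r" for i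
        using that by (simp add: A_def y0_def lin_def matrix_vector_mult_def)
      have "x \<in> sect a r \<longleftrightarrow> (\<forall>i. h i < r \<longrightarrow> lin a (Suc (h i)) x = 0)"
      proof (safe)
        fix i assume "x \<in> sect a r" "h i < r"
        then show "lin a (Suc (h i)) x = 0" by (auto simp: sect_def)
      next
        assume l: "\<forall>i. h i < r \<longrightarrow> lin a (Suc (h i)) x = 0"
        show "x \<in> sect a r" unfolding sect_def
        proof (safe)
          fix m assume m: "m \<in> {1..r}"
          then have "m - 1 \<in> {..<CARD('n)}" using assms by auto
          then obtain i where "m - 1 = h i" using h by (auto simp: bij_betw_def)
          then have "Suc (h i) = m" "h i < r" using m by auto
          then show "lin a m x = 0" using l by auto
        qed
      qed
      also have "\<dots> \<longleftrightarrow> A a *v x - y0 \<in> S" using row by (auto simp: S_def not_le simp del: vector_minus_component)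
      finally show ?thesis .
    qed
    have sub: "vec.subspace S" by (auto simp: S_def vec.subspace_def)
    have lin: "Vector_Spaces.linear (*s) (*s) ((*v) M)" by (rule matrix_vector_mul_linear_gen)
    have "inj ((*v) M)" by (rule injI) (metis M(1))
    have "vec.dim ((*v) M ` S) = vec.dim S"
      by (rule vec.dim_image_eq[OF lin]) (use \<open>inj ((*v) M)\<close> in \<open>auto simp: inj_on_def\<close>)
    also have "\<dots> = card {i. r \<le> h i}" unfolding S_def by (rule dim_substandard_cart)
    also have "\<dots> = card (h ` {i. r \<le> h i})" by (rule card_image[symmetric]) (use h in \<open>auto simp: bij_betw_def inj_on_def\<close>)
    also have "h ` {i. r \<le> h i} = {r..<CARD('n)}"
      using h by (auto simp: bij_betw_def image_iff set_eq_iff) (metis lessThan_iff rangeE)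
    finally have dim: "vec.dim ((*v) M ` S) = CARD('n) - r" by simp
    have "sect a r = (\<lambda>v. M *v y0 + v) ` ((*v) M ` S)"
    proof (intro set_eqI iffI)
      fix x assume "x \<in> sect a r"
      then have "A a *v x - y0 \<in> S" by (simp add: mem)
      moreover have "x = M *v y0 + M *v (A a *v x - y0)" by (simp add: matrix_vector_mult_diff_distrib M)
      ultimately show "x \<in> (\<lambda>v. M *v y0 + v) ` ((*v) M ` S)" by blast
    next
      fix x assume "x \<in> (\<lambda>v. M *v y0 + v) ` ((*v) M ` S)"
      then obtain s where "s \<in> S" "x = M *v y0 + M *v s" by blast
      then show "x \<in> sect a r" unfolding mem by (simp add: matrix_vector_right_distrib M)
    qed
    moreover have "vec.subspace ((*v) M ` S)" by (rule vec.linear_subspace_image[OF lin sub])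
    ultimately show ?thesis unfolding affine_linear_space_def using dim by blast
  qed
  show ?thesis unfolding generically_iff
    by (rule bexI[OF _ pol]) (intro conjI allI impI ex aff)
qed

text \<open>Near \<open>x\<close> the variety \<open>Y\<close> is defined by \<open>rk Y\<close>
  equations from \<open>G\<close>, and the rise of the rank makes the gradient of \<open>p\<close>
  independent of theirs. These equations with \<open>p\<close> therefore imply the whole system
  \<open>G @ [p]\<close> near \<open>x\<close>.\<close>

lemma component_of_hypersurface_section:
  fixes Y :: "(complex ^ 'n::finite) set"
  assumes Y: "irreducible_variety Y" "Y \<subseteq> zeros G" and x: "x \<in> Y" "val p x = 0"
    and r: "jac_rank G x = rk Y" "jac_rank (G @ [p]) x = Suc (rk Y)"
  shows "\<exists>Z. irreducible_component Z (zeros (G @ [p])) \<and> x \<in> Z \<and> rk Z = Suc (rk Y)"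
proof -
  let ?p = "\<lambda>x. val p x"
  obtain g0 :: "'n \<Rightarrow> complex ^ 'n \<Rightarrow> complex" and I0 where g0: "card I0 = rk Y" "\<And>i. g0 i \<in> polyv"
    "\<And>i. i \<in> I0 \<Longrightarrow> g0 i \<in> vals G" "det (jac g0 x) \<noteq> 0"
    using rk_rows[OF x(1) vals_vanish[OF Y(2)] r(1)[unfolded jac_rank_eq]] by metis
  have g0v: "i \<in> I0 \<Longrightarrow> g0 i \<in> vanish Y" for i using g0(3) vals_vanish[OF Y(2)] by blast
  obtain U where U: "open U" "x \<in> U" "\<And>y. y \<in> U \<Longrightarrow> (\<And>i. i \<in> I0 \<Longrightarrow> g0 i y = 0) \<Longrightarrow> y \<in> Y"
    using regular_local[OF Y(1) g0(2) g0v g0(1) x(1) g0(4)] by metis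
  have sub: "grads (g0 ` I0) x \<subseteq> grads (vals G) x" using g0(3) by blast
  have "vec.independent ((\<lambda>i. jac g0 x $ i) ` I0)" "inj (\<lambda>i. jac g0 x $ i)"
    using independent_rows[OF g0(4)] by auto
  moreover have "(\<lambda>i. jac g0 x $ i) ` I0 = grads (g0 ` I0) x" by (simp add: jac_def image_image)
  moreover have "card ((\<lambda>i. jac g0 x $ i) ` I0) = rk Y"
    using calculation(2) g0(1) by (metis card_image inj_on_subset subset_UNIV)
  ultimately have ind: "vec.independent (grads (g0 ` I0) x)" and cd: "card (grads (g0 ` I0) x) = rk Y" by auto
  then have "grads (vals G) x \<subseteq> vec.span (grads (g0 ` I0) x)"
    using vec.card_ge_dim_independent[OF sub ind] r(1) by (simp add: jac_rank_eq)
  then have sp: "vec.span (grads (g0 ` I0 \<union> {?p}) x) = vec.span (grads (vals (G @ [p])) x)"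
  proof (intro subset_antisym vec.span_minimal vec.subspace_span)
    show "grads (g0 ` I0 \<union> {?p}) x \<subseteq> vec.span (grads (vals (G @ [p])) x)"
      using g0(3) by (intro subset_trans[OF _ vec.span_superset]) force
    have "vec.span (grads (g0 ` I0) x) \<subseteq> vec.span (grads (g0 ` I0 \<union> {?p}) x)" by (rule vec.span_mono) auto
    moreover have "grad ?p x \<in> vec.span (grads (g0 ` I0 \<union> {?p}) x)" by (rule vec.span_base) auto
    ultimately show "grads (vals (G @ [p])) x \<subseteq> vec.span (grads (g0 ` I0 \<union> {?p}) x)"
      if "grads (vals G) x \<subseteq> vec.span (grads (g0 ` I0) x)" using that by auto
  qed
  have dimS: "vec.dim (grads (g0 ` I0 \<union> {?p}) x) = Suc (rk Y)"
    using r(2) unfolding jac_rank_eq by (metis sp vec.dim_span)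
  obtain g :: "'n \<Rightarrow> complex ^ 'n \<Rightarrow> complex" and I where g: "card I = vec.dim (grads (g0 ` I0 \<union> {?p}) x)"
    "\<And>i. i \<in> I \<Longrightarrow> g i \<in> g0 ` I0 \<union> {?p}" "\<And>i. i \<notin> I \<Longrightarrow> g i \<in> coords" "det (jac g x) \<noteq> 0"
    using complete_rows[OF span_coords] by metis
  have gp: "g i \<in> polyv" for i using g(2,3)[of i] g0(2) coords_polyv val_polyv by (cases "i \<in> I") auto
  have "inj (\<lambda>i. jac g x $ i)" by (rule independent_rows(1)[OF g(4)])
  then have "inj_on g I" by (auto simp: inj_on_def jac_def)
  then have "card (g ` I) = Suc (rk Y)" using g(1) dimS by (simp add: card_image)
  moreover have "card (g0 ` I0 \<union> {?p}) \<le> Suc (rk Y)"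
    using card_image_le[of I0 g0] g0(1) card_Un_le[of "g0 ` I0" "{?p}"] by simp
  ultimately have gI: "g ` I = g0 ` I0 \<union> {?p}" using g(2) by (intro card_seteq) auto
  have "\<exists>Z. irreducible_component Z (zeros (G @ [p])) \<and> x \<in> Z \<and> rk Z = jac_rank (G @ [p]) x"
  proof (rule component_at_regular_point[where g = g and I = I and U = U])
    show "card I = jac_rank (G @ [p]) x" using g(1) dimS r(2) by simp
    show "g i \<in> vals (G @ [p])" if "i \<in> I" for i using g(2)[OF that] g0(3) by auto
    show "y \<in> zeros (G @ [p])" if y: "y \<in> U" and z: "\<And>i. i \<in> I \<Longrightarrow> g i y = 0" for y
    proof -
      have z': "f y = 0" if "f \<in> g0 ` I0 \<union> {?p}" for f using that z unfolding gI[symmetric] by auto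
      have "y \<in> Y" by (rule U(3)[OF y]) (use z' in auto)
      then show ?thesis using Y(2) z'[of ?p] by (auto simp: zeros_def)
    qed
    show "x \<in> zeros (G @ [p])" using x Y(2) by (auto simp: zeros_def)
  qed (use gp g U in auto)
  then show ?thesis by (simp add: r(2))
qed

lemma set_zip_same_map:
  "length xs = length ys \<Longrightarrow> (\<forall>(g, h)\<in>set (zip (xs @ xs') (ys @ ys')). P g h) \<longleftrightarrow>
     (\<forall>(g, h)\<in>set (zip xs ys). P g h) \<and> (\<forall>(g, h)\<in>set (zip xs' ys'). P g h)"
  by auto

text \<open>An equation common to both systems is reproduced by the combination with weights
  \<open>1 - t\<close> and \<open>t\<close>; only two equations really move.\<close>

lemma homotopy_system:
  "(\<forall>(g, h)\<in>set (zip (start_system F a i j) (target_system F a c i j)). (1 - t) * g (x, u) + t * h (x, u) = 0) \<longleftrightarrow>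
     x \<in> zeros (take i F) \<and> (1 - t) * (u ^ total_degree (F ! i) - 1) + t * val (F ! i) x = 0 \<and>
     x \<in> sect a (CARD('n) - (j + 1)) \<and>
     (1 - t) * lin a (CARD('n) - j) x + t * (u - c) = (0 :: complex)"
  for x :: "complex ^ 'n::finite"
proof -
  have s: "(1 - t) * v + t * v = (v :: complex)" for v by (simp add: algebra_simps)
  have z: "(\<forall>(g, h)\<in>set (zip (map f xs) (map f xs)). (1 - t) * g (x, u) + t * h (x, u) = 0) \<longleftrightarrow>
      (\<forall>y\<in>set xs. f y (x, u) = 0)" for f :: "'b \<Rightarrow> (complex ^ 'n) \<times> complex \<Rightarrow> complex" and xs
    by (simp add: zip_map_map zip_same_conv_map s)
  show ?thesis
    unfolding start_system_def target_system_def zeros_ells[symmetric]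
    by (simp only: set_zip_same_map z length_map list.size) (auto simp: zeros_def val_ell)
qed

lemma vec_dim_Un_le:
  fixes S T :: "(complex ^ 'n::finite) set"
  assumes "finite T" shows "vec.dim (S \<union> T) \<le> vec.dim S + card T"
  using assms
proof induction
  case (insert x T)
  have "vec.dim (S \<union> insert x T) = vec.dim (insert x (S \<union> T))" by simp
  also have "\<dots> \<le> Suc (vec.dim (S \<union> T))" by (simp only: vec.dim_insert) simp
  finally show ?case using insert by simp
qed simp

lemma vals_Cons_ells: "vals (p # ells a r) = vals [p] \<union> lins a r"
  by (auto simp: ells_def lins_def val_ell image_image)

lemma jac_rank_append_le: "jac_rank (G @ [p]) x \<le> Suc (jac_rank G x)"
  using vec_dim_Un_le[of "grads (vals [p]) x" "grads (vals G) x"] by (simp add: jac_rank_eq)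

lemma jac_rank_append_ge: "jac_rank G x \<le> jac_rank (G @ [p]) x"
  unfolding jac_rank_eq by (rule vec.dim_mono) (rule order_trans[OF _ vec.span_superset], auto)

lemma jac_rank_le_length: "jac_rank G x \<le> length G"
proof -
  have "jac_rank G x \<le> card ((\<lambda>g. gradient g x) ` set G)"
    unfolding jac_rank_def by (rule vec.dim_le_card[OF vec.span_superset]) simp
  also have "\<dots> \<le> card (set G)" by (rule card_image_le) simp
  also have "\<dots> \<le> length G" by (rule card_length)
  finally show ?thesis .
qed

lemma zeros_append: "zeros (G @ H) = zeros G \<inter> zeros H"
  by (auto simp: zeros_def)

lemma irreducible_component_subset:
  "irreducible_component Z A \<Longrightarrow> Z \<subseteq> B \<Longrightarrow> B \<subseteq> A \<Longrightarrow> irreducible_component Z B"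
  unfolding irreducible_component_def by (intro conjI allI impI) (elim conjE, assumption | blast)+

lemma component_codim: "irreducible_component Z A \<Longrightarrow> codim Z = rk Z"
  by (rule codim_eq_rk) (simp add: irreducible_component_def)

text \<open>What the flag must satisfy for one component: its witness points are nondegenerate, they
  leave the next hypersurface unless the whole component lies in it, and the next larger section
  obeys the growth bound of the homotopy.\<close>

definition regular_flag ::
  "'n::finite cpoly list \<Rightarrow> nat \<Rightarrow> (complex ^ 'n) set \<Rightarrow> (nat \<times> 'n option \<Rightarrow> complex) \<Rightarrow> bool" where
  "regular_flag F i Y a \<longleftrightarrow>
     (\<forall>x\<in>Y \<inter> sect a (CARD('n) - rk Y). jac_rank (take i F) x = rk Y \<and> nondeg (take i F) a (CARD('n) - rk Y) x) \<and>
     (i < length F \<longrightarrow> \<not> Y \<subseteq> zeros [F ! i] \<longrightarrow> Y \<inter> zeros [F ! i] \<inter> sect a (CARD('n) - rk Y) = {}) \<and>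
     (rk Y < CARD('n) \<longrightarrow> (\<exists>C. \<forall>x\<in>Y \<inter> sect a (CARD('n) - rk Y - 1).
        norm x \<le> C * (1 + norm (lin a (CARD('n) - rk Y) x))))"

abbreviation reduced_components :: "'n::finite cpoly list \<Rightarrow> (complex ^ 'n) set set" where
  "reduced_components G \<equiv> {Y. irreducible_component Y (zeros G) \<and> reduced_component G Y}"

lemma generically_regular_flag:
  fixes Y :: "(complex ^ 'n::finite) set"
  assumes Y: "Y \<in> reduced_components (take i F)"
  shows "generically (lrows (CARD('n) - rk Y)) (regular_flag F i Y)"
proof -
  let ?m = "CARD('n) - rk Y" and ?G = "take i F"
  have Yi: "irreducible_variety Y" "Y \<subseteq> zeros ?G" using Y by (auto simp: irreducible_component_def)
  have alg: "algebraic_set Y" by (rule irreducible_imp_algebraic[OF Yi(1)])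
  obtain x0 where x0: "x0 \<in> Y" "jac_rank ?G x0 = rk Y" using Y reduced_component_iff[of Y ?G] by auto
  have nd: "generically (lrows ?m) (\<lambda>a. \<forall>x\<in>Y \<inter> sect a ?m. jac_rank ?G x = rk Y \<and> nondeg ?G a ?m x)"
    by (rule generically_nondeg[OF Yi x0])
  have cut: "generically (lrows ?m) (\<lambda>a. \<not> Y \<subseteq> zeros [F ! i] \<longrightarrow> Y \<inter> zeros [F ! i] \<inter> sect a ?m = {})"
  proof (cases "Y \<subseteq> zeros [F ! i]")
    case False
    have "misses ?m (Y \<inter> zeros [F ! i])"
      by (rule misses_proper[OF Yi(1) algebraic_set_Int[OF alg algebraic_set_zeros]]) (use False in auto)
    then show ?thesis unfolding misses_def by (rule generically_mono) simp
  qed (auto intro: generically_True)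
  obtain N where "generically (lrows ?m :: (nat \<times> 'n option) set) (\<lambda>a. finite (Y \<inter> sect a ?m) \<and> card (Y \<inter> sect a ?m) = N)"
    using generically_card[OF defset_algebraic[OF alg] irreducible_meets_misses(3)[OF Yi(1)]] by (elim exE)
  then obtain f where f: "f \<in> polyf (lrows ?m :: (nat \<times> 'n option) set)" "\<exists>a. f a \<noteq> 0"
    "\<forall>a. f a \<noteq> 0 \<longrightarrow> finite (Y \<inter> sect a ?m) \<and> card (Y \<inter> sect a ?m) = N"
    unfolding generically_iff by (elim bexE conjE)
  have "generically (lrows ?m) (\<lambda>a. f a \<noteq> 0)"
    unfolding generically_iff by (rule bexI[OF _ f(1)]) (intro conjI f(2) allI impI, assumption)
  from generically_conj[OF generically_conj[OF nd cut] this] show ?thesis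
  proof (rule generically_mono, elim conjE)
    fix a assume a: "\<forall>x\<in>Y \<inter> sect a ?m. jac_rank ?G x = rk Y \<and> nondeg ?G a ?m x"
      "\<not> Y \<subseteq> zeros [F ! i] \<longrightarrow> Y \<inter> zeros [F ! i] \<inter> sect a ?m = {}" "f a \<noteq> 0"
    have "\<exists>C. \<forall>x\<in>Y \<inter> sect a (?m - 1). norm x \<le> C * (1 + norm (lin a ?m x))" if "rk Y < CARD('n)"
    proof -
      have m: "Suc (?m - 1) = ?m" using that by simp
      show ?thesis
        using section_growth[OF Yi m, of f a N] a(1,3) f(1,3) unfolding m by blast
    qed
    with a show "regular_flag F i Y a" unfolding regular_flag_def by (intro conjI impI) auto
  qed
qed

text \<open>A run with successful random choices, so that the induction over the steps is free of
  genericity. In iteration \<open>(i, j)\<close> one set \<open>B (i, j)\<close> serves all reduced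
  components of codimension \<open>j\<close>.\<close>

locale regeneration_run =
  fixes F :: "'n::finite cpoly list" and a :: "nat \<times> 'n option \<Rightarrow> complex" and c :: "nat \<times> nat \<Rightarrow> complex"
    and \<tau> :: "nat \<times> nat \<Rightarrow> real \<Rightarrow> complex" and B :: "nat \<times> nat \<Rightarrow> complex set"
  assumes nonconst: "\<forall>f\<in>set F. nonconstant f"
    and contrib: "\<forall>i\<in>{1..length F}. \<forall>Y Z.
      irreducible_component Y (zeros (take i F)) \<longrightarrow>
      irreducible_component Z (zeros F) \<longrightarrow> reduced_component F Z \<longrightarrow>
      contributes F i Y Z \<longrightarrow> reduced_component (take i F) Y"
    and flag: "\<And>i Y. i \<in> {1..length F} \<Longrightarrow> Y \<in> reduced_components (take i F) \<Longrightarrow> regular_flag F i Y a"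
    and exceptions: "\<And>i Y t. i \<in> {1..<length F} \<Longrightarrow> Y \<in> reduced_components (take i F) \<Longrightarrow> rk Y < CARD('n) \<Longrightarrow>
      t \<notin> B (i, rk Y) \<Longrightarrow>
      locbdd (homotopy.E Y a (CARD('n) - rk Y - 1) (F ! i) (total_degree (F ! i)) (c (i, rk Y))) t \<and>
      (\<forall>(x, u)\<in>homotopy.E Y a (CARD('n) - rk Y - 1) (F ! i) (total_degree (F ! i)) (c (i, rk Y)) t.
         homotopy.hreg (take i F) a (CARD('n) - rk Y - 1) (F ! i) (total_degree (F ! i)) t x u)"
    and paths: "\<And>i j. i \<in> {1..<length F} \<Longrightarrow> j \<in> {1..<CARD('n)} \<Longrightarrow> tracking_path (B (i, j)) (\<tau> (i, j))"

text \<open>The first polynomial is nonconstant, which gives the lower bound, and \<open>i\<close>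
  gradients have rank at most \<open>i\<close>. These are the limits of the loop over
  \<open>j\<close>.\<close>

lemma rk_reduced_component:
  fixes F :: "'n::finite cpoly list"
  assumes F: "\<forall>f\<in>set F. nonconstant f" and i: "i \<in> {1..length F}" and Y: "Y \<in> reduced_components (take i F)"
  shows "rk Y \<in> {1..min i CARD('n)}"
proof -
  have Yi: "irreducible_variety Y" "Y \<subseteq> zeros (take i F)" using Y by (auto simp: irreducible_component_def)
  have F0: "F ! 0 \<in> set (take i F)" using i by (cases F; cases i) auto
  then have "F ! 0 \<in> set F" by (rule in_set_takeD)
  then obtain x :: "complex ^ 'n" where "val (F ! 0) x \<noteq> 0" using nonconstant_val F by blast
  moreover have "(\<lambda>x. val (F ! 0) x) \<in> vanish Y" using vals_vanish[OF Yi(2)] F0 by blast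
  ultimately have "1 \<le> rk Y" by (intro rk_pos[OF Yi(1)])
  moreover obtain x0 where "x0 \<in> Y" "jac_rank (take i F) x0 = rk Y" using Y reduced_component_iff[of Y "take i F"] by auto
  then have "rk Y \<le> i" using jac_rank_le_length[of "take i F" x0] by simp
  ultimately show ?thesis using irreducible_meets_misses(1)[OF Yi(1)] by simp
qed

lemma homotopyI:
  fixes F :: "'n::finite cpoly list"
  assumes F: "\<forall>f\<in>set F. nonconstant f" and i: "i \<in> {1..<length F}" and Y: "Y \<in> reduced_components (take i F)"
    and r: "rk Y < CARD('n)" and fl: "regular_flag F i Y a"
  shows "homotopy Y (take i F) a (CARD('n) - rk Y - 1) (F ! i) (total_degree (F ! i))"
proof
  have m: "Suc (CARD('n) - rk Y - 1) = CARD('n) - rk Y" using r by simp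
  show "irreducible_variety Y" "Y \<subseteq> zeros (take i F)" using Y by (auto simp: irreducible_component_def)
  show "Suc (CARD('n) - rk Y - 1) = CARD('n) - rk Y" by (rule m)
  show "1 \<le> total_degree (F ! i)" using F i by (intro nonconstant_degree) auto
  show "nondeg (take i F) a (Suc (CARD('n) - rk Y - 1)) x" if "x \<in> Y \<inter> sect a (Suc (CARD('n) - rk Y - 1))" for x
    using fl that unfolding regular_flag_def m by blast
  show "\<exists>C. \<forall>x\<in>Y \<inter> sect a (CARD('n) - rk Y - 1). norm x \<le> C * (1 + norm (lin a (Suc (CARD('n) - rk Y - 1)) x))"
    using fl r unfolding regular_flag_def m by blast
qed simp

section \<open>Invariants of a single run\<close>

context regeneration_run
begin

lemma rk_bounds: "i \<in> {1..length F} \<Longrightarrow> Y \<in> reduced_components (take i F) \<Longrightarrow> rk Y \<in> {1..min i CARD('n)}"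
  by (rule rk_reduced_component[OF nonconst])

lemma take_Suc: "i < length F \<Longrightarrow> take (Suc i) F = take i F @ [F ! i]"
  by (rule take_Suc_conv_app_nth)

lemma regular_point:
  assumes "i \<in> {1..length F}" "Y \<in> reduced_components (take i F)" "x \<in> Y" "x \<in> sect a (CARD('n) - rk Y)"
  shows "jac_rank (take i F) x = rk Y" "nondeg (take i F) a (CARD('n) - rk Y) x"
  using flag[OF assms(1,2)] assms(3,4) unfolding regular_flag_def by blast+

lemma subset_hypersurface:
  assumes "i \<in> {1..<length F}" "Y \<in> reduced_components (take i F)" "x \<in> Y" "x \<in> sect a (CARD('n) - rk Y)"
    "val (F ! i) x = 0"
  shows "Y \<subseteq> zeros [F ! i]"
proof (rule ccontr)
  have "i \<in> {1..length F}" using assms(1) by simp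
  from flag[OF this assms(2)] assms(1) have "\<not> Y \<subseteq> zeros [F ! i] \<longrightarrow> Y \<inter> zeros [F ! i] \<inter> sect a (CARD('n) - rk Y) = {}"
    unfolding regular_flag_def by simp
  moreover assume "\<not> Y \<subseteq> zeros [F ! i]"
  ultimately show False using assms(3-5) by (auto simp: zeros_def)
qed

text \<open>Since only \<open>CARD('n) - 1\<close> linear equations are available, full rank forces
  the gradient of the first polynomial to be nonzero at \<open>x\<close>.\<close>

lemma start_sound:
  assumes "1 \<le> length F" "x \<in> start_points F a"
  shows "\<exists>Y\<in>reduced_components (take 1 F). rk Y = 1 \<and> x \<in> Y \<and> x \<in> sect a (CARD('n) - 1)"
proof -
  have t1: "take 1 F = [F ! 0]" using assms(1) by (cases F) auto
  have x: "x \<in> zeros [F ! 0]" "x \<in> sect a (CARD('n) - 1)" "vec.dim (grads (vals [F ! 0] \<union> lins a (CARD('n) - 1)) x) = CARD('n)"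
    using assms(2) unfolding start_points_def jac_rank_eq vals_Cons_ells zeros_ells[symmetric] by (auto simp: zeros_def)
  have "card (grads (lins a (CARD('n) - 1)) x) \<le> card {1..CARD('n) - 1}"
    unfolding lins_def image_image by (rule card_image_le) simp
  moreover have "finite (grads (lins a (CARD('n) - 1)) x)" by (simp add: lins_def)
  then have "CARD('n) \<le> jac_rank [F ! 0] x + card (grads (lins a (CARD('n) - 1)) x)"
    using vec_dim_Un_le[of "grads (lins a (CARD('n) - 1)) x" "grads (vals [F ! 0]) x"] x(3)
    unfolding image_Un[symmetric] jac_rank_eq by simp
  ultimately have "CARD('n) \<le> jac_rank [F ! 0] x + (CARD('n) - 1)" by simp
  then have "1 \<le> jac_rank [F ! 0] x" using zero_less_card_finite[where 'a = 'n] by linarith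
  then have r: "jac_rank [F ! 0] x = 1" using jac_rank_le_length[of "[F ! 0]" x] by simp
  obtain g :: "'n \<Rightarrow> complex ^ 'n \<Rightarrow> complex" and I where g: "card I = vec.dim (grads (vals [F ! 0]) x)"
    "\<And>i. i \<in> I \<Longrightarrow> g i \<in> vals [F ! 0]" "\<And>i. i \<notin> I \<Longrightarrow> g i \<in> coords" "det (jac g x) \<noteq> 0"
    using complete_rows[OF span_coords] by metis
  have cI: "card I = jac_rank [F ! 0] x" using g(1) by (simp add: jac_rank_eq)
  then obtain i0 where i0: "i0 \<in> I" using r by (metis card.empty ex_in_conv zero_neq_one)
  have "\<exists>Z. irreducible_component Z (zeros [F ! 0]) \<and> x \<in> Z \<and> rk Z = jac_rank [F ! 0] x"
  proof (rule component_at_regular_point[where g = g and I = I and U = UNIV])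
    show "g i \<in> polyv" for i using g(2,3)[of i] vals_polyv[of "[F ! 0]"] coords_polyv by (cases "i \<in> I") auto
    show "y \<in> zeros [F ! 0]" if "\<And>i. i \<in> I \<Longrightarrow> g i y = 0" for y
      using that[OF i0] g(2)[OF i0] by (auto simp: zeros_def)
  qed (use g(2,4) cI x(1) in auto)
  then obtain Z where Z: "irreducible_component Z (zeros [F ! 0])" "x \<in> Z" "rk Z = jac_rank [F ! 0] x"
    by (elim exE conjE)
  then have "reduced_component [F ! 0] Z" using reduced_component_iff[OF Z(1)] by metis
  with Z r x(2) show ?thesis unfolding t1 by (intro bexI[of _ Z]) auto
qed

lemma start_complete:
  assumes "1 \<le> length F" and Y: "Y \<in> reduced_components (take 1 F)" "x \<in> Y" "x \<in> sect a (CARD('n) - rk Y)"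
  shows "rk Y = 1" "x \<in> start_points F a"
proof -
  have t1: "take 1 F = [F ! 0]" using assms(1) by (cases F) auto
  have i: "1 \<in> {1..length F}" using assms(1) by simp
  show r: "rk Y = 1" using rk_bounds[OF i Y(1)] by simp
  have "nondeg [F ! 0] a (CARD('n) - 1) x" using regular_point(2)[OF i Y] r t1 by simp
  moreover have "x \<in> zeros [F ! 0]" using Y(1,2) t1 by (auto simp: irreducible_component_def)
  ultimately show "x \<in> start_points F a"
    using Y(3) r unfolding start_points_def nondeg_def jac_rank_eq vals_Cons_ells zeros_ells[symmetric]
    by (auto simp: zeros_def)
qed

lemma zeros_Suc: "i < length F \<Longrightarrow> zeros (take (Suc i) F) = zeros (take i F) \<inter> zeros [F ! i]"
  by (simp add: take_Suc zeros_append)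

lemma reducedI:
  assumes "irreducible_component Z (zeros G)" "x \<in> Z" "jac_rank G x = rk Z" shows "Z \<in> reduced_components G"
  using assms reduced_component_iff[OF assms(1)] by blast

text \<open>Appending a polynomial cannot lower the rank of the Jacobian, and on \<open>Y\<close>
  this rank is bounded by \<open>rk Y\<close>, so \<open>Y\<close> remains reduced.\<close>

lemma contained_component:
  assumes i: "i \<in> {1..<length F}" and Y: "Y \<in> reduced_components (take i F)" and H: "Y \<subseteq> zeros [F ! i]"
  shows "Y \<in> reduced_components (take (Suc i) F)"
proof -
  have il: "i < length F" using i by simp
  have Yc: "irreducible_component Y (zeros (take i F))" using Y by simp
  then have Yi: "irreducible_variety Y" "Y \<subseteq> zeros (take i F)" by (auto simp: irreducible_component_def)
  have sub: "Y \<subseteq> zeros (take (Suc i) F)" using Yi(2) H by (simp add: zeros_Suc[OF il])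
  have comp: "irreducible_component Y (zeros (take (Suc i) F))"
    by (rule irreducible_component_subset[OF Yc sub]) (simp add: zeros_Suc[OF il])
  obtain x where x: "x \<in> Y" "jac_rank (take i F) x = rk Y" using Y reduced_component_iff[OF Yc] by auto
  have "rk Y \<le> jac_rank (take (Suc i) F) x"
    using jac_rank_append_ge[of "take i F" x "F ! i"] x(2) by (simp add: take_Suc[OF il])
  then show ?thesis using jac_rank_le_rk[OF x(1) sub] by (intro reducedI[OF comp x(1)]) simp
qed

lemma step_sound:
  assumes i: "i \<in> {1..<length F}" and Yr: "Y \<in> reduced_components (take i F)" and r: "rk Y < CARD('n)"
    and z: "path z" "fst (z 0) \<in> Y"
    and sol: "\<And>s. s \<in> {0..1} \<Longrightarrow> \<forall>(g, h)\<in>set (zip (start_system F a i (rk Y)) (target_system F a (c (i, rk Y)) i (rk Y))).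
      (1 - \<tau> (i, rk Y) s) * g (z s) + \<tau> (i, rk Y) s * h (z s) = 0"
    and rank: "jac_rank (take (Suc i) F) (fst (z 1)) = Suc (rk Y)"
  shows "\<exists>Z\<in>reduced_components (take (Suc i) F). rk Z = Suc (rk Y) \<and> fst (z 1) \<in> Z \<and> fst (z 1) \<in> sect a (CARD('n) - Suc (rk Y))"
proof -
  let ?\<tau> = "\<tau> (i, rk Y)" and ?x = "fst (z 1)"
  have il: "i < length F" "i \<in> {1..length F}" using i by auto
  have Yi: "irreducible_variety Y" "Y \<subseteq> zeros (take i F)" using Yr by (auto simp: irreducible_component_def)
  have rr: "rk Y \<in> {1..<CARD('n)}" using rk_bounds[OF il(2) Yr] r by simp
  have p: "tracking_path (B (i, rk Y)) ?\<tau>" by (rule paths[OF i rr])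
  have mm: "Suc (CARD('n) - rk Y - 1) = CARD('n) - rk Y" using r by simp
  interpret homotopy Y "take i F" a "CARD('n) - rk Y - 1" "F ! i" "total_degree (F ! i)" "c (i, rk Y)"
    by (rule homotopyI[OF nonconst i Yr r flag[OF il(2) Yr]])
  have sol': "fst (z s) \<in> zeros (take i F) \<and>
      (1 - ?\<tau> s) * (snd (z s) ^ total_degree (F ! i) - 1) + ?\<tau> s * val (F ! i) (fst (z s)) = 0 \<and>
      fst (z s) \<in> sect a (CARD('n) - (rk Y + 1)) \<and>
      (1 - ?\<tau> s) * lin a (CARD('n) - rk Y) (fst (z s)) + ?\<tau> s * (snd (z s) - c (i, rk Y)) = 0" if "s \<in> {0..1}" for s
    using sol[OF that] homotopy_system[where t = "?\<tau> s" and x = "fst (z s)" and u = "snd (z s)"] by simp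
  have xY: "?x \<in> Y"
  proof (rule track_sound[OF _ p z])
    show "\<forall>(x, u)\<in>E t. hreg t x u" if "t \<notin> B (i, rk Y)" for t using exceptions[OF i Yr r that] by (rule conjunct2)
  qed (use sol' mm in auto)
  have "?\<tau> 1 = 1" using p by (simp add: tracking_path_def pathfinish_def)
  then have v: "val (F ! i) ?x = 0" and s: "?x \<in> sect a (CARD('n) - Suc (rk Y))" using sol'[of 1] by auto
  have "rk Y \<le> jac_rank (take i F) ?x"
    using jac_rank_append_le[of "take i F" "F ! i" ?x] rank by (simp add: take_Suc[OF il(1)])
  then have j: "jac_rank (take i F) ?x = rk Y" using jac_rank_le_rk[OF xY Yi(2)] by simp
  obtain Z where Z: "irreducible_component Z (zeros (take (Suc i) F))" "?x \<in> Z" "rk Z = Suc (rk Y)"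
    using component_of_hypersurface_section[OF Yi xY v j] rank unfolding take_Suc[OF il(1)] by blast
  show ?thesis using reducedI[OF Z(1,2)] Z s rank by (intro bexI[of _ Z]) auto
qed

lemma step_complete:
  assumes i: "i \<in> {1..<length F}" and Yr: "Y \<in> reduced_components (take i F)" and r: "rk Y < CARD('n)"
    and e: "e \<in> Y" "e \<in> sect a (CARD('n) - Suc (rk Y))" "val (F ! i) e = 0"
      "nondeg (take (Suc i) F) a (CARD('n) - Suc (rk Y)) e"
    and H: "\<not> Y \<subseteq> zeros [F ! i]" and P: "Y \<inter> sect a (CARD('n) - rk Y) \<subseteq> P"
  shows "e \<in> regenerated F a (c (i, rk Y)) (\<tau> (i, rk Y)) i (rk Y) P"
proof -
  let ?\<tau> = "\<tau> (i, rk Y)"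
  have il: "i < length F" "i \<in> {1..length F}" using i by auto
  have Yi: "irreducible_variety Y" "Y \<subseteq> zeros (take i F)" using Yr by (auto simp: irreducible_component_def)
  have rr: "rk Y \<in> {1..<CARD('n)}" using rk_bounds[OF il(2) Yr] r by simp
  have p: "tracking_path (B (i, rk Y)) ?\<tau>" by (rule paths[OF i rr])
  have mm: "Suc (CARD('n) - rk Y - 1) = CARD('n) - rk Y" "CARD('n) - rk Y - 1 = CARD('n) - Suc (rk Y)"
    "CARD('n) - (rk Y + 1) = CARD('n) - Suc (rk Y)"
    "Suc (CARD('n) - Suc (rk Y)) = CARD('n) - rk Y" using r by auto
  have hom: "homotopy Y (take i F) a (CARD('n) - rk Y - 1) (F ! i) (total_degree (F ! i))"
    by (rule homotopyI[OF nonconst i Yr r flag[OF il(2) Yr]])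
  interpret homotopy Y "take i F" a "CARD('n) - rk Y - 1" "F ! i" "total_degree (F ! i)" "c (i, rk Y)"
    by (rule hom)
  have "\<exists>z. path z \<and> pathfinish z = (e, c (i, rk Y)) \<and> (\<forall>s\<in>{0..1}. z s \<in> E (?\<tau> s))"
  proof (rule track_complete[OF _ p e(1) _ e(3)])
    show "locbdd E t \<and> (\<forall>(x, u)\<in>E t. hreg t x u)" if "t \<notin> B (i, rk Y)" for t by (rule exceptions[OF i Yr r that])
  qed (use e(2,4) mm(2) take_Suc[OF il(1)] in auto)
  then obtain z where z: "path z" "pathfinish z = (e, c (i, rk Y))" "\<forall>s\<in>{0..1}. z s \<in> E (?\<tau> s)"
    by (elim exE conjE)
  have sol: "\<forall>(g, h)\<in>set (zip (start_system F a i (rk Y)) (target_system F a (c (i, rk Y)) i (rk Y))).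
      (1 - ?\<tau> s) * g (z s) + ?\<tau> s * h (z s) = 0" if "s \<in> {0..1}" for s
  proof -
    have zs: "(fst (z s), snd (z s)) \<in> E (?\<tau> s)" using z(3) that by simp
    have "fst (z s) \<in> zeros (take i F) \<and>
      (1 - ?\<tau> s) * (snd (z s) ^ total_degree (F ! i) - 1) + ?\<tau> s * val (F ! i) (fst (z s)) = 0 \<and>
      fst (z s) \<in> sect a (CARD('n) - (rk Y + 1)) \<and>
      (1 - ?\<tau> s) * lin a (CARD('n) - rk Y) (fst (z s)) + ?\<tau> s * (snd (z s) - c (i, rk Y)) = 0"
      using zs Yi(2) unfolding E_def mem_Collect_eq prod.case unfolding mm by auto
    then show ?thesis
      using homotopy_system[where t = "?\<tau> s" and x = "fst (z s)" and u = "snd (z s)"] by simp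
  qed
  \<comment> \<open>The flag avoids the hypersurface on \<open>Y\<close>, so the point reached at
    \<open>t = 0\<close> has not been removed from the start points.\<close>
  have start: "pathstart z \<in> (P - zeros [F ! i]) \<times> roots_of_unity (total_degree (F ! i))"
  proof -
    have "?\<tau> 0 = 0" using p by (simp add: tracking_path_def pathstart_def)
    then have "(fst (z 0), snd (z 0)) \<in> E 0" using z(3) by (metis atLeastAtMost_iff order_refl prod.collapse zero_le_one)
    then have z0: "fst (z 0) \<in> Y" "snd (z 0) ^ total_degree (F ! i) = 1"
      "fst (z 0) \<in> sect a (CARD('n) - rk Y - 1)" "lin a (CARD('n) - rk Y) (fst (z 0)) = 0"
      unfolding E_def mem_Collect_eq prod.case unfolding mm by auto
    have s: "fst (z 0) \<in> sect a (CARD('n) - rk Y)"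
      using sect_Suc[of a "CARD('n) - rk Y - 1"] z0(3,4) unfolding mm by auto
    have "fst (z 0) \<notin> zeros [F ! i]"
      using subset_hypersurface[OF i Yr z0(1) s] H by (auto simp: zeros_def)
    moreover have "1 \<le> total_degree (F ! i)" using nonconst i by (intro nonconstant_degree) auto
    ultimately show ?thesis using z0(1,2) s P by (auto simp: pathstart_def roots_of_unity_eq mem_Times_iff)
  qed
  have "(e, c (i, rk Y)) \<in> track (start_system F a i (rk Y)) (target_system F a (c (i, rk Y)) i (rk Y)) ?\<tau>
     ((P - zeros [F ! i]) \<times> roots_of_unity (total_degree (F ! i)))"
    unfolding track_def mem_Collect_eq by (intro exI[of _ z] conjI z(1,2) start ballI[OF sol])
  then show ?thesis unfolding regenerated_def by (metis fst_conv image_eqI)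
qed

lemma ureg_Suc:
  assumes "1 \<le> i"
  shows "ureg_points F a c \<tau> (Suc i) j =
     (if j \<in> {1..min i CARD('n)} then ureg_points F a c \<tau> i j \<inter> zeros [F ! i] else {})
     \<union> (if j - 1 \<in> {1..min i CARD('n)} \<and> j - 1 < CARD('n)
        then {x \<in> regenerated F a (c (i, j - 1)) (\<tau> (i, j - 1)) i (j - 1) (ureg_points F a c \<tau> i (j - 1)).
               jac_rank (take (Suc i) F) x = j}
        else {})"
proof -
  obtain r where "i = Suc r" using assms by (cases i) auto
  then show ?thesis by (simp only: ureg_points.simps Let_def)
qed

lemma sound:
  assumes "1 \<le> i" "i \<le> length F" "x \<in> ureg_points F a c \<tau> i j"
  shows "\<exists>Y\<in>reduced_components (take i F). rk Y = j \<and> x \<in> Y \<and> x \<in> sect a (CARD('n) - j)"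
  using assms
proof (induction i arbitrary: x j rule: dec_induct)
  case base
  then show ?case using start_sound by (auto split: if_splits)
next
  case (step i)
  have i: "i \<in> {1..<length F}" "i < length F" "i \<le> length F" "1 \<le> i" using step by auto
  from step.prems(2)[unfolded ureg_Suc[OF i(4)]]
  consider (old) "x \<in> ureg_points F a c \<tau> i j" "x \<in> zeros [F ! i]"
    | (new) "j - 1 \<in> {1..min i CARD('n)}" "j - 1 < CARD('n)" "jac_rank (take (Suc i) F) x = j"
      "x \<in> regenerated F a (c (i, j - 1)) (\<tau> (i, j - 1)) i (j - 1) (ureg_points F a c \<tau> i (j - 1))"
    by (auto split: if_splits)
  then show ?case
  proof cases
    case old
    obtain Y where Y: "Y \<in> reduced_components (take i F)" "rk Y = j" "x \<in> Y" "x \<in> sect a (CARD('n) - j)"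
      using step.IH[OF i(3) old(1)] by blast
    have "Y \<subseteq> zeros [F ! i]"
      by (rule subset_hypersurface[OF i(1) Y(1,3)]) (use Y old(2) in \<open>auto simp: zeros_def\<close>)
    from contained_component[OF i(1) Y(1) this] Y(2-4) show ?thesis by blast
  next
    case new
    obtain u where "(x, u) \<in> track (start_system F a i (j - 1)) (target_system F a (c (i, j - 1)) i (j - 1)) (\<tau> (i, j - 1))
        ((ureg_points F a c \<tau> i (j - 1) - zeros [F ! i]) \<times> roots_of_unity (total_degree (F ! i)))"
      using new(4) unfolding regenerated_def by force
    then obtain z where z: "path z" "pathstart z \<in> (ureg_points F a c \<tau> i (j - 1) - zeros [F ! i]) \<times> roots_of_unity (total_degree (F ! i))"
      "pathfinish z = (x, u)" "\<forall>s\<in>{0..1}. \<forall>(g, h)\<in>set (zip (start_system F a i (j - 1)) (target_system F a (c (i, j - 1)) i (j - 1))).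
         (1 - \<tau> (i, j - 1) s) * g (z s) + \<tau> (i, j - 1) s * h (z s) = 0"
      unfolding track_def mem_Collect_eq by (elim exE conjE)
    have "fst (z 0) \<in> ureg_points F a c \<tau> i (j - 1)" using z(2) by (auto simp: pathstart_def)
    from step.IH[OF i(3) this] obtain Y where Y: "Y \<in> reduced_components (take i F)" "rk Y = j - 1" "fst (z 0) \<in> Y"
      by blast
    have x: "fst (z 1) = x" using z(3) by (simp add: pathfinish_def)
    have j: "Suc (j - 1) = j" using new(1) by auto
    have "\<exists>Z\<in>reduced_components (take (Suc i) F). rk Z = Suc (rk Y) \<and> fst (z 1) \<in> Z \<and> fst (z 1) \<in> sect a (CARD('n) - Suc (rk Y))"
      by (rule step_sound[OF i(1) Y(1) _ z(1) Y(3)]) (use new(2,3) x j z(4) Y(2) in auto)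
    then show ?thesis unfolding x Y(2) j .
  qed
qed

text \<open>A component of the next zero set is contained in some component \<open>Y\<close> of the
  present one, and it is a component of the intersection of \<open>Y\<close> with the hypersurface.
  The chain to \<open>Z\<close> thus extends down to \<open>Y\<close>, which the hypothesis on
  contributing components makes reduced, and the induction hypothesis applies to
  \<open>Y\<close>.\<close>

lemma complete:
  assumes "1 \<le> i" "i \<le> length F" and "irreducible_component Y (zeros (take i F))"
    and "irreducible_component Z (zeros F)" "reduced_component F Z" "contributes F i Y Z"
  shows "Y \<inter> sect a (CARD('n) - rk Y) \<subseteq> ureg_points F a c \<tau> i (rk Y)"
  using assms
proof (induction i arbitrary: Y rule: dec_induct)
  case base
  have Y: "Y \<in> reduced_components (take 1 F)" using base contrib by force
  show ?case using start_complete[OF base(1) Y] by auto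
next
  case (step i Y')
  have i: "i \<in> {1..<length F}" "i < length F" "i \<le> length F" "1 \<le> i" "i \<in> {1..length F}" "Suc i \<in> {1..length F}" using step by auto
  have Y': "Y' \<in> reduced_components (take (Suc i) F)" using contrib i(6) step.prems by blast
  have Y'i: "irreducible_variety Y'" "Y' \<subseteq> zeros (take i F)" "Y' \<subseteq> zeros [F ! i]"
    using Y' by (auto simp: irreducible_component_def zeros_Suc[OF i(2)])
  obtain Y where Y: "irreducible_component Y (zeros (take i F))" "Y' \<subseteq> Y"
    using component_exists[OF algebraic_set_zeros Y'i(1,2)] by blast
  have Yi: "irreducible_variety Y" "Y \<subseteq> zeros (take i F)" using Y(1) by (auto simp: irreducible_component_def)
  have "irreducible_component Y' (Y \<inter> zeros [F ! i])"
    by (rule irreducible_component_subset[OF step.prems(2)]) (use Y(2) Y'i(3) Yi(2) in \<open>auto simp: zeros_Suc[OF i(2)]\<close>)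
  then have con: "contributes F i Y Z"
  proof -
    assume c: "irreducible_component Y' (Y \<inter> zeros [F ! i])"
    obtain C where C: "C (Suc i) = Y'" "C (length F) = Z"
      "\<forall>s\<in>{Suc i..<length F}. irreducible_component (C (Suc s)) (C s \<inter> zeros [F ! s])"
      using step.prems(5) unfolding contributes_def by (elim exE conjE)
    show ?thesis unfolding contributes_def
      by (rule exI[of _ "C(i := Y)"]) (use C c i(2) in auto)
  qed
  have Yr: "Y \<in> reduced_components (take i F)" using contrib i(5) Y(1) step.prems(3,4) con by blast
  have IH: "Y \<inter> sect a (CARD('n) - rk Y) \<subseteq> ureg_points F a c \<tau> i (rk Y)"
    by (rule step.IH[OF i(3) Y(1) step.prems(3,4) con])
  note rY = rk_bounds[OF i(5) Yr]
  show ?case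
  proof (cases "Y \<subseteq> zeros [F ! i]")
    case True
    have "Y \<subseteq> zeros (take (Suc i) F)" using True Yi(2) by (simp add: zeros_Suc[OF i(2)])
    then have eq: "Y = Y'" using step.prems(2) Yi(1) Y(2) unfolding irreducible_component_def by blast
    show ?thesis using IH rY True unfolding ureg_Suc[OF i(4)] eq by auto
  next
    case False
    then have "Y' \<subset> Y" using Y(2) Y'i(3) by blast
    then have "rk Y < rk Y'" by (rule rk_strict[OF Y'i(1) Yi(1)])
    obtain y where y: "y \<in> Y'" "jac_rank (take (Suc i) F) y = rk Y'"
      using Y' reduced_component_iff[of Y' "take (Suc i) F"] by blast
    \<comment> \<open>One more polynomial raises the rank at a point by at most one, while the
      proper inclusion raises \<open>rk\<close>. Hence the codimension grows by exactly one, as the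
      loop expects.\<close>
    have "rk Y' \<le> Suc (jac_rank (take i F) y)"
      using jac_rank_append_le[of "take i F" "F ! i" y] y(2) by (simp add: take_Suc[OF i(2)])
    also have "jac_rank (take i F) y \<le> rk Y" using jac_rank_le_rk[of y Y "take i F"] y(1) Y(2) Yi(2) by blast
    finally have eq: "rk Y' = Suc (rk Y)" using \<open>rk Y < rk Y'\<close> by simp
    have r: "rk Y < CARD('n)" using rk_bounds[OF i(6) Y'] eq by simp
    show ?thesis
    proof
      fix e assume e: "e \<in> Y' \<inter> sect a (CARD('n) - rk Y')"
      have reg: "jac_rank (take (Suc i) F) e = rk Y'" "nondeg (take (Suc i) F) a (CARD('n) - rk Y') e"
        using regular_point[OF i(6) Y'] e by auto
      have "e \<in> regenerated F a (c (i, rk Y)) (\<tau> (i, rk Y)) i (rk Y) (ureg_points F a c \<tau> i (rk Y))"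
        by (rule step_complete[OF i(1) Yr r _ _ _ _ False IH]) (use e eq reg Y(2) Y'i(3) in \<open>auto simp: zeros_def\<close>)
      then show "e \<in> ureg_points F a c \<tau> (Suc i) (rk Y')"
        unfolding ureg_Suc[OF i(4)] using rY r reg(1) eq by simp
    qed
  qed
qed

lemma final_points:
  assumes "j \<in> {1..length F}"
  shows "ureg_points F a c \<tau> (length F) j =
    (\<Union>Z\<in>{Z. irreducible_component Z (zeros F) \<and> codim Z = j \<and> reduced_component F Z}. Z \<inter> flag a j)"
proof -
  have k: "1 \<le> length F" using assms by simp
  have con: "contributes F (length F) Z Z" for Z unfolding contributes_def by (intro exI[of _ "\<lambda>_. Z"]) simp
  show ?thesis
  proof (intro subset_antisym subsetI)
    fix x assume "x \<in> ureg_points F a c \<tau> (length F) j"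
    from sound[OF k order_refl this] obtain Y where "Y \<in> reduced_components F" "rk Y = j" "x \<in> Y" "x \<in> sect a (CARD('n) - j)"
      by auto
    then show "x \<in> (\<Union>Z\<in>{Z. irreducible_component Z (zeros F) \<and> codim Z = j \<and> reduced_component F Z}. Z \<inter> flag a j)"
      using component_codim[of Y "zeros F"] by (auto simp: flag_sect)
  next
    fix x assume "x \<in> (\<Union>Z\<in>{Z. irreducible_component Z (zeros F) \<and> codim Z = j \<and> reduced_component F Z}. Z \<inter> flag a j)"
    then obtain Z where Z: "irreducible_component Z (zeros F)" "codim Z = j" "reduced_component F Z" "x \<in> Z" "x \<in> sect a (CARD('n) - j)"
      unfolding flag_sect by blast
    have r: "rk Z = j" using component_codim[OF Z(1)] Z(2) by simp
    have "Z \<inter> sect a (CARD('n) - rk Z) \<subseteq> ureg_points F a c \<tau> (length F) (rk Z)"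
      by (rule complete[OF k order_refl _ Z(1,3) con]) (use Z(1) in simp)
    then show "x \<in> ureg_points F a c \<tau> (length F) j" using Z(4,5) r by auto
  qed
qed

end

text \<open>One path is used for all components treated in the same iteration. There are finitely
  many of these, so their exceptional values can be united.\<close>

lemma exceptional_sets_exist:
  fixes F :: "'n::finite cpoly list"
  assumes F: "\<forall>f\<in>set F. nonconstant f"
    and fl: "\<forall>i\<in>{1..length F}. \<forall>Y\<in>reduced_components (take i F). regular_flag F i Y a"
  shows "\<exists>B :: nat \<times> nat \<Rightarrow> complex set. (\<forall>v. finite (B v) \<and> 0 \<notin> B v) \<and>
    (\<forall>i Y t. i \<in> {1..<length F} \<longrightarrow> Y \<in> reduced_components (take i F) \<longrightarrow> rk Y < CARD('n) \<longrightarrow>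
      t \<notin> B (i, rk Y) \<longrightarrow>
      locbdd (homotopy.E Y a (CARD('n) - rk Y - 1) (F ! i) (total_degree (F ! i)) (c (i, rk Y))) t \<and>
      (\<forall>(x, u)\<in>homotopy.E Y a (CARD('n) - rk Y - 1) (F ! i) (total_degree (F ! i)) (c (i, rk Y)) t.
         homotopy.hreg (take i F) a (CARD('n) - rk Y - 1) (F ! i) (total_degree (F ! i)) t x u))"
proof -
  define Q where "Q i Y t \<longleftrightarrow>
      locbdd (homotopy.E Y a (CARD('n) - rk Y - 1) (F ! i) (total_degree (F ! i)) (c (i, rk Y))) t \<and>
      (\<forall>(x, u)\<in>homotopy.E Y a (CARD('n) - rk Y - 1) (F ! i) (total_degree (F ! i)) (c (i, rk Y)) t.
         homotopy.hreg (take i F) a (CARD('n) - rk Y - 1) (F ! i) (total_degree (F ! i)) t x u)" for i Y t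
  define T where "T = (\<lambda>(i, j). {Y. i \<in> {1..<length F} \<and> Y \<in> reduced_components (take i F) \<and> rk Y = j \<and> j < CARD('n)})"
  define b where "b i Y = (SOME B. finite B \<and> 0 \<notin> B \<and> (\<forall>t. t \<notin> B \<longrightarrow> Q i Y t))" for i Y
  have b: "finite (b i Y) \<and> 0 \<notin> b i Y \<and> (\<forall>t. t \<notin> b i Y \<longrightarrow> Q i Y t)" if Y: "Y \<in> T (i, j)" for i j Y
  proof -
    have Y': "i \<in> {1..<length F}" "i \<in> {1..length F}" "Y \<in> reduced_components (take i F)" "rk Y < CARD('n)"
      using Y by (auto simp: T_def)
    have "\<exists>B. finite B \<and> 0 \<notin> B \<and> (\<forall>t. t \<notin> B \<longrightarrow> Q i Y t)"
      unfolding Q_def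
      by (rule homotopy.finitely_many_exceptions[OF homotopyI[OF F Y'(1,3,4) fl[rule_format, OF Y'(2,3)]]])
    then show ?thesis unfolding b_def by (rule someI_ex)
  qed
  have fin: "finite (T v)" for v
  proof (cases v)
    case (Pair i j)
    have "T (i, j) \<subseteq> {Y. irreducible_component Y (zeros (take i F))}" by (auto simp: T_def)
    then show ?thesis unfolding Pair by (rule finite_subset) (rule finite_components[OF algebraic_set_zeros])
  qed
  define B where "B v = (\<Union>Y\<in>T v. b (fst v) Y)" for v
  show ?thesis unfolding Q_def[symmetric]
  proof (intro exI[of _ B] conjI allI impI)
    fix v
    have "finite (b (fst v) Y)" "0 \<notin> b (fst v) Y" if "Y \<in> T v" for Y using b[of Y "fst v" "snd v"] that by auto
    then show "finite (B v)" "0 \<notin> B v" using fin[of v] by (auto simp: B_def)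
  next
    fix i Y t assume "i \<in> {1..<length F}" "Y \<in> reduced_components (take i F)" "rk Y < CARD('n)" and t: "t \<notin> B (i, rk Y)"
    then have Y: "Y \<in> T (i, rk Y)" by (simp add: T_def)
    then have "t \<notin> b i Y" using t by (auto simp: B_def)
    then show "Q i Y t" using b[OF Y] by blast
  qed
qed

text \<open>Finitely many components are involved, each of codimension at least one, so the
  conditions only concern the \<open>CARD('n) - 1\<close> equations that are drawn.\<close>

lemma generically_good_flag:
  fixes F :: "'n::finite cpoly list"
  assumes F: "\<forall>f\<in>set F. nonconstant f"
  shows "generically (lrows (CARD('n) - 1))
    (\<lambda>a. (\<forall>(i, Y)\<in>(SIGMA i:{1..length F}. reduced_components (take i F)). regular_flag F i Y a) \<and>
      (\<forall>j\<in>{1..CARD('n)}. affine_linear_space j (flag a j :: (complex ^ 'n) set)))"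
proof (rule generically_conj; rule generically_ball)
  have "finite (reduced_components (take i F))" for i
    by (rule finite_subset[OF _ finite_components[OF algebraic_set_zeros[of "take i F"]]]) auto
  then show "finite (SIGMA i:{1..length F}. reduced_components (take i F))" by (intro finite_SigmaI) auto
  fix v assume v: "v \<in> (SIGMA i:{1..length F}. reduced_components (take i F))"
  obtain i Y where iY: "v = (i, Y)" "i \<in> {1..length F}" "Y \<in> reduced_components (take i F)" using v by blast
  have "rk Y \<in> {1..min i CARD('n)}" by (rule rk_reduced_component[OF F iY(2,3)])
  then have "lrows (CARD('n) - rk Y) \<subseteq> (lrows (CARD('n) - 1) :: (nat \<times> 'n option) set)" by auto
  from generically_superset[OF generically_regular_flag[OF iY(3)] this]
  show "generically (lrows (CARD('n) - 1)) (\<lambda>a. case v of (i, Y) \<Rightarrow> regular_flag F i Y a)"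
    unfolding iY(1) by simp
next
  fix j assume j: "j \<in> {1..CARD('n)}"
  then have "CARD('n) - (CARD('n) - j) = j" by simp
  then have "generically (lrows (CARD('n) - j)) (\<lambda>a. affine_linear_space j (flag a j :: (complex ^ 'n) set))"
    using generically_affine[where 'n = 'n, of "CARD('n) - j"] by (simp add: flag_sect)
  then show "generically (lrows (CARD('n) - 1)) (\<lambda>a. affine_linear_space j (flag a j :: (complex ^ 'n) set))"
    by (rule generically_superset) (use j in auto)
qed simp

theorem theorem5p1:
  fixes F :: "'n::finite cpoly list"
  assumes nonconst: "\<forall>f\<in>set F. nonconstant f"
    and contrib: "\<forall>i\<in>{1..length F}. \<forall>Y Z.
      irreducible_component Y (zeros (take i F)) \<longrightarrow>
      irreducible_component Z (zeros F) \<longrightarrow> reduced_component F Z \<longrightarrow>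
      contributes F i Y Z \<longrightarrow> reduced_component (take i F) Y"
  shows "generically (random_params (length F) :: ((nat \<times> 'n option) + (nat \<times> nat)) set)
    (\<lambda>r. let a = (\<lambda>v. r (Inl v)); c = (\<lambda>v. r (Inr v)) in
      \<exists>B :: nat \<times> nat \<Rightarrow> complex set.
        (\<forall>v. finite (B v) \<and> 0 \<notin> B v) \<and>
        (\<forall>\<tau>. (\<forall>i\<in>{1..<length F}. \<forall>j\<in>{1..<CARD('n)}. tracking_path (B (i, j)) (\<tau> (i, j))) \<longrightarrow>
          (\<forall>j\<in>{1..min (length F) CARD('n)}.
            let \<Z> = {Z. irreducible_component Z (zeros F) \<and> codim Z = j \<and> reduced_component F Z} in
            witness_set F \<Z> j (u_regeneration F a c \<tau> j) \<and>
            u_regeneration F a c \<tau> j = (F, flag a j, \<Union>Z\<in>\<Z>. Z \<inter> flag a j))))"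
proof -
  have "generically (Inl ` lrows (CARD('n) - 1) :: ((nat \<times> 'n option) + (nat \<times> nat)) set)
    (\<lambda>r. (\<forall>(i, Y)\<in>(SIGMA i:{1..length F}. reduced_components (take i F)). regular_flag F i Y (\<lambda>v. r (Inl v))) \<and>
      (\<forall>j\<in>{1..CARD('n)}. affine_linear_space j (flag (\<lambda>v. r (Inl v)) j :: (complex ^ 'n) set)))"
    by (rule generically_pullback[OF generically_good_flag[OF nonconst]]) simp
  then have "generically (random_params (length F) :: ((nat \<times> 'n option) + (nat \<times> nat)) set)
    (\<lambda>r. (\<forall>(i, Y)\<in>(SIGMA i:{1..length F}. reduced_components (take i F)). regular_flag F i Y (\<lambda>v. r (Inl v))) \<and>
      (\<forall>j\<in>{1..CARD('n)}. affine_linear_space j (flag (\<lambda>v. r (Inl v)) j :: (complex ^ 'n) set)))"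
    by (rule generically_superset) (simp add: random_params_def)
  then show ?thesis
  proof (rule generically_mono, elim conjE, unfold Let_def)
    fix r :: "(nat \<times> 'n option) + (nat \<times> nat) \<Rightarrow> complex"
    let ?a = "\<lambda>v. r (Inl v)" and ?c = "\<lambda>v. r (Inr v)"
    assume good: "\<forall>(i, Y)\<in>(SIGMA i:{1..length F}. reduced_components (take i F)). regular_flag F i Y ?a"
      and aff: "\<forall>j\<in>{1..CARD('n)}. affine_linear_space j (flag ?a j :: (complex ^ 'n) set)"
    have fl: "\<forall>i\<in>{1..length F}. \<forall>Y\<in>reduced_components (take i F). regular_flag F i Y ?a"
      using good by blast
    obtain B :: "nat \<times> nat \<Rightarrow> complex set" where B: "\<forall>v. finite (B v) \<and> 0 \<notin> B v"
      "\<forall>i Y t. i \<in> {1..<length F} \<longrightarrow> Y \<in> reduced_components (take i F) \<longrightarrow> rk Y < CARD('n) \<longrightarrow>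
      t \<notin> B (i, rk Y) \<longrightarrow>
      locbdd (homotopy.E Y ?a (CARD('n) - rk Y - 1) (F ! i) (total_degree (F ! i)) (?c (i, rk Y))) t \<and>
      (\<forall>(x, u)\<in>homotopy.E Y ?a (CARD('n) - rk Y - 1) (F ! i) (total_degree (F ! i)) (?c (i, rk Y)) t.
         homotopy.hreg (take i F) ?a (CARD('n) - rk Y - 1) (F ! i) (total_degree (F ! i)) t x u)"
      using exceptional_sets_exist[OF nonconst fl, of ?c] by (elim exE conjE)
    show "\<exists>B :: nat \<times> nat \<Rightarrow> complex set.
        (\<forall>v. finite (B v) \<and> 0 \<notin> B v) \<and>
        (\<forall>\<tau>. (\<forall>i\<in>{1..<length F}. \<forall>j\<in>{1..<CARD('n)}. tracking_path (B (i, j)) (\<tau> (i, j))) \<longrightarrow>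
          (\<forall>j\<in>{1..min (length F) CARD('n)}.
            witness_set F {Z. irreducible_component Z (zeros F) \<and> codim Z = j \<and> reduced_component F Z} j
              (u_regeneration F ?a ?c \<tau> j) \<and>
            u_regeneration F ?a ?c \<tau> j = (F, flag ?a j,
              \<Union>Z\<in>{Z. irreducible_component Z (zeros F) \<and> codim Z = j \<and> reduced_component F Z}. Z \<inter> flag ?a j)))"
    proof (intro exI[of _ B] conjI[OF B(1)] allI impI ballI)
      fix \<tau> :: "nat \<times> nat \<Rightarrow> real \<Rightarrow> complex" and j
      assume \<tau>: "\<forall>i\<in>{1..<length F}. \<forall>j\<in>{1..<CARD('n)}. tracking_path (B (i, j)) (\<tau> (i, j))"
        and j: "j \<in> {1..min (length F) CARD('n)}"
      have run: "regeneration_run F ?a ?c \<tau> B"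
      proof (unfold_locales)
        show "\<forall>f\<in>set F. nonconstant f" by (rule nonconst)
        show "\<forall>i\<in>{1..length F}. \<forall>Y Z. irreducible_component Y (zeros (take i F)) \<longrightarrow>
          irreducible_component Z (zeros F) \<longrightarrow> reduced_component F Z \<longrightarrow>
          contributes F i Y Z \<longrightarrow> reduced_component (take i F) Y" by (rule contrib)
      qed (rule fl[rule_format], assumption+, rule B(2)[rule_format], assumption+, use \<tau> in blast)
      have out: "u_regeneration F ?a ?c \<tau> j = (F, flag ?a j,
          \<Union>Z\<in>{Z. irreducible_component Z (zeros F) \<and> codim Z = j \<and> reduced_component F Z}. Z \<inter> flag ?a j)"
        unfolding u_regeneration_def by (subst regeneration_run.final_points[OF run]) (use j in auto)
      have "affine_linear_space j (flag ?a j :: (complex ^ 'n) set)" using aff j by simp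
      then show "witness_set F {Z. irreducible_component Z (zeros F) \<and> codim Z = j \<and> reduced_component F Z} j
              (u_regeneration F ?a ?c \<tau> j) \<and>
            u_regeneration F ?a ?c \<tau> j = (F, flag ?a j,
              \<Union>Z\<in>{Z. irreducible_component Z (zeros F) \<and> codim Z = j \<and> reduced_component F Z}. Z \<inter> flag ?a j)"
        unfolding out witness_set_def by blast
    qed
  qed
qed

end
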